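(* Let $Q^\star_{\mathcal T}\colon H^{-1}(\Omega)\to \mathcal P^0(\mathcal T)$ be a bounded linear projection (i.e. $Q^\star_{\mathcal T}\phi=\phi$ for $\phi\in\mathcal P^0(\mathcal T)$ and $\|Q^\star_{\mathcal T}\phi\|_{-1}\le C_Q\|\phi\|_{-1}$ for all $\phi\in H^{-1}(\Omega)$). Let $f\in H^{-1}(\Omega)$, let $u\in H^1_0(\Omega)$ be the weak solution of $-\Delta u=f$ and $\boldsymbol\sigma=\nabla u$. The modified FOSLS has a unique solution $(u_{\mathcal T},\boldsymbol\sigma_{\mathcal T})\in U_{\mathcal T}\times\Sigma_{\mathcal T}$, and $$\|u-u_{\mathcal T}\|_1+\|\boldsymbol\sigma-\boldsymbol\sigma_{\mathcal T}\|\lesssim\min_{(v,\boldsymbol\tau)\in U_{\mathcal T}\times\Sigma_{\mathcal T}}\big(\|u-v\|_1+\|\boldsymbol\sigma-\boldsymbol\tau\|\big).$$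
   Context: $\Omega\subset\mathbb R^n$, $n\in\{2,3\}$, is a bounded Lipschitz domain with polytopal boundary. $\mathcal T$ is a conforming shape-regular simplicial mesh of $\Omega$ with shape-regularity constant $\kappa_{\mathcal T}=\max_{T\in\mathcal T}\mathrm{diam}(T)^n/|T|$. $\mathcal P^p(\mathcal T)$ denotes $\mathcal T$-piecewise polynomials of degree $\le p$, $U_{\mathcal T}=\mathcal P^1(\mathcal T)\cap H^1_0(\Omega)$, $\Sigma_{\mathcal T}=\mathcal{RT}^0(\mathcal T)$ (lowest-order Raviart–Thomas space). $\|\cdot\|$ is the $L^2(\Omega)$ norm, $\|v\|_1=\|\nabla v\|$ on $H^1_0(\Omega)$, $\|\cdot\|_{-1}$ the dual norm on $H^{-1}(\Omega)$. The modified FOSLS: $(u_{\mathcal T},\boldsymbol\sigma_{\mathcal T})=\operatorname{argmin}_{(v,\boldsymbol\tau)\in U_{\mathcal T}\times\Sigma_{\mathcal T}}\big(\|\operatorname{div}\boldsymbol\tau+Q^\star_{\mathcal T}f\|^2+\|\nabla v-\boldsymbol\tau\|^2\big)$. $A\lesssim B$ means $A\le CB$ with $C$ depending only on $\kappa_{\mathcal T}$, $\Omega$ and $C_Q$. *)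

theory Defs
  imports "HOL-Analysis.Analysis"
begin

text \<open>Bounded Lipschitz domain: nonempty, open, connected, bounded, and locally near every
boundary point the domain is the strict subgraph of a Lipschitz function in some unit
direction e (equivalently, after a rigid rotation, the region below a Lipschitz graph).\<close>
definition lipschitz_domain :: "'a::euclidean_space set \<Rightarrow> bool" where
  "lipschitz_domain \<Omega> \<longleftrightarrow> \<Omega> \<noteq> {} \<and> open \<Omega> \<and> connected \<Omega> \<and> bounded \<Omega> \<and>
    (\<forall>x\<in>frontier \<Omega>. \<exists>r>0. \<exists>e::'a. \<exists>g::'a \<Rightarrow> real. \<exists>L. norm e = 1 \<and>
        L-lipschitz_on UNIV g \<and>
        \<Omega> \<inter> ball x r = {y \<in> ball x r. y \<bullet> e < g (y - (y \<bullet> e) *\<^sub>R e)})"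

definition is_simplex_vertices :: "'a::euclidean_space set \<Rightarrow> bool" where
  "is_simplex_vertices S \<longleftrightarrow> finite S \<and> card S = DIM('a) + 1 \<and> \<not> affine_dependent S"

definition polytopal :: "'a::euclidean_space set \<Rightarrow> bool" where
  "polytopal \<Omega> \<longleftrightarrow> (\<exists>M. finite M \<and> (\<forall>S\<in>M. is_simplex_vertices S) \<and>
      closure \<Omega> = \<Union>((\<lambda>S. convex hull S) ` M))"

definition conforming_mesh :: "'a::euclidean_space set \<Rightarrow> 'a set set \<Rightarrow> bool" where
  "conforming_mesh \<Omega> M \<longleftrightarrow> finite M \<and> (\<forall>S\<in>M. is_simplex_vertices S) \<and>
      \<Union>((\<lambda>S. convex hull S) ` M) = closure \<Omega> \<and>
      (\<forall>S\<in>M. \<forall>S'\<in>M. convex hull S \<inter> convex hull S' = convex hull (S \<inter> S'))"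

definition shape_reg :: "'a::euclidean_space set set \<Rightarrow> real" where
  "shape_reg M = Max ((\<lambda>S. diameter (convex hull S) ^ DIM('a) / measure lebesgue (convex hull S)) ` M)"

definition L2 :: "'a::euclidean_space set \<Rightarrow> ('a \<Rightarrow> 'b::euclidean_space) \<Rightarrow> bool" where
  "L2 \<Omega> v \<longleftrightarrow> set_borel_measurable lebesgue \<Omega> v \<and> set_integrable lebesgue \<Omega> (\<lambda>x. norm (v x) ^ 2)"

definition L2norm :: "'a::euclidean_space set \<Rightarrow> ('a \<Rightarrow> 'b::euclidean_space) \<Rightarrow> real" where
  "L2norm \<Omega> v = sqrt (LINT x:\<Omega>|lebesgue. norm (v x) ^ 2)"

definition test_fun :: "'a::euclidean_space set \<Rightarrow> ('a \<Rightarrow> real) \<Rightarrow> ('a \<Rightarrow> 'a) \<Rightarrow> bool" where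
  "test_fun \<Omega> \<phi> D \<longleftrightarrow> (\<forall>x. (\<phi> has_derivative (\<lambda>h. D x \<bullet> h)) (at x)) \<and> continuous_on UNIV D \<and>
     compact (closure {x. \<phi> x \<noteq> 0}) \<and> closure {x. \<phi> x \<noteq> 0} \<subseteq> \<Omega>"

definition is_weak_grad :: "'a::euclidean_space set \<Rightarrow> ('a \<Rightarrow> real) \<Rightarrow> ('a \<Rightarrow> 'a) \<Rightarrow> bool" where
  "is_weak_grad \<Omega> v g \<longleftrightarrow> (\<forall>\<phi> D. test_fun \<Omega> \<phi> D \<longrightarrow>
      (LINT x:\<Omega>|lebesgue. v x *\<^sub>R D x) = - (LINT x:\<Omega>|lebesgue. \<phi> x *\<^sub>R g x))"

definition is_weak_div :: "'a::euclidean_space set \<Rightarrow> ('a \<Rightarrow> 'a) \<Rightarrow> ('a \<Rightarrow> real) \<Rightarrow> bool" where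
  "is_weak_div \<Omega> \<tau> d \<longleftrightarrow> (\<forall>\<phi> D. test_fun \<Omega> \<phi> D \<longrightarrow>
      (LINT x:\<Omega>|lebesgue. \<tau> x \<bullet> D x) = - (LINT x:\<Omega>|lebesgue. d x * \<phi> x))"

definition H1 :: "'a::euclidean_space set \<Rightarrow> ('a \<Rightarrow> real) \<Rightarrow> bool" where
  "H1 \<Omega> v \<longleftrightarrow> L2 \<Omega> v \<and> (\<exists>g. L2 \<Omega> g \<and> is_weak_grad \<Omega> v g)"

text \<open>The weak gradient (determined a.e. on \<Omega>).\<close>
definition wgrad :: "'a::euclidean_space set \<Rightarrow> ('a \<Rightarrow> real) \<Rightarrow> 'a \<Rightarrow> 'a" where
  "wgrad \<Omega> v = (SOME g. L2 \<Omega> g \<and> is_weak_grad \<Omega> v g)"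

text \<open>H^1_0: closure of compactly supported smooth (here C^1) functions in the H^1 norm.\<close>
definition H10 :: "'a::euclidean_space set \<Rightarrow> ('a \<Rightarrow> real) \<Rightarrow> bool" where
  "H10 \<Omega> v \<longleftrightarrow> H1 \<Omega> v \<and> (\<exists>\<phi> D. (\<forall>k. test_fun \<Omega> (\<phi> k) (D k)) \<and>
      (\<lambda>k. L2norm \<Omega> (\<lambda>x. \<phi> k x - v x)) \<longlonglongrightarrow> 0 \<and>
      (\<lambda>k. L2norm \<Omega> (\<lambda>x. D k x - wgrad \<Omega> v x)) \<longlonglongrightarrow> 0)"

definition Hdiv :: "'a::euclidean_space set \<Rightarrow> ('a \<Rightarrow> 'a) \<Rightarrow> bool" where
  "Hdiv \<Omega> \<tau> \<longleftrightarrow> L2 \<Omega> \<tau> \<and> (\<exists>d. L2 \<Omega> d \<and> is_weak_div \<Omega> \<tau> d)"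

definition wdiv :: "'a::euclidean_space set \<Rightarrow> ('a \<Rightarrow> 'a) \<Rightarrow> 'a \<Rightarrow> real" where
  "wdiv \<Omega> \<tau> = (SOME d. L2 \<Omega> d \<and> is_weak_div \<Omega> \<tau> d)"

definition Hm1 :: "'a::euclidean_space set \<Rightarrow> (('a \<Rightarrow> real) \<Rightarrow> real) \<Rightarrow> bool" where
  "Hm1 \<Omega> f \<longleftrightarrow> (\<forall>v w c. H10 \<Omega> v \<and> H10 \<Omega> w \<longrightarrow> f (\<lambda>x. c * v x + w x) = c * f v + f w) \<and>
     (\<exists>K. \<forall>v. H10 \<Omega> v \<longrightarrow> \<bar>f v\<bar> \<le> K * L2norm \<Omega> (wgrad \<Omega> v))"

definition dual_norm :: "'a::euclidean_space set \<Rightarrow> (('a \<Rightarrow> real) \<Rightarrow> real) \<Rightarrow> real" where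
  "dual_norm \<Omega> f = Sup {\<bar>f v\<bar> | v. H10 \<Omega> v \<and> L2norm \<Omega> (wgrad \<Omega> v) \<le> 1}"

definition emb :: "'a::euclidean_space set \<Rightarrow> ('a \<Rightarrow> real) \<Rightarrow> ('a \<Rightarrow> real) \<Rightarrow> real" where
  "emb \<Omega> q = (\<lambda>v. LINT x:\<Omega>|lebesgue. q x * v x)"

definition P0 :: "'a::euclidean_space set set \<Rightarrow> ('a \<Rightarrow> real) \<Rightarrow> bool" where
  "P0 M q \<longleftrightarrow> (\<forall>S\<in>M. \<exists>c. \<forall>x\<in>interior (convex hull S). q x = c)"

definition P1 :: "'a::euclidean_space set set \<Rightarrow> ('a \<Rightarrow> real) \<Rightarrow> bool" where
  "P1 M v \<longleftrightarrow> (\<forall>S\<in>M. \<exists>a b. \<forall>x\<in>convex hull S. v x = a \<bullet> x + b)"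

definition UT :: "'a::euclidean_space set \<Rightarrow> 'a set set \<Rightarrow> ('a \<Rightarrow> real) set" where
  "UT \<Omega> M = {v. P1 M v \<and> H10 \<Omega> v}"

definition RT0 :: "'a::euclidean_space set \<Rightarrow> 'a set set \<Rightarrow> ('a \<Rightarrow> 'a) set" where
  "RT0 \<Omega> M = {\<tau>. (\<forall>S\<in>M. \<exists>a b. \<forall>x\<in>interior (convex hull S). \<tau> x = a + b *\<^sub>R x) \<and> Hdiv \<Omega> \<tau>}"

definition bounded_P0_projection ::
  "'a::euclidean_space set \<Rightarrow> 'a set set \<Rightarrow> real \<Rightarrow> ((('a \<Rightarrow> real) \<Rightarrow> real) \<Rightarrow> 'a \<Rightarrow> real) \<Rightarrow> bool" where
  "bounded_P0_projection \<Omega> M CQ Q \<longleftrightarrow>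
     (\<forall>\<phi>. Hm1 \<Omega> \<phi> \<longrightarrow> P0 M (Q \<phi>)) \<and>
     (\<forall>\<phi> \<psi> c. Hm1 \<Omega> \<phi> \<and> Hm1 \<Omega> \<psi> \<longrightarrow>
        (AE x in lebesgue. x \<in> \<Omega> \<longrightarrow> Q (\<lambda>v. c * \<phi> v + \<psi> v) x = c * Q \<phi> x + Q \<psi> x)) \<and>
     (\<forall>q. P0 M q \<longrightarrow> (AE x in lebesgue. x \<in> \<Omega> \<longrightarrow> Q (emb \<Omega> q) x = q x)) \<and>
     (\<forall>\<phi>. Hm1 \<Omega> \<phi> \<longrightarrow> dual_norm \<Omega> (emb \<Omega> (Q \<phi>)) \<le> CQ * dual_norm \<Omega> \<phi>)"

definition fosls :: "'a::euclidean_space set \<Rightarrow> ('a \<Rightarrow> real) \<Rightarrow> ('a \<Rightarrow> real) \<Rightarrow> ('a \<Rightarrow> 'a) \<Rightarrow> real" where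
  "fosls \<Omega> Qf v \<tau> = L2norm \<Omega> (\<lambda>x. wdiv \<Omega> \<tau> x + Qf x) ^ 2 + L2norm \<Omega> (\<lambda>x. wgrad \<Omega> v x - \<tau> x) ^ 2"

definition fosls_min :: "'a::euclidean_space set \<Rightarrow> 'a set set \<Rightarrow> ('a \<Rightarrow> real) \<Rightarrow> ('a \<Rightarrow> real) \<Rightarrow> ('a \<Rightarrow> 'a) \<Rightarrow> bool" where
  "fosls_min \<Omega> M Qf v \<tau> \<longleftrightarrow> v \<in> UT \<Omega> M \<and> \<tau> \<in> RT0 \<Omega> M \<and>
     (\<forall>w\<in>UT \<Omega> M. \<forall>\<rho>\<in>RT0 \<Omega> M. fosls \<Omega> Qf v \<tau> \<le> fosls \<Omega> Qf w \<rho>)"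

end

theory Submission
  imports Defs
begin

text \<open>The map \<open>(v, \<tau>) \<mapsto> (div \<tau>, \<nabla>v - \<tau>)\<close> is bounded below on \<open>H\<^sup>1\<^sub>0 \<times> H(div)\<close> by Green's formula and
  the Friedrichs inequality, so the least-squares problem has a solution, unique in the energy norm, and by
  Pythagoras the distance of the solution to any discrete pair is controlled by the functional at that pair.
  Given \<open>(v, \<tau>)\<close>, choose \<open>\<rho> \<in> RT\<^sup>0\<close> with \<open>div \<rho> = Q (div \<tau> + f)\<close> and
  \<open>\<parallel>\<rho>\<parallel> \<lesssim> \<parallel>Q (div \<tau> + f)\<parallel>\<^sub>-\<^sub>1 \<lesssim> \<parallel>div \<tau> + f\<parallel>\<^sub>-\<^sub>1 \<le> \<parallel>\<sigma> - \<tau>\<parallel>\<close>. At \<open>(v, \<tau> - \<rho>)\<close> the divergence residual vanishes,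
  because \<open>Q\<close> is a projection, and the functional is \<open>\<parallel>\<nabla>v - \<tau> + \<rho>\<parallel>\<^sup>2\<close>.

  The field \<open>\<rho>\<close> comes from a discrete inf-sup condition. Weighting the Raviart-Thomas fields of the facets by the
  jumps of a piecewise constant \<open>w\<close> turns \<open>div \<rho> = p\<close> into the Euler equation of the form
  \<open>\<Sum> m [w]\<^sup>2\<close> over all facets, and \<open>\<parallel>\<rho>\<parallel>\<^sup>2\<close> is bounded by this energy. Nodal averaging followed by a correction with
  bubbles gives \<open>W \<in> H\<^sup>1\<^sub>0\<close> with the cell means of \<open>w\<close> and \<open>\<parallel>\<nabla>W\<parallel>\<^sup>2\<close> bounded by the energy, so testing
  \<open>p\<close> with \<open>W\<close> bounds the energy by the dual norm of \<open>p\<close>.\<close>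

section \<open>Square integrable functions\<close>

text \<open>The final constant may see the mesh only through the bound on its shape regularity.
  Hence every local estimate is explicit: the gradients of barycentric coordinates and the number of
  cells at a vertex are bounded by packing disjoint sets into a ball. Surface integrals are never
  formed: the mean over a facet is a volume integral over an adjacent cell, and fluxes cancel
  because the means computed from the two sides coincide. The geometric obstacle is the nodal
  averaging. Values of w in two cells at a vertex can be compared through jumps only along chains of
  cells with common facets. A generic segment near the vertex shows that such chains reach every
  cell there or run into a boundary facet, where the jump compares w with 0. That a Lipschitz domain
  is the interior of its closure then puts every frontier point on a boundary facet, so the
  interpolant vanishes off \<Omega>. The weight m is volume over diameter squared: m times a squared
  difference of cell values scales like the squared norm of a gradient.\<close>

definition sq_int :: "'x measure \<Rightarrow> ('x \<Rightarrow> 'b::euclidean_space) \<Rightarrow> bool" where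
  "sq_int N f \<longleftrightarrow> f \<in> borel_measurable N \<and> integrable N (\<lambda>x. norm (f x) ^ 2)"

text \<open>Measure and value space are arbitrary: square integrability is needed on \<Omega> and on
  single cells, and the residual of the least-squares problem takes values in
  \<open>real \<times> 'a\<close>.\<close>

definition sq_norm :: "'x measure \<Rightarrow> ('x \<Rightarrow> 'b::euclidean_space) \<Rightarrow> real" where
  "sq_norm N f = sqrt (\<integral>x. norm (f x) ^ 2 \<partial>N)"

lemma L2_iff_sq_int:
  assumes "\<Omega> \<in> sets lebesgue"
  shows "L2 \<Omega> v \<longleftrightarrow> sq_int (lebesgue_on \<Omega>) v"
  using assms unfolding L2_def sq_int_def set_borel_measurable_def set_integrable_def
  by (simp add: borel_measurable_restrict_space_iff integrable_restrict_space)

lemma set_integral_eq_lebesgue_on: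
  fixes f :: "'a::euclidean_space \<Rightarrow> 'b::euclidean_space"
  assumes "\<Omega> \<in> sets lebesgue"
  shows "(LINT x:\<Omega>|lebesgue. f x) = (\<integral>x. f x \<partial>lebesgue_on \<Omega>)"
  using assms unfolding set_lebesgue_integral_def by (simp add: integral_restrict_space)

lemma L2norm_eq_sq_norm:
  assumes "\<Omega> \<in> sets lebesgue"
  shows "L2norm \<Omega> v = sq_norm (lebesgue_on \<Omega>) v"
  unfolding L2norm_def sq_norm_def by (simp add: set_integral_eq_lebesgue_on[OF assms])

lemma sq_norm_nonneg [simp]: "0 \<le> sq_norm N f"
  unfolding sq_norm_def by simp

lemma sq_norm_pow2: "sq_norm N f ^ 2 = (\<integral>x. norm (f x) ^ 2 \<partial>N)"
  unfolding sq_norm_def by simp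

lemma sq_int_measurable: "sq_int N f \<Longrightarrow> f \<in> borel_measurable N"
  by (simp add: sq_int_def)

lemma sq_int_inner:
  assumes "sq_int N f" "sq_int N g"
  shows "integrable N (\<lambda>x. f x \<bullet> g x)"
proof (rule Bochner_Integration.integrable_bound)
  show "integrable N (\<lambda>x. norm (f x) ^ 2 + norm (g x) ^ 2)"
    using assms by (simp add: sq_int_def)
  show "(\<lambda>x. f x \<bullet> g x) \<in> borel_measurable N"
    using assms by (auto simp: sq_int_def intro!: borel_measurable_inner)
  have "\<bar>f x \<bullet> g x\<bar> \<le> norm (f x) ^ 2 + norm (g x) ^ 2" for x
  proof -
    have "\<bar>f x \<bullet> g x\<bar> \<le> norm (f x) * norm (g x)" by (rule Cauchy_Schwarz_ineq2)
    moreover have "2 * (norm (f x) * norm (g x)) \<le> norm (f x) ^ 2 + norm (g x) ^ 2"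
      using sum_squares_bound[of "norm (f x)" "norm (g x)"] by simp
    moreover have "0 \<le> norm (f x) * norm (g x)" by simp
    ultimately show ?thesis by linarith
  qed
  then show "AE x in N. norm (f x \<bullet> g x) \<le> norm (norm (f x) ^ 2 + norm (g x) ^ 2)" by simp
qed

lemma sq_int_scaleR_integrable:
  assumes "sq_int N (u :: 'x \<Rightarrow> real)" "sq_int N (g :: 'x \<Rightarrow> 'b::euclidean_space)"
  shows "integrable N (\<lambda>x. u x *\<^sub>R g x)"
proof (rule Bochner_Integration.integrable_bound)
  show "integrable N (\<lambda>x. norm (u x) ^ 2 + norm (g x) ^ 2)"
    using assms by (simp add: sq_int_def)
  show "(\<lambda>x. u x *\<^sub>R g x) \<in> borel_measurable N"
    using assms by (auto simp: sq_int_def intro!: borel_measurable_scaleR)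
  have "norm (u x *\<^sub>R g x) \<le> norm (u x) ^ 2 + norm (g x) ^ 2" for x
  proof -
    have "2 * (norm (u x) * norm (g x)) \<le> norm (u x) ^ 2 + norm (g x) ^ 2"
      using sum_squares_bound[of "norm (u x)" "norm (g x)"] by simp
    moreover have "0 \<le> norm (u x) * norm (g x)" by simp
    ultimately show ?thesis unfolding norm_scaleR real_norm_def by linarith
  qed
  then show "AE x in N. norm (u x *\<^sub>R g x) \<le> norm (norm (u x) ^ 2 + norm (g x) ^ 2)" by simp
qed

lemma sq_int_mult_integrable:
  assumes "sq_int N (u :: 'x \<Rightarrow> real)" "sq_int N (w :: 'x \<Rightarrow> real)"
  shows "integrable N (\<lambda>x. u x * w x)"
  using sq_int_scaleR_integrable[OF assms] by simp

lemma norm_pow2_lincomb: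
  "norm (c *\<^sub>R a + b) ^ 2 = c ^ 2 * norm a ^ 2 + 2 * c * (a \<bullet> b) + norm (b::'b::euclidean_space) ^ 2"
proof -
  have "norm (c *\<^sub>R a + b) ^ 2 = norm (c *\<^sub>R a) ^ 2 + norm b ^ 2 + 2 * (c *\<^sub>R a \<bullet> b)"
    unfolding power2_norm_eq_inner by (simp add: inner_add_left inner_add_right inner_commute)
  then show ?thesis by (simp add: power_mult_distrib)
qed

lemma sq_int_lincomb:
  assumes "sq_int N f" "sq_int N g"
  shows "sq_int N (\<lambda>x. c *\<^sub>R f x + g x)"
  using assms sq_int_inner[OF assms] unfolding sq_int_def by (auto simp: norm_pow2_lincomb)

lemma sq_int_scaleR: "sq_int N f \<Longrightarrow> sq_int N (\<lambda>x. c *\<^sub>R f x)"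
  unfolding sq_int_def by (auto simp: power_mult_distrib)

lemma sq_int_diff: "sq_int N f \<Longrightarrow> sq_int N g \<Longrightarrow> sq_int N (\<lambda>x. f x - g x)"
  using sq_int_lincomb[of N g f "-1"] by simp

lemma sq_norm_scaleR: "sq_norm N (\<lambda>x. c *\<^sub>R f x) = \<bar>c\<bar> * sq_norm N f"
  unfolding sq_norm_def by (simp add: power_mult_distrib real_sqrt_mult)

lemma sq_norm_minus_commute: "sq_norm N (\<lambda>x. f x - g x) = sq_norm N (\<lambda>x. g x - f x)"
  unfolding sq_norm_def by (simp add: norm_minus_commute)

lemma sq_norm_lincomb_pow2:
  assumes "sq_int N f" "sq_int N g"
  shows "sq_norm N (\<lambda>x. c *\<^sub>R f x + g x) ^ 2
    = c ^ 2 * sq_norm N f ^ 2 + 2 * c * (\<integral>x. f x \<bullet> g x \<partial>N) + sq_norm N g ^ 2"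
  using assms sq_int_inner[OF assms] unfolding sq_norm_pow2 sq_int_def
  by (simp add: norm_pow2_lincomb)

text \<open>For b > 0 the value at t = - c / b decides, b < 0 fails for large t, and for b = 0 the
  linear term must vanish. The degenerate case matters because the lemma also serves semidefinite
  forms.\<close>

lemma nonneg_quadratic_discriminant:
  assumes "\<And>t::real. 0 \<le> t ^ 2 * b + 2 * t * c + a"
  shows "c ^ 2 \<le> a * b"
proof (cases "b = 0")
  case True
  have "c = 0"
  proof (rule ccontr)
    assume "c \<noteq> 0"
    then have "2 * (- (a + 1) / (2 * c)) * c + a = - 1" by (simp add: divide_simps)
    then show False using assms[of "- (a + 1) / (2 * c)"] True by simp
  qed
  then show ?thesis using True by simp
next
  case False
  have "0 \<le> b"
  proof (rule ccontr)
    assume "\<not> 0 \<le> b"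
    then have b: "b < 0" by simp
    \<comment> \<open>The quotient makes t * b absorb 2 |c| + |a|; the added 1 keeps t at least 1,
      so that a is at most t |a|.\<close>
    define t where "t = (2 * \<bar>c\<bar> + \<bar>a\<bar> + 1) / (- b) + 1"
    have t: "t \<ge> 1" using b by (simp add: t_def divide_nonneg_neg divide_nonpos_neg)
    have "t * b = - (2 * \<bar>c\<bar> + \<bar>a\<bar> + 1) + b" using b by (simp add: t_def field_simps)
    then have "t * b + 2 * \<bar>c\<bar> + \<bar>a\<bar> < 0" using b by simp
    then have "t * (t * b + 2 * \<bar>c\<bar> + \<bar>a\<bar>) < 0" using t by (simp add: mult_pos_neg)
    moreover have "2 * t * c \<le> t * (2 * \<bar>c\<bar>)" using t by (simp add: abs_le_iff)
    moreover have "a \<le> t * \<bar>a\<bar>" using t mult_right_mono[of 1 t "\<bar>a\<bar>"] by simp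
    ultimately show False using assms[of t] by (simp add: power2_eq_square algebra_simps)
  qed
  with False have b: "b > 0" by simp
  have "0 \<le> (c / b)^2 * b + 2 * (- (c / b)) * c + a" using assms[of "- (c / b)"] by simp
  then have "0 \<le> a - c ^ 2 / b" using b by (simp add: power2_eq_square field_simps)
  then show ?thesis using b by (simp add: field_simps)
qed

lemma sq_norm_Cauchy_Schwarz:
  assumes "sq_int N f" "sq_int N g"
  shows "\<bar>\<integral>x. f x \<bullet> g x \<partial>N\<bar> \<le> sq_norm N f * sq_norm N g"
proof -
  have "(\<integral>x. f x \<bullet> g x \<partial>N) ^ 2 \<le> sq_norm N g ^ 2 * sq_norm N f ^ 2"
  proof (rule nonneg_quadratic_discriminant)
    show "0 \<le> t\<^sup>2 * sq_norm N f ^ 2 + 2 * t * (\<integral>x. f x \<bullet> g x \<partial>N) + sq_norm N g ^ 2" for t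
      unfolding sq_norm_lincomb_pow2[OF assms, symmetric] by simp
  qed
  then have "(\<integral>x. f x \<bullet> g x \<partial>N) ^ 2 \<le> (sq_norm N f * sq_norm N g) ^ 2"
    by (simp add: power_mult_distrib mult.commute)
  then have "\<bar>\<integral>x. f x \<bullet> g x \<partial>N\<bar> \<le> \<bar>sq_norm N f * sq_norm N g\<bar>"
    by (simp only: abs_le_square_iff)
  then show ?thesis by simp
qed

lemma sq_norm_add_le:
  assumes "sq_int N f" "sq_int N g"
  shows "sq_norm N (\<lambda>x. f x + g x) \<le> sq_norm N f + sq_norm N g"
proof (rule power2_le_imp_le)
  have "sq_norm N (\<lambda>x. f x + g x) ^ 2
      = sq_norm N f ^ 2 + 2 * (\<integral>x. f x \<bullet> g x \<partial>N) + sq_norm N g ^ 2"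
    using sq_norm_lincomb_pow2[OF assms, of 1] by simp
  also have "\<dots> \<le> (sq_norm N f + sq_norm N g) ^ 2"
    using sq_norm_Cauchy_Schwarz[OF assms] by (simp add: power2_sum)
  finally show "sq_norm N (\<lambda>x. f x + g x) ^ 2 \<le> (sq_norm N f + sq_norm N g) ^ 2" .
qed simp

lemma sq_norm_triangle:
  assumes "sq_int N f" "sq_int N g" "sq_int N h"
  shows "sq_norm N (\<lambda>x. f x - h x) \<le> sq_norm N (\<lambda>x. f x - g x) + sq_norm N (\<lambda>x. g x - h x)"
  using sq_norm_add_le[OF sq_int_diff[OF assms(1,2)] sq_int_diff[OF assms(2,3)]] by simp

lemma sq_norm_eq_0_iff:
  assumes "sq_int N f"
  shows "sq_norm N f = 0 \<longleftrightarrow> (AE x in N. f x = 0)"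
proof -
  have "sq_norm N f = 0 \<longleftrightarrow> (\<integral>x. norm (f x) ^ 2 \<partial>N) = 0" by (simp add: sq_norm_def)
  also have "\<dots> \<longleftrightarrow> (AE x in N. norm (f x) ^ 2 = 0)"
    by (rule integral_nonneg_eq_0_iff_AE) (use assms in \<open>auto simp: sq_int_def\<close>)
  finally show ?thesis by simp
qed

lemma sq_norm_cong_AE:
  assumes "f \<in> borel_measurable N" "g \<in> borel_measurable N" "AE x in N. f x = g x"
  shows "sq_norm N f = sq_norm N g"
  unfolding sq_norm_def using assms by (intro arg_cong[where f=sqrt] integral_cong_AE) auto

lemma sq_int_bounded:
  assumes "finite_measure N" "f \<in> borel_measurable N" "AE x in N. norm (f x) \<le> B"
  shows "sq_int N f"
proof -
  interpret finite_measure N by fact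
  have "integrable N (\<lambda>x. norm (f x) ^ 2)"
  proof (rule integrable_const_bound)
    show "AE x in N. norm (norm (f x) ^ 2) \<le> B ^ 2"
      using assms(3) by eventually_elim (auto intro: power_mono)
  qed (use assms in auto)
  then show ?thesis using assms by (simp add: sq_int_def)
qed

lemma tendsto_integral_inner:
  assumes "\<And>k. sq_int N (F k)" "sq_int N f" "sq_int N g"
    and "(\<lambda>k. sq_norm N (\<lambda>x. F k x - f x)) \<longlonglongrightarrow> 0"
  shows "(\<lambda>k. \<integral>x. F k x \<bullet> g x \<partial>N) \<longlonglongrightarrow> (\<integral>x. f x \<bullet> g x \<partial>N)"
proof (rule LIM_zero_cancel, rule tendsto_rabs_zero_cancel, rule tendsto_sandwich[OF _ _ tendsto_const])
  show "(\<lambda>k. sq_norm N (\<lambda>x. F k x - f x) * sq_norm N g) \<longlonglongrightarrow> 0"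
    using tendsto_mult_right[OF assms(4), of "sq_norm N g"] by simp
  have "\<bar>(\<integral>x. F k x \<bullet> g x \<partial>N) - (\<integral>x. f x \<bullet> g x \<partial>N)\<bar> \<le> sq_norm N (\<lambda>x. F k x - f x) * sq_norm N g" for k
    using sq_norm_Cauchy_Schwarz[OF sq_int_diff[OF assms(1,2)] assms(3), of k]
      sq_int_inner[OF assms(1,3), of k] sq_int_inner[OF assms(2,3)]
    by (simp add: inner_diff_left)
  then show "\<forall>\<^sub>F k in sequentially. \<bar>(\<integral>x. F k x \<bullet> g x \<partial>N) - (\<integral>x. f x \<bullet> g x \<partial>N)\<bar>
      \<le> sq_norm N (\<lambda>x. F k x - f x) * sq_norm N g" by simp
qed auto

lemma tendsto_sq_norm:
  assumes "\<And>k. sq_int N (F k)" "sq_int N f"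
    and "(\<lambda>k. sq_norm N (\<lambda>x. F k x - f x)) \<longlonglongrightarrow> 0"
  shows "(\<lambda>k. sq_norm N (F k)) \<longlonglongrightarrow> sq_norm N f"
proof (rule LIM_zero_cancel, rule tendsto_rabs_zero_cancel, rule tendsto_sandwich[OF _ _ tendsto_const assms(3)])
  have "\<bar>sq_norm N (F k) - sq_norm N f\<bar> \<le> sq_norm N (\<lambda>x. F k x - f x)" for k
    using sq_norm_add_le[OF sq_int_diff[OF assms(1,2)] assms(2), of k]
      sq_norm_add_le[OF sq_int_diff[OF assms(2) assms(1)[of k]] assms(1)[of k]] sq_norm_minus_commute[of N f "F k"]
    by simp
  then show "\<forall>\<^sub>F k in sequentially. \<bar>sq_norm N (F k) - sq_norm N f\<bar> \<le> sq_norm N (\<lambda>x. F k x - f x)" by simp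
qed auto

section \<open>Test functions\<close>

lemma integrable_lborel_compact_support:
  fixes f :: "'a::euclidean_space \<Rightarrow> 'b::euclidean_space"
  assumes "continuous_on UNIV f" "compact K" "\<And>x. x \<notin> K \<Longrightarrow> f x = 0"
  shows "integrable lborel f"
proof -
  have "integrable lborel (\<lambda>x. indicator K x *\<^sub>R f x)"
    by (rule borel_integrable_compact[OF assms(2) continuous_on_subset[OF assms(1)]]) simp
  moreover have "(\<lambda>x. indicator K x *\<^sub>R f x) = f"
    using assms(3) by (auto simp: fun_eq_iff indicator_def)
  ultimately show ?thesis by simp
qed

lemma test_funD:
  assumes "test_fun \<Omega> \<phi> D"
  shows "(\<phi> has_derivative (\<lambda>h. D x \<bullet> h)) (at x)" "continuous_on UNIV D" "continuous_on UNIV \<phi>"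
    "compact (closure {x. \<phi> x \<noteq> 0})" "closure {x. \<phi> x \<noteq> 0} \<subseteq> \<Omega>"
    "x \<notin> closure {x. \<phi> x \<noteq> 0} \<Longrightarrow> \<phi> x = 0"
proof -
  have d: "(\<phi> has_derivative (\<lambda>h. D x \<bullet> h)) (at x)" for x using assms by (simp add: test_fun_def)
  then show "(\<phi> has_derivative (\<lambda>h. D x \<bullet> h)) (at x)" .
  show "continuous_on UNIV \<phi>"
    using d by (auto intro!: continuous_at_imp_continuous_on has_derivative_continuous)
  show "x \<notin> closure {x. \<phi> x \<noteq> 0} \<Longrightarrow> \<phi> x = 0"
    using subsetD[OF closure_subset, of x "{x. \<phi> x \<noteq> 0}"] by blast
  show "continuous_on UNIV D" "compact (closure {x. \<phi> x \<noteq> 0})" "closure {x. \<phi> x \<noteq> 0} \<subseteq> \<Omega>"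
    using assms unfolding test_fun_def by blast+
qed

lemma compact_closure_subset: "compact K \<Longrightarrow> closure A \<subseteq> K \<Longrightarrow> compact (closure A)"
  by (metis closed_closure compact_Int_closed inf.absorb_iff2)

lemma test_fun_grad_zero:
  assumes "test_fun \<Omega> \<phi> D" "x \<notin> closure {x. \<phi> x \<noteq> 0}"
  shows "D x = 0"
proof -
  have "((\<lambda>_. 0) has_derivative (\<lambda>h. D x \<bullet> h)) (at x)"
  proof (rule has_derivative_transform_within_open[OF test_funD(1)[OF assms(1)]])
    show "open (- closure {x. \<phi> x \<noteq> 0})" by auto
    show "x \<in> - closure {x. \<phi> x \<noteq> 0}" using assms(2) by simp
    show "\<phi> y = 0" if "y \<in> - closure {x. \<phi> x \<noteq> 0}" for y
      by (rule test_funD(6)[OF assms(1)]) (use that in simp)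
  qed
  then have eq: "(\<lambda>h. D x \<bullet> h) = (\<lambda>h. 0)"
    using has_derivative_unique[of "\<lambda>_. 0::real" "\<lambda>h. D x \<bullet> h" x "\<lambda>h. 0"] by simp
  show ?thesis using fun_cong[OF eq, of "D x"] by simp
qed

lemma test_fun_mono: "test_fun A \<phi> D \<Longrightarrow> A \<subseteq> B \<Longrightarrow> test_fun B \<phi> D"
  unfolding test_fun_def by auto

text \<open>The continuous gradient vanishes off the compact support, hence is bounded, and the mean
  value inequality holds on the whole space.\<close>

lemma test_fun_lipschitz:
  assumes "test_fun \<Omega> \<phi> D"
  obtains L where "L \<ge> 0" "\<And>x. norm (D x) \<le> L" "\<And>x y. \<bar>\<phi> x - \<phi> y\<bar> \<le> L * norm (x - y)"
proof -
  let ?K = "closure {x. \<phi> x \<noteq> 0}"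
  have "compact (D ` ?K)"
    using test_funD(2,4)[OF assms] continuous_on_subset by (intro compact_continuous_image) auto
  then obtain L where L: "L > 0" "\<And>x. x \<in> ?K \<Longrightarrow> norm (D x) \<le> L"
    using compact_imp_bounded[of "D ` ?K"] by (auto simp: bounded_pos)
  have nL: "norm (D x) \<le> L" for x
    using L test_fun_grad_zero[OF assms, of x] by (cases "x \<in> ?K") auto
  have "norm (\<phi> x - \<phi> y) \<le> L * norm (x - y)" for x y
  proof (rule differentiable_bound[of UNIV \<phi> "\<lambda>x h. D x \<bullet> h"])
    show "onorm (\<lambda>h. D z \<bullet> h) \<le> L" for z
    proof (rule onorm_le)
      show "norm (D z \<bullet> h) \<le> L * norm h" for h
        using Cauchy_Schwarz_ineq2[of "D z" h] mult_right_mono[OF nL[of z] norm_ge_zero[of h]] by simp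
    qed
  qed (use test_funD(1)[OF assms] in auto)
  then show ?thesis using that[of L] L nL by simp
qed

lemma test_fun_integrable:
  assumes "test_fun \<Omega> \<phi> D"
  shows "integrable lborel \<phi>" "integrable lborel D"
  using integrable_lborel_compact_support[OF test_funD(3,4)[OF assms] test_funD(6)[OF assms]]
    integrable_lborel_compact_support[OF test_funD(2,4)[OF assms] test_fun_grad_zero[OF assms]]
  by simp_all

lemma lborel_integral_translation:
  fixes f :: "'a::euclidean_space \<Rightarrow> 'b::euclidean_space"
  assumes "f \<in> borel_measurable borel"
  shows "(\<integral>x. f (x + c) \<partial>lborel) = (\<integral>x. f x \<partial>lborel)"
proof -
  have "(\<integral>x. f x \<partial>lborel) = (\<integral>x. f x \<partial>distr lborel borel ((+) c))"
    by (simp add: lborel_distr_plus)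
  also have "\<dots> = (\<integral>x. f (c + x) \<partial>lborel)" by (rule integral_distr) (use assms in auto)
  finally show ?thesis by (simp add: add.commute)
qed

text \<open>Differentiate the translation invariance of the integral.\<close>
lemma test_fun_integral_grad_zero:
  assumes "test_fun \<Omega> \<phi> D"
  shows "(\<integral>x. D x \<partial>lborel) = 0"
proof (rule euclidean_eqI)
  fix e :: 'a assume "e \<in> Basis"
  then have e1: "norm e = 1" by simp
  obtain L where L: "L \<ge> 0" "\<And>x. norm (D x) \<le> L" "\<And>x y. \<bar>\<phi> x - \<phi> y\<bar> \<le> L * norm (x - y)"
    using test_fun_lipschitz[OF assms] by blast
  let ?K = "closure {x. \<phi> x \<noteq> 0}"
  obtain R where R: "\<And>x. x \<in> ?K \<Longrightarrow> norm x \<le> R"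
    using compact_imp_bounded[OF test_funD(4)[OF assms]] unfolding bounded_iff by blast
  define t where "t k = inverse (real (Suc k))" for k
  have t: "0 < t k" "t k \<le> 1" for k by (auto simp: t_def field_simps)
  define s where "s k x = (\<phi> (x + t k *\<^sub>R e) - \<phi> x) / t k" for k x
  have phi_m[measurable]: "\<phi> \<in> borel_measurable borel"
    using test_funD(3)[OF assms] by (rule borel_measurable_continuous_onI)
  have D_m[measurable]: "D \<in> borel_measurable borel"
    using test_funD(2)[OF assms] by (rule borel_measurable_continuous_onI)
  have int_tr: "integrable lborel (\<lambda>x. \<phi> (x + c))" for c
  proof (rule integrable_lborel_compact_support)
    show "continuous_on UNIV (\<lambda>x. \<phi> (x + c))"
      by (rule continuous_on_compose2[OF test_funD(3)[OF assms]]) (auto intro!: continuous_intros)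
    show "compact ((\<lambda>x. x - c) ` ?K)"
      using test_funD(4)[OF assms] by (intro compact_continuous_image continuous_intros) auto
    show "\<phi> (x + c) = 0" if "x \<notin> (\<lambda>x. x - c) ` ?K" for x
    proof -
      have "x + c \<notin> ?K" using that by (metis add_diff_cancel imageI)
      then show ?thesis by (rule test_funD(6)[OF assms])
    qed
  qed
  have zero: "(\<integral>x. s k x \<partial>lborel) = 0" for k
    unfolding s_def using lborel_integral_translation[OF phi_m, of "t k *\<^sub>R e"]
      int_tr[of "t k *\<^sub>R e"] int_tr[of 0] by simp
  have "(\<lambda>k. \<integral>x. s k x \<partial>lborel) \<longlonglongrightarrow> (\<integral>x. D x \<bullet> e \<partial>lborel)"
  proof (rule integral_dominated_convergence)
    \<comment> \<open>All steps t k are at most 1, so the shifted supports stay in one ball of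
      radius R + 1 and the difference quotients have a common integrable majorant.\<close>
    show "integrable lborel (\<lambda>x. L * indicator (cball 0 (R + 1)) x :: real)"
      by (rule integrable_mult_right, rule integrable_real_indicator)
        (auto simp: emeasure_compact_finite[OF compact_cball, unfolded infinity_ennreal_def])
    show "AE x in lborel. (\<lambda>k. s k x) \<longlonglongrightarrow> D x \<bullet> e"
    proof (rule AE_I2)
      fix x
      have "((\<lambda>h. \<phi> (x + h *\<^sub>R e)) has_derivative (\<lambda>h. D x \<bullet> (h *\<^sub>R e))) (at 0)"
        by (rule has_derivative_compose[where g=\<phi> and f="\<lambda>h. x + h *\<^sub>R e"])
          (auto intro!: derivative_eq_intros simp: test_funD(1)[OF assms, of x])
      then have "((\<lambda>h. \<phi> (x + h *\<^sub>R e)) has_real_derivative (D x \<bullet> e)) (at 0)"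
        by (simp add: has_field_derivative_def mult_commute_abs)
      then have "((\<lambda>h. (\<phi> (x + h *\<^sub>R e) - \<phi> x) / h) \<longlongrightarrow> D x \<bullet> e) (at 0)"
        by (simp add: DERIV_def)
      moreover have "filterlim t (at 0) sequentially"
        unfolding filterlim_at t_def using LIMSEQ_inverse_real_of_nat by auto
      ultimately have "((\<lambda>k. (\<phi> (x + t k *\<^sub>R e) - \<phi> x) / t k) \<longlongrightarrow> D x \<bullet> e) sequentially"
        by (rule filterlim_compose)
      then show "(\<lambda>k. s k x) \<longlonglongrightarrow> D x \<bullet> e" by (simp add: s_def)
    qed
    show "AE x in lborel. norm (s k x) \<le> L * indicator (cball 0 (R + 1)) x" for k
    proof (rule AE_I2)
      fix x
      show "norm (s k x) \<le> L * indicator (cball 0 (R + 1)) x"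
      proof (cases "x \<in> cball 0 (R + 1)")
        case True
        have "\<bar>\<phi> (x + t k *\<^sub>R e) - \<phi> x\<bar> \<le> L * t k"
          using L(3)[of "x + t k *\<^sub>R e" x] t[of k] e1 by simp
        then show ?thesis using True t[of k] by (simp add: s_def field_simps)
      next
        case False
        then have n: "norm x > R + 1" by simp
        have "norm (x + t k *\<^sub>R e) \<ge> norm x - norm (t k *\<^sub>R e)" using norm_diff_ineq[of x "t k *\<^sub>R e"] by simp
        then have n2: "norm (x + t k *\<^sub>R e) > R" using n t[of k] e1 by simp
        have "x \<notin> ?K" "x + t k *\<^sub>R e \<notin> ?K" using R[of x] R[of "x + t k *\<^sub>R e"] n n2 by linarith+
        then have "\<phi> x = 0" "\<phi> (x + t k *\<^sub>R e) = 0" using test_funD(6)[OF assms] by blast+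
        then show ?thesis using False by (simp add: s_def)
      qed
    qed
    show "s k \<in> borel_measurable lborel" for k unfolding s_def by measurable
  qed measurable
  then have "(\<lambda>k. 0) \<longlonglongrightarrow> (\<integral>x. D x \<bullet> e \<partial>lborel)" using zero by simp
  then have "(\<integral>x. D x \<bullet> e \<partial>lborel) = 0" by (simp only: LIMSEQ_const_iff)
  then show "(\<integral>x. D x \<partial>lborel) \<bullet> e = 0 \<bullet> e"
    using test_fun_integrable(2)[OF assms] by simp
qed

lemma test_fun_mult:
  assumes "test_fun \<Omega> \<phi> D" "\<And>x. (h has_derivative (\<lambda>v. H x \<bullet> v)) (at x)" "continuous_on UNIV H"
  shows "test_fun \<Omega> (\<lambda>x. h x * \<phi> x) (\<lambda>x. h x *\<^sub>R D x + \<phi> x *\<^sub>R H x)"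
proof -
  have "continuous_on UNIV h"
    using assms(2) by (auto intro!: continuous_at_imp_continuous_on has_derivative_continuous)
  moreover have "((\<lambda>x. h x * \<phi> x) has_derivative (\<lambda>v. (h x *\<^sub>R D x + \<phi> x *\<^sub>R H x) \<bullet> v)) (at x)" for x
    using assms(2)[of x] test_funD(1)[OF assms(1), of x]
    by (auto intro!: derivative_eq_intros simp: inner_add_left algebra_simps)
  moreover have sub: "closure {x. h x * \<phi> x \<noteq> 0} \<subseteq> closure {x. \<phi> x \<noteq> 0}"
    by (rule closure_mono) auto
  moreover have "compact (closure {x. h x * \<phi> x \<noteq> 0})"
    using sub test_funD(4)[OF assms(1)] by (rule compact_closure_subset[rotated])
  ultimately show ?thesis
    unfolding test_fun_def using test_funD(2,3,5)[OF assms(1)] assms(3)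
    by (auto intro!: continuous_intros)
qed

lemma test_fun_lincomb:
  assumes "test_fun \<Omega> \<phi> D" "test_fun \<Omega> \<psi> E"
  shows "test_fun \<Omega> (\<lambda>x. c * \<phi> x + \<psi> x) (\<lambda>x. c *\<^sub>R D x + E x)"
proof -
  have "((\<lambda>x. c * \<phi> x + \<psi> x) has_derivative (\<lambda>v. (c *\<^sub>R D x + E x) \<bullet> v)) (at x)" for x
    using test_funD(1)[OF assms(1), of x] test_funD(1)[OF assms(2), of x]
    by (auto intro!: derivative_eq_intros simp: inner_add_left)
  moreover have "closure {x. c * \<phi> x + \<psi> x \<noteq> 0} \<subseteq> closure ({x. \<phi> x \<noteq> 0} \<union> {x. \<psi> x \<noteq> 0})"
    by (rule closure_mono) auto
  then have sub: "closure {x. c * \<phi> x + \<psi> x \<noteq> 0} \<subseteq> closure {x. \<phi> x \<noteq> 0} \<union> closure {x. \<psi> x \<noteq> 0}"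
    by simp
  moreover have "compact (closure {x. c * \<phi> x + \<psi> x \<noteq> 0})"
    using compact_Un[OF test_funD(4)[OF assms(1)] test_funD(4)[OF assms(2)]] sub
    by (rule compact_closure_subset)
  ultimately show ?thesis
    unfolding test_fun_def using test_funD(2,5)[OF assms(1)] test_funD(2,5)[OF assms(2)]
    by (auto intro!: continuous_intros)
qed

text \<open>Integrate the divergence of the field \<open>\<phi> x *\<^sub>R (x - c)\<close>.\<close>
lemma test_fun_integral_radial:
  fixes \<phi> :: "'a::euclidean_space \<Rightarrow> real"
  assumes "test_fun \<Omega> \<phi> D"
  shows "(\<integral>x. (x - c) \<bullet> D x \<partial>lborel) = - (real DIM('a) * (\<integral>x. \<phi> x \<partial>lborel))"
    "integrable lborel (\<lambda>x. (x - c) \<bullet> D x)"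
proof -
  have int: "integrable lborel (\<lambda>x. (x - c) \<bullet> D x)"
    by (rule integrable_lborel_compact_support[OF _ test_funD(4)[OF assms]])
      (auto intro!: continuous_intros test_funD(2)[OF assms] simp: test_fun_grad_zero[OF assms])
  then show "integrable lborel (\<lambda>x. (x - c) \<bullet> D x)" .
  have *: "(\<integral>x. ((x - c) \<bullet> e) * (D x \<bullet> e) \<partial>lborel) = - (\<integral>x. \<phi> x \<partial>lborel)"
    "integrable lborel (\<lambda>x. ((x - c) \<bullet> e) * (D x \<bullet> e))" if e: "e \<in> Basis" for e
  proof -
    have tf: "test_fun \<Omega> (\<lambda>x. ((x - c) \<bullet> e) * \<phi> x) (\<lambda>x. ((x - c) \<bullet> e) *\<^sub>R D x + \<phi> x *\<^sub>R e)"
      by (rule test_fun_mult[OF assms]) (auto intro!: derivative_eq_intros continuous_intros simp: inner_commute)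
    show int: "integrable lborel (\<lambda>x. ((x - c) \<bullet> e) * (D x \<bullet> e))"
      by (rule integrable_lborel_compact_support[OF _ test_funD(4)[OF assms]])
        (auto intro!: continuous_intros test_funD(2)[OF assms] simp: test_fun_grad_zero[OF assms])
    have "0 = (\<integral>x. ((x - c) \<bullet> e) *\<^sub>R D x + \<phi> x *\<^sub>R e \<partial>lborel) \<bullet> e"
      using test_fun_integral_grad_zero[OF tf] by simp
    also have "\<dots> = (\<integral>x. (((x - c) \<bullet> e) *\<^sub>R D x + \<phi> x *\<^sub>R e) \<bullet> e \<partial>lborel)"
      using test_fun_integrable(2)[OF tf] by simp
    also have "\<dots> = (\<integral>x. ((x - c) \<bullet> e) * (D x \<bullet> e) + \<phi> x \<partial>lborel)"
      using e by (simp add: inner_add_left inner_Basis)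
    also have "\<dots> = (\<integral>x. ((x - c) \<bullet> e) * (D x \<bullet> e) \<partial>lborel) + (\<integral>x. \<phi> x \<partial>lborel)"
      using int test_fun_integrable(1)[OF assms] by simp
    finally show "(\<integral>x. ((x - c) \<bullet> e) * (D x \<bullet> e) \<partial>lborel) = - (\<integral>x. \<phi> x \<partial>lborel)" by simp
  qed
  have "(\<integral>x. (x - c) \<bullet> D x \<partial>lborel) = (\<integral>x. (\<Sum>e\<in>Basis. ((x - c) \<bullet> e) * (D x \<bullet> e)) \<partial>lborel)"
    by (subst euclidean_inner) simp
  also have "\<dots> = (\<Sum>e\<in>Basis. \<integral>x. ((x - c) \<bullet> e) * (D x \<bullet> e) \<partial>lborel)"
    by (rule Bochner_Integration.integral_sum) (rule *(2))
  also have "\<dots> = - (real DIM('a) * (\<integral>x. \<phi> x \<partial>lborel))" by (simp add: *(1))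
  finally show "(\<integral>x. (x - c) \<bullet> D x \<partial>lborel) = - (real DIM('a) * (\<integral>x. \<phi> x \<partial>lborel))" .
qed

text \<open>Squaring the positive part makes the function C^1 across the sphere of radius r, which
  is the regularity asked for by \<open>test_fun\<close>, and leaves explicit bounds for the value
  and the gradient.\<close>

definition bump :: "real \<Rightarrow> 'a::euclidean_space \<Rightarrow> real" where
  "bump r z = (max 0 (1 - (norm z)\<^sup>2 / r\<^sup>2))\<^sup>2"

definition bump_grad :: "real \<Rightarrow> 'a::euclidean_space \<Rightarrow> 'a" where
  "bump_grad r z = (- 4 / r\<^sup>2 * max 0 (1 - (norm z)\<^sup>2 / r\<^sup>2)) *\<^sub>R z"

lemma has_real_derivative_pos_part_square:
  "((\<lambda>t::real. (max 0 t)\<^sup>2) has_real_derivative 2 * max 0 t) (at t)"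
proof (cases t "0::real" rule: linorder_cases)
  case less
  show ?thesis
    by (rule has_field_derivative_transform_within_open[where f="\<lambda>_. 0" and S="{..<0}"])
      (use less in auto)
next
  case greater
  have "((\<lambda>t::real. t\<^sup>2) has_real_derivative 2 * max 0 t) (at t)"
    using greater by (auto intro!: derivative_eq_intros)
  then show ?thesis
    by (rule has_field_derivative_transform_within_open[where S="{0<..}"]) (use greater in auto)
next
  case equal
  have "((\<lambda>h::real. (max 0 h)\<^sup>2 / h) \<longlongrightarrow> 0) (at 0)"
  proof (rule Lim_null_comparison[where g="\<lambda>h::real. \<bar>h\<bar>"])
    show "\<forall>\<^sub>F h in at 0. norm ((max 0 h)\<^sup>2 / h) \<le> \<bar>h\<bar>"
      by (auto simp: eventually_at_filter max_def power2_eq_square)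
    show "((\<lambda>h::real. \<bar>h\<bar>) \<longlongrightarrow> 0) (at 0)"
      using tendsto_rabs_zero[OF tendsto_ident_at] by simp
  qed
  then show ?thesis using equal by (simp add: DERIV_def)
qed

lemma bump_has_derivative:
  fixes z :: "'a::euclidean_space"
  shows "(bump r has_derivative (\<lambda>h. bump_grad r z \<bullet> h)) (at z)"
proof -
  let ?q = "\<lambda>z::'a. 1 - (z \<bullet> z) / r\<^sup>2"
  have "(?q has_derivative (\<lambda>h. - (2 * (z \<bullet> h)) / r\<^sup>2)) (at z)"
    by (cases "r = 0")
      (auto intro!: derivative_eq_intros simp: inner_commute fun_eq_iff power2_eq_square)
  from has_derivative_compose[OF this
      has_real_derivative_pos_part_square[of "?q z", unfolded has_field_derivative_def]]
  show ?thesis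
    unfolding bump_def[abs_def] bump_grad_def power2_norm_eq_inner by (simp add: algebra_simps)
qed

lemma bump_bounds: "0 \<le> bump r z" "bump r z \<le> 1"
proof -
  have "max 0 (1 - (norm z)\<^sup>2 / r\<^sup>2) \<le> 1" by (simp add: zero_le_divide_iff)
  then show "bump r z \<le> 1" unfolding bump_def by (intro power_le_one) auto
qed (simp add: bump_def)

lemma bump_eq_0: "0 < r \<Longrightarrow> r \<le> norm z \<Longrightarrow> bump r z = 0"
  and bump_grad_eq_0: "0 < r \<Longrightarrow> r \<le> norm z \<Longrightarrow> bump_grad r z = 0"
proof -
  assume *: "0 < r" "r \<le> norm z"
  then have "r\<^sup>2 \<le> (norm z)\<^sup>2" by (intro power_mono) auto
  then have "1 - (norm z)\<^sup>2 / r\<^sup>2 \<le> 0" using * by (simp add: field_simps)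
  then show "bump r z = 0" "bump_grad r z = 0" by (auto simp: bump_def bump_grad_def)
qed

lemma bump_lower:
  assumes "0 < r" "norm z \<le> r / 2"
  shows "1 / 2 \<le> bump r z"
proof -
  have "(norm z)\<^sup>2 \<le> (r / 2)\<^sup>2" using assms by (intro power_mono) auto
  then have "3 / 4 \<le> 1 - (norm z)\<^sup>2 / r\<^sup>2" using assms by (simp add: field_simps power2_eq_square)
  then have "3 / 4 \<le> max 0 (1 - (norm z)\<^sup>2 / r\<^sup>2)" by (rule max.coboundedI2)
  then have "(3 / 4)\<^sup>2 \<le> bump r z" unfolding bump_def by (rule power_mono) simp
  then show ?thesis by (simp add: power2_eq_square)
qed

lemma bump_grad_norm: "0 < r \<Longrightarrow> norm (bump_grad r z) \<le> 4 / r"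
proof (cases "norm z \<le> r")
  case True
  assume r: "0 < r"
  have "max 0 (1 - (norm z)\<^sup>2 / r\<^sup>2) \<le> 1" by (simp add: zero_le_divide_iff)
  then have "\<bar>- 4 / r\<^sup>2 * max 0 (1 - (norm z)\<^sup>2 / r\<^sup>2)\<bar> \<le> 4 / r\<^sup>2 * 1"
    unfolding abs_mult by (intro mult_mono) (auto simp: zero_le_divide_iff)
  then have "norm (bump_grad r z) \<le> 4 / r\<^sup>2 * r"
    unfolding bump_grad_def norm_scaleR using True r by (intro mult_mono) auto
  then show ?thesis using r by (simp add: power2_eq_square)
qed (simp add: bump_grad_eq_0)

lemma continuous_on_bump_grad: "continuous_on A (bump_grad r)"
  unfolding bump_grad_def[abs_def] by (cases "r = 0") (auto intro!: continuous_intros)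

lemma test_fun_bump:
  assumes "0 < r" "cball c r \<subseteq> \<Omega>"
  shows "test_fun \<Omega> (\<lambda>x. bump r (x - c)) (\<lambda>x. bump_grad r (x - c))"
proof -
  have "closure {x. bump r (x - c) \<noteq> 0} \<subseteq> cball c r"
  proof (rule closure_minimal)
    show "{x. bump r (x - c) \<noteq> 0} \<subseteq> cball c r"
    proof (rule subsetI, rule ccontr)
      fix x assume "x \<in> {x. bump r (x - c) \<noteq> 0}" "x \<notin> cball c r"
      then show False using bump_eq_0[OF assms(1), of "x - c"] by (simp add: dist_norm norm_minus_commute)
    qed
  qed simp
  moreover from this have "compact (closure {x. bump r (x - c) \<noteq> 0})"
    by (rule compact_closure_subset[OF compact_cball])
  moreover have "((\<lambda>x. bump r (x - c)) has_derivative (\<lambda>h. bump_grad r (x - c) \<bullet> h)) (at x)" for x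
    by (rule has_derivative_compose[where g="bump r" and f="\<lambda>x. x - c" and f'="\<lambda>h. h"])
      (auto intro!: derivative_eq_intros bump_has_derivative)
  moreover have "continuous_on UNIV (\<lambda>x. bump_grad r (x - c))"
    by (rule continuous_on_compose2[OF continuous_on_bump_grad[of UNIV]]) (auto intro!: continuous_intros)
  ultimately show ?thesis unfolding test_fun_def using assms(2) by blast
qed

section \<open>Mollification\<close>

text \<open>Differentiation under the integral sign. By the mean value inequality the first-order
  remainder of k is at most 2 L times the norm of the increment, so 2 L |v| is an integrable
  majorant of the remainder quotients.\<close>

lemma kernel_derivative:
  fixes v :: "'a::euclidean_space \<Rightarrow> real" and k :: "'a \<Rightarrow> real"
  assumes v: "integrable lborel v"
    and k: "\<And>z. (k has_derivative (\<lambda>h. dk z \<bullet> h)) (at z)" "continuous_on UNIV dk"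
    and bnd: "\<And>z. \<bar>k z\<bar> \<le> B" "\<And>z. norm (dk z) \<le> L"
  shows "((\<lambda>x. \<integral>y. v y * k (x - y) \<partial>lborel) has_derivative
      (\<lambda>h. (\<integral>y. v y *\<^sub>R dk (x - y) \<partial>lborel) \<bullet> h)) (at x)"
    and "continuous_on UNIV (\<lambda>x. \<integral>y. v y *\<^sub>R dk (x - y) \<partial>lborel)"
    and "integrable lborel (\<lambda>y. v y * k (x - y))"
    and "integrable lborel (\<lambda>y. v y *\<^sub>R dk (x - y))"
proof -
  have v_m[measurable]: "v \<in> borel_measurable borel" using borel_measurable_integrable[OF v] by simp
  have "continuous_on UNIV k"
    using k(1) by (auto intro!: continuous_at_imp_continuous_on has_derivative_continuous)
  then have k_m[measurable]: "k \<in> borel_measurable borel" by (rule borel_measurable_continuous_onI)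
  have dk_m[measurable]: "dk \<in> borel_measurable borel" using k(2) by (rule borel_measurable_continuous_onI)
  have B: "B \<ge> 0" using bnd(1)[of 0] by simp
  have L: "L \<ge> 0" using bnd(2)[of 0] norm_ge_zero order_trans by blast
  have lip: "\<bar>k z - k z'\<bar> \<le> L * norm (z - z')" for z z'
  proof -
    have "norm (k z - k z') \<le> L * norm (z - z')"
    proof (rule differentiable_bound[of UNIV k "\<lambda>x h. dk x \<bullet> h"])
      show "onorm (\<lambda>h. dk z \<bullet> h) \<le> L" for z
      proof (rule onorm_le)
        show "norm (dk z \<bullet> h) \<le> L * norm h" for h
          using Cauchy_Schwarz_ineq2[of "dk z" h] mult_right_mono[OF bnd(2)[of z] norm_ge_zero[of h]] by simp
      qed
    qed (use k(1) in auto)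
    then show ?thesis by simp
  qed
  have iF: "integrable lborel (\<lambda>y. v y * k (x - y))" for x
  proof (rule Bochner_Integration.integrable_bound)
    show "integrable lborel (\<lambda>y. B * v y)" using v by simp
    show "AE y in lborel. norm (v y * k (x - y)) \<le> norm (B * v y)"
    proof (rule AE_I2)
      show "norm (v y * k (x - y)) \<le> norm (B * v y)" for y
        using mult_right_mono[OF bnd(1)[of "x - y"] abs_ge_zero[of "v y"]] B
        by (simp add: abs_mult mult.commute)
    qed
  qed measurable
  have iG: "integrable lborel (\<lambda>y. v y *\<^sub>R dk (x - y))" for x
  proof (rule Bochner_Integration.integrable_bound)
    show "integrable lborel (\<lambda>y. L * v y)" using v by simp
    show "AE y in lborel. norm (v y *\<^sub>R dk (x - y)) \<le> norm (L * v y)"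
    proof (rule AE_I2)
      show "norm (v y *\<^sub>R dk (x - y)) \<le> norm (L * v y)" for y
        using mult_right_mono[OF bnd(2)[of "x - y"] abs_ge_zero[of "v y"]] L
        by (simp add: abs_mult mult.commute)
    qed
  qed measurable
  show "integrable lborel (\<lambda>y. v y * k (x - y))" "integrable lborel (\<lambda>y. v y *\<^sub>R dk (x - y))"
    by (rule iF, rule iG)
  let ?F = "\<lambda>x. \<integral>y. v y * k (x - y) \<partial>lborel" and ?G = "\<lambda>x. \<integral>y. v y *\<^sub>R dk (x - y) \<partial>lborel"
  show "continuous_on UNIV ?G"
    unfolding continuous_on_sequentially o_def
  proof safe
    fix X and a :: 'a assume X: "X \<longlonglongrightarrow> a"
    show "(\<lambda>n. ?G (X n)) \<longlonglongrightarrow> ?G a"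
    proof (rule integral_dominated_convergence[where w="\<lambda>y. norm (L * v y)"])
      show "integrable lborel (\<lambda>y. norm (L * v y))" using v by (intro integrable_norm) simp
      show "AE y in lborel. norm (v y *\<^sub>R dk (X n - y)) \<le> norm (L * v y)" for n
      proof (rule AE_I2)
        show "norm (v y *\<^sub>R dk (X n - y)) \<le> norm (L * v y)" for y
          using mult_right_mono[OF bnd(2)[of "X n - y"] abs_ge_zero[of "v y"]] L
          by (simp add: abs_mult mult.commute)
      qed
      show "AE y in lborel. (\<lambda>n. v y *\<^sub>R dk (X n - y)) \<longlonglongrightarrow> v y *\<^sub>R dk (a - y)"
      proof (rule AE_I2, rule tendsto_scaleR[OF tendsto_const])
        fix y
        have "isCont dk (a - y)" using k(2) by (simp add: continuous_on_eq_continuous_at)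
        then show "(\<lambda>n. dk (X n - y)) \<longlonglongrightarrow> dk (a - y)"
          by (rule isCont_tendsto_compose) (intro tendsto_intros X)
      qed
    qed measurable
  qed
  show "(?F has_derivative (\<lambda>h. ?G x \<bullet> h)) (at x)"
    unfolding has_derivative_at
  proof
    show "bounded_linear (\<lambda>h. ?G x \<bullet> h)" by (rule bounded_linear_inner_right)
    show "(\<lambda>h. norm (?F (x + h) - ?F x - ?G x \<bullet> h) / norm h) \<midarrow>0\<rightarrow> 0"
      unfolding tendsto_at_iff_sequentially o_def
    proof safe
      fix X :: "nat \<Rightarrow> 'a" assume X0: "\<forall>i. X i \<in> UNIV - {0}" and X: "X \<longlonglongrightarrow> 0"
      define s where "s n y = v y * ((k (x + X n - y) - k (x - y) - dk (x - y) \<bullet> X n) / norm (X n))" for n y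
      have int_s: "(\<integral>y. s n y \<partial>lborel) = (?F (x + X n) - ?F x - ?G x \<bullet> X n) / norm (X n)" for n
      proof -
        have "(\<integral>y. s n y \<partial>lborel) = (\<integral>y. (v y * k (x + X n - y) - v y * k (x - y)
            - (v y *\<^sub>R dk (x - y)) \<bullet> X n) / norm (X n) \<partial>lborel)"
          unfolding s_def by (simp add: algebra_simps)
        also have "\<dots> = (?F (x + X n) - ?F x - ?G x \<bullet> X n) / norm (X n)"
          using iF[of "x + X n"] iF[of x] iG[of x] integrable_inner_left[OF iG[of x], of "X n"]
            integral_inner_left[OF iG[of x], of "X n"]
          by (simp add: Bochner_Integration.integral_diff)
        finally show ?thesis .
      qed
      have "(\<lambda>n. \<integral>y. s n y \<partial>lborel) \<longlonglongrightarrow> (\<integral>y. 0 \<partial>(lborel :: 'a measure))"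
      proof (rule integral_dominated_convergence[where w="\<lambda>y. norm (2 * L * v y)"])
        show "integrable lborel (\<lambda>y. norm (2 * L * v y))" using v by (intro integrable_norm) simp
        show "AE y in lborel. norm (s n y) \<le> norm (2 * L * v y)" for n
        proof (rule AE_I2)
          fix y
          have "\<bar>k (x + X n - y) - k (x - y)\<bar> \<le> L * norm (X n)"
            using lip[of "x + X n - y" "x - y"] by (simp add: algebra_simps)
          moreover have "\<bar>dk (x - y) \<bullet> X n\<bar> \<le> L * norm (X n)"
            using Cauchy_Schwarz_ineq2[of "dk (x - y)" "X n"]
              mult_right_mono[OF bnd(2)[of "x - y"] norm_ge_zero[of "X n"]] by simp
          ultimately have "\<bar>k (x + X n - y) - k (x - y) - dk (x - y) \<bullet> X n\<bar> \<le> 2 * L * norm (X n)" by linarith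
          then have "\<bar>(k (x + X n - y) - k (x - y) - dk (x - y) \<bullet> X n) / norm (X n)\<bar> \<le> 2 * L"
            using X0 by (simp add: divide_le_eq)
          then have "\<bar>v y\<bar> * \<bar>(k (x + X n - y) - k (x - y) - dk (x - y) \<bullet> X n) / norm (X n)\<bar> \<le> \<bar>v y\<bar> * (2 * L)"
            by (rule mult_left_mono) simp
          then show "norm (s n y) \<le> norm (2 * L * v y)"
            unfolding s_def real_norm_def abs_mult using L by (simp add: mult_ac)
        qed
        show "AE y in lborel. (\<lambda>n. s n y) \<longlonglongrightarrow> 0"
        proof (rule AE_I2)
          fix y
          have "(\<lambda>h. norm (k ((x - y) + h) - k (x - y) - dk (x - y) \<bullet> h) / norm h) \<midarrow>0\<rightarrow> 0"
            using k(1)[of "x - y"] unfolding has_derivative_at by simp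
          then have "(\<lambda>n. norm (k ((x - y) + X n) - k (x - y) - dk (x - y) \<bullet> X n) / norm (X n)) \<longlonglongrightarrow> 0"
            unfolding tendsto_at_iff_sequentially o_def using X X0 by blast
          then have "(\<lambda>n. norm ((k ((x - y) + X n) - k (x - y) - dk (x - y) \<bullet> X n) / norm (X n))) \<longlonglongrightarrow> 0"
            by simp
          then have "(\<lambda>n. (k ((x - y) + X n) - k (x - y) - dk (x - y) \<bullet> X n) / norm (X n)) \<longlonglongrightarrow> 0"
            by (rule tendsto_norm_zero_cancel)
          then have "(\<lambda>n. v y * ((k ((x - y) + X n) - k (x - y) - dk (x - y) \<bullet> X n) / norm (X n))) \<longlonglongrightarrow> 0"
            by (rule tendsto_mult_right_zero)
          moreover have "x - y + X n = x + X n - y" for n by simp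
          ultimately show "(\<lambda>n. s n y) \<longlonglongrightarrow> 0" unfolding s_def by simp
        qed
      qed (auto simp: s_def)
      then have "(\<lambda>n. (?F (x + X n) - ?F x - ?G x \<bullet> X n) / norm (X n)) \<longlonglongrightarrow> 0" unfolding int_s by simp
      then have "(\<lambda>n. norm ((?F (x + X n) - ?F x - ?G x \<bullet> X n) / norm (X n))) \<longlonglongrightarrow> 0" by (rule tendsto_norm_zero)
      then show "(\<lambda>n. norm (?F (x + X n) - ?F x - ?G x \<bullet> X n) / norm (X n)) \<longlonglongrightarrow> 0"
        by (simp add: norm_divide)
    qed
  qed
qed

lemma lborel_integral_reflect:
  fixes f :: "'a::euclidean_space \<Rightarrow> 'b::euclidean_space"
  assumes "f \<in> borel_measurable borel"
  shows "(\<integral>y. f (x - y) \<partial>lborel) = (\<integral>y. f y \<partial>lborel)"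
proof -
  have "lborel = distr lborel borel (\<lambda>y::'a. x - y)"
    using lborel_affine[of "-1" x] by (simp add: density_1)
  then have "(\<integral>y. f y \<partial>lborel) = (\<integral>y. f y \<partial>distr lborel borel (\<lambda>y. x - y))" by simp
  also have "\<dots> = (\<integral>y. f (x - y) \<partial>lborel)" by (rule integral_distr) (use assms in auto)
  finally show ?thesis by simp
qed

lemma test_fun_bump_0: "0 < r \<Longrightarrow> test_fun UNIV (bump r :: 'a::euclidean_space \<Rightarrow> real) (bump_grad r)"
  using test_fun_bump[of r 0 "UNIV :: 'a set"] by simp

lemma bump_measurable [measurable]: "bump r \<in> borel_measurable borel"
  unfolding bump_def[abs_def] by measurable

lemma integrable_bump: "0 < r \<Longrightarrow> integrable lborel (bump r :: 'a::euclidean_space \<Rightarrow> real)"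
  using test_fun_integrable(1)[OF test_fun_bump_0] by blast

text \<open>The bump is at least 1/2 on the ball of half the radius, whose volume is smaller by the
  factor \<open>2 ^ DIM('a)\<close>.\<close>

lemma bump_integral_lower:
  assumes "0 < r"
  shows "measure lborel (cball (0::'a::euclidean_space) r) \<le> 2 ^ (DIM('a) + 1) * (\<integral>z. bump r (z::'a) \<partial>lborel)"
    and "0 < (\<integral>z. bump r (z::'a) \<partial>lborel)"
proof -
  have "(\<integral>z. (1/2) * indicator (cball 0 (r/2)) (z::'a) \<partial>lborel) \<le> (\<integral>z. bump r (z::'a) \<partial>lborel)"
  proof (rule integral_mono)
    show "integrable lborel (\<lambda>z::'a. 1 / 2 * indicator (cball 0 (r/2)) z :: real)"
      by (rule integrable_mult_right, rule integrable_real_indicator)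
        (auto simp: emeasure_compact_finite[OF compact_cball, unfolded infinity_ennreal_def])
    show "(1/2) * indicator (cball 0 (r/2)) z \<le> bump r z" for z :: 'a
      using bump_lower[OF assms, of z] bump_bounds(1)[of r z] by (auto simp: indicator_def)
  qed (rule integrable_bump[OF assms])
  then have le: "measure lborel (cball (0::'a) (r/2)) / 2 \<le> (\<integral>z. bump r (z::'a) \<partial>lborel)" by simp
  have "measure lborel (cball (0::'a) (r/2)) = measure lborel (cball (0::'a) r) / 2 ^ DIM('a)"
    using assms by (simp add: content_cball power_divide)
  with le show "measure lborel (cball (0::'a) r) \<le> 2 ^ (DIM('a) + 1) * (\<integral>z. bump r (z::'a) \<partial>lborel)"
    by (simp add: field_simps)
  show "0 < (\<integral>z. bump r (z::'a) \<partial>lborel)"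
    using le assms content_cball_gt_0_iff[of "0::'a" "r/2"] by linarith
qed

definition mollify :: "real \<Rightarrow> ('a::euclidean_space \<Rightarrow> real) \<Rightarrow> 'a \<Rightarrow> real" where
  "mollify r v x = (\<integral>y. v y * bump r (x - y) \<partial>lborel) / (\<integral>z. bump r (z::'a) \<partial>lborel)"

definition mollify_grad :: "real \<Rightarrow> ('a::euclidean_space \<Rightarrow> real) \<Rightarrow> 'a \<Rightarrow> 'a" where
  "mollify_grad r v x =
    inverse (\<integral>z. bump r (z::'a) \<partial>lborel) *\<^sub>R (\<integral>y. v y *\<^sub>R bump_grad r (x - y) \<partial>lborel)"

lemma bump_abs_le: "\<bar>bump r z\<bar> \<le> 1"
  using bump_bounds[of r z] by simp

lemmas mollify_kernel = kernel_derivative[OF _ bump_has_derivative continuous_on_bump_grad bump_abs_le bump_grad_norm]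

lemma mollify_has_derivative:
  fixes v :: "'a::euclidean_space \<Rightarrow> real"
  assumes "integrable lborel v" "0 < r"
  shows "(mollify r v has_derivative (\<lambda>h. mollify_grad r v x \<bullet> h)) (at x)"
    and "continuous_on UNIV (mollify_grad r v)"
proof -
  have "((\<lambda>x. (\<integral>y. v y * bump r (x - y) \<partial>lborel) * inverse (\<integral>z. bump r (z::'a) \<partial>lborel)) has_derivative
      (\<lambda>h. ((\<integral>y. v y *\<^sub>R bump_grad r (x - y) \<partial>lborel) \<bullet> h) * inverse (\<integral>z. bump r (z::'a) \<partial>lborel))) (at x)"
    by (rule has_derivative_mult_left[OF mollify_kernel(1)[OF assms]])
  then show "(mollify r v has_derivative (\<lambda>h. mollify_grad r v x \<bullet> h)) (at x)"
    unfolding mollify_def[abs_def] mollify_grad_def by (simp add: divide_inverse mult.commute)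
  show "continuous_on UNIV (mollify_grad r v)"
    unfolding mollify_grad_def[abs_def] by (intro continuous_intros mollify_kernel(2)[OF assms])
qed

lemma bump_integral_reflect:
  "(\<integral>y. bump r ((x::'a::euclidean_space) - y) \<partial>lborel) = (\<integral>z. bump r (z::'a) \<partial>lborel)"
  by (rule lborel_integral_reflect) simp

lemma integrable_bump_reflect:
  assumes "0 < r"
  shows "integrable lborel (\<lambda>y::'a::euclidean_space. bump r (x - y))"
proof (rule integrable_lborel_compact_support[where K="cball x r"])
  show "continuous_on UNIV (\<lambda>y. bump r (x - y))"
    by (rule continuous_on_compose2[OF test_funD(3)[OF test_fun_bump_0[OF assms]]]) (auto intro!: continuous_intros)
  show "bump r (x - y) = 0" if "y \<notin> cball x r" for y
    using that bump_eq_0[OF assms, of "x - y"] by (simp add: dist_norm)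
qed simp

text \<open>A weighted mean of values within E of a is itself within E of a. The case E = 0 gives
  exact values, and with them the supports of mollified functions.\<close>

lemma mollify_error:
  fixes v :: "'a::euclidean_space \<Rightarrow> real"
  assumes v: "integrable lborel v" and r: "0 < r" and err: "\<And>y. norm (y - x) \<le> r \<Longrightarrow> \<bar>v y - a\<bar> \<le> E"
  shows "\<bar>mollify r v x - a\<bar> \<le> E"
proof -
  let ?c = "\<integral>z. bump r (z::'a) \<partial>lborel"
  have c: "0 < ?c" by (rule bump_integral_lower(2)[OF r])
  note i1 = mollify_kernel(3)[OF v r, of x]
  note i2 = integrable_bump_reflect[OF r, of x]
  have "\<bar>(\<integral>y. v y * bump r (x - y) - a * bump r (x - y) \<partial>lborel)\<bar> \<le> (\<integral>y. E * bump r (x - y) \<partial>lborel)"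
  proof (rule integral_abs_bound_integral)
    fix y
    show "\<bar>v y * bump r (x - y) - a * bump r (x - y)\<bar> \<le> E * bump r (x - y)"
    proof (cases "norm (y - x) \<le> r")
      case True
      have "\<bar>v y - a\<bar> * bump r (x - y) \<le> E * bump r (x - y)"
        by (rule mult_right_mono[OF err[OF True] bump_bounds(1)])
      moreover have "\<bar>v y * bump r (x - y) - a * bump r (x - y)\<bar> = \<bar>v y - a\<bar> * bump r (x - y)"
        using bump_bounds(1)[of r "x - y"] by (simp add: left_diff_distrib[symmetric] abs_mult)
      ultimately show ?thesis by simp
    next
      case False
      then show ?thesis using bump_eq_0[OF r, of "x - y"] by (simp add: norm_minus_commute)
    qed
  qed (use i1 i2 in auto)
  then have "\<bar>(\<integral>y. v y * bump r (x - y) \<partial>lborel) - a * ?c\<bar> \<le> E * ?c"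
    using i1 i2 by (simp add: bump_integral_reflect)
  moreover have "(\<integral>y. v y * bump r (x - y) \<partial>lborel) = mollify r v x * ?c"
    using c by (simp add: mollify_def)
  ultimately have "\<bar>mollify r v x - a\<bar> * ?c \<le> E * ?c"
    using c by (simp add: left_diff_distrib[symmetric] abs_mult)
  then show ?thesis using c by simp
qed

text \<open>Mollification reproduces the gradient of an affine function, because the gradient of the
  affine function times the bump has integral 0. Only the deviation from the affine function counts:
  it is at most E * (4 / r) times the ratio of the ball volume to the bump integral, and this ratio
  is at most \<open>2 ^ (DIM('a) + 1)\<close>.\<close>

lemma mollify_grad_error:
  fixes v :: "'a::euclidean_space \<Rightarrow> real"
  assumes v: "integrable lborel v" and r: "0 < r"
    and err: "\<And>y. norm (y - x) \<le> r \<Longrightarrow> \<bar>v y - (a + g \<bullet> (y - x))\<bar> \<le> E"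
  shows "norm (mollify_grad r v x - g) \<le> E * 2 ^ (DIM('a) + 3) / r"
proof -
  let ?c = "\<integral>z. bump r (z::'a) \<partial>lborel" and ?A = "\<lambda>y. a + g \<bullet> (y - x)"
  have c: "0 < ?c" by (rule bump_integral_lower(2)[OF r])
  have E: "0 \<le> E" using err[of x] r by simp
  note i1 = mollify_kernel(4)[OF v r, of x]
  have tf0: "test_fun UNIV (\<lambda>y. bump r (y - x)) (\<lambda>y. bump_grad r (y - x))"
    by (rule test_fun_bump[OF r]) simp
  have tf: "test_fun UNIV (\<lambda>y. ?A y * bump r (y - x)) (\<lambda>y. ?A y *\<^sub>R bump_grad r (y - x) + bump r (y - x) *\<^sub>R g)"
    by (rule test_fun_mult[OF tf0]) (auto intro!: derivative_eq_intros)
  have sym: "bump r (y - x) = bump r (x - y)" "bump_grad r (y - x) = - bump_grad r (x - y)" for y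
    by (auto simp: bump_def bump_grad_def norm_minus_commute algebra_simps)
  have i3: "integrable lborel (\<lambda>y. ?A y *\<^sub>R bump_grad r (x - y))"
  proof -
    have "integrable lborel (\<lambda>y. bump r (x - y) *\<^sub>R g - (?A y *\<^sub>R bump_grad r (y - x) + bump r (y - x) *\<^sub>R g))"
      using test_fun_integrable(2)[OF tf] integrable_bump_reflect[OF r, of x]
      by (intro Bochner_Integration.integrable_diff) auto
    then show ?thesis by (simp add: sym)
  qed
  have "0 = (\<integral>y. ?A y *\<^sub>R bump_grad r (y - x) + bump r (y - x) *\<^sub>R g \<partial>lborel)"
    using test_fun_integral_grad_zero[OF tf] by simp
  also have "\<dots> = (\<integral>y. bump r (x - y) *\<^sub>R g - ?A y *\<^sub>R bump_grad r (x - y) \<partial>lborel)"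
    by (simp add: sym)
  also have "\<dots> = ?c *\<^sub>R g - (\<integral>y. ?A y *\<^sub>R bump_grad r (x - y) \<partial>lborel)"
    using i3 integrable_bump_reflect[OF r, of x] by (simp add: bump_integral_reflect)
  finally have A: "(\<integral>y. ?A y *\<^sub>R bump_grad r (x - y) \<partial>lborel) = ?c *\<^sub>R g" by simp
  have "norm (\<integral>y. v y *\<^sub>R bump_grad r (x - y) - ?A y *\<^sub>R bump_grad r (x - y) \<partial>lborel)
      \<le> (\<integral>y. E * (4 / r) * indicator (cball x r) y \<partial>lborel)"
  proof (rule Bochner_Integration.integral_norm_bound_integral)
    fix y
    show "norm (v y *\<^sub>R bump_grad r (x - y) - ?A y *\<^sub>R bump_grad r (x - y)) \<le> E * (4 / r) * indicator (cball x r) y"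
    proof (cases "norm (y - x) \<le> r")
      case True
      have "norm (v y *\<^sub>R bump_grad r (x - y) - ?A y *\<^sub>R bump_grad r (x - y))
          = \<bar>v y - ?A y\<bar> * norm (bump_grad r (x - y))"
        by (simp only: scaleR_left_diff_distrib[symmetric] norm_scaleR)
      also have "\<dots> \<le> E * (4 / r)" using bump_grad_norm[OF r] err[OF True] E by (intro mult_mono) auto
      finally show ?thesis using True by (simp add: dist_norm norm_minus_commute)
    next
      case False
      then show ?thesis using bump_grad_eq_0[OF r, of "x - y"] by (simp add: norm_minus_commute dist_norm)
    qed
  next
    show "integrable lborel (\<lambda>y. E * (4 / r) * indicator (cball x r) y :: real)"
      by (rule integrable_mult_right, rule integrable_real_indicator)
        (auto simp: emeasure_compact_finite[OF compact_cball, unfolded infinity_ennreal_def])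
  qed (use i1 i3 in auto)
  then have "norm ((\<integral>y. v y *\<^sub>R bump_grad r (x - y) \<partial>lborel) - ?c *\<^sub>R g) \<le> E * (4 / r) * measure lborel (cball x r)"
    using i1 i3 A by simp
  also have "measure lborel (cball x r) = measure lborel (cball (0::'a) r)" using r by (simp add: content_cball)
  also have "E * (4 / r) * measure lborel (cball (0::'a) r) \<le> E * (4 / r) * (2 ^ (DIM('a) + 1) * ?c)"
    using E r by (intro mult_left_mono[OF bump_integral_lower(1)[OF r]]) auto
  finally have "norm ((\<integral>y. v y *\<^sub>R bump_grad r (x - y) \<partial>lborel) - ?c *\<^sub>R g) \<le> ?c * (E * 2 ^ (DIM('a) + 3) / r)"
    by (simp add: mult_ac power_add)
  moreover have "(\<integral>y. v y *\<^sub>R bump_grad r (x - y) \<partial>lborel) = ?c *\<^sub>R mollify_grad r v x"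
    using c by (simp add: mollify_grad_def)
  ultimately have "?c * norm (mollify_grad r v x - g) \<le> ?c * (E * 2 ^ (DIM('a) + 3) / r)"
    using c by (simp add: scaleR_diff_right[symmetric])
  then show ?thesis using c by (rule mult_left_le_imp_le)
qed

lemma mollify_test_fun:
  fixes v :: "'a::euclidean_space \<Rightarrow> real"
  assumes v: "integrable lborel v" and r: "0 < r"
    and K: "compact K" "\<And>x. x \<notin> K \<Longrightarrow> v x = 0" "\<And>x. x \<in> K \<Longrightarrow> cball x r \<subseteq> \<Omega>"
  shows "test_fun \<Omega> (mollify r v) (mollify_grad r v)"
proof -
  let ?K = "{x + y |x y. x \<in> K \<and> y \<in> cball 0 r}"
  have cK: "compact ?K" using K(1) by (rule compact_sums) simp
  have "mollify r v x = 0" if "x \<notin> ?K" for x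
  proof -
    have "\<bar>mollify r v x - 0\<bar> \<le> 0"
    proof (rule mollify_error[OF v r])
      fix y assume y: "norm (y - x) \<le> r"
      have "y \<notin> K"
      proof
        assume "y \<in> K"
        then have "y + (x - y) \<in> ?K" using y by (force simp: norm_minus_commute)
        then show False using that by simp
      qed
      then show "\<bar>v y - 0\<bar> \<le> 0" using K(2) by simp
    qed
    then show ?thesis by simp
  qed
  then have sub: "closure {x. mollify r v x \<noteq> 0} \<subseteq> ?K"
    using cK by (intro closure_minimal compact_imp_closed) blast+
  moreover have "?K \<subseteq> \<Omega>"
  proof
    fix z assume "z \<in> ?K"
    then obtain x y where "z = x + y" "x \<in> K" "norm y \<le> r" by auto
    then have "z \<in> cball x r" by (simp add: dist_norm)
    then show "z \<in> \<Omega>" using K(3) \<open>x \<in> K\<close> by blast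
  qed
  ultimately show ?thesis
    unfolding test_fun_def using mollify_has_derivative[OF v r] compact_closure_subset[OF cK sub] by blast
qed

section \<open>The fundamental lemma of the calculus of variations\<close>

lemma borel_measurable_lebesgue_on:
  "f \<in> borel_measurable borel \<Longrightarrow> f \<in> borel_measurable (lebesgue_on S)"
  by (intro measurable_restrict_space1 measurable_completion) simp

lemma continuous_measurable_lebesgue_on:
  "continuous_on UNIV (f :: 'a::euclidean_space \<Rightarrow> 'b::euclidean_space) \<Longrightarrow> f \<in> borel_measurable (lebesgue_on S)"
  by (intro borel_measurable_lebesgue_on borel_measurable_continuous_onI)

lemma finite_measure_lebesgue_on:
  fixes S :: "'a::euclidean_space set"
  assumes "bounded S" "S \<in> sets lebesgue"
  shows "finite_measure (lebesgue_on S)"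
proof
  have "S \<in> lmeasurable" using assms by (simp add: bounded_set_imp_lmeasurable)
  then show "emeasure (lebesgue_on S) (space (lebesgue_on S)) \<noteq> \<infinity>"
    using assms(2) by (simp add: emeasure_restrict_space fmeasurable_def)
qed

lemma integral_lebesgue_on_supported:
  fixes f :: "'a::euclidean_space \<Rightarrow> 'b::euclidean_space"
  assumes "f \<in> borel_measurable borel" "S \<in> sets lebesgue" "\<And>x. x \<notin> S \<Longrightarrow> f x = 0"
  shows "(\<integral>x. f x \<partial>lebesgue_on S) = (\<integral>x. f x \<partial>lborel)"
proof -
  have "(\<lambda>x. indicator S x *\<^sub>R f x) = f" using assms(3) by (auto simp: fun_eq_iff indicator_def)
  then have "(\<integral>x. f x \<partial>lebesgue_on S) = (\<integral>x. f x \<partial>lebesgue)"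
    using assms(2) by (simp add: integral_restrict_space)
  also have "\<dots> = (\<integral>x. f x \<partial>lborel)" using assms(1) by (simp add: integral_completion)
  finally show ?thesis .
qed

lemma test_fun_sq_int:
  assumes "test_fun A \<phi> D" "bounded S" "S \<in> sets lebesgue"
  shows "sq_int (lebesgue_on S) \<phi>" "sq_int (lebesgue_on S) D"
proof -
  note fin = finite_measure_lebesgue_on[OF assms(2,3)]
  obtain L where L: "\<And>x. norm (D x) \<le> L" using test_fun_lipschitz[OF assms(1)] by metis
  show "sq_int (lebesgue_on S) D"
    by (rule sq_int_bounded[OF fin continuous_measurable_lebesgue_on[OF test_funD(2)[OF assms(1)]]])
      (use L in auto)
  have "compact (\<phi> ` closure {x. \<phi> x \<noteq> 0})"
    using continuous_on_subset[OF test_funD(3)[OF assms(1)]] test_funD(4)[OF assms(1)]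
    by (intro compact_continuous_image) auto
  then obtain B where B: "B > 0" "\<And>x. x \<in> closure {x. \<phi> x \<noteq> 0} \<Longrightarrow> norm (\<phi> x) \<le> B"
    using compact_imp_bounded[of "\<phi> ` closure {x. \<phi> x \<noteq> 0}"] by (auto simp: bounded_pos)
  have "norm (\<phi> x) \<le> B" for x
    using B(2)[of x] B(1) test_funD(6)[OF assms(1), of x]
    by (cases "x \<in> closure {x. \<phi> x \<noteq> 0}") (blast, metis less_imp_le norm_zero)
  then show "sq_int (lebesgue_on S) \<phi>"
    by (intro sq_int_bounded[OF fin continuous_measurable_lebesgue_on[OF test_funD(3)[OF assms(1)]]]) auto
qed

text \<open>Mollify the indicator of a closed neighbourhood of T whose width equals the
  mollification radius. The result is exactly 1 on T and vanishes at distance more than twice that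
  radius, which also keeps the support in \<Omega>.\<close>

lemma compact_indicator_approx:
  fixes T :: "'a::euclidean_space set"
  assumes "open \<Omega>" "compact T" "T \<subseteq> \<Omega>"
  shows "\<exists>\<phi> D. (\<forall>k::nat. test_fun \<Omega> (\<phi> k) (D k)) \<and> (\<forall>k x. \<bar>\<phi> k x\<bar> \<le> 1) \<and>
    (\<forall>x. (\<lambda>k. \<phi> k x) \<longlonglongrightarrow> indicator T x)"
proof (cases "T = {}")
  case True
  have "test_fun \<Omega> (\<lambda>x::'a. 0) (\<lambda>x. 0)" by (simp add: test_fun_def)
  then show ?thesis by (intro exI[of _ "\<lambda>_ _. 0"]) (auto simp: True)
next
  case False
  obtain d where d: "d > 0" "(\<Union>x\<in>T. cball x d) \<subseteq> \<Omega>"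
    by (rule compact_subset_open_imp_cball_epsilon_subset[OF assms(2,1,3)])
  define r where "r k = d / 2 / real (Suc k)" for k
  have r: "0 < r k" "2 * r k \<le> d" for k
    using d(1) by (auto simp: r_def field_simps)
  define K where "K k = {x. infdist x T \<le> r k}" for k
  have cT: "closed T" using assms(2) by (rule compact_imp_closed)
  have K_ex: "\<exists>t\<in>T. dist x t \<le> r k" if "x \<in> K k" for x k
  proof -
    obtain t where "t \<in> T" "infdist x T = dist x t" by (rule infdist_attains_inf[OF cT False])
    then show ?thesis using that unfolding K_def by fastforce
  qed
  have cK: "compact (K k)" for k
  proof -
    obtain R where R: "\<And>t. t \<in> T \<Longrightarrow> norm t \<le> R"
      using compact_imp_bounded[OF assms(2)] unfolding bounded_iff by blast
    have "norm x \<le> R + r k" if "x \<in> K k" for x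
    proof -
      obtain t where "t \<in> T" "dist x t \<le> r k" using K_ex[OF \<open>x \<in> K k\<close>] by blast
      then show ?thesis using R[of t] norm_triangle_ineq2[of x t] by (simp add: dist_norm)
    qed
    then have "bounded (K k)" unfolding bounded_iff by blast
    moreover have "closed (K k)" unfolding K_def by (intro closed_Collect_le continuous_intros)
    ultimately show ?thesis by (simp add: compact_eq_bounded_closed)
  qed
  define v where "v k = (indicator (K k) :: 'a \<Rightarrow> real)" for k
  have int_v: "integrable lborel (v k)" for k
    unfolding v_def using cK[of k]
    by (intro integrable_real_indicator)
      (auto simp: emeasure_compact_finite[unfolded infinity_ennreal_def] borel_compact)
  have tf: "test_fun \<Omega> (mollify (r k) (v k)) (mollify_grad (r k) (v k))" for k
  proof (rule mollify_test_fun[OF int_v r(1) cK])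
    show "cball x (r k) \<subseteq> \<Omega>" if "x \<in> K k" for x
    proof
      fix y assume y: "y \<in> cball x (r k)"
      obtain t where t: "t \<in> T" "dist x t \<le> r k" using K_ex[OF \<open>x \<in> K k\<close>] by blast
      then have "dist t y \<le> d" using y dist_triangle[of t y x] r(2)[of k] by (simp add: dist_commute)
      then have "y \<in> (\<Union>x\<in>T. cball x d)" using t(1) by auto
      then show "y \<in> \<Omega>" by (rule subsetD[OF d(2)])
    qed
  qed (simp add: v_def)
  have bnd: "\<bar>mollify (r k) (v k) x\<bar> \<le> 1" for k x
  proof -
    have "\<bar>mollify (r k) (v k) x - 0\<bar> \<le> 1"
      by (rule mollify_error[OF int_v r(1)]) (simp add: v_def indicator_def)
    then show ?thesis by simp
  qed
  have "(\<lambda>k. mollify (r k) (v k) x) \<longlonglongrightarrow> indicator T x" for x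
  proof (cases "x \<in> T")
    case True
    have "\<bar>mollify (r k) (v k) x - 1\<bar> \<le> 0" for k
    proof (rule mollify_error[OF int_v r(1)])
      fix y assume "norm (y - x) \<le> r k"
      then have "y \<in> K k" using infdist_le[OF True, of y] by (simp add: K_def dist_norm)
      then show "\<bar>v k y - 1\<bar> \<le> 0" by (simp add: v_def)
    qed
    then show ?thesis using True by simp
  next
    case False
    then have pos: "0 < infdist x T"
      using infdist_pos_not_in_closed[OF cT \<open>T \<noteq> {}\<close>] by blast
    have "(\<lambda>k. d / 2 * inverse (real (Suc k))) \<longlonglongrightarrow> 0"
      by (rule tendsto_mult_right_zero[OF LIMSEQ_inverse_real_of_nat])
    then have "r \<longlonglongrightarrow> 0" by (simp only: r_def[abs_def] divide_inverse[of "d / 2"])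
    then have "\<forall>\<^sub>F k in sequentially. r k < infdist x T / 2"
      by (rule order_tendstoD(2)) (use pos in simp)
    then have "\<forall>\<^sub>F k in sequentially. mollify (r k) (v k) x = 0"
    proof eventually_elim
      case (elim k)
      have "\<bar>mollify (r k) (v k) x - 0\<bar> \<le> 0"
      proof (rule mollify_error[OF int_v r(1)])
        fix y assume "norm (y - x) \<le> r k"
        then have "infdist x T \<le> infdist y T + r k"
          using infdist_triangle[of x T y] by (simp add: dist_norm norm_minus_commute)
        then have "y \<notin> K k" using elim by (simp add: K_def)
        then show "\<bar>v k y - 0\<bar> \<le> 0" by (simp add: v_def)
      qed
      then show ?case by simp
    qed
    then show ?thesis using False by (simp add: tendsto_eventually)
  qed
  then show ?thesis
    by (intro exI[of _ "\<lambda>k. mollify (r k) (v k)"] exI[of _ "\<lambda>k. mollify_grad (r k) (v k)"] conjI allI tf bnd)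
      simp
qed

text \<open>Approximating indicators of compact subsets of {h > 0} shows that h integrates to 0 over
  each of them, so they are null; inner regularity then makes the whole set null.\<close>

lemma test_fun_orthogonal_imp_nonpos:
  fixes h :: "'a::euclidean_space \<Rightarrow> real"
  assumes "open \<Omega>" "bounded \<Omega>" and h: "integrable (lebesgue_on \<Omega>) h"
    and orth: "\<And>\<phi> D. test_fun \<Omega> \<phi> D \<Longrightarrow> (\<integral>x. \<phi> x * h x \<partial>lebesgue_on \<Omega>) = 0"
  shows "AE x in lebesgue_on \<Omega>. h x \<le> 0"
proof -
  have O: "\<Omega> \<in> sets lebesgue" using assms(1) by (simp add: borel_open)
  note h_m[measurable] = borel_measurable_integrable[OF h]
  let ?A = "{x\<in>\<Omega>. 0 < h x}"
  have A: "?A \<in> sets lebesgue"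
  proof -
    have "{x \<in> space (lebesgue_on \<Omega>). 0 < h x} \<in> sets (lebesgue_on \<Omega>)" by measurable
    then show ?thesis using O by (simp add: sets_restrict_space_iff)
  qed
  have null: "negligible T" if T: "closed T" "T \<subseteq> ?A" for T
  proof -
    have "bounded T" by (rule bounded_subset[OF assms(2)]) (use T(2) in blast)
    then have cT: "compact T" using T(1) by (simp add: compact_eq_bounded_closed)
    have sT: "T \<in> sets lebesgue" using cT by (simp add: borel_compact)
    have TO: "T \<subseteq> \<Omega>" using T(2) by blast
    then have TN: "T \<in> sets (lebesgue_on \<Omega>)" using sT O by (simp add: sets_restrict_space_iff)
    obtain \<phi> D where \<phi>: "\<And>k::nat. test_fun \<Omega> (\<phi> k) (D k)" "\<And>k x. \<bar>\<phi> k x\<bar> \<le> 1"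
      "\<And>x. (\<lambda>k. \<phi> k x) \<longlonglongrightarrow> indicator T x"
      using compact_indicator_approx[OF assms(1) cT TO] by metis
    have "(\<lambda>k. \<integral>x. \<phi> k x * h x \<partial>lebesgue_on \<Omega>) \<longlonglongrightarrow> (\<integral>x. indicator T x * h x \<partial>lebesgue_on \<Omega>)"
    proof (rule integral_dominated_convergence)
      show "integrable (lebesgue_on \<Omega>) (\<lambda>x. norm (h x))" using h by simp
      show "(\<lambda>x. indicator T x * h x) \<in> borel_measurable (lebesgue_on \<Omega>)"
        by (intro borel_measurable_times h_m borel_measurable_indicator TN)
      show "(\<lambda>x. \<phi> k x * h x) \<in> borel_measurable (lebesgue_on \<Omega>)" for k
        by (intro borel_measurable_times h_m continuous_measurable_lebesgue_on test_funD(3)[OF \<phi>(1)])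
      show "AE x in lebesgue_on \<Omega>. norm (\<phi> k x * h x) \<le> norm (h x)" for k
      proof (rule AE_I2)
        show "norm (\<phi> k x * h x) \<le> norm (h x)" for x
          using mult_right_mono[OF \<phi>(2)[of k x] abs_ge_zero[of "h x"]] by (simp add: abs_mult)
      qed
      show "AE x in lebesgue_on \<Omega>. (\<lambda>k. \<phi> k x * h x) \<longlonglongrightarrow> indicator T x * h x"
        by (intro AE_I2 tendsto_mult_right \<phi>(3))
    qed
    then have zero: "(\<integral>x. indicator T x * h x \<partial>lebesgue_on \<Omega>) = 0"
      using orth[OF \<phi>(1)] by (simp add: LIMSEQ_const_iff)
    have "integrable (lebesgue_on \<Omega>) (\<lambda>x. indicator T x * h x)"
      using integrable_mult_indicator[OF TN h] by simp
    moreover have "AE x in lebesgue_on \<Omega>. 0 \<le> indicator T x * h x"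
      using T(2) by (auto intro!: AE_I2 simp: indicator_def less_imp_le)
    ultimately have "AE x in lebesgue_on \<Omega>. indicator T x * h x = 0"
      using zero by (subst (asm) integral_nonneg_eq_0_iff_AE) 
    then have "AE x in lebesgue_on \<Omega>. x \<notin> T"
    proof eventually_elim
      case (elim x)
      then show ?case using T(2) by (auto simp: indicator_def split: if_splits)
    qed
    then have "AE x in lebesgue. x \<in> \<Omega> \<longrightarrow> x \<notin> T" using O by (simp add: AE_restrict_space_iff)
    then have "AE x in lebesgue. x \<notin> T" by eventually_elim (use TO in blast)
    then show "negligible T"
      using sT by (simp add: negligible_iff_null_sets AE_iff_null_sets)
  qed
  have "emeasure lebesgue ?A \<le> 0"
  proof (rule ennreal_le_epsilon)
    fix e :: real assume "0 < e"
    then obtain T where T: "closed T" "T \<subseteq> ?A" "emeasure lebesgue (?A - T) < ennreal e"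
      using sets_lebesgue_inner_closed[OF A \<open>0 < e\<close>] by metis
    have T0: "T \<in> null_sets lebesgue"
      using null[OF T(1,2)] by (simp add: negligible_iff_null_sets)
    have "?A = T \<union> (?A - T)" using T(2) by blast
    then have "emeasure lebesgue ?A \<le> emeasure lebesgue T + emeasure lebesgue (?A - T)"
      using emeasure_subadditive[of T lebesgue "?A - T"] A T0 by (metis null_setsD2 sets.Diff)
    then show "emeasure lebesgue ?A \<le> 0 + ennreal e" using T(3) null_setsD1[OF T0] by simp
  qed
  then have "?A \<in> null_sets lebesgue" using A by (intro null_setsI) auto
  then have "AE x in lebesgue. x \<notin> ?A" by (rule AE_not_in)
  then have "AE x in lebesgue. x \<in> \<Omega> \<longrightarrow> h x \<le> 0" by eventually_elim auto
  then show ?thesis using O by (simp add: AE_restrict_space_iff)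
qed

text \<open>Apply the sign statement to the scalar functions h \<bullet> e and h \<bullet> (- e) for
  every basis vector e.\<close>

lemma test_fun_orthogonal_imp_zero:
  fixes h :: "'a::euclidean_space \<Rightarrow> 'b::euclidean_space"
  assumes "open \<Omega>" "bounded \<Omega>" and h: "sq_int (lebesgue_on \<Omega>) h"
    and orth: "\<And>\<phi> D. test_fun \<Omega> \<phi> D \<Longrightarrow> (\<integral>x. \<phi> x *\<^sub>R h x \<partial>lebesgue_on \<Omega>) = 0"
  shows "AE x in lebesgue_on \<Omega>. h x = 0"
proof -
  have O: "\<Omega> \<in> sets lebesgue" using assms(1) by (simp add: borel_open)
  note fin = finite_measure_lebesgue_on[OF assms(2) O]
  have int_h: "integrable (lebesgue_on \<Omega>) (\<lambda>x. h x \<bullet> e)" for e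
    by (rule sq_int_inner[OF h sq_int_bounded[OF fin, of "\<lambda>_. e" "norm e"]]) auto
  have "(\<integral>x. \<phi> x * (h x \<bullet> e) \<partial>lebesgue_on \<Omega>) = 0" if tf: "test_fun \<Omega> \<phi> D" for \<phi> D e
  proof -
    have "(\<integral>x. \<phi> x * (h x \<bullet> e) \<partial>lebesgue_on \<Omega>) = (\<integral>x. \<phi> x *\<^sub>R h x \<partial>lebesgue_on \<Omega>) \<bullet> e"
      using integral_inner_left[OF sq_int_scaleR_integrable[OF test_fun_sq_int(1)[OF tf assms(2) O] h], of e]
      by simp
    then show ?thesis using orth[OF tf] by simp
  qed
  then have nonpos: "AE x in lebesgue_on \<Omega>. h x \<bullet> e \<le> 0" for e
    by (intro test_fun_orthogonal_imp_nonpos[OF assms(1,2) int_h])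
  have "AE x in lebesgue_on \<Omega>. \<forall>e\<in>Basis. h x \<bullet> e \<le> 0 \<and> h x \<bullet> (- e) \<le> 0"
    by (intro AE_finite_allI AE_conjI nonpos) simp
  then show ?thesis
  proof eventually_elim
    case (elim x)
    show ?case
    proof (rule euclidean_eqI)
      fix e :: 'b assume "e \<in> Basis"
      then show "h x \<bullet> e = 0 \<bullet> e" using elim by force
    qed
  qed
qed

section \<open>Weak derivatives on a bounded open set\<close>

locale bounded_open =
  fixes \<Omega> :: "'a::euclidean_space set"
  assumes open_dom: "open \<Omega>" and bounded_dom: "bounded \<Omega>"
begin

abbreviation N :: "'a measure" where "N \<equiv> lebesgue_on \<Omega>"

lemma dom_sets: "\<Omega> \<in> sets lebesgue"
  using open_dom by (simp add: borel_open)

lemmas finite_N = finite_measure_lebesgue_on[OF bounded_dom dom_sets]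
lemmas L2_sq_int = L2_iff_sq_int[OF dom_sets]
lemmas L2norm_sq_norm = L2norm_eq_sq_norm[OF dom_sets]
lemmas test_sq_int = test_fun_sq_int[OF _ bounded_dom dom_sets]

lemma is_weak_grad_iff: "is_weak_grad \<Omega> v g \<longleftrightarrow> (\<forall>\<phi> D. test_fun \<Omega> \<phi> D \<longrightarrow>
    (\<integral>x. v x *\<^sub>R D x \<partial>N) = - (\<integral>x. \<phi> x *\<^sub>R g x \<partial>N))"
  unfolding is_weak_grad_def set_integral_eq_lebesgue_on[OF dom_sets] ..

lemma is_weak_div_iff: "is_weak_div \<Omega> \<tau> d \<longleftrightarrow> (\<forall>\<phi> D. test_fun \<Omega> \<phi> D \<longrightarrow>
    (\<integral>x. \<tau> x \<bullet> D x \<partial>N) = - (\<integral>x. d x * \<phi> x \<partial>N))"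
  unfolding is_weak_div_def set_integral_eq_lebesgue_on[OF dom_sets] ..

lemma weak_gradD: "is_weak_grad \<Omega> v g \<Longrightarrow> test_fun \<Omega> \<phi> D \<Longrightarrow>
    (\<integral>x. v x *\<^sub>R D x \<partial>N) = - (\<integral>x. \<phi> x *\<^sub>R g x \<partial>N)"
  unfolding is_weak_grad_iff by blast

lemma weak_divD: "is_weak_div \<Omega> \<tau> d \<Longrightarrow> test_fun \<Omega> \<phi> D \<Longrightarrow>
    (\<integral>x. \<tau> x \<bullet> D x \<partial>N) = - (\<integral>x. d x * \<phi> x \<partial>N)"
  unfolding is_weak_div_iff by blast

lemma weak_grad_unique:
  assumes "is_weak_grad \<Omega> v g" "is_weak_grad \<Omega> v g'" "sq_int N g" "sq_int N g'"
  shows "AE x in N. g x = g' x"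
proof -
  have "AE x in N. g x - g' x = 0"
  proof (rule test_fun_orthogonal_imp_zero[OF open_dom bounded_dom sq_int_diff[OF assms(3,4)]])
    fix \<phi> D assume tf: "test_fun \<Omega> \<phi> D"
    have eq: "(\<integral>x. \<phi> x *\<^sub>R g x \<partial>N) = (\<integral>x. \<phi> x *\<^sub>R g' x \<partial>N)"
      using weak_gradD[OF assms(1) tf] weak_gradD[OF assms(2) tf] by simp
    show "(\<integral>x. \<phi> x *\<^sub>R (g x - g' x) \<partial>N) = 0"
      using eq sq_int_scaleR_integrable[OF test_sq_int(1)[OF tf] assms(3)]
        sq_int_scaleR_integrable[OF test_sq_int(1)[OF tf] assms(4)]
      by (simp add: scaleR_diff_right)
  qed
  then show ?thesis by simp
qed

lemma weak_div_unique:
  assumes "is_weak_div \<Omega> \<tau> d" "is_weak_div \<Omega> \<tau> d'" "sq_int N d" "sq_int N d'"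
  shows "AE x in N. d x = d' x"
proof -
  have "AE x in N. d x - d' x = 0"
  proof (rule test_fun_orthogonal_imp_zero[OF open_dom bounded_dom sq_int_diff[OF assms(3,4)]])
    fix \<phi> D assume tf: "test_fun \<Omega> \<phi> D"
    have eq: "(\<integral>x. d x * \<phi> x \<partial>N) = (\<integral>x. d' x * \<phi> x \<partial>N)"
      using weak_divD[OF assms(1) tf] weak_divD[OF assms(2) tf] by simp
    show "(\<integral>x. \<phi> x *\<^sub>R (d x - d' x) \<partial>N) = 0"
      using eq sq_int_mult_integrable[OF assms(3) test_sq_int(1)[OF tf]]
        sq_int_mult_integrable[OF assms(4) test_sq_int(1)[OF tf]]
      by (simp add: right_diff_distrib mult.commute)
  qed
  then show ?thesis by simp
qed

lemma test_fun_weak_grad: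
  assumes "test_fun \<Omega> \<phi> D"
  shows "is_weak_grad \<Omega> \<phi> D"
  unfolding is_weak_grad_iff
proof (intro allI impI)
  fix \<psi> E assume tf: "test_fun \<Omega> \<psi> E"
  have tm: "test_fun \<Omega> (\<lambda>x. \<phi> x * \<psi> x) (\<lambda>x. \<phi> x *\<^sub>R E x + \<psi> x *\<^sub>R D x)"
    by (rule test_fun_mult[OF tf test_funD(1,2)[OF assms]])
  have z: "\<phi> x *\<^sub>R E x + \<psi> x *\<^sub>R D x = 0" if "x \<notin> \<Omega>" for x
    by (rule test_fun_grad_zero[OF tm]) (use test_funD(5)[OF tm] that in blast)
  have "(\<integral>x. \<phi> x *\<^sub>R E x + \<psi> x *\<^sub>R D x \<partial>N) = (\<integral>x. \<phi> x *\<^sub>R E x + \<psi> x *\<^sub>R D x \<partial>lborel)"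
    by (rule integral_lebesgue_on_supported[OF borel_measurable_continuous_onI[OF test_funD(2)[OF tm]] dom_sets z])
  also have "\<dots> = 0" by (rule test_fun_integral_grad_zero[OF tm])
  finally have "(\<integral>x. \<phi> x *\<^sub>R E x \<partial>N) + (\<integral>x. \<psi> x *\<^sub>R D x \<partial>N) = 0"
    using sq_int_scaleR_integrable[OF test_sq_int(1)[OF assms] test_sq_int(2)[OF tf]]
      sq_int_scaleR_integrable[OF test_sq_int(1)[OF tf] test_sq_int(2)[OF assms]] by simp
  then show "(\<integral>x. \<phi> x *\<^sub>R E x \<partial>N) = - (\<integral>x. \<psi> x *\<^sub>R D x \<partial>N)"
    by (simp add: eq_neg_iff_add_eq_0)
qed

text \<open>The graph of the weak gradient is closed: against a fixed test function both sides of
  the identity are L2 pairings. They are read off component by component to become scalar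
  products.\<close>

lemma weak_grad_limit:
  assumes "\<And>k. sq_int N (V k)" "sq_int N v" "\<And>k. sq_int N (G k)" "sq_int N g"
    and "(\<lambda>k. sq_norm N (\<lambda>x. V k x - v x)) \<longlonglongrightarrow> 0" "(\<lambda>k. sq_norm N (\<lambda>x. G k x - g x)) \<longlonglongrightarrow> 0"
    and "\<And>k. is_weak_grad \<Omega> (V k) (G k)"
  shows "is_weak_grad \<Omega> v g"
  unfolding is_weak_grad_iff
proof (intro allI impI)
  fix \<phi> D assume tf: "test_fun \<Omega> \<phi> D"
  note ip = test_sq_int(1)[OF tf] and iD = test_sq_int(2)[OF tf]
  have De: "sq_int N (\<lambda>x. D x \<bullet> e)" and pe: "sq_int N (\<lambda>x. \<phi> x *\<^sub>R e)" for e
  proof -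
    show "sq_int N (\<lambda>x. D x \<bullet> e)"
    proof -
      obtain L where L: "\<And>x. norm (D x) \<le> L" using test_fun_lipschitz[OF tf] by metis
      have "norm (D x \<bullet> e) \<le> L * norm e" for x
        using Cauchy_Schwarz_ineq2[of "D x" e] mult_right_mono[OF L norm_ge_zero, of x e] by simp
      then show ?thesis
        using sq_int_measurable[OF iD] by (intro sq_int_bounded[OF finite_N, of _ "L * norm e"]) auto
    qed
    show "sq_int N (\<lambda>x. \<phi> x *\<^sub>R e)"
      using ip unfolding sq_int_def by (auto simp: power_mult_distrib)
  qed
  show "(\<integral>x. v x *\<^sub>R D x \<partial>N) = - (\<integral>x. \<phi> x *\<^sub>R g x \<partial>N)"
  proof (rule euclidean_eqI)
    fix e :: 'a
    have l: "(\<integral>x. w x *\<^sub>R D x \<partial>N) \<bullet> e = (\<integral>x. w x \<bullet> (D x \<bullet> e) \<partial>N)" if "sq_int N w" for w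
      using integral_inner_left[OF sq_int_scaleR_integrable[OF that iD], of e] by simp
    have r: "(\<integral>x. \<phi> x *\<^sub>R w x \<partial>N) \<bullet> e = (\<integral>x. w x \<bullet> (\<phi> x *\<^sub>R e) \<partial>N)" if "sq_int N w" for w
      using integral_inner_left[OF sq_int_scaleR_integrable[OF ip that], of e] by simp
    have "(\<integral>x. V k x \<bullet> (D x \<bullet> e) \<partial>N) = - (\<integral>x. G k x \<bullet> (\<phi> x *\<^sub>R e) \<partial>N)" for k
      unfolding l[OF assms(1)[of k], symmetric] r[OF assms(3)[of k], symmetric]
        weak_gradD[OF assms(7) tf] inner_minus_left ..
    then have "(\<lambda>k. - (\<integral>x. G k x \<bullet> (\<phi> x *\<^sub>R e) \<partial>N)) \<longlonglongrightarrow> (\<integral>x. v x \<bullet> (D x \<bullet> e) \<partial>N)"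
      using tendsto_integral_inner[OF assms(1,2) De assms(5), of e] by simp
    moreover have "(\<lambda>k. - (\<integral>x. G k x \<bullet> (\<phi> x *\<^sub>R e) \<partial>N)) \<longlonglongrightarrow> - (\<integral>x. g x \<bullet> (\<phi> x *\<^sub>R e) \<partial>N)"
      by (intro tendsto_minus tendsto_integral_inner assms pe)
    ultimately have "(\<integral>x. v x \<bullet> (D x \<bullet> e) \<partial>N) = - (\<integral>x. g x \<bullet> (\<phi> x *\<^sub>R e) \<partial>N)"
      by (rule LIMSEQ_unique)
    then show "(\<integral>x. v x *\<^sub>R D x \<partial>N) \<bullet> e = - (\<integral>x. \<phi> x *\<^sub>R g x \<partial>N) \<bullet> e"
      unfolding inner_minus_left l[OF assms(2)] r[OF assms(4)] .
  qed
qed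

lemma wgrad_props:
  assumes "is_weak_grad \<Omega> v g" "sq_int N g"
  shows "sq_int N (wgrad \<Omega> v)" "is_weak_grad \<Omega> v (wgrad \<Omega> v)" "AE x in N. wgrad \<Omega> v x = g x"
proof -
  have "L2 \<Omega> (wgrad \<Omega> v) \<and> is_weak_grad \<Omega> v (wgrad \<Omega> v)"
    unfolding wgrad_def by (rule someI[of _ g]) (use assms L2_sq_int in auto)
  then show "sq_int N (wgrad \<Omega> v)" "is_weak_grad \<Omega> v (wgrad \<Omega> v)" using L2_sq_int by auto
  then show "AE x in N. wgrad \<Omega> v x = g x" using assms by (intro weak_grad_unique)
qed

lemma wdiv_props:
  assumes "is_weak_div \<Omega> \<tau> d" "sq_int N d"
  shows "sq_int N (wdiv \<Omega> \<tau>)" "is_weak_div \<Omega> \<tau> (wdiv \<Omega> \<tau>)" "AE x in N. wdiv \<Omega> \<tau> x = d x"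
proof -
  have "L2 \<Omega> (wdiv \<Omega> \<tau>) \<and> is_weak_div \<Omega> \<tau> (wdiv \<Omega> \<tau>)"
    unfolding wdiv_def by (rule someI[of _ d]) (use assms L2_sq_int in auto)
  then show "sq_int N (wdiv \<Omega> \<tau>)" "is_weak_div \<Omega> \<tau> (wdiv \<Omega> \<tau>)" using L2_sq_int by auto
  then show "AE x in N. wdiv \<Omega> \<tau> x = d x" using assms by (intro weak_div_unique)
qed

text \<open>\<open>H10\<close> speaks of the chosen representative \<open>wgrad\<close>. Here any L2
  limit g of the test gradients may take its place, by closedness of the weak gradient and its
  uniqueness almost everywhere.\<close>

lemma H10I:
  assumes "sq_int N v" "sq_int N g" "\<And>k. test_fun \<Omega> (\<phi> k) (D k)"
    and "(\<lambda>k. sq_norm N (\<lambda>x. \<phi> k x - v x)) \<longlonglongrightarrow> 0" "(\<lambda>k. sq_norm N (\<lambda>x. D k x - g x)) \<longlonglongrightarrow> 0"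
  shows "H10 \<Omega> v" "is_weak_grad \<Omega> v g" "AE x in N. wgrad \<Omega> v x = g x"
proof -
  show wg: "is_weak_grad \<Omega> v g"
    by (rule weak_grad_limit[OF test_sq_int(1)[OF assms(3)] assms(1) test_sq_int(2)[OF assms(3)] assms(2,4,5)
          test_fun_weak_grad[OF assms(3)]])
  note w = wgrad_props[OF wg assms(2)]
  show ae: "AE x in N. wgrad \<Omega> v x = g x" by (rule w(3))
  have "sq_norm N (\<lambda>x. D k x - wgrad \<Omega> v x) = sq_norm N (\<lambda>x. D k x - g x)" for k
  proof (rule sq_norm_cong_AE)
    show "AE x in N. D k x - wgrad \<Omega> v x = D k x - g x" using ae by eventually_elim simp
  qed (intro borel_measurable_diff sq_int_measurable w(1) assms(2) test_sq_int(2)[OF assms(3)])+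
  then have "(\<lambda>k. L2norm \<Omega> (\<lambda>x. D k x - wgrad \<Omega> v x)) \<longlonglongrightarrow> 0"
    using assms(5) by (simp add: L2norm_sq_norm)
  then show "H10 \<Omega> v"
    unfolding H10_def H1_def using assms(1,2,3,4) wg by (auto simp: L2_sq_int L2norm_sq_norm)
qed

lemma H10D:
  assumes "H10 \<Omega> v"
  shows "sq_int N v" "sq_int N (wgrad \<Omega> v)" "is_weak_grad \<Omega> v (wgrad \<Omega> v)"
    "\<exists>\<phi> D. (\<forall>k. test_fun \<Omega> (\<phi> k) (D k)) \<and> (\<lambda>k. sq_norm N (\<lambda>x. \<phi> k x - v x)) \<longlonglongrightarrow> 0 \<and>
      (\<lambda>k. sq_norm N (\<lambda>x. D k x - wgrad \<Omega> v x)) \<longlonglongrightarrow> 0"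
proof -
  from assms obtain g where g: "L2 \<Omega> v" "L2 \<Omega> g" "is_weak_grad \<Omega> v g" unfolding H10_def H1_def by blast
  then show "sq_int N v" "sq_int N (wgrad \<Omega> v)" "is_weak_grad \<Omega> v (wgrad \<Omega> v)"
    using wgrad_props[OF g(3)] by (auto simp: L2_sq_int)
  show "\<exists>\<phi> D. (\<forall>k. test_fun \<Omega> (\<phi> k) (D k)) \<and> (\<lambda>k. sq_norm N (\<lambda>x. \<phi> k x - v x)) \<longlonglongrightarrow> 0 \<and>
      (\<lambda>k. sq_norm N (\<lambda>x. D k x - wgrad \<Omega> v x)) \<longlonglongrightarrow> 0"
    using assms unfolding H10_def L2norm_sq_norm by blast
qed

lemma HdivI: "sq_int N \<tau> \<Longrightarrow> is_weak_div \<Omega> \<tau> d \<Longrightarrow> sq_int N d \<Longrightarrow> Hdiv \<Omega> \<tau>"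
  unfolding Hdiv_def L2_sq_int by blast

lemma HdivD:
  assumes "Hdiv \<Omega> \<tau>"
  shows "sq_int N \<tau>" "sq_int N (wdiv \<Omega> \<tau>)" "is_weak_div \<Omega> \<tau> (wdiv \<Omega> \<tau>)"
  using assms wdiv_props unfolding Hdiv_def L2_sq_int by blast+

lemma sq_norm_lincomb_tendsto_zero:
  assumes "\<And>k. sq_int N (F k)" "sq_int N f" "\<And>k. sq_int N (G k)" "sq_int N g"
    and "(\<lambda>k. sq_norm N (\<lambda>x. F k x - f x)) \<longlonglongrightarrow> 0" "(\<lambda>k. sq_norm N (\<lambda>x. G k x - g x)) \<longlonglongrightarrow> 0"
  shows "(\<lambda>k. sq_norm N (\<lambda>x. (c *\<^sub>R F k x + G k x) - (c *\<^sub>R f x + g x))) \<longlonglongrightarrow> 0"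
proof (rule tendsto_sandwich[OF _ _ tendsto_const])
  have "(\<lambda>k. \<bar>c\<bar> * sq_norm N (\<lambda>x. F k x - f x) + sq_norm N (\<lambda>x. G k x - g x)) \<longlonglongrightarrow> \<bar>c\<bar> * 0 + 0"
    by (intro tendsto_intros assms)
  then show "(\<lambda>k. \<bar>c\<bar> * sq_norm N (\<lambda>x. F k x - f x) + sq_norm N (\<lambda>x. G k x - g x)) \<longlonglongrightarrow> 0" by simp
  have "sq_norm N (\<lambda>x. (c *\<^sub>R F k x + G k x) - (c *\<^sub>R f x + g x))
      \<le> \<bar>c\<bar> * sq_norm N (\<lambda>x. F k x - f x) + sq_norm N (\<lambda>x. G k x - g x)" for k
    using sq_norm_add_le[OF sq_int_scaleR[OF sq_int_diff[OF assms(1)[of k] assms(2)], of c]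
        sq_int_diff[OF assms(3)[of k] assms(4)]]
    unfolding sq_norm_scaleR by (simp add: scaleR_diff_right algebra_simps)
  then show "\<forall>\<^sub>F k in sequentially. sq_norm N (\<lambda>x. (c *\<^sub>R F k x + G k x) - (c *\<^sub>R f x + g x))
      \<le> \<bar>c\<bar> * sq_norm N (\<lambda>x. F k x - f x) + sq_norm N (\<lambda>x. G k x - g x)" by simp
qed simp

lemma H10_lincomb:
  assumes "H10 \<Omega> v" "H10 \<Omega> w"
  shows "H10 \<Omega> (\<lambda>x. c * v x + w x)"
    "AE x in N. wgrad \<Omega> (\<lambda>x. c * v x + w x) x = c *\<^sub>R wgrad \<Omega> v x + wgrad \<Omega> w x"
proof -
  obtain \<phi> D where v: "\<And>k::nat. test_fun \<Omega> (\<phi> k) (D k)" "(\<lambda>k. sq_norm N (\<lambda>x. \<phi> k x - v x)) \<longlonglongrightarrow> 0"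
      "(\<lambda>k. sq_norm N (\<lambda>x. D k x - wgrad \<Omega> v x)) \<longlonglongrightarrow> 0"
    using H10D(4)[OF assms(1)] by blast
  obtain \<psi> E where w: "\<And>k::nat. test_fun \<Omega> (\<psi> k) (E k)" "(\<lambda>k. sq_norm N (\<lambda>x. \<psi> k x - w x)) \<longlonglongrightarrow> 0"
      "(\<lambda>k. sq_norm N (\<lambda>x. E k x - wgrad \<Omega> w x)) \<longlonglongrightarrow> 0"
    using H10D(4)[OF assms(2)] by blast
  have 1: "sq_int N (\<lambda>x. c * v x + w x)"
    using sq_int_lincomb[OF H10D(1)[OF assms(1)] H10D(1)[OF assms(2)], of c] by simp
  have 2: "sq_int N (\<lambda>x. c *\<^sub>R wgrad \<Omega> v x + wgrad \<Omega> w x)"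
    by (rule sq_int_lincomb[OF H10D(2)[OF assms(1)] H10D(2)[OF assms(2)]])
  have 3: "test_fun \<Omega> (\<lambda>x. c * \<phi> k x + \<psi> k x) (\<lambda>x. c *\<^sub>R D k x + E k x)" for k
    by (rule test_fun_lincomb[OF v(1) w(1)])
  have 4: "(\<lambda>k. sq_norm N (\<lambda>x. (c * \<phi> k x + \<psi> k x) - (c * v x + w x))) \<longlonglongrightarrow> 0"
    using sq_norm_lincomb_tendsto_zero[OF test_sq_int(1)[OF v(1)] H10D(1)[OF assms(1)]
        test_sq_int(1)[OF w(1)] H10D(1)[OF assms(2)] v(2) w(2), of c] by simp
  have 5: "(\<lambda>k. sq_norm N (\<lambda>x. (c *\<^sub>R D k x + E k x) - (c *\<^sub>R wgrad \<Omega> v x + wgrad \<Omega> w x))) \<longlonglongrightarrow> 0"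
    by (rule sq_norm_lincomb_tendsto_zero[OF test_sq_int(2)[OF v(1)] H10D(2)[OF assms(1)]
        test_sq_int(2)[OF w(1)] H10D(2)[OF assms(2)] v(3) w(3)])
  show "H10 \<Omega> (\<lambda>x. c * v x + w x)"
    "AE x in N. wgrad \<Omega> (\<lambda>x. c * v x + w x) x = c *\<^sub>R wgrad \<Omega> v x + wgrad \<Omega> w x"
    using H10I[OF 1 2 3 4 5] by blast+
qed

lemma test_fun_H10:
  assumes "test_fun \<Omega> \<phi> D"
  shows "H10 \<Omega> \<phi>" "AE x in N. wgrad \<Omega> \<phi> x = D x"
  using H10I[OF test_sq_int(1,2)[OF assms], of "\<lambda>_. \<phi>" "\<lambda>_. D"] assms by (auto simp: sq_norm_def)

lemma weak_div_lincomb: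
  assumes "is_weak_div \<Omega> \<tau> d" "is_weak_div \<Omega> \<rho> e" "sq_int N \<tau>" "sq_int N d" "sq_int N \<rho>" "sq_int N e"
  shows "is_weak_div \<Omega> (\<lambda>x. c *\<^sub>R \<tau> x + \<rho> x) (\<lambda>x. c * d x + e x)"
  unfolding is_weak_div_iff
proof (intro allI impI)
  fix \<phi> D assume tf: "test_fun \<Omega> \<phi> D"
  note ip = test_sq_int(1)[OF tf] and iD = test_sq_int(2)[OF tf]
  have "(\<integral>x. (c *\<^sub>R \<tau> x + \<rho> x) \<bullet> D x \<partial>N) = c * (\<integral>x. \<tau> x \<bullet> D x \<partial>N) + (\<integral>x. \<rho> x \<bullet> D x \<partial>N)"
    using sq_int_inner[OF assms(3) iD] sq_int_inner[OF assms(5) iD] by (simp add: inner_add_left)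
  also have "\<dots> = - (c * (\<integral>x. d x * \<phi> x \<partial>N) + (\<integral>x. e x * \<phi> x \<partial>N))"
    using weak_divD[OF assms(1) tf] weak_divD[OF assms(2) tf] by simp
  also have "c * (\<integral>x. d x * \<phi> x \<partial>N) + (\<integral>x. e x * \<phi> x \<partial>N) = (\<integral>x. c * (d x * \<phi> x) + e x * \<phi> x \<partial>N)"
    using sq_int_mult_integrable[OF assms(4) ip] sq_int_mult_integrable[OF assms(6) ip] by simp
  also have "\<dots> = (\<integral>x. (c * d x + e x) * \<phi> x \<partial>N)" by (simp add: algebra_simps)
  finally show "(\<integral>x. (c *\<^sub>R \<tau> x + \<rho> x) \<bullet> D x \<partial>N) = - (\<integral>x. (c * d x + e x) * \<phi> x \<partial>N)" .
qed

lemma Hdiv_lincomb: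
  assumes "Hdiv \<Omega> \<tau>" "Hdiv \<Omega> \<rho>"
  shows "Hdiv \<Omega> (\<lambda>x. c *\<^sub>R \<tau> x + \<rho> x)"
    "AE x in N. wdiv \<Omega> (\<lambda>x. c *\<^sub>R \<tau> x + \<rho> x) x = c * wdiv \<Omega> \<tau> x + wdiv \<Omega> \<rho> x"
proof -
  note t = HdivD[OF assms(1)] and r = HdivD[OF assms(2)]
  have 1: "is_weak_div \<Omega> (\<lambda>x. c *\<^sub>R \<tau> x + \<rho> x) (\<lambda>x. c * wdiv \<Omega> \<tau> x + wdiv \<Omega> \<rho> x)"
    by (rule weak_div_lincomb[OF t(3) r(3) t(1,2) r(1,2)])
  have 2: "sq_int N (\<lambda>x. c * wdiv \<Omega> \<tau> x + wdiv \<Omega> \<rho> x)" using sq_int_lincomb[OF t(2) r(2), of c] by simp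
  show "Hdiv \<Omega> (\<lambda>x. c *\<^sub>R \<tau> x + \<rho> x)" by (rule HdivI[OF sq_int_lincomb[OF t(1) r(1)] 1 2])
  show "AE x in N. wdiv \<Omega> (\<lambda>x. c *\<^sub>R \<tau> x + \<rho> x) x = c * wdiv \<Omega> \<tau> x + wdiv \<Omega> \<rho> x"
    by (rule wdiv_props(3)[OF 1 2])
qed

text \<open>For test functions this is the definition of the weak divergence; both sides are
  continuous under the convergence that defines \<open>H10\<close>, so no boundary term
  appears.\<close>

lemma Green_H10_Hdiv:
  assumes "H10 \<Omega> v" "sq_int N \<tau>" "is_weak_div \<Omega> \<tau> d" "sq_int N d"
  shows "(\<integral>x. wgrad \<Omega> v x \<bullet> \<tau> x \<partial>N) = - (\<integral>x. d x * v x \<partial>N)"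
proof -
  obtain \<phi> D where v: "\<And>k::nat. test_fun \<Omega> (\<phi> k) (D k)" "(\<lambda>k. sq_norm N (\<lambda>x. \<phi> k x - v x)) \<longlonglongrightarrow> 0"
      "(\<lambda>k. sq_norm N (\<lambda>x. D k x - wgrad \<Omega> v x)) \<longlonglongrightarrow> 0"
    using H10D(4)[OF assms(1)] by blast
  have eq: "(\<integral>x. D k x \<bullet> \<tau> x \<partial>N) = - (\<integral>x. \<phi> k x \<bullet> d x \<partial>N)" for k
    using weak_divD[OF assms(3) v(1)[of k]] by (simp add: inner_commute mult.commute)
  have "(\<lambda>k. - (\<integral>x. \<phi> k x \<bullet> d x \<partial>N)) \<longlonglongrightarrow> (\<integral>x. wgrad \<Omega> v x \<bullet> \<tau> x \<partial>N)"
    using tendsto_integral_inner[OF test_sq_int(2)[OF v(1)] H10D(2)[OF assms(1)] assms(2) v(3)] eq by simp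
  moreover have "(\<lambda>k. - (\<integral>x. \<phi> k x \<bullet> d x \<partial>N)) \<longlonglongrightarrow> - (\<integral>x. v x \<bullet> d x \<partial>N)"
    by (intro tendsto_minus tendsto_integral_inner[OF test_sq_int(1)[OF v(1)] H10D(1)[OF assms(1)] assms(4) v(2)])
  ultimately have "(\<integral>x. wgrad \<Omega> v x \<bullet> \<tau> x \<partial>N) = - (\<integral>x. v x \<bullet> d x \<partial>N)" by (rule LIMSEQ_unique)
  then show ?thesis by (simp add: mult.commute)
qed

text \<open>Integrate the divergence of the squared function times the field x. This gives DIM times
  the squared norm of \<phi> as - 2 times the integral of \<phi> x \<bullet> D, which is at most 2 R
  times the product of the two norms.\<close>

lemma test_fun_Friedrichs:
  assumes "test_fun \<Omega> \<phi> D" "\<And>x. x \<in> \<Omega> \<Longrightarrow> norm x \<le> R"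
  shows "sq_norm N \<phi> \<le> 2 * R * sq_norm N D"
proof (cases "\<Omega> = {}")
  case True
  then show ?thesis by (simp add: sq_norm_def)
next
  case False
  then obtain y where "y \<in> \<Omega>" by blast
  then have R: "0 \<le> R" using assms(2)[of y] norm_ge_zero order_trans by blast
  note ip = test_sq_int(1)[OF assms(1)] and iD = test_sq_int(2)[OF assms(1)]
  have tm: "test_fun \<Omega> (\<lambda>x. \<phi> x * \<phi> x) (\<lambda>x. \<phi> x *\<^sub>R D x + \<phi> x *\<^sub>R D x)"
    by (rule test_fun_mult[OF assms(1) test_funD(1,2)[OF assms(1)]])
  have z: "\<phi> x = 0" if "x \<notin> \<Omega>" for x
    by (rule test_funD(6)[OF assms(1)]) (use test_funD(5)[OF assms(1)] that in blast)
  have ix: "sq_int N (\<lambda>x. \<phi> x *\<^sub>R x)"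
  proof -
    have m: "(\<lambda>x. \<phi> x *\<^sub>R x) \<in> borel_measurable N"
      by (intro continuous_measurable_lebesgue_on continuous_intros test_funD(3)[OF assms(1)])
    have "integrable N (\<lambda>x. norm (\<phi> x *\<^sub>R x) ^ 2)"
    proof (rule Bochner_Integration.integrable_bound)
      show "integrable N (\<lambda>x. R ^ 2 * norm (\<phi> x) ^ 2)" using ip by (simp add: sq_int_def)
      show "(\<lambda>x. (norm (\<phi> x *\<^sub>R x))\<^sup>2) \<in> borel_measurable N" using m by measurable
      show "AE x in N. norm ((norm (\<phi> x *\<^sub>R x))\<^sup>2) \<le> norm (R\<^sup>2 * (norm (\<phi> x))\<^sup>2)"
      proof (rule AE_I2)
        fix x assume "x \<in> space N"
        then have "norm x ^ 2 \<le> R ^ 2" using assms(2) by (intro power_mono) auto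
        then show "norm ((norm (\<phi> x *\<^sub>R x))\<^sup>2) \<le> norm (R\<^sup>2 * (norm (\<phi> x))\<^sup>2)"
          using mult_right_mono[of "norm x ^ 2" "R ^ 2" "norm (\<phi> x) ^ 2"]
          by (simp add: power_mult_distrib mult.commute)
      qed
    qed
    with m show ?thesis by (simp add: sq_int_def)
  qed
  have nx: "sq_norm N (\<lambda>x. \<phi> x *\<^sub>R x) \<le> R * sq_norm N \<phi>"
  proof (rule power2_le_imp_le)
    have "sq_norm N (\<lambda>x. \<phi> x *\<^sub>R x) ^ 2 \<le> (\<integral>x. R ^ 2 * norm (\<phi> x) ^ 2 \<partial>N)"
      unfolding sq_norm_pow2
    proof (rule integral_mono)
      fix x assume "x \<in> space N"
      then have "norm x ^ 2 \<le> R ^ 2" using assms(2) by (intro power_mono) auto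
      then show "norm (\<phi> x *\<^sub>R x) ^ 2 \<le> R ^ 2 * norm (\<phi> x) ^ 2"
        using mult_right_mono[of "norm x ^ 2" "R ^ 2" "norm (\<phi> x) ^ 2"]
        by (simp add: power_mult_distrib mult.commute)
    qed (use ix ip in \<open>auto simp: sq_int_def\<close>)
    then show "sq_norm N (\<lambda>x. \<phi> x *\<^sub>R x) ^ 2 \<le> (R * sq_norm N \<phi>) ^ 2"
      by (simp add: power_mult_distrib sq_norm_pow2)
  qed (use R in simp)
  have "real DIM('a) * (\<integral>x. \<phi> x * \<phi> x \<partial>lborel) = - (\<integral>x. (x - 0) \<bullet> (\<phi> x *\<^sub>R D x + \<phi> x *\<^sub>R D x) \<partial>lborel)"
    using test_fun_integral_radial(1)[OF tm, of 0] by simp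
  also have "(\<integral>x. (x - 0) \<bullet> (\<phi> x *\<^sub>R D x + \<phi> x *\<^sub>R D x) \<partial>lborel) = (\<integral>x. (x - 0) \<bullet> (\<phi> x *\<^sub>R D x + \<phi> x *\<^sub>R D x) \<partial>N)"
    by (rule integral_lebesgue_on_supported[symmetric, OF borel_measurable_continuous_onI dom_sets])
      (auto intro!: continuous_intros test_funD(2,3)[OF assms(1)] simp: z)
  also have "\<dots> = (\<integral>x. 2 * ((\<phi> x *\<^sub>R x) \<bullet> D x) \<partial>N)" by (simp add: inner_add_right)
  also have "- \<dots> \<le> 2 * (R * sq_norm N \<phi> * sq_norm N D)"
  proof -
    have "\<bar>\<integral>x. (\<phi> x *\<^sub>R x) \<bullet> D x \<partial>N\<bar> \<le> R * sq_norm N \<phi> * sq_norm N D"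
      by (rule order_trans[OF sq_norm_Cauchy_Schwarz[OF ix iD] mult_right_mono[OF nx sq_norm_nonneg]])
    moreover have "(\<integral>x. 2 * ((\<phi> x *\<^sub>R x) \<bullet> D x) \<partial>N) = 2 * (\<integral>x. (\<phi> x *\<^sub>R x) \<bullet> D x \<partial>N)"
      by (rule integral_mult_right_zero)
    ultimately show ?thesis by linarith
  qed
  also have "(\<integral>x. \<phi> x * \<phi> x \<partial>lborel) = (\<integral>x. \<phi> x * \<phi> x \<partial>N)"
    by (rule integral_lebesgue_on_supported[symmetric, OF borel_measurable_continuous_onI dom_sets])
      (auto intro!: continuous_intros test_funD(3)[OF assms(1)] simp: z)
  also have "\<dots> = sq_norm N \<phi> ^ 2" unfolding sq_norm_pow2 by (simp add: power2_eq_square)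
  finally have "real DIM('a) * sq_norm N \<phi> ^ 2 \<le> 2 * (R * sq_norm N \<phi> * sq_norm N D)" .
  moreover have "1 * sq_norm N \<phi> ^ 2 \<le> real DIM('a) * sq_norm N \<phi> ^ 2"
    by (rule mult_right_mono) (use DIM_positive[where 'a='a] in \<open>simp_all add: Suc_le_eq\<close>)
  ultimately have "sq_norm N \<phi> * sq_norm N \<phi> \<le> sq_norm N \<phi> * (2 * R * sq_norm N D)"
    by (simp add: power2_eq_square mult_ac)
  then show ?thesis
  proof (cases "sq_norm N \<phi> = 0")
    case True
    then show ?thesis using R by simp
  next
    case False
    then have "0 < sq_norm N \<phi>" using sq_norm_nonneg[of N \<phi>] by linarith
    then show ?thesis using \<open>sq_norm N \<phi> * sq_norm N \<phi> \<le> sq_norm N \<phi> * (2 * R * sq_norm N D)\<close>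
      by (simp only: mult_le_cancel_left_pos)
  qed
qed

text \<open>The constant is twice the radius of a ball around 0 that contains \<Omega>; this is how
  the domain enters the final estimate.\<close>

lemma Friedrichs: "\<exists>C\<ge>0. \<forall>v. H10 \<Omega> v \<longrightarrow> sq_norm N v \<le> C * sq_norm N (wgrad \<Omega> v)"
proof -
  obtain R where R: "R > 0" "\<And>x. x \<in> \<Omega> \<Longrightarrow> norm x \<le> R" using bounded_dom unfolding bounded_pos by blast
  have "sq_norm N v \<le> (2 * R) * sq_norm N (wgrad \<Omega> v)" if v0: "H10 \<Omega> v" for v
  proof -
    obtain \<phi> D where v: "\<And>k::nat. test_fun \<Omega> (\<phi> k) (D k)" "(\<lambda>k. sq_norm N (\<lambda>x. \<phi> k x - v x)) \<longlonglongrightarrow> 0"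
        "(\<lambda>k. sq_norm N (\<lambda>x. D k x - wgrad \<Omega> v x)) \<longlonglongrightarrow> 0"
      using H10D(4)[OF v0] by blast
    show ?thesis
    proof (rule LIMSEQ_le)
      show "(\<lambda>k. sq_norm N (\<phi> k)) \<longlonglongrightarrow> sq_norm N v"
        by (rule tendsto_sq_norm[OF test_sq_int(1)[OF v(1)] H10D(1)[OF v0] v(2)])
      show "(\<lambda>k. 2 * R * sq_norm N (D k)) \<longlonglongrightarrow> 2 * R * sq_norm N (wgrad \<Omega> v)"
        by (intro tendsto_mult_left tendsto_sq_norm[OF test_sq_int(2)[OF v(1)] H10D(2)[OF v0] v(3)])
      show "\<exists>n. \<forall>k\<ge>n. sq_norm N (\<phi> k) \<le> 2 * R * sq_norm N (D k)"
        using test_fun_Friedrichs[OF v(1) R(2)] by blast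
    qed
  qed
  then show ?thesis using R(1) by (intro exI[of _ "2 * R"]) auto
qed

end

section \<open>Lipschitz functions vanishing on the boundary\<close>

lemma sq_norm_dominated_tendsto_zero:
  fixes F :: "nat \<Rightarrow> 'x \<Rightarrow> 'b::euclidean_space"
  assumes fin: "finite_measure N"
    and meas: "\<And>k. F k \<in> borel_measurable N" "f \<in> borel_measurable N"
    and conv: "AE x in N. (\<lambda>k. F k x) \<longlonglongrightarrow> f x"
    and bnd: "\<And>k. AE x in N. norm (F k x - f x) \<le> B"
  shows "(\<lambda>k. sq_norm N (\<lambda>x. F k x - f x)) \<longlonglongrightarrow> 0"
proof -
  interpret finite_measure N by fact
  have "(\<lambda>k. \<integral>x. norm (F k x - f x) ^ 2 \<partial>N) \<longlonglongrightarrow> (\<integral>x. 0 \<partial>N)"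
  proof (rule integral_dominated_convergence)
    show "integrable N (\<lambda>x. B ^ 2)" by simp
    show "(\<lambda>x. norm (F k x - f x) ^ 2) \<in> borel_measurable N" for k
      using meas(1)[of k] meas(2) by measurable
    show "AE x in N. (\<lambda>k. norm (F k x - f x) ^ 2) \<longlonglongrightarrow> 0"
      using conv
    proof eventually_elim
      case (elim x)
      then have "(\<lambda>k. norm (F k x - f x)) \<longlonglongrightarrow> 0"
        by (intro tendsto_norm_zero) (simp add: LIM_zero)
      then have "(\<lambda>k. norm (F k x - f x) ^ 2) \<longlonglongrightarrow> 0 ^ 2" by (rule tendsto_power)
      then show ?case by simp
    qed
    show "AE x in N. norm (norm (F k x - f x) ^ 2) \<le> B ^ 2" for k
      using bnd[of k]
    proof eventually_elim
      case (elim x)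
      then show ?case using power_mono[OF elim norm_ge_zero, of 2] by simp
    qed
  qed simp
  then have "(\<lambda>k. sqrt (\<integral>x. norm (F k x - f x) ^ 2 \<partial>N)) \<longlonglongrightarrow> sqrt 0"
    by (intro tendsto_real_sqrt) simp
  then show ?thesis unfolding sq_norm_def by simp
qed

section \<open>Truncation near the value zero\<close>

lemma lipschitz_bound_of_derivative_le_1:
  assumes "\<And>t::real. (f has_real_derivative f' t) (at t)" "\<And>t. \<bar>f' t\<bar> \<le> 1"
  shows "\<bar>f s - f t\<bar> \<le> \<bar>s - t\<bar>"
proof -
  have "norm (f s - f t) \<le> 1 * norm (s - t)"
    by (rule field_differentiable_bound[of UNIV f f']) (use assms in auto)
  then show ?thesis by simp
qed

text \<open>A C^1 substitute for the positive part that vanishes up to \<delta>. Dividing the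
  squared positive part by t keeps the slope between 0 and 1; for t at most \<delta> the numerator
  is 0, so the quotient is 0 there, also at t = 0.\<close>

definition ptrunc :: "real \<Rightarrow> real \<Rightarrow> real" where
  "ptrunc \<delta> t = (max 0 (t - \<delta>))\<^sup>2 / t"

definition ptrunc' :: "real \<Rightarrow> real \<Rightarrow> real" where
  "ptrunc' \<delta> t = 2 * (max 0 (t - \<delta>) / t) - (max 0 (t - \<delta>) / t)\<^sup>2"

lemma ptrunc_derivative:
  assumes "0 < \<delta>"
  shows "(ptrunc \<delta> has_real_derivative ptrunc' \<delta> t) (at t)"
proof (cases "t < \<delta>")
  case True
  have "(ptrunc \<delta> has_real_derivative 0) (at t)"
    by (rule has_field_derivative_transform_within_open[where f="\<lambda>_. 0" and S="{..<\<delta>}"])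
      (use True in \<open>auto simp: ptrunc_def max_absorb1\<close>)
  then show ?thesis using True by (simp add: ptrunc'_def max_absorb1)
next
  case False
  then have t: "t > 0" using assms by simp
  have "((\<lambda>t. (max 0 (t - \<delta>))\<^sup>2) has_real_derivative 2 * max 0 (t - \<delta>)) (at t)"
    using DERIV_shift[of "\<lambda>t. (max 0 t)\<^sup>2" "2 * max 0 (t - \<delta>)" t "- \<delta>"]
      has_real_derivative_pos_part_square[of "t - \<delta>"] by simp
  from DERIV_divide[OF this DERIV_ident] t
  have "(ptrunc \<delta> has_real_derivative (2 * max 0 (t - \<delta>) * t - (max 0 (t - \<delta>))\<^sup>2 * 1) / (t * t)) (at t)"
    unfolding ptrunc_def[abs_def] by simp
  moreover have "(2 * max 0 (t - \<delta>) * t - (max 0 (t - \<delta>))\<^sup>2 * 1) / (t * t) = ptrunc' \<delta> t"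
    using t by (simp add: ptrunc'_def diff_divide_distrib power2_eq_square)
  ultimately show ?thesis by simp
qed

lemma ptrunc_ratio:
  fixes t \<delta> :: real
  assumes "0 < \<delta>"
  shows "0 \<le> max 0 (t - \<delta>) / t" "max 0 (t - \<delta>) / t \<le> 1"
proof -
  have "0 \<le> max 0 (t - \<delta>) / t \<and> max 0 (t - \<delta>) / t \<le> 1"
  proof (cases "t \<le> \<delta>")
    case True
    then have "max 0 (t - \<delta>) = 0" by (simp add: max_absorb1)
    then show ?thesis by simp
  next
    case False
    then have "max 0 (t - \<delta>) = t - \<delta>" by (simp add: max_absorb2)
    then show ?thesis using False assms by simp
  qed
  then show "0 \<le> max 0 (t - \<delta>) / t" "max 0 (t - \<delta>) / t \<le> 1" by blast+
qed

text \<open>With s the ratio of \<open>ptrunc_ratio\<close>, which lies between 0 and 1, the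
  derivative is 1 minus the square of 1 - s.\<close>

lemma ptrunc'_bounds:
  assumes "0 < \<delta>"
  shows "0 \<le> ptrunc' \<delta> t" "ptrunc' \<delta> t \<le> 1"
proof -
  let ?s = "max 0 (t - \<delta>) / t"
  have e: "ptrunc' \<delta> t = 1 - (1 - ?s)\<^sup>2" unfolding ptrunc'_def by (simp add: power2_eq_square algebra_simps)
  have "(1 - ?s)\<^sup>2 \<le> 1" using ptrunc_ratio[OF assms, of t] by (intro power_le_one) auto
  then show "0 \<le> ptrunc' \<delta> t" "ptrunc' \<delta> t \<le> 1" unfolding e by auto
qed

text \<open>A \<open>C\<^sup>1\<close> approximation of the identity that vanishes near 0.\<close>
definition trunc :: "real \<Rightarrow> real \<Rightarrow> real" where
  "trunc \<delta> t = ptrunc \<delta> t - ptrunc \<delta> (- t)"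

definition trunc' :: "real \<Rightarrow> real \<Rightarrow> real" where
  "trunc' \<delta> t = ptrunc' \<delta> t + ptrunc' \<delta> (- t)"

lemma trunc_derivative:
  assumes "0 < \<delta>"
  shows "(trunc \<delta> has_real_derivative trunc' \<delta> t) (at t)"
proof -
  have "((\<lambda>t. ptrunc \<delta> (- t)) has_real_derivative ptrunc' \<delta> (- t) * (- 1)) (at t)"
    by (rule DERIV_chain2[OF ptrunc_derivative[OF assms]]) (auto intro!: derivative_eq_intros)
  from DERIV_diff[OF ptrunc_derivative[OF assms] this] show ?thesis
    unfolding trunc_def[abs_def] trunc'_def by simp
qed

lemma ptrunc_nonpos: "0 < \<delta> \<Longrightarrow> t \<le> \<delta> \<Longrightarrow> ptrunc \<delta> t = 0" "0 < \<delta> \<Longrightarrow> t \<le> \<delta> \<Longrightarrow> ptrunc' \<delta> t = 0"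
  by (simp_all add: ptrunc_def ptrunc'_def)

lemma trunc'_bounds:
  assumes "0 < \<delta>"
  shows "0 \<le> trunc' \<delta> t" "trunc' \<delta> t \<le> 1"
proof -
  have "ptrunc' \<delta> t = 0 \<or> ptrunc' \<delta> (- t) = 0"
    using ptrunc_nonpos(2)[OF assms, of t] ptrunc_nonpos(2)[OF assms, of "- t"] assms by linarith
  then show "0 \<le> trunc' \<delta> t" "trunc' \<delta> t \<le> 1"
    using ptrunc'_bounds[OF assms, of t] ptrunc'_bounds[OF assms, of "- t"] unfolding trunc'_def by auto
qed

lemma trunc_lipschitz: "0 < \<delta> \<Longrightarrow> \<bar>trunc \<delta> s - trunc \<delta> t\<bar> \<le> \<bar>s - t\<bar>"
  by (rule lipschitz_bound_of_derivative_le_1[OF trunc_derivative]) (use trunc'_bounds in auto)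

lemma trunc_zero: "0 < \<delta> \<Longrightarrow> \<bar>t\<bar> \<le> \<delta> \<Longrightarrow> trunc \<delta> t = 0"
  by (simp add: trunc_def ptrunc_nonpos)

lemma trunc_abs_le: "0 < \<delta> \<Longrightarrow> \<bar>trunc \<delta> t\<bar> \<le> \<bar>t\<bar>"
  using trunc_lipschitz[of \<delta> t 0] trunc_zero[of \<delta> 0] by simp

lemma ptrunc_limits:
  assumes d: "\<And>k. 0 < d k" "d \<longlonglongrightarrow> 0"
  shows "0 < t \<Longrightarrow> (\<lambda>k. ptrunc (d k) t) \<longlonglongrightarrow> t" "0 < t \<Longrightarrow> (\<lambda>k. ptrunc' (d k) t) \<longlonglongrightarrow> 1"
proof -
  assume t: "0 < t"
  have m: "(\<lambda>k. max 0 (t - d k)) \<longlonglongrightarrow> max 0 (t - 0)" by (intro tendsto_intros d)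
  then have m: "(\<lambda>k. max 0 (t - d k)) \<longlonglongrightarrow> t" using t by simp
  have "(\<lambda>k. ptrunc (d k) t) \<longlonglongrightarrow> t\<^sup>2 / t" unfolding ptrunc_def using t by (intro tendsto_intros m) simp
  then show "(\<lambda>k. ptrunc (d k) t) \<longlonglongrightarrow> t" using t by (simp add: power2_eq_square)
  have "(\<lambda>k. ptrunc' (d k) t) \<longlonglongrightarrow> 2 * (t / t) - (t / t)\<^sup>2"
    unfolding ptrunc'_def using t by (intro tendsto_intros m) simp_all
  then show "(\<lambda>k. ptrunc' (d k) t) \<longlonglongrightarrow> 1" using t by simp
qed

text \<open>At t = 0 every truncation has slope 0, so the slopes converge to 1 only for other t.
  This is why \<open>H10_lipschitz\<close> asks for a gradient that vanishes wherever the function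
  does.\<close>

lemma trunc_limits:
  assumes d: "\<And>k. 0 < d k" "d \<longlonglongrightarrow> 0"
  shows "(\<lambda>k. trunc (d k) t) \<longlonglongrightarrow> t" "t \<noteq> 0 \<Longrightarrow> (\<lambda>k. trunc' (d k) t) \<longlonglongrightarrow> 1"
proof -
  have n: "ptrunc (d k) s = 0" "ptrunc' (d k) s = 0" if "s \<le> 0" for s k
    using ptrunc_nonpos[OF d(1), of s k] d(1)[of k] that by simp_all
  consider "t < 0" | "t = 0" | "0 < t" by linarith
  then show "(\<lambda>k. trunc (d k) t) \<longlonglongrightarrow> t"
  proof cases
    case 1
    then show ?thesis using tendsto_minus[OF ptrunc_limits(1)[OF d, of "- t"]] n(1)[of t] by (simp add: trunc_def)
  next
    case 2
    then show ?thesis using n(1)[of 0] by (simp add: trunc_def)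
  next
    case 3
    then show ?thesis using ptrunc_limits(1)[OF d, of t] n(1)[of "- t"] by (simp add: trunc_def)
  qed
  assume "t \<noteq> 0"
  then consider "t < 0" | "0 < t" by linarith
  then show "(\<lambda>k. trunc' (d k) t) \<longlonglongrightarrow> 1"
  proof cases
    case 1
    then show ?thesis using ptrunc_limits(2)[OF d, of "- t"] n(2)[of t] by (simp add: trunc'_def)
  next
    case 2
    then show ?thesis using ptrunc_limits(2)[OF d, of t] n(2)[of "- t"] by (simp add: trunc'_def)
  qed
qed

text \<open>At a point of differentiability the deviation from the affine approximation is o(r),
  which beats the factor 1 / r in \<open>mollify_grad_error\<close>.\<close>

lemma mollify_grad_tendsto:
  fixes v :: "'a::euclidean_space \<Rightarrow> real"
  assumes v: "integrable lborel v" and der: "(v has_derivative (\<lambda>h. g \<bullet> h)) (at x)"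
    and r: "\<And>k. 0 < r k" "r \<longlonglongrightarrow> 0"
  shows "(\<lambda>k. mollify_grad (r k) v x) \<longlonglongrightarrow> g"
proof (rule metric_LIMSEQ_I)
  fix e :: real assume e: "0 < e"
  let ?C = "2 ^ (DIM('a) + 3) :: real"
  define e' where "e' = e / (2 * ?C)"
  have e': "0 < e'" using e by (simp add: e'_def)
  obtain \<delta> where \<delta>: "0 < \<delta>" "\<And>y. norm (y - x) < \<delta> \<Longrightarrow> norm (v y - v x - g \<bullet> (y - x)) \<le> e' * norm (y - x)"
    using der e' unfolding has_derivative_at_alt by blast
  obtain K where K: "\<And>k. k \<ge> K \<Longrightarrow> r k < \<delta>"
    using order_tendstoD(2)[OF r(2) \<delta>(1)] unfolding eventually_sequentially by blast
  have "dist (mollify_grad (r k) v x) g < e" if "k \<ge> K" for k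
  proof -
    have "norm (mollify_grad (r k) v x - g) \<le> (e' * r k) * 2 ^ (DIM('a) + 3) / r k"
    proof (rule mollify_grad_error[OF v r(1)])
      fix y assume y: "norm (y - x) \<le> r k"
      have "norm (v y - v x - g \<bullet> (y - x)) \<le> e' * norm (y - x)"
        by (rule \<delta>(2)) (use y K[OF that] in linarith)
      also have "\<dots> \<le> e' * r k" using y e' by simp
      finally show "\<bar>v y - (v x + g \<bullet> (y - x))\<bar> \<le> e' * r k" by (simp add: algebra_simps)
    qed
    also have "\<dots> = e / 2" using r(1)[of k] by (simp add: e'_def)
    finally show ?thesis using e by (simp add: dist_norm)
  qed
  then show "\<exists>no. \<forall>n\<ge>no. dist (mollify_grad (r n) v x) g < e" by blast
qed

section \<open>Lipschitz functions that vanish off the domain belong to H^1_0\<close>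

context bounded_open
begin

text \<open>The mollified gradients converge wherever v is differentiable and are bounded by a
  multiple of L everywhere, so dominated convergence applies. Differentiability almost everywhere is
  a hypothesis in place of Rademacher's theorem: the functions treated later are piecewise
  affine.\<close>

lemma lipschitz_approx_compact_support:
  fixes v :: "'a \<Rightarrow> real"
  assumes lip: "\<And>x y. \<bar>v x - v y\<bar> \<le> L * norm (x - y)"
    and K: "compact K" "K \<subseteq> \<Omega>" "\<And>x. x \<notin> K \<Longrightarrow> v x = 0"
    and der: "AE x in N. (v has_derivative (\<lambda>h. g x \<bullet> h)) (at x)"
    and g: "g \<in> borel_measurable N"
  shows "\<exists>\<phi> D. (\<forall>k::nat. test_fun \<Omega> (\<phi> k) (D k)) \<and> (\<lambda>k. sq_norm N (\<lambda>x. \<phi> k x - v x)) \<longlonglongrightarrow> 0 \<and>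
      (\<lambda>k. sq_norm N (\<lambda>x. D k x - g x)) \<longlonglongrightarrow> 0"
    and "sq_int N v" "sq_int N g" "AE x in N. norm (g x) \<le> L * 2 ^ (DIM('a) + 3)"
proof -
  have L: "0 \<le> L"
  proof -
    obtain e :: 'a where "e \<in> Basis" using nonempty_Basis by blast
    then show ?thesis using lip[of e 0] by (simp add: order_trans[OF abs_ge_zero])
  qed
  have cont: "continuous_on UNIV v"
    by (rule lipschitz_on_continuous_on[of L]) (use lip L in \<open>auto intro!: lipschitz_onI simp: dist_norm\<close>)
  have v_int: "integrable lborel v" by (rule integrable_lborel_compact_support[OF cont K(1,3)])
  obtain d where d: "d > 0" "(\<Union>x\<in>K. cball x d) \<subseteq> \<Omega>"
    by (rule compact_subset_open_imp_cball_epsilon_subset[OF K(1) open_dom K(2)])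
  define r where "r k = d * inverse (real (Suc k))" for k
  have "inverse (real (Suc k)) \<le> 1" for k by (simp add: field_simps)
  then have r: "0 < r k" "r k \<le> d" for k
    using d(1) mult_left_mono[of "inverse (real (Suc k))" 1 d] by (auto simp: r_def)
  have r0: "r \<longlonglongrightarrow> 0"
    unfolding r_def[abs_def] by (rule tendsto_mult_right_zero[OF LIMSEQ_inverse_real_of_nat])
  have tf: "test_fun \<Omega> (mollify (r k) v) (mollify_grad (r k) v)" for k
  proof (rule mollify_test_fun[OF v_int r(1) K(1,3)])
    show "cball x (r k) \<subseteq> \<Omega>" if "x \<in> K" for x
      using d(2) r(2)[of k] that subset_cball[of "r k" d x] by blast
  qed
  have near: "\<bar>mollify (r k) v x - v x\<bar> \<le> L * r k" for k x
  proof (rule mollify_error[OF v_int r(1)])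
    fix y assume "norm (y - x) \<le> r k"
    then show "\<bar>v y - v x\<bar> \<le> L * r k" using lip[of y x] mult_left_mono[OF _ L] order_trans by blast
  qed
  have gbnd: "norm (mollify_grad (r k) v x) \<le> L * 2 ^ (DIM('a) + 3)" for k x
  proof -
    have "norm (mollify_grad (r k) v x - 0) \<le> (L * r k) * 2 ^ (DIM('a) + 3) / r k"
    proof (rule mollify_grad_error[OF v_int r(1)])
      fix y assume "norm (y - x) \<le> r k"
      then show "\<bar>v y - (v x + 0 \<bullet> (y - x))\<bar> \<le> L * r k"
        using order_trans[OF lip[of y x] mult_left_mono[OF _ L]] by simp
    qed
    then show ?thesis using r(1)[of k] by simp
  qed
  have conv: "AE x in N. (\<lambda>k. mollify_grad (r k) v x) \<longlonglongrightarrow> g x"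
    using der by eventually_elim (rule mollify_grad_tendsto[OF v_int _ r(1) r0])
  show gb: "AE x in N. norm (g x) \<le> L * 2 ^ (DIM('a) + 3)"
    using conv
  proof eventually_elim
    case (elim x)
    show ?case by (rule Lim_bounded[OF tendsto_norm[OF elim], of 0]) (use gbnd in simp)
  qed
  show "sq_int N g" by (rule sq_int_bounded[OF finite_N g gb])
  have "bounded (v ` K)"
    by (intro compact_imp_bounded compact_continuous_image continuous_on_subset[OF cont] K(1)) simp
  then obtain B where "B > 0" "\<And>x. x \<in> K \<Longrightarrow> norm (v x) \<le> B" by (auto simp: bounded_pos)
  then have "norm (v x) \<le> B" for x using K(3)[of x] by (cases "x \<in> K") auto
  then show "sq_int N v"
    by (intro sq_int_bounded[OF finite_N continuous_measurable_lebesgue_on[OF cont]]) auto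
  have 1: "(\<lambda>k. sq_norm N (\<lambda>x. mollify (r k) v x - v x)) \<longlonglongrightarrow> 0"
  proof (rule sq_norm_dominated_tendsto_zero[OF finite_N])
    show "mollify (r k) v \<in> borel_measurable N" for k
      by (rule continuous_measurable_lebesgue_on[OF test_funD(3)[OF tf]])
    show "v \<in> borel_measurable N" by (rule continuous_measurable_lebesgue_on[OF cont])
    show "AE x in N. norm (mollify (r k) v x - v x) \<le> L * d" for k
      using order_trans[OF near mult_left_mono[OF r(2) L]] by (intro AE_I2) simp
    show "AE x in N. (\<lambda>k. mollify (r k) v x) \<longlonglongrightarrow> v x"
    proof (rule AE_I2, rule LIM_zero_cancel, rule Lim_null_comparison)
      show "(\<lambda>k. L * r k) \<longlonglongrightarrow> 0" by (rule tendsto_mult_right_zero[OF r0])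
      show "\<forall>\<^sub>F k in sequentially. norm (mollify (r k) v x - v x) \<le> L * r k" for x
        using near by simp
    qed
  qed
  have 2: "(\<lambda>k. sq_norm N (\<lambda>x. mollify_grad (r k) v x - g x)) \<longlonglongrightarrow> 0"
  proof (rule sq_norm_dominated_tendsto_zero[OF finite_N _ g conv])
    show "mollify_grad (r k) v \<in> borel_measurable N" for k
      by (rule continuous_measurable_lebesgue_on[OF test_funD(2)[OF tf]])
    show "AE x in N. norm (mollify_grad (r k) v x - g x) \<le> L * 2 ^ (DIM('a) + 3) + L * 2 ^ (DIM('a) + 3)" for k
      using gb
    proof eventually_elim
      case (elim x)
      then show ?case
        using norm_triangle_ineq4[of "mollify_grad (r k) v x" "g x"] gbnd[of k x] by linarith
    qed
  qed
  show "\<exists>\<phi> D. (\<forall>k::nat. test_fun \<Omega> (\<phi> k) (D k)) \<and> (\<lambda>k. sq_norm N (\<lambda>x. \<phi> k x - v x)) \<longlonglongrightarrow> 0 \<and>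
      (\<lambda>k. sq_norm N (\<lambda>x. D k x - g x)) \<longlonglongrightarrow> 0"
    by (intro exI[of _ "\<lambda>k. mollify (r k) v"] exI[of _ "\<lambda>k. mollify_grad (r k) v"] conjI allI tf 1 2)
qed

text \<open>The support of v may touch the boundary, where mollification would leave \<Omega>.
  Composing with \<open>trunc\<close> moves the support into the set where |v| is at least \<delta>,
  which is closed, bounded and contained in \<Omega>; then \<delta> tends to 0.\<close>

lemma H10_lipschitz:
  fixes v :: "'a \<Rightarrow> real"
  assumes lip: "\<And>x y. \<bar>v x - v y\<bar> \<le> L * norm (x - y)"
    and out: "\<And>x. x \<notin> \<Omega> \<Longrightarrow> v x = 0"
    and der: "AE x in N. (v has_derivative (\<lambda>h. g x \<bullet> h)) (at x)"
    and flat: "AE x in N. v x = 0 \<longrightarrow> g x = 0"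
    and g: "g \<in> borel_measurable N" and gB: "AE x in N. norm (g x) \<le> B"
  shows "H10 \<Omega> v" "AE x in N. wgrad \<Omega> v x = g x"
proof -
  define d where "d k = inverse (real (Suc k))" for k
  have d: "0 < d k" for k by (simp add: d_def)
  have d0: "d \<longlonglongrightarrow> 0" unfolding d_def[abs_def] by (rule LIMSEQ_inverse_real_of_nat)
  have L: "0 \<le> L"
  proof -
    obtain e :: 'a where "e \<in> Basis" using nonempty_Basis by blast
    then show ?thesis using lip[of e 0] by (simp add: order_trans[OF abs_ge_zero])
  qed
  have cont: "continuous_on UNIV v"
    by (rule lipschitz_on_continuous_on[of L]) (use lip L in \<open>auto intro!: lipschitz_onI simp: dist_norm\<close>)
  have vm: "v \<in> borel_measurable N" by (rule continuous_measurable_lebesgue_on[OF cont])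
  have gi: "sq_int N g" by (rule sq_int_bounded[OF finite_N g gB])
  define w where "w k x = trunc (d k) (v x)" for k x
  define G where "G k x = trunc' (d k) (v x) *\<^sub>R g x" for k x
  have trunc'_m: "trunc' \<delta> \<in> borel_measurable borel" for \<delta>
    unfolding trunc'_def[abs_def] ptrunc'_def[abs_def] by measurable
  have trunc_m: "trunc \<delta> \<in> borel_measurable borel" for \<delta>
    unfolding trunc_def[abs_def] ptrunc_def[abs_def] by measurable
  have Gm: "G k \<in> borel_measurable N" for k
    unfolding G_def[abs_def] by (intro borel_measurable_scaleR g measurable_compose[OF vm trunc'_m])
  have wm: "w k \<in> borel_measurable N" for k
    unfolding w_def[abs_def] by (rule measurable_compose[OF vm trunc_m])
  define K where "K k = {x. d k \<le> \<bar>v x\<bar>}" for k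
  have KO: "K k \<subseteq> \<Omega>" for k using out d[of k] by (force simp: K_def)
  have cK: "compact (K k)" for k
  proof -
    have "closed (K k)" unfolding K_def by (intro closed_Collect_le continuous_intros cont)
    moreover have "bounded (K k)" by (rule bounded_subset[OF bounded_dom KO])
    ultimately show ?thesis by (simp add: compact_eq_bounded_closed)
  qed
  have app: "\<exists>\<phi> D. (\<forall>j::nat. test_fun \<Omega> (\<phi> j) (D j)) \<and> (\<lambda>j. sq_norm N (\<lambda>x. \<phi> j x - w k x)) \<longlonglongrightarrow> 0 \<and>
      (\<lambda>j. sq_norm N (\<lambda>x. D j x - G k x)) \<longlonglongrightarrow> 0"
    and wi: "sq_int N (w k)" and Gi: "sq_int N (G k)" for k
  proof -
    have 1: "\<bar>w k x - w k y\<bar> \<le> L * norm (x - y)" for x y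
      unfolding w_def by (rule order_trans[OF trunc_lipschitz[OF d] lip])
    have 2: "w k x = 0" if "x \<notin> K k" for x
      unfolding w_def by (rule trunc_zero[OF d]) (use that in \<open>simp add: K_def\<close>)
    have 3: "AE x in N. (w k has_derivative (\<lambda>h. G k x \<bullet> h)) (at x)"
      using der
    proof eventually_elim
      case (elim x)
      from has_derivative_compose[OF elim trunc_derivative[OF d, unfolded has_field_derivative_def]]
      show ?case unfolding w_def[abs_def] G_def by simp
    qed
    note * = lipschitz_approx_compact_support[OF 1 cK KO 2 3 Gm]
    show "\<exists>\<phi> D. (\<forall>j::nat. test_fun \<Omega> (\<phi> j) (D j)) \<and> (\<lambda>j. sq_norm N (\<lambda>x. \<phi> j x - w k x)) \<longlonglongrightarrow> 0 \<and>
      (\<lambda>j. sq_norm N (\<lambda>x. D j x - G k x)) \<longlonglongrightarrow> 0"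
      by (rule *(1))
    show "sq_int N (w k)" by (rule *(2))
    show "sq_int N (G k)" by (rule *(3))
  qed
  have vB: "\<exists>B. \<forall>x. \<bar>v x\<bar> \<le> B"
  proof -
    have "bounded (v ` closure \<Omega>)"
      using bounded_dom by (intro compact_imp_bounded compact_continuous_image continuous_on_subset[OF cont]) auto
    then obtain B where B: "B > 0" "\<And>x. x \<in> closure \<Omega> \<Longrightarrow> norm (v x) \<le> B" by (auto simp: bounded_pos)
    have "\<bar>v x\<bar> \<le> B" for x
    proof (cases "x \<in> closure \<Omega>")
      case True
      then show ?thesis using B(2) by simp
    next
      case False
      then have "x \<notin> \<Omega>" using closure_subset by blast
      then show ?thesis using B(1) out by simp
    qed
    then show ?thesis by blast
  qed
  then obtain Bv where Bv: "\<And>x. \<bar>v x\<bar> \<le> Bv" by blast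
  have vi: "sq_int N v" by (rule sq_int_bounded[OF finite_N vm, of Bv]) (use Bv in auto)
  have lim1: "(\<lambda>k. sq_norm N (\<lambda>x. w k x - v x)) \<longlonglongrightarrow> 0"
  proof (rule sq_norm_dominated_tendsto_zero[OF finite_N wm vm])
    show "AE x in N. (\<lambda>k. w k x) \<longlonglongrightarrow> v x" unfolding w_def by (intro AE_I2 trunc_limits(1) d d0)
    show "AE x in N. norm (w k x - v x) \<le> 2 * Bv" for k
    proof (rule AE_I2)
      show "norm (w k x - v x) \<le> 2 * Bv" for x
        using trunc_abs_le[OF d, of k "v x"] Bv[of x] by (simp add: w_def)
    qed
  qed
  have lim2: "(\<lambda>k. sq_norm N (\<lambda>x. G k x - g x)) \<longlonglongrightarrow> 0"
  proof (rule sq_norm_dominated_tendsto_zero[OF finite_N Gm g])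
    show "AE x in N. (\<lambda>k. G k x) \<longlonglongrightarrow> g x"
      using flat
    proof eventually_elim
      case (elim x)
      show ?case
      proof (cases "v x = 0")
        case True
        then show ?thesis using elim by (simp add: G_def)
      next
        case False
        have "(\<lambda>k. trunc' (d k) (v x) *\<^sub>R g x) \<longlonglongrightarrow> 1 *\<^sub>R g x"
          by (intro tendsto_scaleR trunc_limits(2) d d0 False tendsto_const)
        then show ?thesis by (simp add: G_def)
      qed
    qed
    show "AE x in N. norm (G k x - g x) \<le> B" for k
      using gB
    proof eventually_elim
      case (elim x)
      have "G k x - g x = (trunc' (d k) (v x) - 1) *\<^sub>R g x" by (simp add: G_def scaleR_left_diff_distrib)
      then have "norm (G k x - g x) = \<bar>trunc' (d k) (v x) - 1\<bar> * norm (g x)" by simp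
      also have "\<dots> \<le> 1 * B"
        using trunc'_bounds[OF d, of k "v x"] elim by (intro mult_mono) auto
      finally show ?case by simp
    qed
  qed
  \<comment> \<open>Diagonal choice: for each truncation one test function within d k of it, both in
    value and in gradient.\<close>
  have "\<exists>\<phi> D. test_fun \<Omega> \<phi> D \<and> sq_norm N (\<lambda>x. \<phi> x - w k x) < d k \<and> sq_norm N (\<lambda>x. D x - G k x) < d k" for k
  proof -
    obtain \<phi> D where *: "\<And>j::nat. test_fun \<Omega> (\<phi> j) (D j)" "(\<lambda>j. sq_norm N (\<lambda>x. \<phi> j x - w k x)) \<longlonglongrightarrow> 0"
      "(\<lambda>j. sq_norm N (\<lambda>x. D j x - G k x)) \<longlonglongrightarrow> 0" using app[of k] by blast
    have "\<forall>\<^sub>F j in sequentially. sq_norm N (\<lambda>x. \<phi> j x - w k x) < d k \<and> sq_norm N (\<lambda>x. D j x - G k x) < d k"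
      by (intro eventually_conj order_tendstoD(2)[OF *(2)] order_tendstoD(2)[OF *(3)] d)
    then obtain j where "sq_norm N (\<lambda>x. \<phi> j x - w k x) < d k \<and> sq_norm N (\<lambda>x. D j x - G k x) < d k"
      unfolding eventually_sequentially by blast
    then show ?thesis using *(1)[of j] by blast
  qed
  then obtain \<phi> D where \<phi>: "\<And>k. test_fun \<Omega> (\<phi> k) (D k)" "\<And>k. sq_norm N (\<lambda>x. \<phi> k x - w k x) < d k"
    "\<And>k. sq_norm N (\<lambda>x. D k x - G k x) < d k" by metis
  have squeeze: "(\<lambda>k. sq_norm N (\<lambda>x. F k x - f x)) \<longlonglongrightarrow> 0"
    if F: "\<And>k. sq_int N (F k)" "\<And>k. sq_int N (H k)" "sq_int N f" "\<And>k. sq_norm N (\<lambda>x. F k x - H k x) < d k"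
      "(\<lambda>k. sq_norm N (\<lambda>x. H k x - f x)) \<longlonglongrightarrow> 0" for F H :: "nat \<Rightarrow> 'a \<Rightarrow> 'c::euclidean_space" and f
  proof (rule tendsto_sandwich[OF _ _ tendsto_const])
    show "(\<lambda>k. d k + sq_norm N (\<lambda>x. H k x - f x)) \<longlonglongrightarrow> 0" using tendsto_add[OF d0 F(5)] by simp
    show "\<forall>\<^sub>F k in sequentially. sq_norm N (\<lambda>x. F k x - f x) \<le> d k + sq_norm N (\<lambda>x. H k x - f x)"
    proof (rule always_eventually, rule allI)
      show "sq_norm N (\<lambda>x. F k x - f x) \<le> d k + sq_norm N (\<lambda>x. H k x - f x)" for k
        using sq_norm_triangle[OF F(1)[of k] F(2)[of k] F(3)] F(4)[of k] by linarith
    qed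
  qed simp
  note lims = H10I[OF vi gi \<phi>(1) squeeze[OF test_sq_int(1)[OF \<phi>(1)] wi vi \<phi>(2) lim1]
      squeeze[OF test_sq_int(2)[OF \<phi>(1)] Gi gi \<phi>(3) lim2]]
  show "H10 \<Omega> v" "AE x in N. wgrad \<Omega> v x = g x" by (rule lims(1), rule lims(3))
qed

end

section \<open>Barycentric coordinates and the geometry of simplices\<close>

text \<open>Gradient and constant term of the barycentric coordinate of \<open>s\<close> in the simplex \<open>S\<close>.\<close>
definition bary :: "'a::euclidean_space set \<Rightarrow> 'a \<Rightarrow> 'a \<times> real" where
  "bary S s = (SOME p. \<forall>t\<in>S. fst p \<bullet> t + snd p = (if t = s then 1 else 0))"

definition bgrad :: "'a::euclidean_space set \<Rightarrow> 'a \<Rightarrow> 'a" where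
  "bgrad S s = fst (bary S s)"

definition bcoord :: "'a::euclidean_space set \<Rightarrow> 'a \<Rightarrow> 'a \<Rightarrow> real" where
  "bcoord S s x = bgrad S s \<bullet> x + snd (bary S s)"

lemma simplex_verticesD:
  assumes "is_simplex_vertices (S :: 'a::euclidean_space set)"
  shows "finite S" "card S = DIM('a) + 1" "\<not> affine_dependent S" "S \<noteq> {}"
  using assms unfolding is_simplex_vertices_def by auto

text \<open>The vertices other than s span a hyperplane \<open>a \<bullet> x = b\<close> that misses
  s; the affine function \<open>a \<bullet> x - b\<close> divided by its value at s has the required
  values, so the choice in \<open>bary\<close> is justified.\<close>

lemma bcoord_vertex:
  assumes S: "is_simplex_vertices (S :: 'a::euclidean_space set)" and "s \<in> S" "t \<in> S"
  shows "bcoord S s t = (if t = s then 1 else 0)"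
proof -
  note D = simplex_verticesD[OF S]
  have ind: "\<not> affine_dependent (S - {s})"
    using affine_independent_Diff[OF D(3)] .
  have "aff_dim (S - {s}) = DIM('a) - 1"
    using aff_dim_affine_independent[OF ind] D(1,2) assms(2) DIM_positive[where 'a='a] by simp
  then have "\<exists>a b. a \<noteq> 0 \<and> affine hull (S - {s}) = {x. a \<bullet> x = b}"
    by (simp only: aff_dim_eq_hyperplane)
  then obtain a b where ab: "affine hull (S - {s}) = {x. a \<bullet> x = b}"
    by blast
  have "s \<notin> affine hull (S - {s})" using D(3) assms(2) unfolding affine_dependent_def by blast
  then have c: "a \<bullet> s - b \<noteq> 0" using ab by simp
  have "\<forall>t\<in>S. (inverse (a \<bullet> s - b) *\<^sub>R a) \<bullet> t + (- b / (a \<bullet> s - b)) = (if t = s then 1 else 0)"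
  proof
    fix t assume "t \<in> S"
    show "(inverse (a \<bullet> s - b) *\<^sub>R a) \<bullet> t + (- b / (a \<bullet> s - b)) = (if t = s then 1 else 0)"
    proof (cases "t = s")
      case True
      then show ?thesis using c by (simp add: divide_simps)
    next
      case False
      then have "t \<in> affine hull (S - {s})" using \<open>t \<in> S\<close> by (intro hull_inc) simp
      then have "a \<bullet> t = b" using ab by simp
      then show ?thesis using False c by (simp add: divide_simps)
    qed
  qed
  then have "\<exists>p. \<forall>t\<in>S. fst p \<bullet> t + snd p = (if t = s then 1 else 0)"
    by (intro exI[of _ "(inverse (a \<bullet> s - b) *\<^sub>R a, - b / (a \<bullet> s - b))"]) simp
  then have "\<forall>t\<in>S. fst (bary S s) \<bullet> t + snd (bary S s) = (if t = s then 1 else 0)"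
    unfolding bary_def by (rule someI_ex)
  then show ?thesis using assms(3) unfolding bcoord_def bgrad_def by blast
qed

lemma bcoord_affine: "bcoord S s y = bcoord S s x + bgrad S s \<bullet> (y - x)"
  unfolding bcoord_def by (simp add: inner_diff_right)

lemma continuous_on_bcoord [continuous_intros]: "continuous_on A (bcoord S s)"
  unfolding bcoord_def[abs_def] by (intro continuous_intros)

lemma bcoord_sum:
  assumes S: "is_simplex_vertices S" and "s \<in> S" "sum u S = 1"
  shows "bcoord S s (\<Sum>v\<in>S. u v *\<^sub>R v) = u s"
proof -
  have "bcoord S s (\<Sum>v\<in>S. u v *\<^sub>R v) = (\<Sum>v\<in>S. u v * (bgrad S s \<bullet> v)) + (\<Sum>v\<in>S. u v) * snd (bary S s)"
    unfolding bcoord_def by (simp add: inner_sum_right assms(3))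
  also have "\<dots> = (\<Sum>v\<in>S. u v * bcoord S s v)"
    unfolding bcoord_def by (simp add: distrib_left sum.distrib sum_distrib_right)
  also have "\<dots> = (\<Sum>v\<in>S. if v = s then u v else 0)"
    by (rule sum.cong) (simp_all add: bcoord_vertex[OF S assms(2)])
  also have "\<dots> = u s" using simplex_verticesD(1)[OF S] assms(2) by simp
  finally show ?thesis .
qed

lemma bcoord_representation:
  assumes S: "is_simplex_vertices (S :: 'a::euclidean_space set)"
  shows "(\<Sum>s\<in>S. bcoord S s x) = 1" "(\<Sum>s\<in>S. bcoord S s x *\<^sub>R s) = x"
proof -
  note D = simplex_verticesD[OF S]
  have "affine hull S = UNIV" by (rule affine_independent_span_eq[OF D(3)]) (simp add: D(2))
  then have "x \<in> affine hull S" by simp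
  then obtain u where u: "sum u S = 1" "(\<Sum>v\<in>S. u v *\<^sub>R v) = x"
    unfolding affine_hull_finite[OF D(1)] by blast
  have *: "bcoord S s x = u s" if "s \<in> S" for s
    using bcoord_sum[OF S that u(1)] unfolding u(2) .
  show "(\<Sum>s\<in>S. bcoord S s x) = 1" using u(1) * by simp
  have "(\<Sum>s\<in>S. bcoord S s x *\<^sub>R s) = (\<Sum>v\<in>S. u v *\<^sub>R v)" by (rule sum.cong) (simp_all add: *)
  then show "(\<Sum>s\<in>S. bcoord S s x *\<^sub>R s) = x" using u(2) by simp
qed

lemma in_face_iff:
  assumes S: "is_simplex_vertices S" and "T \<subseteq> S"
  shows "x \<in> convex hull T \<longleftrightarrow> (\<forall>s\<in>S. 0 \<le> bcoord S s x) \<and> (\<forall>s\<in>S - T. bcoord S s x = 0)"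
proof
  have fT: "finite T" using assms(2) simplex_verticesD(1)[OF S] finite_subset by blast
  assume "x \<in> convex hull T"
  then obtain u where u: "\<forall>x\<in>T. 0 \<le> u x" "sum u T = 1" "(\<Sum>v\<in>T. u v *\<^sub>R v) = x"
    unfolding convex_hull_finite[OF fT] by blast
  let ?u = "\<lambda>v. if v \<in> T then u v else 0"
  have "sum ?u S = 1" "(\<Sum>v\<in>S. ?u v *\<^sub>R v) = x"
    using u(2,3) sum.mono_neutral_cong_right[OF simplex_verticesD(1)[OF S] assms(2), of ?u u]
      sum.mono_neutral_cong_right[OF simplex_verticesD(1)[OF S] assms(2), of "\<lambda>v. ?u v *\<^sub>R v" "\<lambda>v. u v *\<^sub>R v"]
    by auto
  then have "bcoord S s x = ?u s" if "s \<in> S" for s using bcoord_sum[OF S that, of ?u] by simp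
  then show "(\<forall>s\<in>S. 0 \<le> bcoord S s x) \<and> (\<forall>s\<in>S - T. bcoord S s x = 0)" using u(1) by simp
next
  have fT: "finite T" using assms(2) simplex_verticesD(1)[OF S] finite_subset by blast
  assume a: "(\<forall>s\<in>S. 0 \<le> bcoord S s x) \<and> (\<forall>s\<in>S - T. bcoord S s x = 0)"
  then have "(\<Sum>s\<in>T. bcoord S s x) = 1" "(\<Sum>s\<in>T. bcoord S s x *\<^sub>R s) = x"
    using bcoord_representation[OF S, of x]
      sum.mono_neutral_left[OF simplex_verticesD(1)[OF S] assms(2), of "\<lambda>s. bcoord S s x"]
      sum.mono_neutral_left[OF simplex_verticesD(1)[OF S] assms(2), of "\<lambda>s. bcoord S s x *\<^sub>R s"]
    by auto
  then show "x \<in> convex hull T"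
    unfolding convex_hull_finite[OF fT] using a assms(2) by (intro CollectI exI[of _ "\<lambda>s. bcoord S s x"]) auto
qed

lemma in_simplex_iff:
  assumes "is_simplex_vertices S"
  shows "x \<in> convex hull S \<longleftrightarrow> (\<forall>s\<in>S. 0 \<le> bcoord S s x)"
  using in_face_iff[OF assms subset_refl] by simp

lemma simplex_other_vertex:
  assumes S: "is_simplex_vertices (S :: 'a::euclidean_space set)"
  obtains t where "t \<in> S" "t \<noteq> s"
proof -
  have "S - {s} \<noteq> {}"
  proof
    assume "S - {s} = {}"
    then have "card S \<le> card {s}" by (intro card_mono) auto
    then show False using simplex_verticesD(2)[OF S] by simp
  qed
  then show ?thesis using that by blast
qed

text \<open>The second part bounds edges from below by the reciprocal of a gradient. Together with
  an upper bound for the gradient it will compare the diameters of cells with a common edge.\<close>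

lemma bgrad_edge:
  assumes S: "is_simplex_vertices S" and "s \<in> S" "t \<in> S" "t \<noteq> s"
  shows "bgrad S s \<bullet> (s - t) = 1" "1 \<le> norm (bgrad S s) * norm (s - t)"
proof -
  show 1: "bgrad S s \<bullet> (s - t) = 1"
    using bcoord_affine[of S s s t] bcoord_vertex[OF S assms(2,2)] bcoord_vertex[OF S assms(2,3)] assms(4) by simp
  show "1 \<le> norm (bgrad S s) * norm (s - t)"
    using Cauchy_Schwarz_ineq2[of "bgrad S s" "s - t"] unfolding 1 by simp
qed

lemma bgrad_nonzero:
  assumes S: "is_simplex_vertices S" and "s \<in> S"
  shows "bgrad S s \<noteq> 0"
proof -
  obtain t where "t \<in> S" "t \<noteq> s" using simplex_other_vertex[OF S] by blast
  then show ?thesis using bgrad_edge(1)[OF S assms(2), of t] by auto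
qed

lemma in_interior_simplex_iff:
  assumes S: "is_simplex_vertices S"
  shows "x \<in> interior (convex hull S) \<longleftrightarrow> (\<forall>s\<in>S. 0 < bcoord S s x)"
proof
  assume "\<forall>s\<in>S. 0 < bcoord S s x"
  then have x: "x \<in> (\<Inter>s\<in>S. {y. 0 < bcoord S s y})" by simp
  have "open (\<Inter>s\<in>S. {y. 0 < bcoord S s y})"
    using simplex_verticesD(1)[OF S] by (intro open_INT ballI open_Collect_less continuous_intros) auto
  moreover have "(\<Inter>s\<in>S. {y. 0 < bcoord S s y}) \<subseteq> convex hull S"
    using in_simplex_iff[OF S] by (auto intro: less_imp_le)
  ultimately show "x \<in> interior (convex hull S)" using x interiorI by blast
next
  assume "x \<in> interior (convex hull S)"
  then obtain e where e: "e > 0" "ball x e \<subseteq> convex hull S" unfolding mem_interior by blast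
  show "\<forall>s\<in>S. 0 < bcoord S s x"
  proof
    fix s assume s: "s \<in> S"
    let ?g = "bgrad S s"
    have g: "0 < norm ?g" using bgrad_nonzero[OF S s] by simp
    \<comment> \<open>Moving against the gradient stays in the ball but strictly lowers the
      coordinate of s, which therefore was positive at x.\<close>
    let ?y = "x - (e / 2 / norm ?g) *\<^sub>R ?g"
    have "?y \<in> ball x e" using e g by (simp add: dist_norm)
    then have "0 \<le> bcoord S s ?y" using e(2) in_simplex_iff[OF S, of ?y] s by blast
    moreover have "bcoord S s ?y = bcoord S s x - e / 2 / norm ?g * (?g \<bullet> ?g)"
      using bcoord_affine[of S s ?y x] by simp
    moreover have "0 < e / 2 / norm ?g * (?g \<bullet> ?g)"
      using e g by (intro mult_pos_pos divide_pos_pos) auto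
    ultimately show "0 < bcoord S s x" by linarith
  qed
qed

section \<open>Volume, diameter and packing\<close>

lemma compact_simplex: "is_simplex_vertices S \<Longrightarrow> compact (convex hull S)"
  by (intro finite_imp_compact_convex_hull simplex_verticesD(1))

lemma lmeasurable_simplex: "is_simplex_vertices S \<Longrightarrow> convex hull S \<in> lmeasurable"
  by (intro lmeasurable_compact compact_simplex)

lemma barycenter_coord:
  assumes S: "is_simplex_vertices (S :: 'a::euclidean_space set)" and "s \<in> S"
  shows "bcoord S s (\<Sum>v\<in>S. (1 / (real DIM('a) + 1)) *\<^sub>R v) = 1 / (real DIM('a) + 1)"
proof (rule bcoord_sum[OF assms])
  show "(\<Sum>v\<in>S. 1 / (real DIM('a) + 1)) = 1"
    using simplex_verticesD(2)[OF S] by (simp add: field_simps)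
qed

text \<open>At the barycenter all coordinates equal 1 / (DIM + 1), and a move of length r changes
  the coordinate of s by at most r times the norm of its gradient.\<close>

lemma simplex_ball_interior:
  assumes S: "is_simplex_vertices (S :: 'a::euclidean_space set)"
    and r: "\<And>s. s \<in> S \<Longrightarrow> norm (bgrad S s) * r < 1 / (real DIM('a) + 1)"
  shows "cball (\<Sum>v\<in>S. (1 / (real DIM('a) + 1)) *\<^sub>R v) r \<subseteq> interior (convex hull S)"
proof
  let ?c = "\<Sum>v\<in>S. (1 / (real DIM('a) + 1)) *\<^sub>R v"
  fix x assume x: "x \<in> cball ?c r"
  show "x \<in> interior (convex hull S)"
    unfolding in_interior_simplex_iff[OF S]
  proof
    fix s assume s: "s \<in> S"
    have "\<bar>bgrad S s \<bullet> (x - ?c)\<bar> \<le> norm (bgrad S s) * norm (x - ?c)" by (rule Cauchy_Schwarz_ineq2)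
    also have "\<dots> \<le> norm (bgrad S s) * r"
      using x by (intro mult_left_mono) (auto simp: dist_norm norm_minus_commute)
    finally show "0 < bcoord S s x"
      using r[OF s] bcoord_affine[of S s x ?c] barycenter_coord[OF S s] by linarith
  qed
qed

lemma simplex_interior_nonempty:
  assumes S: "is_simplex_vertices (S :: 'a::euclidean_space set)"
  shows "interior (convex hull S) \<noteq> {}"
  using simplex_ball_interior[OF S, of 0] by auto

lemma negligible_frontier_simplex: "negligible (frontier (convex hull S))"
  by (rule negligible_convex_frontier) simp

lemma measure_interior_simplex:
  "is_simplex_vertices S \<Longrightarrow> measure lebesgue (interior (convex hull S)) = measure lebesgue (convex hull S)"
  by (intro measure_interior compact_imp_bounded compact_simplex negligible_frontier_simplex)

lemma simplex_measure_pos: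
  assumes S: "is_simplex_vertices (S :: 'a::euclidean_space set)"
  shows "0 < measure lebesgue (convex hull S)"
proof -
  have "\<not> negligible (convex hull S)"
    using simplex_interior_nonempty[OF S] by (simp add: negligible_convex_interior)
  then show ?thesis
    using lmeasurable_simplex[OF S] by (simp add: negligible_iff_measure zero_less_measure_iff)
qed

lemma simplex_dist_le_diameter:
  assumes "is_simplex_vertices S" "x \<in> convex hull S" "y \<in> convex hull S"
  shows "norm (x - y) \<le> diameter (convex hull S)"
  using diameter_bounded_bound[OF compact_imp_bounded[OF compact_simplex[OF assms(1)]] assms(2,3)]
  by (simp add: dist_norm)

lemma simplex_diameter_pos:
  assumes S: "is_simplex_vertices (S :: 'a::euclidean_space set)"
  shows "0 < diameter (convex hull S)"
proof -
  obtain s where s: "s \<in> S" using simplex_verticesD(4)[OF S] by blast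
  obtain t where t: "t \<in> S" "t \<noteq> s" using simplex_other_vertex[OF S] by blast
  have "0 < norm (s - t)" using t(2) by simp
  also have "\<dots> \<le> diameter (convex hull S)"
    using s t by (intro simplex_dist_le_diameter[OF S] hull_inc)
  finally show ?thesis .
qed

text \<open>The volume argument behind both shape regularity bounds: that for the coordinate
  gradients and that for the number of cells at a vertex.\<close>

lemma packing_card_le:
  fixes A :: "'i \<Rightarrow> 'a::euclidean_space set"
  assumes "finite I" "\<And>i. i \<in> I \<Longrightarrow> A i \<in> lmeasurable" "pairwise (\<lambda>i j. disjnt (A i) (A j)) I"
    and "\<And>i. i \<in> I \<Longrightarrow> A i \<subseteq> B" "B \<in> lmeasurable" "\<And>i. i \<in> I \<Longrightarrow> m \<le> measure lebesgue (A i)"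
  shows "real (card I) * m \<le> measure lebesgue B"
proof -
  have "real (card I) * m = (\<Sum>i\<in>I. m)" by simp
  also have "\<dots> \<le> (\<Sum>i\<in>I. measure lebesgue (A i))" by (rule sum_mono) (rule assms(6))
  also have "\<dots> = measure lebesgue (\<Union>i\<in>I. A i)" using measure_UNION'[OF assms(1,2,3)] by simp
  also have "\<dots> \<le> measure lebesgue B"
  proof (rule measure_mono_fmeasurable)
    show "(\<Union>i\<in>I. A i) \<in> sets lebesgue"
      using assms(1,2) by (intro sets.finite_UN) (auto dest: fmeasurableD)
  qed (use assms(4,5) in auto)
  finally show ?thesis .
qed

lemma measure_lebesgue_cball:
  "0 \<le> r \<Longrightarrow> measure lebesgue (cball (c::'a::euclidean_space) r) = unit_ball_vol (real DIM('a)) * r ^ DIM('a)"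
  by (simp add: content_cball)

text \<open>Shifting the simplex in the direction of \<open>bgrad S s\<close> by multiples of its height over the
  facet opposite to \<open>s\<close> gives disjoint copies inside a ball of radius twice the diameter.\<close>
lemma bgrad_bound:
  fixes S :: "'a::euclidean_space set"
  defines "h \<equiv> diameter (convex hull S)"
  assumes S: "is_simplex_vertices S" and s: "s \<in> S"
    and shape: "h ^ DIM('a) \<le> \<kappa> * measure lebesgue (convex hull S)"
  shows "norm (bgrad S s) * h \<le> unit_ball_vol (real DIM('a)) * 2 ^ DIM('a) * \<kappa>"
proof -
  let ?g = "bgrad S s" and ?V = "measure lebesgue (convex hull S)" and ?I = "interior (convex hull S)"
  have g: "0 < norm ?g" using bgrad_nonzero[OF S s] by simp
  have h: "0 < h" unfolding h_def by (rule simplex_diameter_pos[OF S])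
  \<comment> \<open>Translation by e raises the coordinate of s by exactly 1; its length 1 / norm g
    is the height of the simplex over the facet opposite to s.\<close>
  define e where "e = inverse ((norm ?g)\<^sup>2) *\<^sub>R ?g"
  have ge: "?g \<bullet> e = 1" using g by (simp add: e_def dot_square_norm)
  have ne: "norm e = inverse (norm ?g)" using g by (simp add: e_def power2_eq_square)
  \<comment> \<open>For k < m the shift by k e has length at most h, so the m copies stay near s,
    while any bound for m also bounds the product of gradient and diameter.\<close>
  define m where "m = nat \<lceil>norm ?g * h\<rceil>"
  have m: "norm ?g * h \<le> real m" unfolding m_def by linarith
  have strip: "0 < bcoord S s x \<and> bcoord S s x < 1" if "x \<in> ?I" for x
  proof -
    have pos: "\<forall>t\<in>S. 0 < bcoord S t x" using that in_interior_simplex_iff[OF S] by blast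
    obtain t where t: "t \<in> S" "t \<noteq> s" using simplex_other_vertex[OF S] by blast
    have "(\<Sum>t\<in>S. bcoord S t x) = bcoord S s x + (\<Sum>t\<in>S - {s}. bcoord S t x)"
      using simplex_verticesD(1)[OF S] s by (rule sum.remove)
    moreover have "0 < (\<Sum>t\<in>S - {s}. bcoord S t x)"
      using t pos simplex_verticesD(1)[OF S] by (intro sum_pos) auto
    ultimately show ?thesis using pos s bcoord_representation(1)[OF S, of x] by auto
  qed
  have "real (card {..<m}) * ?V \<le> measure lebesgue (cball s (2 * h))"
  proof (rule packing_card_le[where A="\<lambda>k. (+) (real k *\<^sub>R e) ` ?I"])
    show "(+) (real k *\<^sub>R e) ` ?I \<in> lmeasurable" for k
      using lmeasurable_simplex[OF S] by (intro measurable_translation lmeasurable_interior compact_imp_bounded compact_simplex S)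
    show "?V \<le> measure lebesgue ((+) (real k *\<^sub>R e) ` ?I)" for k
      by (simp add: measure_translation measure_interior_simplex[OF S])
    have strip_k: "real k < bcoord S s y \<and> bcoord S s y < real k + 1"
      if y: "y \<in> (+) (real k *\<^sub>R e) ` ?I" for k y
    proof -
      obtain x where x: "x \<in> ?I" "y = real k *\<^sub>R e + x" using y by blast
      have "bcoord S s y = bcoord S s x + real k" using bcoord_affine[of S s y x] x(2) ge by simp
      then show ?thesis using strip[OF x(1)] by simp
    qed
    show "pairwise (\<lambda>i j. disjnt ((+) (real i *\<^sub>R e) ` ?I) ((+) (real j *\<^sub>R e) ` ?I)) {..<m}"
      unfolding pairwise_def disjnt_iff
    proof safe
      fix i j :: nat and x y z assume ij: "i \<noteq> j" "x \<in> ?I" "y \<in> ?I" "real i *\<^sub>R e + x = real j *\<^sub>R e + y"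
      have "real i < real j + 1" "real j < real i + 1"
        using strip_k[of "real i *\<^sub>R e + x" i] strip_k[of "real i *\<^sub>R e + x" j] ij(2,3,4) by (force+)
      then show False using ij(1) by linarith
    qed
    show "(+) (real k *\<^sub>R e) ` ?I \<subseteq> cball s (2 * h)" if "k \<in> {..<m}" for k
    proof safe
      fix x assume "x \<in> ?I"
      then have "norm (x - s) \<le> h"
        unfolding h_def using interior_subset s by (intro simplex_dist_le_diameter[OF S]) (auto intro: hull_inc)
      moreover have "real k < norm ?g * h" using that unfolding m_def lessThan_iff by linarith
      then have "norm (real k *\<^sub>R e) \<le> h" using g by (simp add: ne field_simps)
      ultimately have "norm (real k *\<^sub>R e + (x - s)) \<le> 2 * h"
        using norm_triangle_ineq[of "real k *\<^sub>R e" "x - s"] by linarith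
      then show "real k *\<^sub>R e + x \<in> cball s (2 * h)"
        by (simp add: dist_norm norm_minus_commute[of s] add_diff_eq)
    qed
  qed auto
  then have "real m * ?V \<le> unit_ball_vol (real DIM('a)) * (2 * h) ^ DIM('a)"
    using h measure_lebesgue_cball[of "2 * h" s] by simp
  also have "\<dots> \<le> unit_ball_vol (real DIM('a)) * (2 ^ DIM('a) * (\<kappa> * ?V))"
    using shape by (intro mult_left_mono) (simp_all add: power_mult_distrib)
  finally have "real m * ?V \<le> (unit_ball_vol (real DIM('a)) * 2 ^ DIM('a) * \<kappa>) * ?V" by (simp add: mult_ac)
  then have "real m \<le> unit_ball_vol (real DIM('a)) * 2 ^ DIM('a) * \<kappa>"
    using simplex_measure_pos[OF S] by (simp only: mult_le_cancel_right_pos)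
  with m show ?thesis by linarith
qed

lemma simplex_measure_le:
  assumes S: "is_simplex_vertices (S :: 'a::euclidean_space set)"
  shows "measure lebesgue (convex hull S) \<le> unit_ball_vol (real DIM('a)) * diameter (convex hull S) ^ DIM('a)"
proof -
  obtain s where s: "s \<in> S" using simplex_verticesD(4)[OF S] by blast
  have "measure lebesgue (convex hull S) \<le> measure lebesgue (cball s (diameter (convex hull S)))"
  proof (rule measure_mono_fmeasurable)
    show "convex hull S \<subseteq> cball s (diameter (convex hull S))"
      using simplex_dist_le_diameter[OF S hull_inc[OF s]] by (auto simp: dist_norm)
  qed (use lmeasurable_simplex[OF S] in \<open>auto dest: fmeasurableD\<close>)
  then show ?thesis
    using measure_lebesgue_cball[OF less_imp_le[OF simplex_diameter_pos[OF S]], of s] by linarith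
qed

section \<open>Linear changes of variables\<close>

lemma Basis_cart: "(Basis :: (real ^ 'n) set) = range (\<lambda>i. axis i 1)"
  by (auto simp: Basis_vec_def)

lemma prod_Basis_cart: "(\<Prod>b\<in>Basis. (v :: real ^ 'n) \<bullet> b) = (\<Prod>i\<in>UNIV. v $ i)"
proof -
  have "inj (\<lambda>i. axis i 1 :: real ^ 'n)" by (auto simp: inj_def axis_eq_axis)
  then show ?thesis unfolding Basis_cart by (simp add: prod.reindex inner_axis)
qed

text \<open>Enumerating \<open>Basis\<close> by the index type carries Lebesgue measure and boxes to
  \<open>real ^ 'n\<close>, where linear images multiply volumes by a determinant.\<close>

lemma euclidean_cart_isomorphism:
  assumes "DIM('a::euclidean_space) = CARD('n::finite)"
  shows "\<exists>(\<phi> :: 'a \<Rightarrow> real ^ 'n) \<psi>. linear \<phi> \<and> linear \<psi> \<and> (\<forall>x. \<psi> (\<phi> x) = x) \<and> (\<forall>y. \<phi> (\<psi> y) = y) \<and>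
    distr lborel borel \<psi> = lborel \<and> (\<forall>l u. \<phi> ` box l u = box (\<phi> l) (\<phi> u)) \<and>
    (\<forall>l u. (\<forall>b\<in>Basis. l \<bullet> b \<le> u \<bullet> b) \<longrightarrow>
      measure lborel (box (\<phi> l) (\<phi> u)) = (\<Prod>b\<in>Basis. (u - l) \<bullet> b))"
proof -
  obtain b where b: "bij_betw b (UNIV :: 'n set) (Basis :: 'a set)"
    using finite_same_card_bij[of "UNIV :: 'n set" "Basis :: 'a set"] assms by auto
  then have bB: "b i \<in> Basis" and rb: "range b = Basis" and inj: "inj b" for i
    by (auto simp: bij_betw_def)
  define \<phi> :: "'a \<Rightarrow> real ^ 'n" where "\<phi> x = (\<chi> i. x \<bullet> b i)" for x
  define \<psi> :: "real ^ 'n \<Rightarrow> 'a" where "\<psi> y = (\<Sum>i\<in>UNIV. (y $ i) *\<^sub>R b i)" for y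
  have l\<phi>: "linear \<phi>" unfolding \<phi>_def by (rule linearI) (auto simp: vec_eq_iff inner_add_left)
  have l\<psi>: "linear \<psi>" unfolding \<psi>_def
    by (rule linearI) (auto simp: scaleR_add_left sum.distrib scaleR_sum_right)
  have \<psi>b: "\<psi> y \<bullet> b j = y $ j" for y j
  proof -
    have "\<psi> y \<bullet> b j = (\<Sum>i\<in>UNIV. y $ i * (b i \<bullet> b j))" unfolding \<psi>_def by (simp add: inner_sum_left)
    also have "\<dots> = (\<Sum>i\<in>UNIV. if i = j then y $ i else 0)"
      using bB inj by (intro sum.cong) (auto simp: inner_Basis inj_eq)
    finally show ?thesis by simp
  qed
  have \<phi>\<psi>: "\<phi> (\<psi> y) = y" for y by (simp add: \<phi>_def \<psi>b vec_eq_iff)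
  have \<psi>\<phi>: "\<psi> (\<phi> x) = x" for x
  proof (rule euclidean_eqI)
    fix e :: 'a assume "e \<in> Basis"
    then obtain j where "e = b j" using rb by blast
    then show "\<psi> (\<phi> x) \<bullet> e = x \<bullet> e" by (simp add: \<psi>b) (simp add: \<phi>_def)
  qed
  have box: "\<phi> ` box l u = box (\<phi> l) (\<phi> u)" for l u
  proof -
    have mem: "\<phi> x \<in> box (\<phi> l) (\<phi> u) \<longleftrightarrow> x \<in> box l u" for x
      unfolding mem_box_cart mem_box rb[symmetric] by (simp add: \<phi>_def)
    show ?thesis
    proof
      show "box (\<phi> l) (\<phi> u) \<subseteq> \<phi> ` box l u"
      proof
        fix y assume "y \<in> box (\<phi> l) (\<phi> u)"
        then have "\<psi> y \<in> box l u" using mem[of "\<psi> y"] \<phi>\<psi> by simp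
        then show "y \<in> \<phi> ` box l u" using \<phi>\<psi>[of y] by (metis imageI)
      qed
    qed (use mem in blast)
  qed
  have prod: "(\<Prod>e\<in>Basis. (u - l) \<bullet> e) = (\<Prod>i\<in>UNIV. (\<phi> u - \<phi> l) $ i)" for u l
    unfolding rb[symmetric] by (simp add: prod.reindex[OF inj] \<phi>_def inner_diff_left)
  have vol: "measure lborel (box (\<phi> l) (\<phi> u)) = (\<Prod>e\<in>Basis. (u - l) \<bullet> e)" if "\<forall>e\<in>Basis. l \<bullet> e \<le> u \<bullet> e" for l u
  proof -
    have "\<forall>e\<in>Basis. \<phi> l \<bullet> e \<le> \<phi> u \<bullet> e" using that bB unfolding Basis_cart by (auto simp: \<phi>_def inner_axis)
    then show ?thesis unfolding prod prod_Basis_cart[symmetric] by (simp add: measure_lborel_box)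
  qed
  have m: "\<psi> \<in> borel \<rightarrow>\<^sub>M borel"
    by (intro borel_measurable_continuous_onI linear_continuous_on linear_conv_bounded_linear[THEN iffD1] l\<psi>)
  have "lborel = distr lborel borel \<psi>"
  proof (rule lborel_eqI)
    fix l u :: 'a assume le: "\<And>e. e \<in> Basis \<Longrightarrow> l \<bullet> e \<le> u \<bullet> e"
    have "\<psi> -` box l u = box (\<phi> l) (\<phi> u)"
    proof -
      have "\<psi> y \<in> box l u \<longleftrightarrow> y \<in> \<phi> ` box l u" for y
        using \<phi>\<psi>[of y] \<psi>\<phi> by (metis image_iff)
      then show ?thesis unfolding box[symmetric] by blast
    qed
    then show "emeasure (distr lborel borel \<psi>) (box l u) = ennreal (\<Prod>e\<in>Basis. (u - l) \<bullet> e)"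
    proof -
      have "emeasure lborel (box (\<phi> l) (\<phi> u)) = ennreal (measure lborel (box (\<phi> l) (\<phi> u)))"
        by (rule emeasure_eq_ennreal_measure) (use emeasure_lborel_box_finite[of "\<phi> l" "\<phi> u"] in simp)
      then show ?thesis
        using m vol[of l u] le \<open>\<psi> -` box l u = box (\<phi> l) (\<phi> u)\<close> by (simp add: emeasure_distr)
    qed
  qed simp
  then show ?thesis using l\<phi> l\<psi> \<psi>\<phi> \<phi>\<psi> box vol by (intro exI[of _ \<phi>] exI[of _ \<psi>]) auto
qed

text \<open>The preimage of a box under T is its image under the inverse U, so the push-forward of
  Lebesgue measure multiplies boxes by the absolute determinant c of U in coordinates; the density
  is the reciprocal of c.\<close>

lemma lborel_linear_bijection:
  fixes T U :: "'a::euclidean_space \<Rightarrow> 'a"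
  assumes dim: "DIM('a) = CARD('n::{finite,wellorder})"
    and T: "linear T" and U: "linear U" "\<And>x. U (T x) = x" "\<And>x. T (U x) = x"
  shows "\<exists>k>0. lborel = density (distr lborel borel T) (\<lambda>_. ennreal k)"
proof -
  obtain \<phi> :: "'a \<Rightarrow> (real, 'n) vec" and \<psi> where iso: "linear \<phi>" "linear \<psi>" "\<And>x. \<psi> (\<phi> x) = x" "\<And>y. \<phi> (\<psi> y) = y"
    "distr lborel borel \<psi> = lborel" "\<And>l u. \<phi> ` box l u = box (\<phi> l) (\<phi> u)"
    "\<And>l u. (\<forall>b\<in>Basis. l \<bullet> b \<le> u \<bullet> b) \<Longrightarrow> measure lborel (box (\<phi> l) (\<phi> u)) = (\<Prod>b\<in>Basis. (u - l) \<bullet> b)"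
    using euclidean_cart_isomorphism[OF dim] by metis
  define g where "g = \<phi> \<circ> U \<circ> \<psi>"
  have lg: "linear g" unfolding g_def using iso(1,2) U(1) by (intro linear_compose)
  have inj: "inj g"
  proof (rule injI)
    fix x y assume "g x = g y"
    then have "\<psi> (g x) = \<psi> (g y)" by simp
    then have "U (\<psi> x) = U (\<psi> y)" by (simp add: g_def iso(3))
    then have "T (U (\<psi> x)) = T (U (\<psi> y))" by simp
    then have "\<phi> (\<psi> x) = \<phi> (\<psi> y)" by (simp add: U(3))
    then show "x = y" by (simp add: iso(4))
  qed
  define c where "c = \<bar>det (matrix g)\<bar>"
  have c: "c > 0" unfolding c_def using det_nz_iff_inj[OF lg] inj by simp
  have mT: "T \<in> borel \<rightarrow>\<^sub>M borel" and m\<psi>: "\<psi> \<in> borel \<rightarrow>\<^sub>M borel"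
    using T iso(2) by (auto intro!: borel_measurable_continuous_onI linear_continuous_on simp: linear_conv_bounded_linear)
  have pre: "emeasure lborel (T -` box l u) = ennreal (c * (\<Prod>b\<in>Basis. (u - l) \<bullet> b))"
    if le: "\<forall>b\<in>Basis. l \<bullet> b \<le> u \<bullet> b" for l u
  proof -
    have mb: "T -` box l u \<in> sets borel" using measurable_sets[OF mT, of "box l u"] by simp
    have "emeasure lborel (T -` box l u) = emeasure (distr lborel borel \<psi>) (T -` box l u)" unfolding iso(5) ..
    also have "\<dots> = emeasure lborel (\<psi> -` (T -` box l u))"
      using m\<psi> mb by (simp add: emeasure_distr)
    also have "\<psi> -` (T -` box l u) = g ` box (\<phi> l) (\<phi> u)"
    proof -
      have "y \<in> g ` (\<phi> ` box l u) \<longleftrightarrow> T (\<psi> y) \<in> box l u" for y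
      proof
        assume "y \<in> g ` (\<phi> ` box l u)"
        then obtain x where "x \<in> box l u" "y = \<phi> (U (\<psi> (\<phi> x)))" by (auto simp: g_def)
        then show "T (\<psi> y) \<in> box l u" by (simp add: iso(3) U(3))
      next
        assume a: "T (\<psi> y) \<in> box l u"
        have "y = g (\<phi> (T (\<psi> y)))" by (simp add: g_def iso(3,4) U(2))
        then show "y \<in> g ` (\<phi> ` box l u)" using a by blast
      qed
      then show ?thesis unfolding iso(6)[symmetric] by blast
    qed
    finally have e: "emeasure lborel (T -` box l u) = emeasure lborel (g ` box (\<phi> l) (\<phi> u))" .
    have lm: "g ` box (\<phi> l) (\<phi> u) \<in> lmeasurable"
      by (rule measurable_linear_image[OF lg]) (simp add: lmeasurable_box)
    have "measure lebesgue (g ` box (\<phi> l) (\<phi> u)) = c * measure lebesgue (box (\<phi> l) (\<phi> u))"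
      unfolding c_def by (rule measure_linear_image[OF lg]) (simp add: lmeasurable_box)
    also have "measure lebesgue (box (\<phi> l) (\<phi> u)) = (\<Prod>b\<in>Basis. (u - l) \<bullet> b)" using iso(7)[OF le] by simp
    finally have "measure lebesgue (g ` box (\<phi> l) (\<phi> u)) = c * (\<Prod>b\<in>Basis. (u - l) \<bullet> b)" .
    then have em: "emeasure lebesgue (g ` box (\<phi> l) (\<phi> u)) = ennreal (c * (\<Prod>b\<in>Basis. (u - l) \<bullet> b))"
      using lm by (simp add: emeasure_eq_measure2)
    have "\<psi> -` (T -` box l u) \<in> sets borel" using measurable_sets[OF m\<psi>, of "T -` box l u"] mb by simp
    then have "g ` box (\<phi> l) (\<phi> u) \<in> sets lborel"
      unfolding \<open>\<psi> -` (T -` box l u) = g ` box (\<phi> l) (\<phi> u)\<close> by simp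
    then show ?thesis using e em by simp
  qed
  have "lborel = density (distr lborel borel T) (\<lambda>_. ennreal (inverse c))"
  proof (rule lborel_eqI)
    fix l u :: 'a assume le: "\<And>b. b \<in> Basis \<Longrightarrow> l \<bullet> b \<le> u \<bullet> b"
    have "emeasure (density (distr lborel borel T) (\<lambda>_. ennreal (inverse c))) (box l u)
        = ennreal (inverse c) * emeasure lborel (T -` box l u)"
      using mT by (simp add: emeasure_density nn_integral_cmult emeasure_distr)
    also have "\<dots> = ennreal (inverse c * (c * (\<Prod>b\<in>Basis. (u - l) \<bullet> b)))"
      using pre[of l u] le c by (simp add: ennreal_mult'[symmetric])
    also have "\<dots> = ennreal (\<Prod>b\<in>Basis. (u - l) \<bullet> b)" using c by (simp add: field_simps)
    finally show "emeasure (density (distr lborel borel T) (\<lambda>_. ennreal (inverse c))) (box l u)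
        = ennreal (\<Prod>b\<in>Basis. (u - l) \<bullet> b)" .
  qed simp
  then show ?thesis using c by (intro exI[of _ "inverse c"]) auto
qed

text \<open>The scaling factor may stay anonymous, since later it multiplies an integral and a
  volume alike and cancels. The case distinction on the dimension selects \<open>2\<close> or
  \<open>3\<close> as index type for the coordinates.\<close>

lemma lborel_affine_bijection:
  fixes T U :: "'a::euclidean_space \<Rightarrow> 'a"
  assumes dim: "DIM('a) = 2 \<or> DIM('a) = 3"
    and T: "linear T" and U: "linear U" "\<And>x. U (T x) = x" "\<And>x. T (U x) = x"
  shows "\<exists>k>0. \<forall>f :: 'a \<Rightarrow> real. f \<in> borel_measurable borel \<longrightarrow>
    (\<integral>x. f x \<partial>lborel) = k * (\<integral>x. f (T x + a) \<partial>lborel)"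
proof -
  obtain k where k: "k > 0" "lborel = density (distr lborel borel T) (\<lambda>_. ennreal k)"
    using dim
  proof
    assume "DIM('a) = 2"
    then show ?thesis using lborel_linear_bijection[where 'n=2, OF _ T U] that by auto
  next
    assume "DIM('a) = 3"
    then show ?thesis using lborel_linear_bijection[where 'n=3, OF _ T U] that by auto
  qed
  have mT: "T \<in> borel \<rightarrow>\<^sub>M borel"
    using T by (auto intro!: borel_measurable_continuous_onI linear_continuous_on simp: linear_conv_bounded_linear)
  have "(\<integral>x. f x \<partial>lborel) = k * (\<integral>x. f (T x + a) \<partial>lborel)" if f: "f \<in> borel_measurable borel" for f :: "'a \<Rightarrow> real"
  proof -
    have fa: "(\<lambda>x. f (x + a)) \<in> borel_measurable borel" using f by measurable
    have "(\<integral>x. f x \<partial>lborel) = (\<integral>x. f (x + a) \<partial>lborel)" by (rule lborel_integral_translation[OF f, symmetric])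
    also have "\<dots> = (\<integral>x. f (x + a) \<partial>density (distr lborel borel T) (\<lambda>_. ennreal k))"
      using k(2) by simp
    also have "\<dots> = (\<integral>x. k *\<^sub>R f (x + a) \<partial>distr lborel borel T)"
      using fa k(1) by (intro integral_density) auto
    also have "\<dots> = (\<integral>x. k *\<^sub>R f (T x + a) \<partial>lborel)"
      using fa mT by (intro integral_distr) auto
    finally show ?thesis by simp
  qed
  then show ?thesis using k(1) by blast
qed

section \<open>Facet means and radial fields\<close>

text \<open>\<open>facet_mean S s \<psi> D\<close> is the mean of \<open>\<psi>\<close> over the facet opposite to \<open>s\<close>, written as a volume integral
  by means of the divergence theorem for the radial field \<open>x - s\<close>.\<close>
definition facet_mean :: "'a::euclidean_space set \<Rightarrow> 'a \<Rightarrow> ('a \<Rightarrow> real) \<Rightarrow> ('a \<Rightarrow> 'a) \<Rightarrow> real" where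
  "facet_mean S s \<psi> D = (LINT x:(convex hull S)|lborel. real DIM('a) * \<psi> x + (x - s) \<bullet> D x)
    / (real DIM('a) * measure lebesgue (convex hull S))"

lemma set_integrable_compact:
  fixes f :: "'a::euclidean_space \<Rightarrow> 'b::euclidean_space"
  assumes "compact K" "continuous_on K f"
  shows "set_integrable lborel K f"
  unfolding set_integrable_def by (rule borel_integrable_compact[OF assms])

lemma Bernoulli_complement:
  assumes "0 \<le> t" "t \<le> (1::real)"
  shows "1 - t ^ n \<le> real n * (1 - t)"
  using Bernoulli_inequality[of "t - 1" n] assms by (simp add: algebra_simps)

lemma LINT_scale:
  fixes \<psi> :: "'a::euclidean_space \<Rightarrow> real"
  assumes "0 < t" "compact K" "continuous_on UNIV \<psi>"
  shows "(LINT x:K|lborel. t ^ DIM('a) * \<psi> (s + t *\<^sub>R (x - s)))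
    = (LINT x:((\<lambda>x. s + t *\<^sub>R (x - s)) ` K)|lborel. \<psi> x)"
proof -
  let ?T = "\<lambda>x. (s - t *\<^sub>R s) + t *\<^sub>R x" and ?K = "(\<lambda>x. s + t *\<^sub>R (x - s)) ` K"
  have T: "?T x = s + t *\<^sub>R (x - s)" for x by (simp add: algebra_simps)
  have "compact ?K" by (intro compact_continuous_image continuous_intros assms)
  then have K: "?K \<in> sets borel" by (simp add: borel_compact)
  have \<psi>m: "\<psi> \<in> borel_measurable borel" by (rule borel_measurable_continuous_onI[OF assms(3)])
  have f: "(\<lambda>x. indicator ?K x * \<psi> x) \<in> borel_measurable borel"
    using K \<psi>m by (intro borel_measurable_times borel_measurable_indicator) auto
  have mem: "s + t *\<^sub>R (x - s) \<in> ?K \<longleftrightarrow> x \<in> K" for x using assms(1) by (auto simp: image_iff)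
  have "(LINT x:?K|lborel. \<psi> x) = (\<integral>x. indicator ?K x * \<psi> x \<partial>density (distr lborel borel ?T) (\<lambda>_. \<bar>t\<bar> ^ DIM('a)))"
    unfolding set_lebesgue_integral_def using lborel_affine[of t "s - t *\<^sub>R s"] assms(1) by simp
  also have "\<dots> = (\<integral>x. (t ^ DIM('a)) *\<^sub>R (indicator ?K x * \<psi> x) \<partial>distr lborel borel ?T)"
    using f assms(1) by (subst integral_density) (auto simp: ennreal_power[symmetric])
  also have "\<dots> = (\<integral>x. (t ^ DIM('a)) *\<^sub>R (indicator ?K (?T x) * \<psi> (?T x)) \<partial>lborel)"
    using f by (intro integral_distr) auto
  also have "\<dots> = (LINT x:K|lborel. t ^ DIM('a) * \<psi> (s + t *\<^sub>R (x - s)))"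
    unfolding set_lebesgue_integral_def T
    by (intro Bochner_Integration.integral_cong) (auto simp: indicator_def mem)
  finally show ?thesis by simp
qed

text \<open>The integrand is the derivative at t = 1 of t ^ DIM times \<psi> (s + t (x - s)). By
  scaling, the integral of its difference quotient is the integral of \<psi> over the shell between
  the simplex and its shrunken copy, divided by 1 - t. In the shell \<psi> is of order 1 - t because
  it vanishes on the facet, and so is the volume; the quotient tends to 0.\<close>

lemma facet_integral_eq_0:
  fixes S :: "'a::euclidean_space set"
  assumes S: "is_simplex_vertices S" and s: "s \<in> S"
    and der: "\<And>x. (\<psi> has_derivative (\<lambda>h. D x \<bullet> h)) (at x)" and D: "continuous_on UNIV D"
    and zero: "\<And>x. x \<in> convex hull (S - {s}) \<Longrightarrow> \<psi> x = 0"
  shows "(LINT x:(convex hull S)|lborel. real DIM('a) * \<psi> x + (x - s) \<bullet> D x) = 0"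
proof -
  let ?n = "DIM('a)" and ?K = "convex hull S" and ?V = "measure lborel (convex hull S)"
  define h where "h = diameter ?K"
  have K: "compact ?K" by (rule compact_simplex[OF S])
  have Kb: "?K \<in> sets borel" using K by (simp add: borel_compact)
  have sK: "s \<in> ?K" using s by (rule hull_inc)
  have \<psi>: "continuous_on UNIV \<psi>"
    using der by (auto intro!: continuous_at_imp_continuous_on has_derivative_continuous)
  have "bounded (D ` ?K)" "bounded (\<psi> ` ?K)"
    by (intro compact_imp_bounded compact_continuous_image K continuous_on_subset[OF D] continuous_on_subset[OF \<psi>], simp)+
  then obtain L M where L: "L > 0" "\<And>x. x \<in> ?K \<Longrightarrow> norm (D x) \<le> L"
    and M: "M > 0" "\<And>x. x \<in> ?K \<Longrightarrow> \<bar>\<psi> x\<bar> \<le> M" by (auto simp: bounded_pos)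
  have lip: "\<bar>\<psi> x - \<psi> y\<bar> \<le> L * norm (x - y)" if "x \<in> ?K" "y \<in> ?K" for x y
  proof -
    have "norm (\<psi> x - \<psi> y) \<le> L * norm (x - y)"
    proof (rule differentiable_bound[of ?K \<psi> "\<lambda>x h. D x \<bullet> h"])
      show "onorm (\<lambda>h. D z \<bullet> h) \<le> L" if "z \<in> ?K" for z
      proof (rule onorm_le)
        show "norm (D z \<bullet> h) \<le> L * norm h" for h
          using Cauchy_Schwarz_ineq2[of "D z" h] mult_right_mono[OF L(2)[OF that] norm_ge_zero[of h]] by simp
      qed
    qed (use that has_derivative_at_withinI[OF der] in auto)
    then show ?thesis by simp
  qed
  \<comment> \<open>Project x from s onto the opposite facet. The image y has \<psi> y = 0, and x
    differs from it by the coordinate of s times s - y.\<close>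
  have near: "\<bar>\<psi> x\<bar> \<le> L * h * bcoord S s x" if x: "x \<in> ?K" "bcoord S s x < 1" for x
  proof -
    let ?l = "bcoord S s x"
    have l: "0 \<le> ?l" using x(1) s in_simplex_iff[OF S] by blast
    define y where "y = s + (1 / (1 - ?l)) *\<^sub>R (x - s)"
    have cy: "bcoord S t y = bcoord S t s + (1 / (1 - ?l)) * (bcoord S t x - bcoord S t s)" for t
      unfolding bcoord_affine[of S t y s] bcoord_affine[of S t x s] by (simp add: y_def)
    have "y \<in> convex hull (S - {s})"
      unfolding in_face_iff[OF S Diff_subset]
    proof (intro conjI ballI)
      fix t assume t: "t \<in> S"
      show "0 \<le> bcoord S t y"
      proof (cases "t = s")
        case True
        then show ?thesis using cy[of s] bcoord_vertex[OF S s s] x(2) by (simp add: divide_simps)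
      next
        case False
        then have "bcoord S t s = 0" using bcoord_vertex[OF S t s] by simp
        then show ?thesis using cy[of t] x in_simplex_iff[OF S] t by simp
      qed
    next
      fix t assume "t \<in> S - (S - {s})"
      then have "t = s" by blast
      then show "bcoord S t y = 0" using cy[of s] bcoord_vertex[OF S s s] x(2) by (simp add: divide_simps)
    qed
    then have y: "\<psi> y = 0" "y \<in> ?K" using zero hull_mono[of "S - {s}" S convex] by auto
    have "x - y = ?l *\<^sub>R (s - y)"
    proof -
      have "(1 - ?l) *\<^sub>R (y - s) = x - s" using x(2) by (simp add: y_def)
      then show ?thesis by (simp add: algebra_simps)
    qed
    then have "norm (x - y) \<le> ?l * h"
      using l simplex_dist_le_diameter[OF S sK y(2)] by (simp add: h_def mult_left_mono)
    then have "L * norm (x - y) \<le> L * (?l * h)" using L(1) by (intro mult_left_mono) auto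
    then show ?thesis using lip[OF x(1) y(2)] y(1) by (simp add: mult_ac)
  qed
  have h: "h > 0" unfolding h_def by (rule simplex_diameter_pos[OF S])
  \<comment> \<open>Two successors rather than one, so that already t 0 = 1/2 is positive.\<close>
  define t where "t k = 1 - inverse (real (Suc (Suc k)))" for k
  have t: "0 < t k" "t k < 1" for k by (auto simp: t_def field_simps)
  have t1: "t \<longlonglongrightarrow> 1"
    unfolding t_def[abs_def] using tendsto_diff[OF tendsto_const LIMSEQ_Suc[OF LIMSEQ_inverse_real_of_nat], of 1] by simp
  let ?P = "\<lambda>k x. s + t k *\<^sub>R (x - s)"
  have PK: "?P k x \<in> ?K" if "x \<in> ?K" for k x
  proof -
    have "?P k x = (1 - t k) *\<^sub>R s + t k *\<^sub>R x" by (simp add: algebra_simps)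
    also have "\<dots> \<in> ?K" using that sK t[of k] by (intro convexD convex_convex_hull) auto
    finally show ?thesis .
  qed
  define F where "F k x = (\<psi> x - t k ^ ?n * \<psi> (?P k x)) / (1 - t k)" for k x
  let ?G = "\<lambda>x. real ?n * \<psi> x + (x - s) \<bullet> D x"
  have cP: "continuous_on A (\<lambda>x. \<psi> (?P k x))" for A k
    by (rule continuous_on_compose2[OF \<psi>]) (auto intro!: continuous_intros)
  have lim: "(\<lambda>k. LINT x:?K|lborel. F k x) \<longlonglongrightarrow> (LINT x:?K|lborel. ?G x)"
    unfolding set_lebesgue_integral_def
  proof (rule integral_dominated_convergence)
    show "integrable lborel (\<lambda>x. (L * h + real ?n * M) * indicator ?K x :: real)"
      by (rule integrable_mult_right, rule integrable_real_indicator)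
        (use K in \<open>auto simp: borel_compact emeasure_compact_finite[unfolded infinity_ennreal_def]\<close>)
    have "F k \<in> borel_measurable borel" for k
      unfolding F_def[abs_def] using t(2)[of k]
      by (intro borel_measurable_continuous_onI continuous_intros \<psi> cP) auto
    then show "(\<lambda>x. indicator ?K x *\<^sub>R F k x) \<in> borel_measurable lborel" for k
      using Kb by (intro borel_measurable_scaleR borel_measurable_indicator) auto
    have "?G \<in> borel_measurable borel"
      by (intro borel_measurable_continuous_onI continuous_intros \<psi> D)
    then show "(\<lambda>x. indicator ?K x *\<^sub>R ?G x) \<in> borel_measurable lborel"
      using Kb by (intro borel_measurable_scaleR borel_measurable_indicator) auto
    show "AE x in lborel. norm (indicator ?K x *\<^sub>R F k x) \<le> (L * h + real ?n * M) * indicator ?K x" for k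
    proof (rule AE_I2)
      fix x
      show "norm (indicator ?K x *\<^sub>R F k x) \<le> (L * h + real ?n * M) * indicator ?K x"
      proof (cases "x \<in> ?K")
        case True
        have "\<bar>\<psi> x - \<psi> (?P k x)\<bar> \<le> L * norm (x - ?P k x)" by (rule lip[OF True PK[OF True]])
        also have "x - ?P k x = (1 - t k) *\<^sub>R (x - s)" by (simp add: algebra_simps)
        also have "L * norm ((1 - t k) *\<^sub>R (x - s)) \<le> L * ((1 - t k) * h)"
          using L(1) t[of k] simplex_dist_le_diameter[OF S True sK] by (simp add: h_def)
        finally have 1: "\<bar>\<psi> x - \<psi> (?P k x)\<bar> \<le> L * h * (1 - t k)" by (simp add: mult_ac)
        have "0 \<le> 1 - t k ^ ?n" using t[of k] by (simp add: power_le_one)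
        moreover have "1 - t k ^ ?n \<le> real ?n * (1 - t k)" using t[of k] by (intro Bernoulli_complement) auto
        ultimately have "(1 - t k ^ ?n) * \<bar>\<psi> (?P k x)\<bar> \<le> (real ?n * (1 - t k)) * M"
          using M(2)[OF PK[OF True, of k]] t[of k] by (intro mult_mono) auto
        moreover have "\<psi> x - t k ^ ?n * \<psi> (?P k x) = (\<psi> x - \<psi> (?P k x)) + (1 - t k ^ ?n) * \<psi> (?P k x)"
          by (simp add: algebra_simps)
        moreover have "\<bar>(1 - t k ^ ?n) * \<psi> (?P k x)\<bar> = (1 - t k ^ ?n) * \<bar>\<psi> (?P k x)\<bar>"
          using \<open>0 \<le> 1 - t k ^ ?n\<close> by (simp add: abs_mult)
        ultimately have "\<bar>\<psi> x - t k ^ ?n * \<psi> (?P k x)\<bar> \<le> (L * h + real ?n * M) * (1 - t k)"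
          using 1 by (simp add: algebra_simps)
        then show ?thesis using True t[of k] by (simp add: F_def pos_divide_le_eq)
      qed simp
    qed
    show "AE x in lborel. (\<lambda>k. indicator ?K x *\<^sub>R F k x) \<longlonglongrightarrow> indicator ?K x *\<^sub>R ?G x"
    proof (rule AE_I2, rule tendsto_scaleR[OF tendsto_const])
      fix x
      let ?f = "\<lambda>\<tau>::real. \<tau> ^ ?n * \<psi> (s + \<tau> *\<^sub>R (x - s))"
      have "((\<lambda>\<tau>. \<psi> (s + \<tau> *\<^sub>R (x - s))) has_derivative (\<lambda>\<tau>. D x \<bullet> (\<tau> *\<^sub>R (x - s)))) (at 1)"
        by (rule has_derivative_compose[where g=\<psi> and f="\<lambda>\<tau>. s + \<tau> *\<^sub>R (x - s)"])
          (auto intro!: derivative_eq_intros simp: der[of x])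
      then have "((\<lambda>\<tau>. \<psi> (s + \<tau> *\<^sub>R (x - s))) has_real_derivative D x \<bullet> (x - s)) (at 1)"
        by (simp add: has_field_derivative_def mult_commute_abs)
      from DERIV_mult[OF DERIV_pow[of ?n 1] this]
      have "(?f has_real_derivative ?G x) (at 1)"
        by (simp add: inner_commute add.commute mult.commute)
      then have "((\<lambda>h. (?f (1 + h) - ?f 1) / h) \<longlongrightarrow> ?G x) (at 0)" by (simp add: DERIV_def)
      moreover have "filterlim (\<lambda>k. t k - 1) (at 0) sequentially"
        unfolding filterlim_at using t1 t(2) by (auto simp: LIM_zero intro!: always_eventually less_imp_neq)
      ultimately have "(\<lambda>k. (?f (1 + (t k - 1)) - ?f 1) / (t k - 1)) \<longlonglongrightarrow> ?G x"
        by (rule filterlim_compose)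
      moreover have "(?f (1 + (t k - 1)) - ?f 1) / (t k - 1) = F k x" for k
        using minus_divide_divide[of "\<psi> x - t k ^ ?n * \<psi> (?P k x)" "1 - t k"] by (simp add: F_def)
      ultimately show "(\<lambda>k. F k x) \<longlonglongrightarrow> ?G x" by simp
    qed
  qed
  have bound: "\<bar>LINT x:?K|lborel. F k x\<bar> \<le> L * h * (real ?n * (1 - t k) * ?V)" for k
  proof -
    let ?Kt = "?P k ` ?K"
    have Kt: "compact ?Kt" by (intro compact_continuous_image continuous_intros K)
    have KtK: "?Kt \<subseteq> ?K" using PK by blast
    have Ktb: "?Kt \<in> sets borel" using Kt by (simp add: borel_compact)
    note i\<psi> = set_integrable_compact[OF K continuous_on_subset[OF \<psi> subset_UNIV]]
      set_integrable_compact[OF Kt continuous_on_subset[OF \<psi> subset_UNIV]]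
      set_integrable_compact[OF K cP[of _ k]]
    have i1: "set_integrable lborel A (\<lambda>x. 1::real)" if "compact A" for A :: "'a set"
      by (rule set_integrable_compact[OF that]) simp
    have "(1 - t k) * (LINT x:?K|lborel. F k x) = (LINT x:?K|lborel. (1 - t k) * F k x)" by simp
    also have "\<dots> = (LINT x:?K|lborel. \<psi> x - t k ^ ?n * \<psi> (?P k x))"
      using t(2)[of k] by (simp add: F_def)
    also have "\<dots> = (LINT x:?K|lborel. \<psi> x) - (LINT x:?K|lborel. t k ^ ?n * \<psi> (?P k x))"
      by (rule set_integral_diff(2)) (use i\<psi> in auto)
    also have "(LINT x:?K|lborel. t k ^ ?n * \<psi> (?P k x)) = (LINT x:?Kt|lborel. \<psi> x)"
      by (rule LINT_scale[OF t(1) K \<psi>])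
    also have "(LINT x:?K|lborel. \<psi> x) - (LINT x:?Kt|lborel. \<psi> x)
        = (\<integral>x. (indicator ?K x - indicator ?Kt x) * \<psi> x \<partial>lborel)"
      using i\<psi>(1,2) unfolding set_lebesgue_integral_def set_integrable_def by (simp add: left_diff_distrib)
    finally have e1: "(1 - t k) * (LINT x:?K|lborel. F k x) = (\<integral>x. (indicator ?K x - indicator ?Kt x) * \<psi> x \<partial>lborel)" .
    \<comment> \<open>A point of the shell has s-coordinate below 1 - t: otherwise stretching it
      away from s by 1 / t would stay in the simplex, and the point would lie in the shrunken
      copy.\<close>
    have pt: "\<bar>(indicator ?K x - indicator ?Kt x) * \<psi> x\<bar> \<le> L * h * (1 - t k) * (indicator ?K x - indicator ?Kt x)" for x
    proof (cases "x \<in> ?K - ?Kt")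
      case True
      have "bcoord S s x < 1 - t k"
      proof (rule ccontr)
        assume "\<not> bcoord S s x < 1 - t k"
        then have b: "1 - t k \<le> bcoord S s x" by simp
        let ?z = "s + (1 / t k) *\<^sub>R (x - s)"
        have cz: "bcoord S j ?z = bcoord S j s + (1 / t k) * (bcoord S j x - bcoord S j s)" for j
          unfolding bcoord_affine[of S j ?z s] bcoord_affine[of S j x s] by simp
        have "?z \<in> ?K"
          unfolding in_simplex_iff[OF S]
        proof
          fix j assume j: "j \<in> S"
          show "0 \<le> bcoord S j ?z"
          proof (cases "j = s")
            case True
            have "bcoord S s ?z = 1 - (1 - bcoord S s x) / t k"
              using cz[of s] bcoord_vertex[OF S s s] t(1)[of k] by (simp add: diff_divide_distrib)
            moreover have "(1 - bcoord S s x) / t k \<le> 1" using b t(1)[of k] by simp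
            ultimately show ?thesis using True by simp
          next
            case False
            then have "bcoord S j s = 0" using bcoord_vertex[OF S j s] by simp
            then show ?thesis using cz[of j] True in_simplex_iff[OF S] j t(1)[of k] by simp
          qed
        qed
        then have "?P k ?z \<in> ?Kt" by blast
        then show False using True t(1)[of k] by simp
      qed
      then have "\<bar>\<psi> x\<bar> \<le> L * h * (1 - t k)"
        using near[of x] True t[of k] mult_left_mono[of "bcoord S s x" "1 - t k" "L * h"] L(1) h by fastforce
      then show ?thesis using True by (simp add: indicator_def)
    next
      case False
      then have "indicator ?K x - (indicator ?Kt x :: real) = 0" using KtK by (auto simp: indicator_def)
      then show ?thesis by simp
    qed
    have iI: "integrable lborel (\<lambda>x. indicator ?K x - indicator ?Kt x :: real)"
      using i1[OF K] i1[OF Kt] unfolding set_integrable_def by simp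
    have "\<bar>\<integral>x. (indicator ?K x - indicator ?Kt x) * \<psi> x \<partial>lborel\<bar>
        \<le> (\<integral>x. L * h * (1 - t k) * (indicator ?K x - indicator ?Kt x) \<partial>lborel)"
      by (rule Bochner_Integration.integral_abs_bound_integral)
        (use i\<psi>(1,2) iI pt in \<open>auto simp: set_integrable_def left_diff_distrib\<close>)
    also have "\<dots> = L * h * (1 - t k) * (?V - measure lborel ?Kt)"
      using i1[OF K] i1[OF Kt] Kb Ktb unfolding set_integrable_def by simp
    also have "measure lborel ?Kt = t k ^ ?n * ?V"
      using LINT_scale[OF t(1)[of k] K, of "\<lambda>_. 1" s] Kb Ktb by (simp add: set_lebesgue_integral_def mult.commute)
    also have "L * h * (1 - t k) * (?V - t k ^ ?n * ?V) \<le> L * h * (1 - t k) * ((real ?n * (1 - t k)) * ?V)"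
    proof (rule mult_left_mono)
      have "(1 - t k ^ ?n) * ?V \<le> (real ?n * (1 - t k)) * ?V"
        using t[of k] by (intro mult_right_mono Bernoulli_complement) auto
      then show "?V - t k ^ ?n * ?V \<le> (real ?n * (1 - t k)) * ?V" by (simp add: left_diff_distrib)
    qed (use L(1) h t[of k] in simp)
    finally have "(1 - t k) * \<bar>LINT x:?K|lborel. F k x\<bar> \<le> (1 - t k) * (L * h * (real ?n * (1 - t k) * ?V))"
      using t(2)[of k] unfolding e1[symmetric] by (simp add: abs_mult mult_ac)
    then show ?thesis using t(2)[of k] by (simp only: mult_le_cancel_left_pos diff_gt_0_iff_gt)
  qed
  have "(\<lambda>k. LINT x:?K|lborel. F k x) \<longlonglongrightarrow> 0"
  proof (rule Lim_null_comparison)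
    have "(\<lambda>k. L * h * (real ?n * (1 - t k) * ?V)) \<longlonglongrightarrow> L * h * (real ?n * (1 - 1) * ?V)"
      by (intro tendsto_intros t1)
    then show "(\<lambda>k. L * h * (real ?n * (1 - t k) * ?V)) \<longlonglongrightarrow> 0" by simp
    show "\<forall>\<^sub>F k in sequentially. norm (LINT x:?K|lborel. F k x) \<le> L * h * (real ?n * (1 - t k) * ?V)"
      using bound by simp
  qed
  with lim show ?thesis by (rule LIMSEQ_unique)
qed

text \<open>The difference vanishes on the facet, so its integral is 0: the expression depends only
  on the values on the facet and is entitled to be called a mean over it.\<close>

lemma facet_mean_cong_facet:
  fixes S :: "'a::euclidean_space set"
  assumes S: "is_simplex_vertices S" and s: "s \<in> S"
    and \<psi>: "\<And>x. (\<psi> has_derivative (\<lambda>h. D x \<bullet> h)) (at x)" "continuous_on UNIV D"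
    and \<theta>: "\<And>x. (\<theta> has_derivative (\<lambda>h. E x \<bullet> h)) (at x)" "continuous_on UNIV E"
    and eq: "\<And>x. x \<in> convex hull (S - {s}) \<Longrightarrow> \<psi> x = \<theta> x"
  shows "facet_mean S s \<psi> D = facet_mean S s \<theta> E"
proof -
  have c: "continuous_on UNIV \<psi>" "continuous_on UNIV \<theta>"
    using \<psi>(1) \<theta>(1) by (auto intro!: continuous_at_imp_continuous_on has_derivative_continuous)
  have i: "set_integrable lborel (convex hull S) (\<lambda>x. real DIM('a) * \<psi> x + (x - s) \<bullet> D x)"
    "set_integrable lborel (convex hull S) (\<lambda>x. real DIM('a) * \<theta> x + (x - s) \<bullet> E x)"
    by (intro set_integrable_compact compact_simplex S continuous_intros
        continuous_on_subset[OF c(1)] continuous_on_subset[OF c(2)]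
        continuous_on_subset[OF \<psi>(2)] continuous_on_subset[OF \<theta>(2)]; simp)+
  have "(LINT x:(convex hull S)|lborel. real DIM('a) * (\<psi> x - \<theta> x) + (x - s) \<bullet> (D x - E x)) = 0"
  proof (rule facet_integral_eq_0[OF S s])
    show "((\<lambda>x. \<psi> x - \<theta> x) has_derivative (\<lambda>h. (D x - E x) \<bullet> h)) (at x)" for x
      using has_derivative_diff[OF \<psi>(1)[of x] \<theta>(1)[of x]] by (simp add: inner_diff_left)
    show "continuous_on UNIV (\<lambda>x. D x - E x)" by (intro continuous_intros \<psi> \<theta>)
    show "\<psi> x - \<theta> x = 0" if "x \<in> convex hull (S - {s})" for x using eq[OF that] by simp
  qed
  moreover have "(LINT x:(convex hull S)|lborel. real DIM('a) * (\<psi> x - \<theta> x) + (x - s) \<bullet> (D x - E x))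
    = (LINT x:(convex hull S)|lborel. (real DIM('a) * \<psi> x + (x - s) \<bullet> D x) - (real DIM('a) * \<theta> x + (x - s) \<bullet> E x))"
    by (simp add: algebra_simps inner_diff_right)
  ultimately show ?thesis unfolding facet_mean_def by (simp add: set_integral_diff(2)[OF i])
qed

text \<open>The affine map that fixes the common facet pointwise and maps \<open>s'\<close> to \<open>s\<close> carries one integral to
  the other up to the ratio of the volumes.\<close>
lemma facet_mean_common_facet:
  fixes S S' :: "'a::euclidean_space set"
  assumes dim: "DIM('a) = 2 \<or> DIM('a) = 3"
    and S: "is_simplex_vertices S" "s \<in> S" and S': "is_simplex_vertices S'" "s' \<in> S'"
    and facet: "S - {s} = S' - {s'}"
    and \<psi>: "\<And>x. (\<psi> has_derivative (\<lambda>h. D x \<bullet> h)) (at x)" "continuous_on UNIV D"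
  shows "facet_mean S s \<psi> D = facet_mean S' s' \<psi> D"
proof -
  let ?g' = "bgrad S' s'" and ?g = "bgrad S s"
  define T where "T v = v + (?g' \<bullet> v) *\<^sub>R (s - s')" for v
  define U where "U v = v + (?g \<bullet> v) *\<^sub>R (s' - s)" for v
  define A where "A x = x + bcoord S' s' x *\<^sub>R (s - s')" for x
  have lin: "linear T" "linear U"
    unfolding T_def U_def by (rule linearI; simp add: inner_add_right algebra_simps)+
  have AT: "A y = T (y - x) + A x" for x y
    unfolding A_def T_def bcoord_affine[of S' s' y x] by (simp add: algebra_simps)
  have As: "A s' = s" unfolding A_def using bcoord_vertex[OF S'(1,2,2)] by simp
  \<comment> \<open>A carries barycentric coordinates over: those of the shared vertices are kept,
    and that of s' becomes that of s. Hence A maps the second simplex onto the first.\<close>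
  have cA: "bcoord S s (A x) = bcoord S' s' x" "\<And>t. t \<in> S - {s} \<Longrightarrow> bcoord S t (A x) = bcoord S' t x" for x
  proof -
    define u where "u t = (if t = s then bcoord S' s' x else bcoord S' t x)" for t
    have f: "finite S" "finite S'" using simplex_verticesD(1) S(1) S'(1) by auto
    have r: "sum u (S - {s}) = (\<Sum>t\<in>S' - {s'}. bcoord S' t x)"
      "(\<Sum>t\<in>S - {s}. u t *\<^sub>R t) = (\<Sum>t\<in>S' - {s'}. bcoord S' t x *\<^sub>R t)"
      unfolding facet[symmetric] by (auto simp: u_def intro!: sum.cong)
    have 1: "sum u S = 1"
      using sum.remove[OF f(1) S(2), of u] r(1) sum.remove[OF f(2) S'(2), of "\<lambda>t. bcoord S' t x"]
        bcoord_representation(1)[OF S'(1), of x] by (simp add: u_def)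
    have "(\<Sum>t\<in>S. u t *\<^sub>R t) = bcoord S' s' x *\<^sub>R s + (x - bcoord S' s' x *\<^sub>R s')"
      using sum.remove[OF f(1) S(2), of "\<lambda>t. u t *\<^sub>R t"] r(2)
        sum.remove[OF f(2) S'(2), of "\<lambda>t. bcoord S' t x *\<^sub>R t"] bcoord_representation(2)[OF S'(1), of x]
      by (simp add: u_def algebra_simps)
    also have "\<dots> = A x" by (simp add: A_def algebra_simps)
    finally have 2: "(\<Sum>t\<in>S. u t *\<^sub>R t) = A x" .
    have 3: "bcoord S t (A x) = u t" if "t \<in> S" for t using bcoord_sum[OF S(1) that 1] unfolding 2 .
    show "bcoord S s (A x) = bcoord S' s' x" using 3[OF S(2)] by (simp add: u_def)
    show "bcoord S t (A x) = bcoord S' t x" if "t \<in> S - {s}" for t using 3[of t] that by (simp add: u_def)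
  qed
  have mem: "A x \<in> convex hull S \<longleftrightarrow> x \<in> convex hull S'" for x
    unfolding in_simplex_iff[OF S(1)] in_simplex_iff[OF S'(1)]
    using cA(1)[of x] cA(2)[of _ x] facet S(2) S'(2) by (metis Diff_iff singletonD singletonI)
  have gT: "?g \<bullet> T v = ?g' \<bullet> v" for v
  proof -
    have "bcoord S s (A v) - bcoord S s (A 0) = ?g \<bullet> T v"
      using bcoord_affine[of S s "A v" "A 0"] AT[of v 0] by simp
    then show ?thesis using cA(1)[of v] cA(1)[of 0] bcoord_affine[of S' s' v 0] by simp
  qed
  have UT: "U (T v) = v" for v
  proof -
    have "U (T v) = T v + (?g' \<bullet> v) *\<^sub>R (s' - s)" unfolding U_def gT ..
    then show ?thesis by (simp add: T_def algebra_simps)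
  qed
  have TU: "T (U v) = v" for v
  proof -
    have inj: "inj U \<longrightarrow> ?thesis" using UT by (metis injD)
    have "surj U" by (metis UT surjI)
    then have "inj U" using linear_surjective_imp_injective[OF lin(2)] by simp
    then show ?thesis using inj by simp
  qed
  obtain k where k: "k > 0" "\<And>f :: 'a \<Rightarrow> real. f \<in> borel_measurable borel \<Longrightarrow>
      (\<integral>x. f x \<partial>lborel) = k * (\<integral>x. f (T x + A 0) \<partial>lborel)"
    using lborel_affine_bijection[OF dim lin UT TU, of "A 0"] by blast
  have A0: "T x + A 0 = A x" for x using AT[of x 0] by simp
  have Kb: "convex hull S \<in> sets borel" using compact_simplex[OF S(1)] by (simp add: borel_compact)
  have transfer: "(LINT x:(convex hull S)|lborel. f x) = k * (LINT x:(convex hull S')|lborel. f (A x))"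
    if f: "f \<in> borel_measurable borel" for f :: "'a \<Rightarrow> real"
  proof -
    have "(\<lambda>x. indicator (convex hull S) x *\<^sub>R f x) \<in> borel_measurable borel"
      using Kb f by (intro borel_measurable_scaleR borel_measurable_indicator) auto
    from k(2)[OF this] show ?thesis
      unfolding set_lebesgue_integral_def A0 by (simp add: indicator_def mem)
  qed
  have vol: "measure lebesgue (convex hull S) = k * measure lebesgue (convex hull S')"
  proof -
    have "convex hull S' \<in> sets borel" using compact_simplex[OF S'(1)] by (simp add: borel_compact)
    then show ?thesis
      using transfer[of "\<lambda>_. 1"] Kb by (simp add: set_lebesgue_integral_def)
  qed
  have c\<psi>: "continuous_on UNIV \<psi>"
    using \<psi>(1) by (auto intro!: continuous_at_imp_continuous_on has_derivative_continuous)
  let ?\<theta> = "\<lambda>x. \<psi> (A x)" and ?E = "\<lambda>x. D (A x) + (D (A x) \<bullet> (s - s')) *\<^sub>R ?g'"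
  have cont_A: "continuous_on UNIV A" unfolding A_def[abs_def] by (intro continuous_intros)
  have dA: "(A has_derivative T) (at x)" for x
    unfolding A_def[abs_def] T_def[abs_def] bcoord_def[abs_def]
    by (auto intro!: derivative_eq_intros)
  have d\<theta>: "(?\<theta> has_derivative (\<lambda>h. ?E x \<bullet> h)) (at x)" for x
  proof -
    have "(\<lambda>h. D (A x) \<bullet> T h) = (\<lambda>h. ?E x \<bullet> h)"
      by (simp add: fun_eq_iff T_def inner_add_left inner_add_right mult.commute)
    then show ?thesis using has_derivative_compose[OF dA \<psi>(1), of x] by simp
  qed
  have cE: "continuous_on UNIV ?E"
    by (intro continuous_intros continuous_on_compose2[OF \<psi>(2) cont_A]; simp)
  \<comment> \<open>A is affine with linear part T and sends s' to s, and E is the transpose of T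
    applied to D at A x; so the radial derivative is transported unchanged.\<close>
  have radial: "(A x - s) \<bullet> D (A x) = (x - s') \<bullet> ?E x" for x
    unfolding AT[of x s'] As by (simp add: T_def inner_add_left inner_add_right inner_commute)
  have "(\<lambda>x. real DIM('a) * \<psi> x + (x - s) \<bullet> D x) \<in> borel_measurable borel"
    by (intro borel_measurable_continuous_onI continuous_intros \<psi>(2) c\<psi>)
  from transfer[OF this] have "facet_mean S s \<psi> D = facet_mean S' s' ?\<theta> ?E"
    unfolding facet_mean_def vol radial using k(1) by simp
  \<comment> \<open>On the common facet the coordinate of s' is 0 and A is the identity, so \<psi>
    composed with A and \<psi> agree there.\<close>
  also have "\<dots> = facet_mean S' s' \<psi> D"
  proof (rule facet_mean_cong_facet[OF S' d\<theta> cE \<psi>])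
    fix x assume "x \<in> convex hull (S' - {s'})"
    then have "bcoord S' s' x = 0" using in_face_iff[OF S'(1) Diff_subset, of x "{s'}"] S'(2) by simp
    then show "\<psi> (A x) = \<psi> x" by (simp add: A_def)
  qed
  finally show ?thesis .
qed

text \<open>The lowest-order Raviart-Thomas shape field of a facet: total flux 1 through the facet
  opposite to s, none through the other facets since these contain s, and divergence 1 / volume
  inside the cell.\<close>

definition cone_field :: "'a::euclidean_space set \<Rightarrow> 'a \<Rightarrow> 'a \<Rightarrow> 'a" where
  "cone_field S s x = (indicator (interior (convex hull S)) x / (real DIM('a) * measure lebesgue (convex hull S))) *\<^sub>R (x - s)"

text \<open>The divergence inside the cell that all the fields \<open>cone_field S s\<close> have in
  common.\<close>

definition cell_density :: "'a::euclidean_space set \<Rightarrow> 'a \<Rightarrow> real" where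
  "cell_density S x = indicator (interior (convex hull S)) x / measure lebesgue (convex hull S)"

lemma LINT_interior_simplex:
  fixes f :: "'a::euclidean_space \<Rightarrow> real"
  assumes S: "is_simplex_vertices S" and f: "continuous_on UNIV f"
  shows "(\<integral>x. indicator (interior (convex hull S)) x * f x \<partial>lborel) = (LINT x:(convex hull S)|lborel. f x)"
proof -
  have fm: "f \<in> borel_measurable borel" by (rule borel_measurable_continuous_onI[OF f])
  have Kb: "convex hull S \<in> sets borel" using compact_simplex[OF S] by (simp add: borel_compact)
  have "frontier (convex hull S) \<in> null_sets lebesgue"
    using negligible_frontier_simplex[of S] by (simp add: negligible_iff_null_sets)
  then have "AE x in lebesgue. x \<notin> frontier (convex hull S)" by (rule AE_not_in)
  then have ae: "AE x in lborel. x \<notin> frontier (convex hull S)" by (simp add: AE_completion_iff)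
  show ?thesis
    unfolding set_lebesgue_integral_def
  proof (rule integral_cong_AE)
    show "(\<lambda>x. indicator (interior (convex hull S)) x * f x) \<in> borel_measurable lborel"
      using fm by (intro borel_measurable_times borel_measurable_indicator) auto
    show "(\<lambda>x. indicator (convex hull S) x *\<^sub>R f x) \<in> borel_measurable lborel"
      using fm Kb by (intro borel_measurable_scaleR borel_measurable_indicator) auto
    show "AE x in lborel. indicator (interior (convex hull S)) x * f x = indicator (convex hull S) x *\<^sub>R f x"
      using ae
    proof eventually_elim
      case (elim x)
      then have "x \<in> interior (convex hull S) \<longleftrightarrow> x \<in> convex hull S"
        using closure_subset[of "convex hull S"] interior_subset[of "convex hull S"] unfolding frontier_def by blast
      then show ?case by (simp add: indicator_def)
    qed
  qed
qed

text \<open>The facet mean is the boundary term of the integration by parts: the flux through the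
  opposite facet is uniform and has total 1.\<close>

lemma cone_field_weak_div:
  fixes S :: "'a::euclidean_space set"
  assumes S: "is_simplex_vertices S" and tf: "test_fun A \<psi> D"
  shows "(\<integral>x. cone_field S s x \<bullet> D x \<partial>lborel) = facet_mean S s \<psi> D - (\<integral>x. cell_density S x * \<psi> x \<partial>lborel)"
proof -
  let ?K = "convex hull S" and ?V = "measure lebesgue (convex hull S)" and ?n = "real DIM('a)"
  have V: "?V > 0" by (rule simplex_measure_pos[OF S])
  have c1: "continuous_on UNIV (\<lambda>x. (x - s) \<bullet> D x)" by (intro continuous_intros test_funD(2)[OF tf])
  have c2: "continuous_on UNIV \<psi>" by (rule test_funD(3)[OF tf])
  have "(\<integral>x. cone_field S s x \<bullet> D x \<partial>lborel)
      = (\<integral>x. (indicator (interior ?K) x * ((x - s) \<bullet> D x)) / (?n * ?V) \<partial>lborel)"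
    unfolding cone_field_def by simp
  also have "\<dots> = (LINT x:?K|lborel. (x - s) \<bullet> D x) / (?n * ?V)"
    using LINT_interior_simplex[OF S c1] by simp
  also have "(LINT x:?K|lborel. (x - s) \<bullet> D x)
      = (LINT x:?K|lborel. ?n * \<psi> x + (x - s) \<bullet> D x) - (LINT x:?K|lborel. ?n * \<psi> x)"
  proof -
    have i: "set_integrable lborel ?K (\<lambda>x. ?n * \<psi> x + (x - s) \<bullet> D x)" "set_integrable lborel ?K (\<lambda>x. ?n * \<psi> x)"
      by (intro set_integrable_compact compact_simplex S continuous_intros continuous_on_subset[OF c2]
          continuous_on_subset[OF test_funD(2)[OF tf]]; simp)+
    show ?thesis using set_integral_diff(2)[OF i] by simp
  qed
  also have "(\<dots>) / (?n * ?V) = facet_mean S s \<psi> D - (LINT x:?K|lborel. \<psi> x) / ?V"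
    using V by (simp add: facet_mean_def diff_divide_distrib)
  also have "(LINT x:?K|lborel. \<psi> x) / ?V = (\<integral>x. cell_density S x * \<psi> x \<partial>lborel)"
    using LINT_interior_simplex[OF S c2] by (simp add: cell_density_def)
  finally show ?thesis .
qed

section \<open>Conforming simplicial meshes\<close>

lemma bcoord_face_eq:
  assumes S: "is_simplex_vertices S" and S': "is_simplex_vertices S'"
    and T: "T \<subseteq> S" "T \<subseteq> S'" and x: "x \<in> convex hull T" and t: "t \<in> T"
  shows "bcoord S t x = bcoord S' t x"
proof -
  let ?H = "{x. (bgrad S t - bgrad S' t) \<bullet> x = snd (bary S' t) - snd (bary S t)}"
  have H: "x \<in> ?H \<longleftrightarrow> bcoord S t x = bcoord S' t x" for x
    by (auto simp: bcoord_def inner_diff_left)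
  have "T \<subseteq> ?H"
  proof
    fix v assume "v \<in> T"
    then show "v \<in> ?H"
      unfolding H using bcoord_vertex[OF S, of t v] bcoord_vertex[OF S', of t v] T t by (simp add: subset_iff)
  qed
  then have "convex hull T \<subseteq> ?H" by (rule hull_minimal) (rule convex_hyperplane)
  then show ?thesis using x H by blast
qed

lemma bcoord_combination:
  assumes S: "is_simplex_vertices S"
  shows "bcoord S' t x = (\<Sum>v\<in>S. bcoord S v x * bcoord S' t v)"
proof -
  have "bcoord S' t x = bgrad S' t \<bullet> (\<Sum>v\<in>S. bcoord S v x *\<^sub>R v) + snd (bary S' t)"
    using bcoord_representation(2)[OF S, of x] by (simp add: bcoord_def[of S'])
  also have "\<dots> = (\<Sum>v\<in>S. bcoord S v x * (bgrad S' t \<bullet> v)) + (\<Sum>v\<in>S. bcoord S v x) * snd (bary S' t)"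
    unfolding bcoord_representation(1)[OF S] by (simp add: inner_sum_right)
  also have "\<dots> = (\<Sum>v\<in>S. bcoord S v x * bcoord S' t v)"
    unfolding bcoord_def[of S' t] by (simp add: distrib_left sum.distrib sum_distrib_right)
  finally show ?thesis .
qed

lemma positive_near:
  fixes f :: "'i \<Rightarrow> 'a::metric_space \<Rightarrow> real"
  assumes "finite I" "\<And>i. i \<in> I \<Longrightarrow> continuous_on UNIV (f i)" "\<And>i. i \<in> I \<Longrightarrow> 0 < f i p"
  shows "\<exists>e>0. \<forall>q. dist p q < e \<longrightarrow> (\<forall>i\<in>I. 0 < f i q)"
proof -
  have "open (\<Inter>i\<in>I. {q. 0 < f i q})"
    using assms(1,2) by (intro open_INT ballI open_Collect_less continuous_on_const)
  moreover have "p \<in> (\<Inter>i\<in>I. {q. 0 < f i q})" using assms(3) by simp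
  ultimately obtain e where "e > 0" "ball p e \<subseteq> (\<Inter>i\<in>I. {q. 0 < f i q})" unfolding open_contains_ball by blast
  then show ?thesis by (intro exI[of _ e]) auto
qed

text \<open>Near a boundary point the domain lies on one side of a graph, and immediately above the
  point there is an open set that misses \<Omega>. This excludes slits, across which cells of the
  mesh could be neighbours although the slit is not in the domain.\<close>

lemma lipschitz_domain_interior_closure:
  fixes \<Omega> :: "'a::euclidean_space set"
  assumes "lipschitz_domain \<Omega>"
  shows "interior (closure \<Omega>) = \<Omega>"
proof
  have op: "open \<Omega>" using assms unfolding lipschitz_domain_def by blast
  then show "\<Omega> \<subseteq> interior (closure \<Omega>)" by (intro interior_maximal closure_subset)
  show "interior (closure \<Omega>) \<subseteq> \<Omega>"
  proof
    fix x assume x: "x \<in> interior (closure \<Omega>)"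
    show "x \<in> \<Omega>"
    proof (rule ccontr)
      assume nx: "x \<notin> \<Omega>"
      then have fr: "x \<in> frontier \<Omega>"
        using x interior_subset[of "closure \<Omega>"] op by (auto simp: frontier_def interior_open)
      obtain r e g L where r: "r > 0" "norm e = 1" "L-lipschitz_on UNIV g"
        "\<Omega> \<inter> ball x r = {y \<in> ball x r. y \<bullet> e < g (y - (y \<bullet> e) *\<^sub>R e)}"
      proof -
        have "\<exists>r>0. \<exists>e::'a. \<exists>g::'a \<Rightarrow> real. \<exists>L. norm e = 1 \<and> L-lipschitz_on UNIV g \<and>
            \<Omega> \<inter> ball x r = {y \<in> ball x r. y \<bullet> e < g (y - (y \<bullet> e) *\<^sub>R e)}"
          using assms fr unfolding lipschitz_domain_def by blast
        then show ?thesis by (elim exE conjE) (rule that)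
      qed
      have ge: "g (x - (x \<bullet> e) *\<^sub>R e) \<le> x \<bullet> e"
      proof (rule ccontr)
        assume "\<not> g (x - (x \<bullet> e) *\<^sub>R e) \<le> x \<bullet> e"
        then have "x \<in> {y \<in> ball x r. y \<bullet> e < g (y - (y \<bullet> e) *\<^sub>R e)}" using r(1) by simp
        then have "x \<in> \<Omega> \<inter> ball x r" unfolding r(4) .
        then show False using nx by blast
      qed
      obtain d where d: "d > 0" "ball x d \<subseteq> closure \<Omega>" using x unfolding mem_interior by blast
      define t where "t = min r d / 2"
      have t: "0 < t" "t < r" "t < d" using r(1) d(1) by (auto simp: t_def)
      \<comment> \<open>A move along e leaves the argument of g unchanged and raises the height, so
        y lies strictly above the graph.\<close>
      define y where "y = x + t *\<^sub>R e"
      have ee: "e \<bullet> e = 1" using r(2) by (simp add: dot_square_norm)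
      have "y \<bullet> e = x \<bullet> e + t" by (simp add: y_def inner_add_left ee)
      moreover have "y - (y \<bullet> e) *\<^sub>R e = x - (x \<bullet> e) *\<^sub>R e"
        by (simp add: y_def inner_add_left ee algebra_simps)
      ultimately have gy: "g (y - (y \<bullet> e) *\<^sub>R e) < y \<bullet> e" using ge t(1) by simp
      have cg: "continuous_on UNIV g" using r(3) by (rule lipschitz_on_continuous_on)
      let ?W = "ball x r \<inter> {z. g (z - (z \<bullet> e) *\<^sub>R e) < z \<bullet> e}"
      have "open ?W"
        by (intro open_Int open_ball open_Collect_less continuous_on_compose2[OF cg] continuous_intros) simp_all
      moreover have "y \<in> ?W" using gy t(1,2) r(2) by (simp add: y_def dist_norm)
      moreover have "?W \<inter> \<Omega> = {}"
      proof -
        have "z \<notin> ?W" if "z \<in> \<Omega>" for z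
        proof
          assume z: "z \<in> ?W"
          then have "z \<in> \<Omega> \<inter> ball x r" using that by blast
          then have "z \<in> {y \<in> ball x r. y \<bullet> e < g (y - (y \<bullet> e) *\<^sub>R e)}" unfolding r(4) .
          then show False using z by auto
        qed
        then show ?thesis by blast
      qed
      ultimately have "y \<notin> closure \<Omega>" using open_Int_closure_eq_empty[of ?W \<Omega>] by blast
      moreover have "y \<in> ball x d" using t r(2) by (simp add: y_def dist_norm)
      ultimately show False using d(2) by blast
    qed
  qed
qed

text \<open>\<open>regular_open\<close> carries the information on the boundary. The parameter
  \<kappa> is only an upper bound for the shape regularity, so constants built from it are the same
  for all meshes that obey the bound.\<close>

locale simplicial_mesh = bounded_open \<Omega> for \<Omega> :: "'a::euclidean_space set" +
  fixes M :: "'a set set" and \<kappa> :: real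
  assumes conforming: "conforming_mesh \<Omega> M"
    and regular_open: "interior (closure \<Omega>) = \<Omega>"
    and dom_nonempty: "\<Omega> \<noteq> {}"
    and dim_cases: "DIM('a) = 2 \<or> DIM('a) = 3"
    and shape: "S \<in> M \<Longrightarrow> diameter (convex hull S) ^ DIM('a) \<le> \<kappa> * measure lebesgue (convex hull S)"
begin

lemma finite_mesh: "finite M"
  and simplex: "S \<in> M \<Longrightarrow> is_simplex_vertices S"
  and cells_union: "(\<Union>S\<in>M. convex hull S) = closure \<Omega>"
  and cells_inter: "S \<in> M \<Longrightarrow> S' \<in> M \<Longrightarrow> convex hull S \<inter> convex hull S' = convex hull (S \<inter> S')"
  using conforming unfolding conforming_mesh_def by auto

lemma vertices_finite: "S \<in> M \<Longrightarrow> finite S"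
  and vertices_card: "S \<in> M \<Longrightarrow> card S = DIM('a) + 1"
  using simplex simplex_verticesD by blast+

lemma mesh_subset_eq: "S \<in> M \<Longrightarrow> S' \<in> M \<Longrightarrow> S \<subseteq> S' \<Longrightarrow> S = S'"
  using vertices_finite vertices_card by (metis card_subset_eq)

text \<open>By conformity x lies in the common face, but all its coordinates in S are positive, so
  this face contains every vertex of S.\<close>

lemma interior_cell_unique:
  assumes "S \<in> M" "S' \<in> M" "x \<in> interior (convex hull S)" "x \<in> convex hull S'"
  shows "S' = S"
proof -
  have "x \<in> convex hull (S \<inter> S')"
    using cells_inter[OF assms(1,2)] assms(3,4) interior_subset by blast
  then have "\<forall>s\<in>S - S \<inter> S'. bcoord S s x = 0"
    using in_face_iff[OF simplex[OF assms(1)], of "S \<inter> S'" x] by blast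
  moreover have "\<forall>s\<in>S. 0 < bcoord S s x"
    using assms(3) in_interior_simplex_iff[OF simplex[OF assms(1)]] by blast
  ultimately have "S \<subseteq> S'" by force
  then show ?thesis using mesh_subset_eq[OF assms(1,2)] by simp
qed

lemma interior_cell_subset: "S \<in> M \<Longrightarrow> interior (convex hull S) \<subseteq> \<Omega>"
  using interior_mono[of "convex hull S" "closure \<Omega>"] cells_union regular_open by blast

lemma AE_interior_cell: "AE x in N. \<exists>S\<in>M. x \<in> interior (convex hull S)"
proof -
  have "negligible (\<Union>S\<in>M. frontier (convex hull S))"
    using finite_mesh negligible_frontier_simplex by (intro negligible_Union) auto
  then have "AE x in lebesgue. x \<notin> (\<Union>S\<in>M. frontier (convex hull S))"
    by (intro AE_not_in) (simp add: negligible_iff_null_sets)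
  then have "AE x in lebesgue. x \<in> \<Omega> \<longrightarrow> (\<exists>S\<in>M. x \<in> interior (convex hull S))"
  proof eventually_elim
    case (elim x)
    show ?case
    proof
      assume "x \<in> \<Omega>"
      then obtain S where S: "S \<in> M" "x \<in> convex hull S" using cells_union closure_subset by blast
      then have "x \<in> interior (convex hull S)"
        using elim closure_subset[of "convex hull S"] unfolding frontier_def by blast
      then show "\<exists>S\<in>M. x \<in> interior (convex hull S)" using S(1) by blast
    qed
  qed
  then show ?thesis using dom_sets by (simp add: AE_restrict_space_iff)
qed

text \<open>The cell across the facet of \<open>S\<close> opposite to \<open>s\<close>, or \<open>{}\<close> if that facet lies on the boundary.\<close>
definition nb :: "'a set \<Rightarrow> 'a \<Rightarrow> 'a set" where
  "nb S s = (if \<exists>S'\<in>M. S' \<noteq> S \<and> S - {s} \<subseteq> S' then SOME S'. S' \<in> M \<and> S' \<noteq> S \<and> S - {s} \<subseteq> S' else {})"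

lemma nb_props:
  assumes "nb S s \<noteq> {}"
  shows "nb S s \<in> M" "nb S s \<noteq> S" "S - {s} \<subseteq> nb S s"
proof -
  have "\<exists>S'. S' \<in> M \<and> S' \<noteq> S \<and> S - {s} \<subseteq> S'" using assms unfolding nb_def by (metis (no_types, lifting))
  from someI_ex[OF this] show "nb S s \<in> M" "nb S s \<noteq> S" "S - {s} \<subseteq> nb S s"
    unfolding nb_def using \<open>\<exists>S'. S' \<in> M \<and> S' \<noteq> S \<and> S - {s} \<subseteq> S'\<close> by auto
qed

lemma nb_empty:
  assumes "nb S s = {}" "S' \<in> M" "S' \<noteq> S"
  shows "\<not> S - {s} \<subseteq> S'"
proof
  assume a: "S - {s} \<subseteq> S'"
  then have ex: "\<exists>S'. S' \<in> M \<and> S' \<noteq> S \<and> S - {s} \<subseteq> S'" using assms by blast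
  then have "nb S s \<in> M" unfolding nb_def using someI_ex[OF ex] by auto
  then show False using assms(1) vertices_card by fastforce
qed

text \<open>The two cells lie on opposite sides of the shared facet, as the negative factor
  expresses. Were the factor of the other sign, a point slightly inside S near the barycenter of the
  facet would lie in both cells but not in their common face.\<close>

lemma nb_vertex:
  assumes S: "S \<in> M" "s \<in> S" and nb: "nb S s \<noteq> {}"
  shows "\<exists>s'. s' \<in> nb S s \<and> s' \<notin> S \<and> nb S s - {s'} = S - {s} \<and>
    (\<exists>c>0. \<forall>x. bcoord (nb S s) s' x = - (c * bcoord S s x))"
proof -
  let ?S' = "nb S s" and ?T = "S - {s}"
  note p = nb_props[OF nb]
  note sS = simplex[OF S(1)] and sS' = simplex[OF p(1)]
  have cT: "card ?T = DIM('a)" using vertices_card[OF S(1)] S(2) vertices_finite[OF S(1)] by simp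
  have "card (?S' - ?T) = 1"
    using card_Diff_subset[of ?T ?S'] p(3) vertices_finite[OF S(1)] cT vertices_card[OF p(1)] by simp
  then obtain s' where s': "?S' - ?T = {s'}" by (auto simp: card_1_singleton_iff)
  have S'T: "?S' - {s'} = ?T" using s' p(3) by blast
  have s'S': "s' \<in> ?S'" "s' \<notin> ?T" using s' by blast+
  have s'S: "s' \<notin> S"
  proof
    assume "s' \<in> S"
    then have "?S' \<subseteq> S" using S'T by blast
    then show False using mesh_subset_eq[OF p(1) S(1)] p(2) by blast
  qed
  define c where "c = - bcoord ?S' s' s"
  have coord_prop: "bcoord ?S' s' x = - (c * bcoord S s x)" for x
  proof -
    have "bcoord ?S' s' x = (\<Sum>v\<in>S. bcoord S v x * bcoord ?S' s' v)" by (rule bcoord_combination[OF sS])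
    also have "\<dots> = bcoord S s x * bcoord ?S' s' s + (\<Sum>v\<in>?T. bcoord S v x * bcoord ?S' s' v)"
      by (rule sum.remove[OF vertices_finite[OF S(1)] S(2)])
    also have "(\<Sum>v\<in>?T. bcoord S v x * bcoord ?S' s' v) = 0"
    proof (rule sum.neutral, rule ballI)
      fix v assume v: "v \<in> ?T"
      then have "v \<in> ?S'" "v \<noteq> s'" using p(3) s'S'(2) by blast+
      then show "bcoord S v x * bcoord ?S' s' v = 0"
        using bcoord_vertex[OF sS' s'S'(1), of v] by simp
    qed
    finally show ?thesis by (simp add: c_def)
  qed
  have "c > 0"
  proof (rule ccontr)
    assume "\<not> c > 0"
    then have c0: "c \<le> 0" by simp
    define n where "n = real DIM('a)"
    have n: "n > 0" by (simp add: n_def)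
    \<comment> \<open>The barycenter of the shared facet: the coordinates of the facet vertices are
      1 / n in both cells and remain positive nearby.\<close>
    define q where "q = (\<Sum>v\<in>?T. (1 / n) *\<^sub>R v)"
    have q_sum: "(\<Sum>v\<in>A. (if v \<in> ?T then 1 / n else 0) *\<^sub>R v) = q"
      "(\<Sum>v\<in>A. if v \<in> ?T then 1 / n else 0) = 1" if A: "finite A" "?T \<subseteq> A" for A
    proof -
      show "(\<Sum>v\<in>A. (if v \<in> ?T then 1 / n else 0) *\<^sub>R v) = q"
        unfolding q_def by (rule sum.mono_neutral_cong_right[OF A]) auto
      have "(\<Sum>v\<in>A. if v \<in> ?T then 1 / n else 0) = (\<Sum>v\<in>?T. 1 / n)"
        by (rule sum.mono_neutral_cong_right[OF A]) auto
      then show "(\<Sum>v\<in>A. if v \<in> ?T then 1 / n else 0) = 1" using cT n by (simp add: n_def)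
    qed
    note q_eq = q_sum[OF vertices_finite[OF S(1)] Diff_subset]
    note q_eq' = q_sum[OF vertices_finite[OF p(1)] p(3)]
    have qS: "bcoord S v q = (if v \<in> ?T then 1 / n else 0)" if "v \<in> S" for v
      using bcoord_sum[OF sS that q_eq(2)] q_eq(1) by simp
    have qS': "bcoord ?S' v q = (if v \<in> ?T then 1 / n else 0)" if "v \<in> ?S'" for v
      using bcoord_sum[OF sS' that q_eq'(2)] q_eq'(1) by simp
    have "\<exists>e>0. \<forall>y. dist q y < e \<longrightarrow> (\<forall>v\<in>?T. 0 < bcoord S v y)"
      by (rule positive_near) (use vertices_finite[OF S(1)] qS n in \<open>auto intro: continuous_on_bcoord\<close>)
    then obtain e1 where e1: "e1 > 0" "\<And>y v. dist q y < e1 \<Longrightarrow> v \<in> ?T \<Longrightarrow> 0 < bcoord S v y" by blast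
    have "\<exists>e>0. \<forall>y. dist q y < e \<longrightarrow> (\<forall>v\<in>?T. 0 < bcoord ?S' v y)"
      by (rule positive_near) (use vertices_finite[OF S(1)] qS' p(3) n in \<open>auto intro: continuous_on_bcoord\<close>)
    then obtain e2 where e2: "e2 > 0" "\<And>y v. dist q y < e2 \<Longrightarrow> v \<in> ?T \<Longrightarrow> 0 < bcoord ?S' v y" by blast
    let ?g = "bgrad S s"
    have g: "0 < norm ?g" using bgrad_nonzero[OF sS S(2)] by simp
    define y where "y = q + (min e1 e2 / 2 / norm ?g) *\<^sub>R ?g"
    have dy: "dist q y < e1" "dist q y < e2" using e1(1) e2(1) g by (auto simp: y_def dist_norm)
    have ypos: "0 < bcoord S s y"
    proof -
      have "bcoord S s y = 0 + (min e1 e2 / 2 / norm ?g) * (?g \<bullet> ?g)"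
        using bcoord_affine[of S s y q] qS[OF S(2)] by (simp add: y_def)
      then show ?thesis using e1(1) e2(1) g by (simp add: dot_square_norm)
    qed
    have "0 \<le> bcoord S v y" if "v \<in> S" for v using that e1(2)[OF dy(1), of v] ypos by (cases "v = s") auto
    then have yS: "y \<in> convex hull S" unfolding in_simplex_iff[OF sS] by blast
    have "0 \<le> bcoord ?S' v y" if v: "v \<in> ?S'" for v
    proof (cases "v = s'")
      case True
      then show ?thesis using coord_prop[of y] c0 ypos by (simp add: mult_nonpos_nonneg)
    next
      case False
      then have "v \<in> ?T" using v S'T by blast
      then show ?thesis using e2(2)[OF dy(2), of v] by simp
    qed
    then have "y \<in> convex hull ?S'" unfolding in_simplex_iff[OF sS'] by blast
    then have "y \<in> convex hull (S \<inter> ?S')" using yS cells_inter[OF S(1) p(1)] by blast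
    moreover have "s \<in> S - S \<inter> ?S'"
      using S(2) S'T s'S s'S' by blast
    ultimately have "bcoord S s y = 0" using in_face_iff[OF sS, of "S \<inter> ?S'" y] by blast
    then show False using ypos by simp
  qed
  then show ?thesis using s'S' s'S S'T coord_prop by blast
qed

text \<open>A point of the relative interior of the facet keeps positive distance from all other
  cells, since a cell containing it would contain the facet. Stepping across the facet therefore
  leaves every cell and with them the closure of \<Omega>.\<close>

lemma boundary_facet_not_in_domain:
  assumes S: "S \<in> M" "s \<in> S" and nb: "nb S s = {}"
    and p: "bcoord S s p = 0" "\<And>t. t \<in> S \<Longrightarrow> t \<noteq> s \<Longrightarrow> 0 < bcoord S t p"
  shows "p \<notin> \<Omega>"
proof
  assume "p \<in> \<Omega>"
  then obtain r where r: "r > 0" "ball p r \<subseteq> \<Omega>" using open_dom unfolding open_contains_ball by blast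
  note sS = simplex[OF S(1)]
  let ?U = "\<Union>S'\<in>M - {S}. convex hull S'"
  have pS: "p \<in> convex hull S" unfolding in_simplex_iff[OF sS] using p by (metis less_imp_le order_refl)
  have "closed ?U"
    using finite_mesh simplex compact_simplex by (intro closed_UN) (auto intro: compact_imp_closed)
  moreover have "p \<notin> ?U"
  proof
    assume "p \<in> ?U"
    then obtain S' where S': "S' \<in> M" "S' \<noteq> S" "p \<in> convex hull S'" by blast
    then have "p \<in> convex hull (S \<inter> S')" using pS cells_inter[OF S(1) S'(1)] by blast
    then have z: "\<forall>t\<in>S - S \<inter> S'. bcoord S t p = 0" using in_face_iff[OF sS, of "S \<inter> S'" p] by blast
    have "S - {s} \<subseteq> S'"
    proof
      fix t assume t: "t \<in> S - {s}"
      show "t \<in> S'"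
      proof (rule ccontr)
        assume "t \<notin> S'"
        then have "bcoord S t p = 0" using z t by blast
        moreover have "0 < bcoord S t p" using p(2) t by blast
        ultimately show False by simp
      qed
    qed
    then show False using nb_empty[OF nb S'(1,2)] by blast
  qed
  ultimately have "open (- ?U) \<and> p \<in> - ?U" by (meson ComplI open_Compl)
  then obtain e where e: "e > 0" "ball p e \<subseteq> - ?U" using open_contains_ball[of "- ?U"] by blast
  then have e: "e > 0" "ball p e \<inter> ?U = {}" by blast+
  let ?g = "bgrad S s"
  have g: "0 < norm ?g" using bgrad_nonzero[OF sS S(2)] by simp
  define y where "y = p - (min e r / 2 / norm ?g) *\<^sub>R ?g"
  have y: "y \<in> ball p e" "y \<in> ball p r" using e(1) r(1) g by (auto simp: y_def dist_norm)
  then have "y \<in> closure \<Omega>" using r(2) closure_subset by blast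
  then have "y \<in> convex hull S" using cells_union y(1) e(2) by blast
  then have "0 \<le> bcoord S s y" using in_simplex_iff[OF sS] S(2) by blast
  moreover have "bcoord S s y = - ((min e r / 2 / norm ?g) * (?g \<bullet> ?g))"
    using bcoord_affine[of S s y p] p(1) by (simp add: y_def)
  moreover have "0 < (min e r / 2 / norm ?g) * (?g \<bullet> ?g)" using e(1) r(1) g by (simp add: dot_square_norm)
  ultimately show False by linarith
qed

text \<open>In the relative interior of the facet the test function vanishes because such points are
  outside \<Omega>; continuity extends this to the relative boundary.\<close>

lemma test_fun_zero_boundary_facet:
  assumes S: "S \<in> M" "s \<in> S" and nb: "nb S s = {}" and tf: "test_fun \<Omega> \<psi> D"
    and x: "x \<in> convex hull (S - {s})"
  shows "\<psi> x = 0"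
proof -
  note sS = simplex[OF S(1)]
  have bx: "\<And>t. t \<in> S \<Longrightarrow> 0 \<le> bcoord S t x" "bcoord S s x = 0"
    using x in_face_iff[OF sS Diff_subset, of x "{s}"] S(2) by auto
  \<comment> \<open>The barycenter of the facet. Moving from x towards it makes every facet
    coordinate positive.\<close>
  define b where "b = (\<Sum>v\<in>S. (if v = s then 0 else 1 / real DIM('a)) *\<^sub>R v)"
  have sum1: "(\<Sum>v\<in>S. if v = s then 0 else 1 / real DIM('a)) = 1"
  proof -
    have "(\<Sum>v\<in>S. if v = s then 0 else 1 / real DIM('a)) = (\<Sum>v\<in>S - {s}. 1 / real DIM('a))"
      using sum.remove[OF vertices_finite[OF S(1)] S(2), of "\<lambda>v. if v = s then 0 else 1 / real DIM('a)"]
      by (simp cong: sum.cong_simp)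
    then show ?thesis using vertices_card[OF S(1)] S(2) vertices_finite[OF S(1)] by simp
  qed
  have bb: "bcoord S t b = (if t = s then 0 else 1 / real DIM('a))" if "t \<in> S" for t
    using bcoord_sum[OF sS that sum1] by (simp add: b_def)
  define t where "t k = inverse (real (Suc k))" for k
  have t: "0 < t k" "t k \<le> 1" for k by (auto simp: t_def field_simps)
  have z: "\<psi> (x + t k *\<^sub>R (b - x)) = 0" for k
  proof -
    let ?y = "x + t k *\<^sub>R (b - x)"
    have y: "bcoord S j ?y = (1 - t k) * bcoord S j x + t k * bcoord S j b" for j
    proof -
      have "bgrad S j \<bullet> (b - x) = bcoord S j b - bcoord S j x" using bcoord_affine[of S j b x] by simp
      moreover have "bcoord S j ?y = bcoord S j x + t k * (bgrad S j \<bullet> (b - x))"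
        using bcoord_affine[of S j ?y x] by simp
      ultimately have "bcoord S j ?y = bcoord S j x + t k * (bcoord S j b - bcoord S j x)" by (simp only:)
      then show ?thesis by (simp only: algebra_simps)
    qed
    have "?y \<notin> \<Omega>"
    proof (rule boundary_facet_not_in_domain[OF S nb])
      show "bcoord S s ?y = 0" using y[of s] bx(2) bb[OF S(2)] by simp
      fix j assume j: "j \<in> S" "j \<noteq> s"
      have "0 < t k * bcoord S j b" using t[of k] bb[OF j(1)] j(2) by simp
      moreover have "0 \<le> (1 - t k) * bcoord S j x" using t[of k] bx(1)[OF j(1)] by simp
      ultimately show "0 < bcoord S j ?y" using y[of j] by linarith
    qed
    then show ?thesis using test_funD(5)[OF tf] by (intro test_funD(6)[OF tf]) blast
  qed
  have "t \<longlonglongrightarrow> 0" unfolding t_def[abs_def] by (rule LIMSEQ_inverse_real_of_nat)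
  then have "(\<lambda>k. x + t k *\<^sub>R (b - x)) \<longlonglongrightarrow> x + 0 *\<^sub>R (b - x)" by (intro tendsto_intros)
  then have "(\<lambda>k. x + t k *\<^sub>R (b - x)) \<longlonglongrightarrow> x" by simp
  moreover have "isCont \<psi> x" using test_funD(3)[OF tf] by (simp add: continuous_on_eq_continuous_at)
  ultimately have "(\<lambda>k. \<psi> (x + t k *\<^sub>R (b - x))) \<longlonglongrightarrow> \<psi> x" by (rule isCont_tendsto_compose[rotated])
  then show ?thesis unfolding z by (simp add: LIMSEQ_const_iff)
qed

end

section \<open>Facet paths around a point\<close>

context simplicial_mesh
begin

text \<open>Only crossings through facets that contain z are allowed, so that chains stay among the
  cells around z and their jumps are counted by the energy of that patch.\<close>

definition facet_step :: "'a \<Rightarrow> ('a set \<times> 'a set) set" where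
  "facet_step z = {(L, nb L s) | L s. L \<in> M \<and> s \<in> L \<and> z \<in> convex hull (L - {s}) \<and> nb L s \<noteq> {}}"

lemma facet_step_mesh: "(K, L) \<in> (facet_step z)\<^sup>* \<Longrightarrow> K \<in> M \<Longrightarrow> L \<in> M"
proof (induction rule: rtrancl_induct)
  case (step L L')
  then show ?case using nb_props(1) unfolding facet_step_def by blast
qed

text \<open>If no boundary facet through \<open>z\<close> can be reached from \<open>K\<close> by crossing facets through \<open>z\<close>, the reachable
  cells cover a ball: walk along a generic segment that avoids all faces of codimension two.\<close>
lemma reachable_cells_cover:
  assumes K: "K \<in> M" "z \<in> convex hull K"
    and no_bd: "\<And>L s. (K, L) \<in> (facet_step z)\<^sup>* \<Longrightarrow> s \<in> L \<Longrightarrow> z \<in> convex hull (L - {s}) \<Longrightarrow> nb L s \<noteq> {}"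
  shows "\<exists>r>0. ball z r \<subseteq> (\<Union>L\<in>{L. (K, L) \<in> (facet_step z)\<^sup>*}. convex hull L)"
proof -
  define R where "R = {L. (K, L) \<in> (facet_step z)\<^sup>*}"
  define U where "U = (\<Union>L\<in>R. convex hull L)"
  have RM: "R \<subseteq> M" using facet_step_mesh K(1) unfolding R_def by blast
  have KR: "K \<in> R" by (simp add: R_def)
  have finR: "finite R" using RM finite_mesh by (rule finite_subset)
  have closedU: "closed U"
    unfolding U_def using finR RM compact_simplex[OF simplex]
    by (intro closed_UN ballI compact_imp_closed) auto
  \<comment> \<open>The finitely many faces that miss z. A ball around z that avoids them meets only
    faces through z, so every facet crossed inside the ball is admissible for
    \<open>facet_step\<close>.\<close>
  define Fc where "Fc = {T. (\<exists>S\<in>M. T \<subseteq> S) \<and> z \<notin> convex hull T}"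
  have finPow: "finite (\<Union>S\<in>M. Pow S)" using finite_mesh vertices_finite by blast
  have finF: "finite Fc" by (rule finite_subset[OF _ finPow]) (auto simp: Fc_def)
  have "closed (\<Union>T\<in>Fc. convex hull T)"
  proof (rule closed_UN[OF finF], rule ballI)
    fix T assume "T \<in> Fc"
    then have "finite T" using vertices_finite finite_subset unfolding Fc_def by blast
    then show "closed (convex hull T)" by (intro compact_imp_closed finite_imp_compact_convex_hull)
  qed
  then have "open (- (\<Union>T\<in>Fc. convex hull T))" by (rule open_Compl)
  moreover have "z \<in> - (\<Union>T\<in>Fc. convex hull T)" by (auto simp: Fc_def)
  ultimately obtain r where r: "r > 0" "ball z r \<subseteq> - (\<Union>T\<in>Fc. convex hull T)"
    using open_contains_ball[of "- (\<Union>T\<in>Fc. convex hull T)"] by blast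
  have near: "z \<in> convex hull T" if "S \<in> M" "T \<subseteq> S" "p \<in> convex hull T" "p \<in> ball z r" for S T p
    using that r(2) unfolding Fc_def by blast
  have "ball z r \<subseteq> U"
  proof (rule ccontr)
    assume "\<not> ball z r \<subseteq> U"
    then obtain y where y: "y \<in> ball z r" "y \<notin> U" by blast
    have "open (ball z r - U)" using closedU by (intro open_Diff) auto
    then obtain \<delta> where \<delta>: "\<delta> > 0" "ball y \<delta> \<subseteq> ball z r - U"
      using y open_contains_ball[of "ball z r - U"] by blast
    have "z \<in> closure (interior (convex hull K))"
      using K(2) closure_subset[of "convex hull K"]
        convex_closure_interior[OF convex_convex_hull simplex_interior_nonempty[OF simplex[OF K(1)]]] by blast
    then obtain x where x: "x \<in> interior (convex hull K)" "dist x z < r"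
      using r(1) unfolding closure_approachable by blast
    have xz: "x \<in> ball z r" using x(2) by (simp add: dist_commute)
    \<comment> \<open>Faces with at most DIM - 1 vertices. Together with x each of them spans a null
      set, so an end point y' near y can be chosen such that the segment from x meets none of them
      after its start.\<close>
    define C where "C = {T. (\<exists>S\<in>M. T \<subseteq> S) \<and> card T + 1 \<le> DIM('a)}"
    have finC: "finite C" by (rule finite_subset[OF _ finPow]) (auto simp: C_def)
    have "negligible (\<Union>T\<in>C. affine hull (insert x T))"
    proof (rule negligible_Union)
      show "finite ((\<lambda>T. affine hull (insert x T)) ` C)" using finC by simp
      fix A assume "A \<in> (\<lambda>T. affine hull (insert x T)) ` C"
      then obtain T where T: "T \<in> C" "A = affine hull (insert x T)" by blast
      then have fT: "finite T" using vertices_finite finite_subset unfolding C_def by blast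
      have "card (insert x T) \<le> DIM('a)" using T(1) card_insert_le_m1[of "card T + 1" T x] fT
        unfolding C_def by (simp add: card_insert_if)
      then have "interior A = {}"
        unfolding T(2) using fT by (intro empty_interior_affine_hull) auto
      then show "negligible A"
        unfolding T(2) using negligible_convex_interior[OF affine_imp_convex[OF affine_affine_hull]] by blast
    qed
    moreover have "\<not> negligible (ball y \<delta>)"
      using \<delta>(1) by (simp add: negligible_convex_interior[OF convex_ball])
    ultimately obtain y' where y': "y' \<in> ball y \<delta>" "\<And>T. T \<in> C \<Longrightarrow> y' \<notin> affine hull (insert x T)"
      using negligible_subset[of "\<Union>T\<in>C. affine hull (insert x T)" "ball y \<delta>"] by blast
    have y'U: "y' \<notin> U" and y'z: "y' \<in> ball z r" using y'(1) \<delta>(2) by blast+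
    define d where "d = y' - x"
    define \<gamma> where "\<gamma> t = x + t *\<^sub>R d" for t
    have \<gamma>0: "\<gamma> 0 = x" and \<gamma>1: "\<gamma> 1 = y'" by (auto simp: \<gamma>_def d_def)
    have \<gamma>c: "continuous_on A \<gamma>" for A unfolding \<gamma>_def[abs_def] by (intro continuous_intros)
    have \<gamma>ball: "\<gamma> t \<in> ball z r" if "0 \<le> t" "t \<le> 1" for t
    proof -
      have "\<gamma> t = (1 - t) *\<^sub>R x + t *\<^sub>R y'" by (simp add: \<gamma>_def d_def algebra_simps)
      also have "\<dots> \<in> ball z r" using that xz y'z by (intro convexD[OF convex_ball]) auto
      finally show ?thesis .
    qed
    have avoid: "\<gamma> t \<notin> convex hull T" if "0 < t" "T \<in> C" for t T
    proof
      assume "\<gamma> t \<in> convex hull T"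
      then have "\<gamma> t \<in> affine hull (insert x T)"
        using convex_hull_subset_affine_hull[of T] hull_mono[of T "insert x T" affine] by blast
      moreover have "x \<in> affine hull (insert x T)" by (rule hull_inc) simp
      ultimately have "(1 - 1 / t) *\<^sub>R x + (1 / t) *\<^sub>R \<gamma> t \<in> affine hull (insert x T)"
        by (intro mem_affine[OF affine_affine_hull]) auto
      moreover have "(1 - 1 / t) *\<^sub>R x + (1 / t) *\<^sub>R \<gamma> t = y'"
        using that(1) by (simp add: \<gamma>_def d_def algebra_simps)
      ultimately show False using y'(2)[OF that(2)] by simp
    qed
    \<comment> \<open>I is compact and contains 0 but not 1; at its largest element t0 the segment
      leaves the reachable cells for good.\<close>
    define I where "I = {t \<in> {0..1}. \<gamma> t \<in> U}"
    have cI: "compact I"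
    proof -
      have "closed I"
      proof -
        have "I = {0..1} \<inter> \<gamma> -` U" by (auto simp: I_def)
        then show ?thesis using continuous_closed_preimage[OF \<gamma>c closed_atLeastAtMost closedU] by simp
      qed
      moreover have "bounded I" by (rule bounded_subset[of "{0..1}"]) (auto simp: I_def)
      ultimately show ?thesis by (simp add: compact_eq_bounded_closed)
    qed
    have xU: "x \<in> U" using KR x(1) interior_subset unfolding U_def by blast
    then have "0 \<in> I" by (simp add: I_def \<gamma>0)
    then obtain t0 where t0: "t0 \<in> I" "\<And>t. t \<in> I \<Longrightarrow> t \<le> t0"
      using compact_attains_sup[OF cI] by blast
    have t01: "0 \<le> t0" "t0 < 1"
    proof -
      show "0 \<le> t0" using t0(1) by (simp add: I_def)
      have "t0 \<le> 1" "t0 \<noteq> 1" using t0(1) y'U \<gamma>1 by (auto simp: I_def)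
      then show "t0 < 1" by simp
    qed
    have stuck: "\<gamma> t \<notin> U" if "t0 < t" "t \<le> 1" for t
      using t0(2)[of t] that t01 by (force simp: I_def)
    have advance: "\<exists>t>t0. t \<le> 1 \<and> dist (\<gamma> t0) (\<gamma> t) < e" if "e > 0" for e
    proof -
      have nd: "0 < norm d + 1" by (simp add: add_nonneg_pos)
      define \<tau> where "\<tau> = min (1 - t0) (e / 2 / (norm d + 1))"
      have \<tau>: "0 < \<tau>" "\<tau> \<le> 1 - t0" using that t01 nd by (auto simp: \<tau>_def)
      have "\<tau> * norm d \<le> e / 2 / (norm d + 1) * norm d" by (intro mult_right_mono) (auto simp: \<tau>_def)
      also have "\<dots> \<le> e / 2"
        using that nd by (simp add: divide_le_eq mult_left_mono)
      finally have "\<tau> * norm d < e" using that by simp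
      moreover have "\<gamma> (t0 + \<tau>) = \<gamma> t0 + \<tau> *\<^sub>R d" by (simp add: \<gamma>_def algebra_simps)
      ultimately show ?thesis using \<tau> by (intro exI[of _ "t0 + \<tau>"]) (auto simp: dist_norm)
    qed
    define p where "p = \<gamma> t0"
    have no_interior: "p \<notin> interior (convex hull L)" if L: "L \<in> R" for L
    proof
      assume "p \<in> interior (convex hull L)"
      then obtain e where e: "e > 0" "ball p e \<subseteq> convex hull L" unfolding mem_interior by blast
      obtain t where t: "t > t0" "t \<le> 1" "dist p (\<gamma> t) < e" using advance[OF e(1)] unfolding p_def by blast
      then have "\<gamma> t \<in> convex hull L" using e(2) by auto
      then show False using stuck[OF t(1,2)] L unfolding U_def by blast
    qed
    have t0pos: "0 < t0"
    proof (rule ccontr)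
      assume "\<not> 0 < t0"
      then have "p = x" using t01 by (simp add: p_def \<gamma>0)
      then show False using no_interior[OF KR] x(1) by simp
    qed
    obtain L where L: "L \<in> R" "p \<in> convex hull L" using t0(1) unfolding I_def U_def p_def by blast
    have LM: "L \<in> M" using L(1) RM by blast
    note sL = simplex[OF LM]
    have nonneg: "\<And>v. v \<in> L \<Longrightarrow> 0 \<le> bcoord L v p" using L(2) in_simplex_iff[OF sL] by blast
    have "\<not> (\<forall>v\<in>L. 0 < bcoord L v p)" using no_interior[OF L(1)] in_interior_simplex_iff[OF sL] by blast
    then obtain s where s: "s \<in> L" "\<not> 0 < bcoord L s p" by blast
    then have s: "s \<in> L" "bcoord L s p = 0" using nonneg[OF s(1)] by simp_all
    \<comment> \<open>A second vanishing coordinate would put p in a face of codimension two, which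
      the segment avoids. So p is in the relative interior of a single facet.\<close>
    have pos: "0 < bcoord L v p" if v: "v \<in> L" "v \<noteq> s" for v
    proof (rule ccontr)
      assume "\<not> 0 < bcoord L v p"
      then have "bcoord L v p = 0" using nonneg[OF v(1)] by simp
      then have "p \<in> convex hull (L - {s, v})"
        unfolding in_face_iff[OF sL Diff_subset] using nonneg s(2) by auto
      moreover have "L - {s, v} \<in> C"
        unfolding C_def using LM vertices_card[OF LM] vertices_finite[OF LM] s(1) v
        by (auto simp: card_Diff_subset)
      ultimately show False using avoid[OF t0pos] unfolding p_def by blast
    qed
    have pF: "p \<in> convex hull (L - {s})"
      unfolding in_face_iff[OF sL Diff_subset] using nonneg s(2) by auto
    have pball: "p \<in> ball z r" unfolding p_def using \<gamma>ball t01 by simp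
    have zF: "z \<in> convex hull (L - {s})" by (rule near[OF LM Diff_subset pF pball])
    have KL: "(K, L) \<in> (facet_step z)\<^sup>*" using L(1) by (simp add: R_def)
    have nbL: "nb L s \<noteq> {}" by (rule no_bd[OF KL s(1) zF])
    let ?L' = "nb L s"
    have L'M: "?L' \<in> M" by (rule nb_props(1)[OF nbL])
    note sL' = simplex[OF L'M]
    have "(L, ?L') \<in> facet_step z" unfolding facet_step_def using LM s(1) zF nbL by blast
    then have L'R: "?L' \<in> R" using KL unfolding R_def by (auto intro: rtrancl_into_rtrancl)
    obtain s' c where s': "s' \<in> ?L'" "?L' - {s'} = L - {s}" "c > 0"
      "\<And>x. bcoord ?L' s' x = - (c * bcoord L s x)"
      using nb_vertex[OF LM s(1) nbL] by blast
    have pos': "0 < bcoord ?L' v p" if v: "v \<in> L - {s}" for v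
      using bcoord_face_eq[OF sL sL' Diff_subset nb_props(3)[OF nbL] pF v] pos[of v] v by auto
    have "\<exists>e>0. \<forall>q. dist p q < e \<longrightarrow> (\<forall>v\<in>L - {s}. 0 < bcoord L v q)"
      by (rule positive_near) (use vertices_finite[OF LM] pos in \<open>auto intro: continuous_on_bcoord\<close>)
    then obtain e1 where e1: "e1 > 0" "\<And>q v. dist p q < e1 \<Longrightarrow> v \<in> L - {s} \<Longrightarrow> 0 < bcoord L v q" by blast
    have "\<exists>e>0. \<forall>q. dist p q < e \<longrightarrow> (\<forall>v\<in>L - {s}. 0 < bcoord ?L' v q)"
      by (rule positive_near) (use vertices_finite[OF LM] pos' in \<open>auto intro: continuous_on_bcoord\<close>)
    then obtain e2 where e2: "e2 > 0" "\<And>q v. dist p q < e2 \<Longrightarrow> v \<in> L - {s} \<Longrightarrow> 0 < bcoord ?L' v q" by blast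
    obtain t where t: "t > t0" "t \<le> 1" "dist p (\<gamma> t) < min e1 e2"
      using advance[of "min e1 e2"] e1(1) e2(1) unfolding p_def by auto
    show False
    \<comment> \<open>Just after t0 the sign of the coordinate of s decides whether the segment runs
      in L or, by the opposite sign in \<open>nb_vertex\<close>, in the cell across the facet. Both
      are reachable, which contradicts the choice of t0.\<close>
    proof (cases "0 \<le> bcoord L s (\<gamma> t)")
      case True
      have "0 \<le> bcoord L v (\<gamma> t)" if "v \<in> L" for v
        using True e1(2)[of "\<gamma> t" v] t(3) that by (cases "v = s") (auto intro: less_imp_le)
      then have "\<gamma> t \<in> convex hull L" unfolding in_simplex_iff[OF sL] by blast
      then show False using stuck[OF t(1,2)] L(1) unfolding U_def by blast
    next
      case False
      then have "0 \<le> bcoord ?L' s' (\<gamma> t)" unfolding s'(4) using s'(3) by (simp add: mult_le_0_iff)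
      moreover have "0 \<le> bcoord ?L' v (\<gamma> t)" if "v \<in> ?L'" "v \<noteq> s'" for v
      proof -
        have "v \<in> L - {s}" using that s'(2) by blast
        then show ?thesis using e2(2)[of "\<gamma> t" v] t(3) by simp
      qed
      ultimately have "\<gamma> t \<in> convex hull ?L'" unfolding in_simplex_iff[OF sL'] by blast
      then show False using stuck[OF t(1,2)] L'R unfolding U_def by blast
    qed
  qed
  then show ?thesis using r(1) unfolding U_def R_def by blast
qed

text \<open>Otherwise the reachable cells would cover a ball around z, making z an interior point of
  the closure and hence a point of \<Omega>.\<close>

lemma frontier_reaches_boundary_facet:
  assumes "z \<in> frontier \<Omega>" "K \<in> M" "z \<in> convex hull K"
  shows "\<exists>L s. (K, L) \<in> (facet_step z)\<^sup>* \<and> s \<in> L \<and> z \<in> convex hull (L - {s}) \<and> nb L s = {}"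
proof (rule ccontr)
  assume "\<not> ?thesis"
  then obtain r where r: "r > 0" "ball z r \<subseteq> (\<Union>L\<in>{L. (K, L) \<in> (facet_step z)\<^sup>*}. convex hull L)"
    using reachable_cells_cover[OF assms(2,3)] by blast
  then have "ball z r \<subseteq> closure \<Omega>" using facet_step_mesh assms(2) cells_union by blast
  then have "z \<in> interior (closure \<Omega>)" using r(1) mem_interior by blast
  then show False using assms(1) regular_open open_dom by (simp add: frontier_def interior_open)
qed

text \<open>The reachable cells cover a ball around z, and interior points of K' come arbitrarily
  close to z. Such a point belongs to no cell but K', so K' is among the reachable ones.\<close>

lemma reachable_or_boundary:
  assumes "K \<in> M" "z \<in> convex hull K" "K' \<in> M" "z \<in> convex hull K'"
    and no_bd: "\<And>L s. (K, L) \<in> (facet_step z)\<^sup>* \<Longrightarrow> s \<in> L \<Longrightarrow> z \<in> convex hull (L - {s}) \<Longrightarrow> nb L s \<noteq> {}"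
  shows "(K, K') \<in> (facet_step z)\<^sup>*"
proof -
  obtain r where r: "r > 0" "ball z r \<subseteq> (\<Union>L\<in>{L. (K, L) \<in> (facet_step z)\<^sup>*}. convex hull L)"
    using reachable_cells_cover[OF assms(1,2) no_bd] by blast
  have "z \<in> closure (interior (convex hull K'))"
    using assms(4) closure_subset[of "convex hull K'"]
      convex_closure_interior[OF convex_convex_hull simplex_interior_nonempty[OF simplex[OF assms(3)]]] by blast
  then obtain x where x: "x \<in> interior (convex hull K')" "dist x z < r"
    using r(1) unfolding closure_approachable by blast
  then have "x \<in> ball z r" by (simp add: dist_commute)
  then obtain L where L: "(K, L) \<in> (facet_step z)\<^sup>*" "x \<in> convex hull L" using r(2) by blast
  have "L = K'" by (rule interior_cell_unique[OF assms(3) facet_step_mesh[OF L(1) assms(1)] x(1) L(2)])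
  then show ?thesis using L(1) by simp
qed

end

section \<open>Shape regularity and nodal averaging\<close>

lemma measure_homothety:
  fixes K :: "'a::euclidean_space set"
  assumes "0 < t" "compact K"
  shows "measure lebesgue ((\<lambda>x. s + t *\<^sub>R (x - s)) ` K) = t ^ DIM('a) * measure lebesgue K"
proof -
  let ?K = "(\<lambda>x. s + t *\<^sub>R (x - s)) ` K"
  have "compact ?K" by (intro compact_continuous_image continuous_intros assms)
  then have "?K \<in> sets borel" "K \<in> sets borel" using assms(2) by (auto simp: borel_compact)
  then show ?thesis
    using LINT_scale[OF assms, of "\<lambda>_. 1" s] by (simp add: set_lebesgue_integral_def mult.commute)
qed

section \<open>Comparison of neighbouring cells\<close>

context simplicial_mesh
begin

abbreviation diam :: "'a set \<Rightarrow> real" where "diam S \<equiv> diameter (convex hull S)"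
abbreviation vol :: "'a set \<Rightarrow> real" where "vol S \<equiv> measure lebesgue (convex hull S)"

definition \<omega> :: real where "\<omega> = unit_ball_vol (real DIM('a))"
text \<open>The scale-free bound of \<open>bgrad_bound\<close> for gradient times diameter.\<close>

definition G :: real where "G = \<omega> * 2 ^ DIM('a) * \<kappa>"

lemma dim2: "2 \<le> DIM('a)" using dim_cases by auto

lemma omega_pos: "0 < \<omega>" unfolding \<omega>_def by (rule unit_ball_vol_pos) simp

lemma diam_pos: "S \<in> M \<Longrightarrow> 0 < diam S" and vol_pos: "S \<in> M \<Longrightarrow> 0 < vol S"
  by (rule simplex_diameter_pos[OF simplex], assumption, rule simplex_measure_pos[OF simplex], assumption)

lemma mesh_nonempty: "\<exists>S. S \<in> M"
  using cells_union dom_nonempty closure_subset by blast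

lemma kappa_pos: "0 < \<kappa>"
proof -
  obtain S where S: "S \<in> M" using mesh_nonempty by blast
  have "0 < \<kappa> * vol S" using shape[OF S] diam_pos[OF S] by (meson less_le_trans zero_less_power)
  then show ?thesis using vol_pos[OF S] by (simp add: zero_less_mult_iff)
qed

lemma bgrad_diam: "S \<in> M \<Longrightarrow> s \<in> S \<Longrightarrow> norm (bgrad S s) * diam S \<le> G"
  unfolding G_def \<omega>_def by (rule bgrad_bound[OF simplex _ shape])

text \<open>The common edge from a to b has length at most diam S' and, by the gradient bound in S,
  at least diam S / G.\<close>

lemma diam_compare:
  assumes "S \<in> M" "S' \<in> M" "a \<in> S \<inter> S'" "b \<in> S \<inter> S'" "a \<noteq> b"
  shows "diam S \<le> G * diam S'"
proof -
  have 1: "1 \<le> norm (bgrad S a) * norm (a - b)"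
    using bgrad_edge(2)[OF simplex[OF assms(1)], of a b] assms by auto
  have 2: "norm (a - b) \<le> diam S'"
    using assms by (intro simplex_dist_le_diameter[OF simplex] hull_inc) auto
  have "diam S * 1 \<le> diam S * (norm (bgrad S a) * norm (a - b))"
    using 1 diam_pos[OF assms(1)] by (intro mult_left_mono) auto
  also have "\<dots> = (norm (bgrad S a) * diam S) * norm (a - b)" by simp
  also have "\<dots> \<le> G * norm (a - b)" using bgrad_diam[OF assms(1)] assms(3) by (intro mult_right_mono) auto
  also have "\<dots> \<le> G * diam S'"
  proof (rule mult_left_mono[OF 2])
    show "0 \<le> G" unfolding G_def using omega_pos kappa_pos by simp
  qed
  finally show ?thesis by simp
qed

lemma G_ge_1: "1 \<le> G"
proof -
  obtain S where S: "S \<in> M" using mesh_nonempty by blast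
  obtain a where a: "a \<in> S" using simplex_verticesD(4)[OF simplex[OF S]] by blast
  obtain b where b: "b \<in> S" "b \<noteq> a" using simplex_other_vertex[OF simplex[OF S]] by blast
  have "1 * diam S \<le> G * diam S" using diam_compare[OF S S, of a b] a b by simp
  then show ?thesis using diam_pos[OF S] by (simp only: mult_le_cancel_right_pos)
qed

lemma vol_le: "S \<in> M \<Longrightarrow> vol S \<le> \<omega> * diam S ^ DIM('a)"
  unfolding \<omega>_def by (rule simplex_measure_le[OF simplex])

text \<open>The weight under which a squared difference of cell values scales like a squared
  gradient norm on the cell. Its reciprocal bounds the squared norm of the Raviart-Thomas shape
  fields of the cell.\<close>

definition m :: "'a set \<Rightarrow> real" where "m S = vol S / diam S ^ 2"
text \<open>The largest ratio of weights across a facet; the summand 1 ensures that powers of q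
  increase with the exponent.\<close>

definition q :: real where "q = 1 + \<omega> * \<kappa> * G ^ DIM('a)"

lemma m_pos: "S \<in> M \<Longrightarrow> 0 < m S"
  unfolding m_def by (intro divide_pos_pos zero_less_power vol_pos diam_pos)

lemma q_ge_1: "1 \<le> q"
  unfolding q_def using omega_pos kappa_pos G_ge_1 by simp

text \<open>In dimension at least 2 a common facet contains an edge, so the diameters are
  comparable. By shape regularity m is comparable to the diameter to the power DIM - 2, and the
  comparison carries over.\<close>

lemma m_neighbour:
  assumes "S \<in> M" "s \<in> S" "nb S s \<noteq> {}"
  shows "m S \<le> q * m (nb S s)"
proof -
  let ?S' = "nb S s" and ?k = "DIM('a) - 2"
  note p = nb_props[OF assms(3)]
  have "card (S - {s}) = DIM('a)" using vertices_card[OF assms(1)] vertices_finite[OF assms(1)] assms(2) by simp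
  then have "\<not> card (S - {s}) \<le> Suc 0" using dim2 by simp
  then obtain a b where ab: "a \<in> S - {s}" "b \<in> S - {s}" "a \<noteq> b"
    using vertices_finite[OF assms(1)] by (metis card_le_Suc0_iff_eq finite_Diff)
  then have le: "diam S \<le> G * diam ?S'"
    using diam_compare[OF assms(1) p(1), of a b] p(3) by blast
  have pow: "diam K ^ DIM('a) = diam K ^ 2 * diam K ^ ?k" for K :: "'a set"
    unfolding power_add[symmetric] using dim2 by (simp only: le_add_diff_inverse)
  have "m S \<le> \<omega> * diam S ^ ?k"
    unfolding m_def using vol_le[OF assms(1)] diam_pos[OF assms(1)] by (simp add: pow divide_le_eq mult_ac)
  also have "\<dots> \<le> \<omega> * (G * diam ?S') ^ ?k"
    using le diam_pos[OF assms(1)] omega_pos by (intro mult_left_mono power_mono) auto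
  also have "\<dots> = \<omega> * G ^ ?k * diam ?S' ^ ?k" by (simp add: power_mult_distrib)
  also have "\<dots> \<le> \<omega> * G ^ DIM('a) * (\<kappa> * m ?S')"
  proof (rule mult_mono)
    show "\<omega> * G ^ ?k \<le> \<omega> * G ^ DIM('a)"
      using omega_pos G_ge_1 by (intro mult_left_mono power_increasing) auto
    have "diam ?S' ^ 2 * diam ?S' ^ ?k \<le> \<kappa> * vol ?S'" using shape[OF p(1)] by (simp add: pow)
    then show "diam ?S' ^ ?k \<le> \<kappa> * m ?S'"
      unfolding m_def using diam_pos[OF p(1)] by (simp add: pos_le_divide_eq mult_ac)
  qed (use omega_pos G_ge_1 diam_pos[OF p(1)] in auto)
  also have "\<dots> \<le> q * m ?S'"
    unfolding q_def using m_pos[OF p(1)] by (simp add: distrib_right mult_ac)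
  finally show ?thesis .
qed

text \<open>Shrink every cell at z towards z until its diameter is the smallest one, \<rho>. The
  shrunken cells keep disjoint interiors, lie in the ball of radius \<rho>, and have volume at least
  \<rho> ^ DIM / \<kappa>.\<close>

lemma patch_card: "real (card {S \<in> M. z \<in> S}) \<le> \<omega> * \<kappa>"
proof (cases "{S \<in> M. z \<in> S} = {}")
  case True
  then have "card {S \<in> M. z \<in> S} = 0" by (simp only: card.empty)
  then show ?thesis using omega_pos kappa_pos by simp
next
  case False
  let ?P = "{S \<in> M. z \<in> S}"
  have fin: "finite ?P" using finite_mesh by simp
  define \<rho> where "\<rho> = Min (diam ` ?P)"
  have \<rho>: "\<rho> \<le> diam S" if "S \<in> ?P" for S unfolding \<rho>_def using fin that by (intro Min_le) auto
  have \<rho>0: "0 < \<rho>" unfolding \<rho>_def using fin False diam_pos by (subst Min_gr_iff) auto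
  define T where "T S x = z + (\<rho> / diam S) *\<^sub>R (x - z)" for S x
  have "real (card ?P) * (\<rho> ^ DIM('a) / \<kappa>) \<le> measure lebesgue (cball z \<rho>)"
  proof (rule packing_card_le[OF fin, where A="\<lambda>S. interior (T S ` (convex hull S))"])
    fix S assume S: "S \<in> ?P"
    then have SM: "S \<in> M" and zS: "z \<in> convex hull S" by (auto intro: hull_inc)
    have d: "0 < \<rho> / diam S" "\<rho> / diam S \<le> 1" using \<rho>[OF S] \<rho>0 diam_pos[OF SM] by auto
    have c: "compact (T S ` (convex hull S))"
      unfolding T_def by (intro compact_continuous_image continuous_intros compact_simplex simplex SM)
    then have b: "bounded (T S ` (convex hull S))" by (rule compact_imp_bounded)
    show "interior (T S ` (convex hull S)) \<in> lmeasurable" using b by (rule lmeasurable_interior)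
    have "T S ` (convex hull S) = (\<lambda>x. (z - (\<rho> / diam S) *\<^sub>R z) + (\<rho> / diam S) *\<^sub>R x) ` (convex hull S)"
      by (simp add: T_def[abs_def] algebra_simps)
    then have "convex (T S ` (convex hull S))" by (simp only: convex_affinity convex_convex_hull)
    then have "measure lebesgue (interior (T S ` (convex hull S))) = measure lebesgue (T S ` (convex hull S))"
      by (intro measure_interior b negligible_convex_frontier)
    also have "\<dots> = (\<rho> / diam S) ^ DIM('a) * vol S"
      unfolding T_def using measure_homothety[OF d(1) compact_simplex[OF simplex[OF SM]]] .
    also have "\<dots> = \<rho> ^ DIM('a) * (vol S / diam S ^ DIM('a))" by (simp add: power_divide)
    also have "\<dots> \<ge> \<rho> ^ DIM('a) * (1 / \<kappa>)"
    proof (rule mult_left_mono)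
      show "1 / \<kappa> \<le> vol S / diam S ^ DIM('a)"
        using shape[OF SM] kappa_pos diam_pos[OF SM] by (simp add: field_simps)
    qed (use \<rho>0 in simp)
    finally show "\<rho> ^ DIM('a) / \<kappa> \<le> measure lebesgue (interior (T S ` (convex hull S)))" by simp
    have "T S ` (convex hull S) \<subseteq> cball z \<rho>"
    proof
      fix y assume "y \<in> T S ` (convex hull S)"
      then obtain x where x: "x \<in> convex hull S" "y = T S x" by blast
      have "norm (x - z) \<le> diam S" by (rule simplex_dist_le_diameter[OF simplex[OF SM] x(1) zS])
      then have "\<rho> / diam S * norm (x - z) \<le> \<rho> / diam S * diam S" using d by (intro mult_left_mono) auto
      then show "y \<in> cball z \<rho>" using diam_pos[OF SM] \<rho>0 by (simp add: x(2) T_def dist_norm)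
    qed
    then show "interior (T S ` (convex hull S)) \<subseteq> cball z \<rho>" using interior_subset by blast
  next
    have sub: "interior (T S ` (convex hull S)) \<subseteq> interior (convex hull S)" if S: "S \<in> ?P" for S
    proof (rule interior_mono, rule subsetI)
      have SM: "S \<in> M" and zS: "z \<in> convex hull S" using S by (auto intro: hull_inc)
      have d: "0 \<le> \<rho> / diam S" "\<rho> / diam S \<le> 1" using \<rho>[OF S] \<rho>0 diam_pos[OF SM] by auto
      fix y assume "y \<in> T S ` (convex hull S)"
      then obtain x where x: "x \<in> convex hull S" "y = T S x" by blast
      have "y = (1 - \<rho> / diam S) *\<^sub>R z + (\<rho> / diam S) *\<^sub>R x" by (simp add: x(2) T_def algebra_simps)
      then show "y \<in> convex hull S" using d x(1) zS by (simp add: convexD[OF convex_convex_hull])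
    qed
    show "pairwise (\<lambda>S S'. disjnt (interior (T S ` (convex hull S))) (interior (T S' ` (convex hull S')))) ?P"
      unfolding pairwise_def disjnt_iff
    proof (intro ballI impI allI notI)
      fix S S' x assume a: "S \<in> ?P" "S' \<in> ?P" "S \<noteq> S'"
        "x \<in> interior (T S ` (convex hull S)) \<and> x \<in> interior (T S' ` (convex hull S'))"
      then have "x \<in> interior (convex hull S)" "x \<in> convex hull S'"
        using sub[OF a(1)] sub[OF a(2)] interior_subset by blast+
      then show False using interior_cell_unique[of S S' x] a(1,2,3) by blast
    qed
  qed simp
  also have "measure lebesgue (cball z \<rho>) = \<omega> * \<rho> ^ DIM('a)"
    unfolding \<omega>_def using measure_lebesgue_cball[of \<rho> z] \<rho>0 by simp
  finally have "real (card ?P) * \<rho> ^ DIM('a) \<le> (\<omega> * \<kappa>) * \<rho> ^ DIM('a)"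
    using kappa_pos by (simp add: pos_divide_le_eq mult_ac)
  then show ?thesis using \<rho>0 by (simp only: mult_le_cancel_right_pos zero_less_power)
qed

text \<open>Beyond a boundary facet w counts as 0. The energy of the jumps thus encodes the
  homogeneous Dirichlet condition and controls w itself, not only its differences.\<close>

definition jump :: "('a set \<Rightarrow> real) \<Rightarrow> 'a set \<Rightarrow> 'a \<Rightarrow> real" where
  "jump w S s = w S - (if nb S s = {} then 0 else w (nb S s))"

definition cell_energy :: "('a set \<Rightarrow> real) \<Rightarrow> 'a set \<Rightarrow> real" where
  "cell_energy w S = (\<Sum>s\<in>S. m S * (jump w S s)\<^sup>2)"

definition patch_energy :: "('a set \<Rightarrow> real) \<Rightarrow> 'a \<Rightarrow> real" where
  "patch_energy w z = (\<Sum>S\<in>{S\<in>M. z \<in> S}. cell_energy w S)"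

lemma cell_energy_nonneg: "S \<in> M \<Longrightarrow> 0 \<le> cell_energy w S"
  unfolding cell_energy_def using m_pos by (intro sum_nonneg) (simp add: less_imp_le)

lemma patch_energy_nonneg: "0 \<le> patch_energy w z"
  unfolding patch_energy_def using cell_energy_nonneg by (intro sum_nonneg) auto

lemma jump_le_patch_energy:
  assumes "S \<in> M" "z \<in> S" "s \<in> S"
  shows "sqrt (m S) * \<bar>jump w S s\<bar> \<le> sqrt (patch_energy w z)"
proof -
  have "m S * (jump w S s)\<^sup>2 \<le> cell_energy w S"
    unfolding cell_energy_def using m_pos[OF assms(1)]
    by (intro member_le_sum[OF assms(3)] vertices_finite[OF assms(1)]) (simp add: less_imp_le)
  also have "\<dots> \<le> patch_energy w z"
    unfolding patch_energy_def using assms(1,2) finite_mesh cell_energy_nonneg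
    by (intro member_le_sum) auto
  finally have "sqrt (m S * (jump w S s)\<^sup>2) \<le> sqrt (patch_energy w z)" by (rule real_sqrt_le_mono)
  then show ?thesis by (simp add: real_sqrt_mult)
qed

lemma vertex_of_cell:
  assumes "S \<in> M" "z \<in> S" "L \<in> M" "z \<in> convex hull L"
  shows "z \<in> L"
proof (rule ccontr)
  assume "z \<notin> L"
  have "z \<in> convex hull (S \<inter> L)" using cells_inter[OF assms(1,3)] hull_inc[OF assms(2)] assms(4) by blast
  then have "bcoord S z z = 0"
    using in_face_iff[OF simplex[OF assms(1)], of "S \<inter> L" z] assms(2) \<open>z \<notin> L\<close> by blast
  then show False using bcoord_vertex[OF simplex[OF assms(1)] assms(2,2)] by simp
qed

text \<open>A bound for the number of facet crossings around one vertex: at most \<omega> \<kappa>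
  cells with DIM + 1 facets each. A reachable cell can be reached in at most that many
  steps.\<close>

definition path_length :: nat where "path_length = nat \<lceil>\<omega> * \<kappa>\<rceil> * (DIM('a) + 1)"

lemma card_facet_step:
  assumes "S \<in> M" "z \<in> S"
  shows "finite (facet_step z)" "card (facet_step z) \<le> path_length"
proof -
  let ?I = "SIGMA L:{L\<in>M. z \<in> L}. L"
  have fin: "finite ?I" using finite_mesh vertices_finite by (intro finite_SigmaI) auto
  have sub: "facet_step z \<subseteq> (\<lambda>(L, s). (L, nb L s)) ` ?I"
  proof
    fix p assume "p \<in> facet_step z"
    then obtain L s where p: "p = (L, nb L s)" "L \<in> M" "s \<in> L" "z \<in> convex hull (L - {s})"
      unfolding facet_step_def by blast
    then have "z \<in> convex hull L" using hull_mono[of "L - {s}" L convex] by blast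
    then have "z \<in> L" using vertex_of_cell assms p(2) by blast
    then have "(L, s) \<in> ?I" using p by blast
    then show "p \<in> (\<lambda>(L, s). (L, nb L s)) ` ?I" using p(1) by (intro image_eqI[of _ _ "(L, s)"]) auto
  qed
  show "finite (facet_step z)" using finite_subset[OF sub] fin by blast
  have "card (facet_step z) \<le> card ?I" using surj_card_le[OF fin sub] .
  also have "\<dots> = (\<Sum>L\<in>{L\<in>M. z \<in> L}. card L)" using finite_mesh vertices_finite by (intro card_SigmaI) auto
  also have "\<dots> = card {L\<in>M. z \<in> L} * (DIM('a) + 1)" using vertices_card by simp
  also have "\<dots> \<le> path_length"
    unfolding path_length_def
  proof (rule mult_right_mono)
    show "card {L \<in> M. z \<in> L} \<le> nat \<lceil>\<omega> * \<kappa>\<rceil>" using patch_card[of z] by linarith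
  qed simp
  finally show "card (facet_step z) \<le> path_length" .
qed

text \<open>A telescoping sum of jumps. Every jump is weighted by m of the cell it starts from, so
  each step costs a factor q to return to the weight of K.\<close>

lemma path_estimate_relpow:
  assumes "K \<in> M" "z \<in> K" "(K, L) \<in> facet_step z ^^ k"
  shows "sqrt (m K) * \<bar>w K - w L\<bar> \<le> real k * q ^ k * sqrt (patch_energy w z) \<and> m K \<le> q ^ k * m L"
  using assms(3)
proof (induction k arbitrary: L)
  case 0
  then show ?case by simp
next
  case (Suc k)
  let ?D = "sqrt (patch_energy w z)"
  obtain L' where L': "(K, L') \<in> facet_step z ^^ k" "(L', L) \<in> facet_step z" using Suc.prems by auto
  obtain s where s: "L' \<in> M" "s \<in> L'" "z \<in> convex hull (L' - {s})" "nb L' s \<noteq> {}" "L = nb L' s"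
    using L'(2) unfolding facet_step_def by blast
  note IH = Suc.IH[OF L'(1)]
  have "z \<in> convex hull L'" using s(3) hull_mono[of "L' - {s}" L' convex] by blast
  then have zL': "z \<in> L'" using vertex_of_cell[OF assms(1,2) s(1)] by blast
  have q0: "0 \<le> q" "1 \<le> q ^ k" "q ^ k \<le> q ^ Suc k" using q_ge_1 by (auto intro: power_increasing)
  have j: "sqrt (m L') * \<bar>w L' - w L\<bar> \<le> ?D"
    using jump_le_patch_energy[OF s(1) zL' s(2), of w] s(4,5) by (simp add: jump_def)
  \<comment> \<open>Squaring the factor is a deliberate loss: its square root is again the power q ^
    k.\<close>
  have "m K \<le> (q ^ k)\<^sup>2 * m L'"
  proof -
    have "q ^ k * m L' \<le> (q ^ k * q ^ k) * m L'"
      using q0 m_pos[OF s(1)] by (intro mult_right_mono) auto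
    then show ?thesis using IH by (simp add: power2_eq_square)
  qed
  then have "sqrt (m K) \<le> sqrt ((q ^ k)\<^sup>2 * m L')" by (rule real_sqrt_le_mono)
  also have "\<dots> = q ^ k * sqrt (m L')" using q0 by (simp add: real_sqrt_mult)
  finally have sm: "sqrt (m K) \<le> q ^ k * sqrt (m L')" .
  have "sqrt (m K) * \<bar>w K - w L\<bar> \<le> sqrt (m K) * \<bar>w K - w L'\<bar> + sqrt (m K) * \<bar>w L' - w L\<bar>"
    unfolding distrib_left[symmetric] using m_pos[OF assms(1)] by (intro mult_left_mono) auto
  also have "\<dots> \<le> real k * q ^ k * ?D + q ^ k * ?D"
  proof (rule add_mono)
    show "sqrt (m K) * \<bar>w K - w L'\<bar> \<le> real k * q ^ k * ?D" using IH by blast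
    have "sqrt (m K) * \<bar>w L' - w L\<bar> \<le> (q ^ k * sqrt (m L')) * \<bar>w L' - w L\<bar>" using sm by (intro mult_right_mono) auto
    also have "\<dots> \<le> q ^ k * ?D" using mult_left_mono[OF j, of "q ^ k"] q0 by (simp add: mult_ac)
    finally show "sqrt (m K) * \<bar>w L' - w L\<bar> \<le> q ^ k * ?D" .
  qed
  also have "\<dots> = real (Suc k) * q ^ k * ?D" by (simp add: distrib_right)
  also have "\<dots> \<le> real (Suc k) * q ^ Suc k * ?D"
    using q0 patch_energy_nonneg by (intro mult_right_mono mult_left_mono) auto
  finally have 1: "sqrt (m K) * \<bar>w K - w L\<bar> \<le> real (Suc k) * q ^ Suc k * ?D" .
  have "m K \<le> q ^ k * (q * m (nb L' s))"
    using IH mult_left_mono[OF m_neighbour[OF s(1,2,4)], of "q ^ k"] q0 by linarith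
  then have "m K \<le> q ^ Suc k * m L" using s(5) by (simp add: mult_ac)
  with 1 show ?case by blast
qed

lemma path_estimate:
  assumes "K \<in> M" "z \<in> K" "(K, L) \<in> (facet_step z)\<^sup>*"
  shows "sqrt (m K) * \<bar>w K - w L\<bar> \<le> real path_length * q ^ path_length * sqrt (patch_energy w z)"
    and "m K \<le> q ^ path_length * m L"
proof -
  obtain k where k: "k \<le> card (facet_step z)" "(K, L) \<in> facet_step z ^^ k"
    using assms(3) rtrancl_finite_eq_relpow[OF card_facet_step(1)[OF assms(1,2)]] by blast
  have kl: "k \<le> path_length" using k(1) card_facet_step(2)[OF assms(1,2)] by linarith
  have pw: "q ^ k \<le> q ^ path_length" "1 \<le> q ^ k" using kl q_ge_1 by (auto intro: power_increasing)
  have L: "L \<in> M" using facet_step_mesh[OF assms(3,1)] .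
  note e = path_estimate_relpow[OF assms(1,2) k(2), of w]
  have "real k * q ^ k * sqrt (patch_energy w z) \<le> real path_length * q ^ path_length * sqrt (patch_energy w z)"
    using kl pw patch_energy_nonneg by (intro mult_right_mono mult_mono) auto
  then show "sqrt (m K) * \<bar>w K - w L\<bar> \<le> real path_length * q ^ path_length * sqrt (patch_energy w z)"
    using e by linarith
  have "q ^ k * m L \<le> q ^ path_length * m L" using pw m_pos[OF L] by (intro mult_right_mono) auto
  then show "m K \<le> q ^ path_length * m L" using e by linarith
qed

section \<open>Nodal values of a piecewise constant function\<close>

definition boundary_vertex :: "'a \<Rightarrow> bool" where
  "boundary_vertex z \<longleftrightarrow> (\<exists>S\<in>M. \<exists>s\<in>S. z \<in> convex hull (S - {s}) \<and> nb S s = {})"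

text \<open>The value of a single cell stands in for the average: at a vertex on no boundary facet
  all cells are joined by facet paths, so any choice is controlled by the jumps. The value 0 at
  boundary vertices makes the interpolant vanish on the frontier.\<close>

definition nodal :: "('a set \<Rightarrow> real) \<Rightarrow> 'a \<Rightarrow> real" where
  "nodal w z = (if boundary_vertex z then 0 else w (SOME K. K \<in> M \<and> z \<in> K))"

definition nodal_const :: real where
  "nodal_const = (real path_length + 1) * q ^ path_length"

text \<open>If a path from K reaches a boundary facet at z, then the nodal value is 0 and the last
  jump is the full value of w there. Otherwise every cell at z is reachable, in particular the one
  that supplied the nodal value.\<close>

lemma nodal_estimate:
  assumes "K \<in> M" "z \<in> K"
  shows "m K * (w K - nodal w z)\<^sup>2 \<le> nodal_const\<^sup>2 * patch_energy w z"
proof -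
  let ?D = "sqrt (patch_energy w z)" and ?B = path_length
  have zK: "z \<in> convex hull K" by (rule hull_inc[OF assms(2)])
  have q0: "1 \<le> q ^ ?B" using q_ge_1 by simp
  have D0: "0 \<le> ?D" using patch_energy_nonneg by simp
  have "sqrt (m K) * \<bar>w K - nodal w z\<bar> \<le> nodal_const * ?D"
  proof (cases "\<exists>L s. (K, L) \<in> (facet_step z)\<^sup>* \<and> s \<in> L \<and> z \<in> convex hull (L - {s}) \<and> nb L s = {}")
    case True
    then obtain L s where L: "(K, L) \<in> (facet_step z)\<^sup>*" "s \<in> L" "z \<in> convex hull (L - {s})" "nb L s = {}" by blast
    have LM: "L \<in> M" using facet_step_mesh[OF L(1) assms(1)] .
    have "boundary_vertex z" unfolding boundary_vertex_def using LM L by blast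
    then have n0: "nodal w z = 0" by (simp add: nodal_def)
    have "z \<in> convex hull L" using L(3) hull_mono[of "L - {s}" L convex] by blast
    then have zL: "z \<in> L" using vertex_of_cell[OF assms LM] by blast
    have j: "sqrt (m L) * \<bar>w L\<bar> \<le> ?D" using jump_le_patch_energy[OF LM zL L(2), of w] L(4) by (simp add: jump_def)
    have "m K \<le> (q ^ ?B)\<^sup>2 * m L"
    proof -
      have "q ^ ?B * m L \<le> (q ^ ?B * q ^ ?B) * m L" using q0 m_pos[OF LM] by (intro mult_right_mono) auto
      then show ?thesis using path_estimate(2)[OF assms L(1)] by (simp add: power2_eq_square)
    qed
    then have "sqrt (m K) \<le> sqrt ((q ^ ?B)\<^sup>2 * m L)" by (rule real_sqrt_le_mono)
    also have "\<dots> = q ^ ?B * sqrt (m L)" using q0 by (simp add: real_sqrt_mult)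
    finally have sm: "sqrt (m K) * \<bar>w L\<bar> \<le> (q ^ ?B * sqrt (m L)) * \<bar>w L\<bar>" by (intro mult_right_mono) auto
    have s2: "(q ^ ?B * sqrt (m L)) * \<bar>w L\<bar> \<le> q ^ ?B * ?D" using mult_left_mono[OF j, of "q ^ ?B"] q0 by (simp add: mult_ac)
    have "sqrt (m K) * \<bar>w K\<bar> \<le> sqrt (m K) * \<bar>w K - w L\<bar> + sqrt (m K) * \<bar>w L\<bar>"
      unfolding distrib_left[symmetric] using m_pos[OF assms(1)] by (intro mult_left_mono) auto
    then have "sqrt (m K) * \<bar>w K\<bar> \<le> real ?B * q ^ ?B * ?D + q ^ ?B * ?D"
      using path_estimate(1)[OF assms L(1), of w] sm s2 by linarith
    then show ?thesis by (simp add: n0 nodal_const_def algebra_simps)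
  next
    case False
    have reach: "(K, K') \<in> (facet_step z)\<^sup>*" if "K' \<in> M" "z \<in> convex hull K'" for K'
      by (rule reachable_or_boundary[OF assms(1) zK that]) (use False in blast)
    \<comment> \<open>A boundary facet through z would belong to a cell that is reachable as well,
      against the case assumption.\<close>
    have "\<not> boundary_vertex z"
    proof
      assume "boundary_vertex z"
      then obtain S s where S: "S \<in> M" "s \<in> S" "z \<in> convex hull (S - {s})" "nb S s = {}" unfolding boundary_vertex_def by blast
      then have "z \<in> convex hull S" using hull_mono[of "S - {s}" S convex] by blast
      then show False using reach[OF S(1)] S False by blast
    qed
    moreover define K' where "K' = (SOME K. K \<in> M \<and> z \<in> K)"
    ultimately have n: "nodal w z = w K'" by (simp add: nodal_def)
    have K': "K' \<in> M" "z \<in> K'" unfolding K'_def using someI[of "\<lambda>K. K \<in> M \<and> z \<in> K" K] assms by blast+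
    have "real ?B * q ^ ?B * ?D \<le> nodal_const * ?D"
      unfolding nodal_const_def using q0 D0 by (intro mult_right_mono) auto
    then show ?thesis
      using path_estimate(1)[OF assms reach[OF K'(1) hull_inc[OF K'(2)]], of w] unfolding n by linarith
  qed
  then have "(sqrt (m K) * \<bar>w K - nodal w z\<bar>)\<^sup>2 \<le> (nodal_const * ?D)\<^sup>2"
    using m_pos[OF assms(1)] by (intro power_mono) auto
  then show ?thesis using m_pos[OF assms(1)] patch_energy_nonneg by (simp add: power_mult_distrib)
qed

end

section \<open>A conforming lifting of piecewise constants\<close>

context simplicial_mesh
begin

definition cell_grad :: "('a \<Rightarrow> real) \<Rightarrow> 'a set \<Rightarrow> 'a" where
  "cell_grad a S = (\<Sum>s\<in>S. a s *\<^sub>R bgrad S s)"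

text \<open>On the frontier of a cell several choices of S compete; \<open>interpolant_cell\<close>
  shows that they agree. The value 0 outside makes it a function on the whole space, as
  \<open>H10_lipschitz\<close> needs.\<close>

definition interpolant :: "('a \<Rightarrow> real) \<Rightarrow> 'a \<Rightarrow> real" where
  "interpolant a x = (if x \<in> closure \<Omega> then
     (let S = (SOME S. S \<in> M \<and> x \<in> convex hull S) in \<Sum>s\<in>S. a s * bcoord S s x) else 0)"

text \<open>By conformity x lies in the common face of the two cells. Coordinates of vertices
  outside this face vanish at x, and those of shared vertices coincide.\<close>

lemma interpolant_cell:
  assumes S: "S \<in> M" "x \<in> convex hull S"
  shows "interpolant a x = (\<Sum>s\<in>S. a s * bcoord S s x)"
proof -
  define S' where "S' = (SOME S. S \<in> M \<and> x \<in> convex hull S)"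
  have S': "S' \<in> M" "x \<in> convex hull S'"
    unfolding S'_def using someI[of "\<lambda>S. S \<in> M \<and> x \<in> convex hull S" S] S by blast+
  have x: "x \<in> convex hull (S \<inter> S')" using cells_inter[OF S(1) S'(1)] S(2) S'(2) by blast
  have red: "(\<Sum>s\<in>K. a s * bcoord K s x) = (\<Sum>s\<in>S \<inter> S'. a s * bcoord S s x)"
    if K: "K \<in> M" "S \<inter> S' \<subseteq> K" for K
  proof -
    have "\<forall>s\<in>K - S \<inter> S'. bcoord K s x = 0" using in_face_iff[OF simplex[OF K(1)] K(2)] x by blast
    then have "(\<Sum>s\<in>K. a s * bcoord K s x) = (\<Sum>s\<in>S \<inter> S'. a s * bcoord K s x)"
      by (intro sum.mono_neutral_right vertices_finite K) auto
    also have "\<dots> = (\<Sum>s\<in>S \<inter> S'. a s * bcoord S s x)"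
      using bcoord_face_eq[OF simplex[OF K(1)] simplex[OF S(1)] K(2) Int_lower1 x]
      by (intro sum.cong refl) simp
    finally show ?thesis .
  qed
  have "x \<in> closure \<Omega>" using S cells_union by blast
  then have "interpolant a x = (\<Sum>s\<in>S'. a s * bcoord S' s x)" by (simp add: interpolant_def S'_def Let_def)
  then show ?thesis using red[OF S'(1)] red[OF S(1)] by simp
qed

lemma interpolant_affine:
  assumes S: "S \<in> M" "x \<in> convex hull S" "y \<in> convex hull S"
  shows "interpolant a y = interpolant a x + cell_grad a S \<bullet> (y - x)"
proof -
  have "(\<Sum>s\<in>S. a s * bcoord S s y) = (\<Sum>s\<in>S. a s * bcoord S s x + a s * (bgrad S s \<bullet> (y - x)))"
    by (rule sum.cong[OF refl]) (simp add: bcoord_affine[of S _ y x] distrib_left)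
  also have "\<dots> = (\<Sum>s\<in>S. a s * bcoord S s x) + cell_grad a S \<bullet> (y - x)"
    by (simp add: cell_grad_def sum.distrib inner_sum_left)
  finally show ?thesis unfolding interpolant_cell[OF S(1,2)] interpolant_cell[OF S(1,3)] .
qed

text \<open>A frontier point lies on some boundary facet. All vertices of that facet are boundary
  vertices, so their nodal values vanish, and the remaining vertex has coordinate 0.\<close>

lemma interpolant_outside:
  assumes bd: "\<forall>z. boundary_vertex z \<longrightarrow> a z = 0" and x: "x \<notin> \<Omega>"
  shows "interpolant a x = 0"
proof (cases "x \<in> closure \<Omega>")
  case False
  then show ?thesis by (simp add: interpolant_def)
next
  case True
  then obtain K where K: "K \<in> M" "x \<in> convex hull K" using cells_union by blast
  have "x \<in> frontier \<Omega>" using True x open_dom by (simp add: frontier_def interior_open)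
  then obtain L s where L: "(K, L) \<in> (facet_step x)\<^sup>*" "s \<in> L" "x \<in> convex hull (L - {s})" "nb L s = {}"
    using frontier_reaches_boundary_facet[OF _ K] by blast
  have LM: "L \<in> M" using facet_step_mesh[OF L(1) K(1)] .
  have xL: "x \<in> convex hull L" using L(3) hull_mono[of "L - {s}" L convex] by blast
  have "a t * bcoord L t x = 0" if t: "t \<in> L" for t
  proof (cases "t = s")
    case True
    then show ?thesis using in_face_iff[OF simplex[OF LM] Diff_subset, of x "{s}"] L(2,3) by simp
  next
    case False
    then have "t \<in> convex hull (L - {s})" using t by (intro hull_inc) simp
    then have "boundary_vertex t" unfolding boundary_vertex_def using LM L(2,4) by blast
    then show ?thesis using bd by simp
  qed
  then show ?thesis unfolding interpolant_cell[OF LM xL] by (intro sum.neutral ballI)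
qed

text \<open>Along a segment the parameter interval is covered by finitely many closed sets, one per
  cell and one for the exterior, with a Lipschitz bound on each. The crude constant is used only for
  membership in \<open>H10\<close> and never enters an estimate.\<close>

lemma interpolant_lipschitz:
  assumes bd: "\<forall>z. boundary_vertex z \<longrightarrow> a z = 0"
  shows "\<bar>interpolant a x - interpolant a y\<bar> \<le> (\<Sum>S\<in>M. norm (cell_grad a S)) * norm (x - y)"
proof -
  let ?L = "\<Sum>S\<in>M. norm (cell_grad a S)" and ?E = "closure (- closure \<Omega>)"
  define \<gamma> where "\<gamma> t = y + t *\<^sub>R (x - y)" for t
  have \<gamma>c: "continuous_on UNIV \<gamma>" unfolding \<gamma>_def[abs_def] by (intro continuous_intros)
  have \<gamma>d: "\<gamma> t - \<gamma> t' = (t - t') *\<^sub>R (x - y)" for t t' by (simp add: \<gamma>_def algebra_simps)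
  have L0: "0 \<le> ?L" by (intro sum_nonneg) simp
  \<comment> \<open>The closure of the exterior stands for the uncovered part: it is closed and
    disjoint from the open set \<Omega>, so the interpolant vanishes on it.\<close>
  define U where "U i = \<gamma> -` (case i of None \<Rightarrow> ?E | Some S \<Rightarrow> convex hull S)" for i
  have "lipschitz_on (?L * norm (x - y)) {0..1} (\<lambda>t. interpolant a (\<gamma> t))"
  proof (rule lipschitz_on_closed_Union[where I="insert None (Some ` M)" and U=U])
    show "finite (insert None (Some ` M))" using finite_mesh by simp
    show "0 \<le> ?L * norm (x - y)" using L0 by simp
    show "{0..1} \<subseteq> (\<Union>i\<in>insert None (Some ` M). U i)"
    proof
      fix t :: real
      show "t \<in> (\<Union>i\<in>insert None (Some ` M). U i)"
      proof (cases "\<gamma> t \<in> closure \<Omega>")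
        case True
        then obtain S where "S \<in> M" "\<gamma> t \<in> convex hull S" using cells_union by blast
        then have "t \<in> U (Some S)" by (simp add: U_def)
        then show ?thesis using \<open>S \<in> M\<close> by blast
      next
        case False
        then have "\<gamma> t \<in> ?E" using closure_subset by blast
        then have "t \<in> U None" by (simp add: U_def)
        then show ?thesis by blast
      qed
    qed
    fix i assume i: "i \<in> insert None (Some ` M)"
    show "closed (U i)"
    proof -
      have "closed (case i of None \<Rightarrow> ?E | Some S \<Rightarrow> convex hull S)"
        using i compact_imp_closed[OF compact_simplex[OF simplex]] by (cases i) auto
      then show ?thesis unfolding U_def using continuous_closed_vimage \<gamma>c
        by (metis continuous_on_eq_continuous_at open_UNIV UNIV_I)
    qed
    show "lipschitz_on (?L * norm (x - y)) (U i) (\<lambda>t. interpolant a (\<gamma> t))"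
    proof (rule lipschitz_onI)
      fix t t' assume t: "t \<in> U i" "t' \<in> U i"
      show "dist (interpolant a (\<gamma> t)) (interpolant a (\<gamma> t')) \<le> ?L * norm (x - y) * dist t t'"
      proof (cases i)
        case None
        have "z \<notin> \<Omega>" if "z \<in> ?E" for z
        proof
          assume z: "z \<in> \<Omega>"
          have "\<Omega> \<inter> - closure \<Omega> = {}" using closure_subset by blast
          then have "\<Omega> \<inter> ?E = {}" using open_Int_closure_eq_empty[OF open_dom] by blast
          then show False using z that by blast
        qed
        moreover have "\<gamma> t \<in> ?E" "\<gamma> t' \<in> ?E" using t None by (auto simp: U_def)
        ultimately have "interpolant a (\<gamma> t) = 0" "interpolant a (\<gamma> t') = 0"
          by (auto intro!: interpolant_outside[OF bd])
        then show ?thesis using L0 by simp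
      next
        case (Some S)
        then have S: "S \<in> M" "\<gamma> t \<in> convex hull S" "\<gamma> t' \<in> convex hull S" using i t by (auto simp: U_def)
        have "\<bar>interpolant a (\<gamma> t) - interpolant a (\<gamma> t')\<bar> = \<bar>cell_grad a S \<bullet> (\<gamma> t - \<gamma> t')\<bar>"
          using interpolant_affine[OF S(1,3,2)] by simp
        also have "\<dots> \<le> norm (cell_grad a S) * norm (\<gamma> t - \<gamma> t')" by (rule Cauchy_Schwarz_ineq2)
        also have "\<dots> \<le> ?L * norm (\<gamma> t - \<gamma> t')"
          using finite_mesh S(1) by (intro mult_right_mono member_le_sum) auto
        also have "\<dots> = ?L * norm (x - y) * dist t t'" by (simp add: \<gamma>d dist_real_def mult_ac)
        finally show ?thesis by (simp add: dist_real_def)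
      qed
    qed (use L0 in simp)
  qed
  from lipschitz_onD[OF this, of 1 0] show ?thesis by (simp add: \<gamma>_def dist_real_def)
qed

definition pw_grad :: "('a \<Rightarrow> real) \<Rightarrow> 'a \<Rightarrow> 'a" where
  "pw_grad a x = (\<Sum>S\<in>M. indicator (interior (convex hull S)) x *\<^sub>R cell_grad a S)"

lemma sum_interior_indicator:
  fixes f :: "'a set \<Rightarrow> 'b::real_vector"
  assumes "S \<in> M" "x \<in> interior (convex hull S)"
  shows "(\<Sum>K\<in>M. indicator (interior (convex hull K)) x *\<^sub>R f K) = f S"
proof -
  have "(\<Sum>K\<in>M. indicator (interior (convex hull K)) x *\<^sub>R f K) = (\<Sum>K\<in>M. if K = S then f K else 0)"
  proof (rule sum.cong[OF refl])
    fix K assume "K \<in> M"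
    then show "indicator (interior (convex hull K)) x *\<^sub>R f K = (if K = S then f K else 0)"
      using interior_cell_unique[of K S x] assms interior_subset[of "convex hull S"]
      by (auto simp: indicator_def)
  qed
  then show ?thesis using finite_mesh assms(1) by simp
qed

lemma interior_measurable: "(\<lambda>x. indicator (interior (convex hull S)) x :: real) \<in> borel_measurable N"
  by (intro borel_measurable_lebesgue_on borel_measurable_indicator) simp

lemma interpolant_H10:
  assumes bd: "\<forall>z. boundary_vertex z \<longrightarrow> a z = 0"
  shows "H10 \<Omega> (interpolant a)" "AE x in N. wgrad \<Omega> (interpolant a) x = pw_grad a x"
proof -
  let ?v = "interpolant a"
  have der: "AE x in N. (?v has_derivative (\<lambda>h. pw_grad a x \<bullet> h)) (at x)"
    using AE_interior_cell
  proof eventually_elim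
    case (elim x)
    then obtain S where S: "S \<in> M" "x \<in> interior (convex hull S)" by blast
    have g: "pw_grad a x = cell_grad a S" unfolding pw_grad_def by (rule sum_interior_indicator[OF S])
    have "((\<lambda>y. ?v x + cell_grad a S \<bullet> (y - x)) has_derivative (\<lambda>h. cell_grad a S \<bullet> h)) (at x)"
      by (auto intro!: derivative_eq_intros)
    then show ?case unfolding g
    proof (rule has_derivative_transform_within_open[OF _ open_interior S(2)])
      fix y assume "y \<in> interior (convex hull S)"
      then show "?v x + cell_grad a S \<bullet> (y - x) = ?v y"
        using interpolant_affine[OF S(1) subsetD[OF interior_subset S(2)] subsetD[OF interior_subset], of y a] by simp
    qed
  qed
  \<comment> \<open>In a cell with nonzero gradient the zeros of the affine function lie in a
    hyperplane. Hence the gradient vanishes almost everywhere on the zero set, as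
    \<open>H10_lipschitz\<close> requires.\<close>
  have null: "negligible (\<Union>S\<in>{S\<in>M. cell_grad a S \<noteq> 0}. {y. y \<in> convex hull S \<and> ?v y = 0})"
  proof (rule negligible_Union)
    show "finite ((\<lambda>S. {y. y \<in> convex hull S \<and> ?v y = 0}) ` {S\<in>M. cell_grad a S \<noteq> 0})" using finite_mesh by simp
    fix Z assume "Z \<in> (\<lambda>S. {y. y \<in> convex hull S \<and> ?v y = 0}) ` {S\<in>M. cell_grad a S \<noteq> 0}"
    then obtain S where S: "S \<in> M" "cell_grad a S \<noteq> 0" "Z = {y. y \<in> convex hull S \<and> ?v y = 0}" by blast
    obtain c where c: "c \<in> S" using simplex_verticesD(4)[OF simplex[OF S(1)]] by blast
    have "Z \<subseteq> {y. cell_grad a S \<bullet> y = cell_grad a S \<bullet> c - ?v c}"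
      using interpolant_affine[OF S(1) hull_inc[OF c]] by (auto simp: S(3) inner_diff_right)
    then show "negligible Z" using negligible_hyperplane S(2) negligible_subset by blast
  qed
  then have "AE x in lebesgue. x \<notin> (\<Union>S\<in>{S\<in>M. cell_grad a S \<noteq> 0}. {y. y \<in> convex hull S \<and> ?v y = 0})"
    by (intro AE_not_in) (simp only: negligible_iff_null_sets)
  then have nullN: "AE x in N. x \<notin> (\<Union>S\<in>{S\<in>M. cell_grad a S \<noteq> 0}. {y. y \<in> convex hull S \<and> ?v y = 0})"
    using dom_sets by (simp add: AE_restrict_space_iff) (erule eventually_mono, blast)
  have flat: "AE x in N. ?v x = 0 \<longrightarrow> pw_grad a x = 0"
    using AE_interior_cell nullN
  proof eventually_elim
    case (elim x)
    then obtain S where S: "S \<in> M" "x \<in> interior (convex hull S)" by blast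
    have g: "pw_grad a x = cell_grad a S" unfolding pw_grad_def by (rule sum_interior_indicator[OF S])
    have "x \<in> convex hull S" using S(2) interior_subset by blast
    then show ?case unfolding g using elim(2) S(1) by blast
  qed
  have meas: "pw_grad a \<in> borel_measurable N"
    unfolding pw_grad_def[abs_def] by (intro borel_measurable_sum borel_measurable_scaleR interior_measurable) simp
  have bnd: "AE x in N. norm (pw_grad a x) \<le> (\<Sum>S\<in>M. norm (cell_grad a S))"
  proof (rule AE_I2)
    fix x
    show "norm (pw_grad a x) \<le> (\<Sum>S\<in>M. norm (cell_grad a S))"
      unfolding pw_grad_def by (rule sum_norm_le) (simp add: indicator_def)
  qed
  note * = H10_lipschitz[OF interpolant_lipschitz[OF bd] interpolant_outside[OF bd] der flat meas bnd]
  show "H10 \<Omega> ?v" by (rule *(1))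
  show "AE x in N. wgrad \<Omega> ?v x = pw_grad a x" by (rule *(2))
qed

lemma cellwise_integral:
  fixes f :: "'a \<Rightarrow> real"
  assumes "integrable N f"
  shows "(\<integral>x. f x \<partial>N) = (\<Sum>S\<in>M. \<integral>x. indicator (interior (convex hull S)) x * f x \<partial>N)"
    and "S \<in> M \<Longrightarrow> integrable N (\<lambda>x. indicator (interior (convex hull S)) x * f x)"
proof -
  have i: "integrable N (\<lambda>x. indicator (interior (convex hull S)) x * f x)" for S
  proof (rule Bochner_Integration.integrable_bound[OF assms])
    show "(\<lambda>x. indicator (interior (convex hull S)) x * f x) \<in> borel_measurable N"
      by (intro borel_measurable_times interior_measurable borel_measurable_integrable assms)
  qed (auto simp: indicator_def)
  then show "integrable N (\<lambda>x. indicator (interior (convex hull S)) x * f x)" .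
  have "(\<integral>x. f x \<partial>N) = (\<integral>x. (\<Sum>S\<in>M. indicator (interior (convex hull S)) x * f x) \<partial>N)"
  proof (rule integral_cong_AE)
    show "f \<in> borel_measurable N" by (rule borel_measurable_integrable[OF assms])
    show "(\<lambda>x. \<Sum>S\<in>M. indicator (interior (convex hull S)) x * f x) \<in> borel_measurable N"
      by (intro borel_measurable_sum borel_measurable_integrable i)
    show "AE x in N. f x = (\<Sum>S\<in>M. indicator (interior (convex hull S)) x * f x)"
      using AE_interior_cell
    proof eventually_elim
      case (elim x)
      then obtain S where S: "S \<in> M" "x \<in> interior (convex hull S)" by blast
      show ?case using sum_interior_indicator[OF S, of "\<lambda>_. f x"] by simp
    qed
  qed
  also have "\<dots> = (\<Sum>S\<in>M. \<integral>x. indicator (interior (convex hull S)) x * f x \<partial>N)"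
    by (rule Bochner_Integration.integral_sum) (rule i)
  finally show "(\<integral>x. f x \<partial>N) = (\<Sum>S\<in>M. \<integral>x. indicator (interior (convex hull S)) x * f x \<partial>N)" .
qed

lemma integral_indicator_cell:
  assumes "S \<in> M"
  shows "(\<integral>x. indicator (interior (convex hull S)) x \<partial>N) = vol S"
proof -
  have "(\<integral>x. indicator (interior (convex hull S)) x \<partial>N)
      = (\<integral>x. indicator (interior (convex hull S)) x \<partial>(lborel :: 'a measure) :: real)"
  proof (rule integral_lebesgue_on_supported)
    show "indicator (interior (convex hull S)) x = (0 :: real)" if "x \<notin> \<Omega>" for x
      using that interior_cell_subset[OF assms] by (auto simp: indicator_def)
  qed (simp_all add: dom_sets)
  also have "\<dots> = measure lborel (interior (convex hull S))" by simp
  finally show ?thesis using measure_interior_simplex[OF simplex[OF assms]] by simp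
qed

lemma integrable_indicator_cell: "integrable N (\<lambda>x. indicator (interior (convex hull S)) x :: real)"
proof -
  interpret finite_measure N by (rule finite_N)
  show ?thesis by (rule integrable_const_bound[of _ 1]) (simp_all add: interior_measurable indicator_le_1)
qed

lemma sum_square_le_card:
  fixes f :: "'i \<Rightarrow> real"
  shows "(\<Sum>i\<in>I. f i)\<^sup>2 \<le> real (card I) * (\<Sum>i\<in>I. (f i)\<^sup>2)"
  using Cauchy_Schwarz_ineq_sum[of "\<lambda>_. 1" f I] by simp

definition dev :: "('a \<Rightarrow> real) \<Rightarrow> ('a set \<Rightarrow> real) \<Rightarrow> 'a set \<Rightarrow> real" where
  "dev a w S = (\<Sum>s\<in>S. (a s - w S)\<^sup>2)"

text \<open>The gradients of the barycentric coordinates sum to 0, so the constant w S may be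
  subtracted from all nodal values before estimating.\<close>

lemma cell_grad_bound:
  assumes S: "S \<in> M"
  shows "vol S * norm (cell_grad a S) ^ 2 \<le> (real DIM('a) + 1) * G\<^sup>2 * (m S * dev a w S)"
proof -
  have "(\<Sum>s\<in>S. bgrad S s) \<bullet> v = 0" for v
  proof -
    have "(\<Sum>s\<in>S. bcoord S s v) = (\<Sum>s\<in>S. bcoord S s 0) + (\<Sum>s\<in>S. bgrad S s) \<bullet> v"
      using bcoord_affine[of S _ v 0] by (simp add: sum.distrib inner_sum_left)
    then show ?thesis using bcoord_representation(1)[OF simplex[OF S]] by simp
  qed
  then have z: "(\<Sum>s\<in>S. bgrad S s) = 0" by (metis inner_eq_zero_iff)
  have "cell_grad a S = (\<Sum>s\<in>S. (a s - w S) *\<^sub>R bgrad S s)"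
    unfolding cell_grad_def scaleR_left_diff_distrib sum_subtractf scaleR_sum_right[symmetric] z by simp
  then have "norm (cell_grad a S) \<le> (\<Sum>s\<in>S. \<bar>a s - w S\<bar> * norm (bgrad S s))"
    by (simp add: order_trans[OF norm_sum])
  also have "\<dots> \<le> (\<Sum>s\<in>S. \<bar>a s - w S\<bar> * (G / diam S))"
    using bgrad_diam[OF S] diam_pos[OF S]
    by (intro sum_mono mult_left_mono) (auto simp: pos_le_divide_eq)
  finally have "norm (cell_grad a S) \<le> (\<Sum>s\<in>S. \<bar>a s - w S\<bar>) * (G / diam S)"
    unfolding sum_distrib_right .
  then have "norm (cell_grad a S) ^ 2 \<le> ((\<Sum>s\<in>S. \<bar>a s - w S\<bar>) * (G / diam S))\<^sup>2"
    by (intro power_mono) auto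
  also have "\<dots> = (\<Sum>s\<in>S. \<bar>a s - w S\<bar>)\<^sup>2 * (G\<^sup>2 / diam S ^ 2)" by (simp add: power_mult_distrib power_divide)
  also have "\<dots> \<le> ((real DIM('a) + 1) * dev a w S) * (G\<^sup>2 / diam S ^ 2)"
    using sum_square_le_card[of "\<lambda>s. \<bar>a s - w S\<bar>" S] vertices_card[OF S]
    by (intro mult_right_mono) (auto simp: dev_def add.commute)
  finally have "vol S * norm (cell_grad a S) ^ 2 \<le> vol S * (((real DIM('a) + 1) * dev a w S) * (G\<^sup>2 / diam S ^ 2))"
    using vol_pos[OF S] by (intro mult_left_mono) auto
  then show ?thesis by (simp add: m_def mult_ac)
qed

text \<open>The coordinates sum to 1, so the difference is the same combination of the deviations at
  the vertices, with coefficients between 0 and 1.\<close>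

lemma interpolant_mean_error:
  assumes S: "S \<in> M" "x \<in> convex hull S"
  shows "(interpolant a x - w S)\<^sup>2 \<le> (real DIM('a) + 1) * dev a w S"
proof -
  have b: "0 \<le> bcoord S s x" "bcoord S s x \<le> 1" if "s \<in> S" for s
  proof -
    have nn: "\<forall>s\<in>S. 0 \<le> bcoord S s x" using S in_simplex_iff[OF simplex] by blast
    then show "0 \<le> bcoord S s x" using that by blast
    have "bcoord S s x \<le> (\<Sum>s\<in>S. bcoord S s x)" using nn that vertices_finite[OF S(1)] by (intro member_le_sum) auto
    then show "bcoord S s x \<le> 1" using bcoord_representation(1)[OF simplex[OF S(1)]] by simp
  qed
  have "interpolant a x - w S = (\<Sum>s\<in>S. a s * bcoord S s x) - w S * (\<Sum>s\<in>S. bcoord S s x)"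
    unfolding interpolant_cell[OF S] bcoord_representation(1)[OF simplex[OF S(1)]] by simp
  also have "\<dots> = (\<Sum>s\<in>S. (a s - w S) * bcoord S s x)"
    by (simp add: sum_distrib_left left_diff_distrib sum_subtractf)
  finally have "(interpolant a x - w S)\<^sup>2 \<le> real (card S) * (\<Sum>s\<in>S. ((a s - w S) * bcoord S s x)\<^sup>2)"
    using sum_square_le_card[of "\<lambda>s. (a s - w S) * bcoord S s x" S] by simp
  also have "(\<Sum>s\<in>S. ((a s - w S) * bcoord S s x)\<^sup>2) \<le> dev a w S"
    unfolding dev_def power_mult_distrib using b
    by (intro sum_mono) (simp add: mult_left_le power_le_one)
  finally show ?thesis using vertices_card[OF S(1)] by (simp add: mult_left_mono add.commute)
qed

end

lemma test_fun_sum: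
  assumes "finite I" "\<And>i. i \<in> I \<Longrightarrow> test_fun \<Omega> (\<phi> i) (D i)"
  shows "test_fun \<Omega> (\<lambda>x. \<Sum>i\<in>I. c i * \<phi> i x) (\<lambda>x. \<Sum>i\<in>I. c i *\<^sub>R D i x)"
  using assms
proof (induction I rule: finite_induct)
  case empty
  show ?case by (simp add: test_fun_def)
next
  case (insert i I)
  have "test_fun \<Omega> (\<lambda>x. c i * \<phi> i x + (\<Sum>i\<in>I. c i * \<phi> i x)) (\<lambda>x. c i *\<^sub>R D i x + (\<Sum>i\<in>I. c i *\<^sub>R D i x))"
    using insert by (intro test_fun_lincomb) auto
  then show ?case using insert(1,2) by simp
qed

section \<open>Bubble correction of the cell means\<close>

context simplicial_mesh
begin

definition center :: "'a set \<Rightarrow> 'a" where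
  "center S = (\<Sum>v\<in>S. (1 / (real DIM('a) + 1)) *\<^sub>R v)"

text \<open>The 2, where the barycenter would suggest 1, yields the strict inequality that
  \<open>simplex_ball_interior\<close> asks for.\<close>

definition gam :: real where "gam = G * (real DIM('a) + 2)"

definition inrad :: "'a set \<Rightarrow> real" where "inrad S = diam S / gam"

lemma gam_pos: "0 < gam" unfolding gam_def using G_ge_1 by simp

lemma inrad_pos: "S \<in> M \<Longrightarrow> 0 < inrad S"
  unfolding inrad_def using gam_pos diam_pos by (intro divide_pos_pos)

lemma inball: "S \<in> M \<Longrightarrow> cball (center S) (inrad S) \<subseteq> interior (convex hull S)"
  unfolding center_def
proof (rule simplex_ball_interior[OF simplex])
  fix s assume S: "S \<in> M" "s \<in> S"
  have "norm (bgrad S s) * inrad S = (norm (bgrad S s) * diam S) / gam" by (simp add: inrad_def)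
  also have "\<dots> \<le> G / gam" using bgrad_diam[OF S] gam_pos by (intro divide_right_mono) auto
  also have "\<dots> = 1 / (real DIM('a) + 2)" using G_ge_1 by (simp add: gam_def)
  also have "\<dots> < 1 / (real DIM('a) + 1)" by (simp add: frac_less2)
  finally show "norm (bgrad S s) * inrad S < 1 / (real DIM('a) + 1)" .
qed

text \<open>A bump in a ball inside the cell replaces the usual product of barycentric coordinates:
  it is already a test function with explicit gradient bound, and bubbles of different cells do not
  interact.\<close>

definition bubble :: "'a set \<Rightarrow> 'a \<Rightarrow> real" where "bubble S x = bump (inrad S) (x - center S)"
definition bubble_grad :: "'a set \<Rightarrow> 'a \<Rightarrow> 'a" where "bubble_grad S x = bump_grad (inrad S) (x - center S)"

lemma test_fun_bubble: "S \<in> M \<Longrightarrow> test_fun \<Omega> (bubble S) (bubble_grad S)"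
  unfolding bubble_def[abs_def] bubble_grad_def[abs_def]
  using inball interior_cell_subset by (intro test_fun_bump inrad_pos) blast+

lemma bubble_outside:
  assumes "S \<in> M" "x \<notin> cball (center S) (inrad S)"
  shows "bubble S x = 0" "bubble_grad S x = 0"
proof -
  have "inrad S \<le> norm (x - center S)" using assms(2) by (simp add: dist_norm norm_minus_commute)
  then show "bubble S x = 0" "bubble_grad S x = 0"
    using inrad_pos[OF assms(1)] unfolding bubble_def bubble_grad_def by (auto intro: bump_eq_0 bump_grad_eq_0)
qed

definition bubble_mass :: "'a set \<Rightarrow> real" where "bubble_mass S = (\<integral>x. bubble S x \<partial>N)"

lemma bubble_mass_lower:
  assumes S: "S \<in> M"
  shows "\<omega> * inrad S ^ DIM('a) \<le> 2 ^ (DIM('a) + 1) * bubble_mass S" "0 < bubble_mass S"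
proof -
  have z: "bubble S x = 0" if "x \<notin> \<Omega>" for x
    by (rule test_funD(6)[OF test_fun_bubble[OF S]]) (use test_funD(5)[OF test_fun_bubble[OF S]] that in blast)
  have "bubble_mass S = (\<integral>x. bubble S x \<partial>lborel)"
    unfolding bubble_mass_def
    by (rule integral_lebesgue_on_supported[OF borel_measurable_continuous_onI[OF test_funD(3)[OF test_fun_bubble[OF S]]] dom_sets z])
  also have "\<dots> = (\<integral>x. bump (inrad S) x \<partial>(lborel :: 'a measure))"
    unfolding bubble_def using lborel_integral_translation[of "bump (inrad S)" "- center S"] by simp
  finally have e: "bubble_mass S = (\<integral>x. bump (inrad S) x \<partial>(lborel :: 'a measure))" .
  show "0 < bubble_mass S" unfolding e by (rule bump_integral_lower(2)[OF inrad_pos[OF S]])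
  have "measure lborel (cball (0::'a) (inrad S)) = \<omega> * inrad S ^ DIM('a)"
    using content_cball[of "inrad S" "0::'a"] inrad_pos[OF S] by (simp add: \<omega>_def)
  then show "\<omega> * inrad S ^ DIM('a) \<le> 2 ^ (DIM('a) + 1) * bubble_mass S"
    using bump_integral_lower(1)[OF inrad_pos[OF S], where 'a='a] unfolding e by simp
qed

definition energy :: "('a set \<Rightarrow> real) \<Rightarrow> real" where "energy w = (\<Sum>S\<in>M. cell_energy w S)"

lemma energy_nonneg: "0 \<le> energy w"
  unfolding energy_def by (intro sum_nonneg cell_energy_nonneg)

text \<open>Exchange the sums over cells and vertices twice: a vertex belongs to at most \<omega>
  \<kappa> cells, and a cell energy occurs in the patches of its DIM + 1 vertices.\<close>

lemma sum_dev_le: "(\<Sum>S\<in>M. m S * dev (nodal w) w S) \<le> nodal_const\<^sup>2 * (\<omega> * \<kappa>) * (real DIM('a) + 1) * energy w"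
proof -
  define V where "V = \<Union>M"
  have fV: "finite V" unfolding V_def using finite_mesh vertices_finite by blast
  have restr: "(\<Sum>s\<in>S. f s) = (\<Sum>s\<in>V. if s \<in> S then f s else 0)" if "S \<in> M" for S and f :: "'a \<Rightarrow> real"
    using fV that by (simp add: sum.If_cases V_def Int_absorb1 Union_upper)
  have "(\<Sum>S\<in>M. m S * dev (nodal w) w S) \<le> (\<Sum>S\<in>M. \<Sum>s\<in>S. nodal_const\<^sup>2 * patch_energy w s)"
    unfolding dev_def sum_distrib_left
  proof (intro sum_mono)
    fix S s assume "S \<in> M" "s \<in> S"
    then show "m S * (nodal w s - w S)\<^sup>2 \<le> nodal_const\<^sup>2 * patch_energy w s"
      using nodal_estimate[of S s w] by (simp add: power2_commute)
  qed
  also have "\<dots> = (\<Sum>S\<in>M. \<Sum>s\<in>V. if s \<in> S then nodal_const\<^sup>2 * patch_energy w s else 0)"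
    by (intro sum.cong refl restr)
  also have "\<dots> = (\<Sum>s\<in>V. \<Sum>S\<in>M. if s \<in> S then nodal_const\<^sup>2 * patch_energy w s else 0)" by (rule sum.swap)
  also have "\<dots> = (\<Sum>s\<in>V. real (card {S\<in>M. s \<in> S}) * (nodal_const\<^sup>2 * patch_energy w s))"
    using finite_mesh by (simp add: sum.If_cases Int_def)
  also have "\<dots> \<le> (\<Sum>s\<in>V. (\<omega> * \<kappa>) * (nodal_const\<^sup>2 * patch_energy w s))"
    by (intro sum_mono mult_right_mono patch_card mult_nonneg_nonneg patch_energy_nonneg) simp
  also have "\<dots> = nodal_const\<^sup>2 * (\<omega> * \<kappa>) * (\<Sum>s\<in>V. patch_energy w s)"
    unfolding sum_distrib_left by (intro sum.cong refl) (simp only: mult_ac)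
  also have "(\<Sum>s\<in>V. patch_energy w s) = (\<Sum>s\<in>V. \<Sum>S\<in>M. if s \<in> S then cell_energy w S else 0)"
    unfolding patch_energy_def using finite_mesh by (simp add: sum.If_cases Int_def)
  also have "\<dots> = (\<Sum>S\<in>M. \<Sum>s\<in>V. if s \<in> S then cell_energy w S else 0)" by (rule sum.swap)
  also have "\<dots> = (\<Sum>S\<in>M. \<Sum>s\<in>S. cell_energy w S)" by (intro sum.cong refl restr[symmetric])
  also have "\<dots> = (real DIM('a) + 1) * energy w"
    unfolding energy_def sum_distrib_left by (intro sum.cong refl) (simp add: vertices_card)
  finally show ?thesis by (simp add: mult_ac)
qed

text \<open>The 16 comes from the squared gradient bound 4 / r of the bump, DIM + 1 from
  \<open>interpolant_mean_error\<close>, the power of 4 from the squared lower bound for the bubble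
  mass, and the power of \<open>gam\<close> from the ratio of diameter to ball radius.\<close>

definition bubble_const :: real where
  "bubble_const = 16 * (real DIM('a) + 1) * 4 ^ (DIM('a) + 1) * gam ^ (DIM('a) + 2)"

text \<open>The two summands belong to the interpolant and to the bubbles, each doubled by bounding
  the square of a sum; the last factor is the constant of \<open>sum_dev_le\<close>.\<close>

definition lift_const :: real where
  "lift_const = (2 * (real DIM('a) + 1) * G\<^sup>2 + 2 * bubble_const)
    * (nodal_const\<^sup>2 * (\<omega> * \<kappa>) * (real DIM('a) + 1))"

lemma bubble_const_nonneg: "0 \<le> bubble_const"
  unfolding bubble_const_def using gam_pos by simp

lemma lift_const_nonneg: "0 \<le> lift_const"
  unfolding lift_const_def using bubble_const_nonneg omega_pos kappa_pos G_ge_1 by simp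

text \<open>With e the defect of the cell mean, e / \<open>bubble_mass S\<close> is the coefficient
  of the bubble, and the left side bounds the squared gradient norm of its contribution.\<close>

lemma bubble_coefficient_bound:
  assumes S: "S \<in> M" and I: "\<bar>e\<bar> \<le> vol S * sqrt ((real DIM('a) + 1) * \<delta>)" and \<delta>: "0 \<le> \<delta>"
  shows "(e / bubble_mass S)\<^sup>2 * (4 / inrad S)\<^sup>2 * (\<omega> * inrad S ^ DIM('a)) \<le> bubble_const * (m S * \<delta>)"
proof -
  let ?n = "DIM('a)" and ?r = "inrad S" and ?B = "bubble_mass S"
  have r: "0 < ?r" by (rule inrad_pos[OF S])
  have B: "0 < ?B" by (rule bubble_mass_lower(2)[OF S])
  have P: "0 < \<omega> * ?r ^ ?n" using omega_pos r by simp
  have "\<bar>e\<bar>\<^sup>2 \<le> (vol S * sqrt ((real ?n + 1) * \<delta>))\<^sup>2" by (rule power_mono[OF I]) simp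
  then have e2: "e\<^sup>2 \<le> vol S ^ 2 * ((real ?n + 1) * \<delta>)" using \<delta> by (simp add: power_mult_distrib)
  have "(\<omega> * ?r ^ ?n)\<^sup>2 \<le> (2 ^ (?n + 1) * ?B)\<^sup>2" using bubble_mass_lower(1)[OF S] P by (intro power_mono) auto
  moreover have "(2 ^ (?n + 1) * ?B)\<^sup>2 = 4 ^ (?n + 1) * ?B\<^sup>2"
  proof -
    have "((2::real) ^ (?n + 1))\<^sup>2 = (2\<^sup>2) ^ (?n + 1)"
      by (simp only: power_mult[symmetric] mult.commute)
    then have "((2::real) ^ (?n + 1))\<^sup>2 = 4 ^ (?n + 1)" by (simp only: power2_eq_square) simp
    then show ?thesis by (simp only: power_mult_distrib)
  qed
  ultimately have B2: "(\<omega> * ?r ^ ?n)\<^sup>2 \<le> 4 ^ (?n + 1) * ?B\<^sup>2" by simp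
  have "(e / ?B)\<^sup>2 * (\<omega> * ?r ^ ?n) = e\<^sup>2 * (\<omega> * ?r ^ ?n) / ?B\<^sup>2" by (simp add: power_divide)
  also have "\<dots> \<le> e\<^sup>2 * 4 ^ (?n + 1) / (\<omega> * ?r ^ ?n)"
  proof -
    have "e\<^sup>2 * (\<omega> * ?r ^ ?n)\<^sup>2 \<le> e\<^sup>2 * (4 ^ (?n + 1) * ?B\<^sup>2)" using B2 by (intro mult_left_mono) auto
    then have "e\<^sup>2 * (\<omega> * ?r ^ ?n) * (\<omega> * ?r ^ ?n) \<le> e\<^sup>2 * 4 ^ (?n + 1) * ?B\<^sup>2"
      by (simp only: power2_eq_square mult_ac)
    then show ?thesis using B P by (simp add: divide_le_eq le_divide_eq mult_ac)
  qed
  also have "\<dots> \<le> (vol S ^ 2 * ((real ?n + 1) * \<delta>)) * 4 ^ (?n + 1) / (\<omega> * ?r ^ ?n)"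
    using e2 P by (intro divide_right_mono mult_right_mono) auto
  finally have 1: "(e / ?B)\<^sup>2 * (\<omega> * ?r ^ ?n) \<le> (vol S ^ 2 * ((real ?n + 1) * \<delta>)) * 4 ^ (?n + 1) / (\<omega> * ?r ^ ?n)" .
  have "(e / ?B)\<^sup>2 * (4 / ?r)\<^sup>2 * (\<omega> * ?r ^ ?n) = ((e / ?B)\<^sup>2 * (\<omega> * ?r ^ ?n)) * (4 / ?r)\<^sup>2" by simp
  also have "\<dots> \<le> ((vol S ^ 2 * ((real ?n + 1) * \<delta>)) * 4 ^ (?n + 1) / (\<omega> * ?r ^ ?n)) * (4 / ?r)\<^sup>2"
    by (rule mult_right_mono[OF 1]) simp
  also have "\<dots> = (16 * (real ?n + 1) * 4 ^ (?n + 1) * \<delta>) * (vol S ^ 2 / (\<omega> * ?r ^ (?n + 2)))"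
    using r omega_pos by (simp add: power_divide power_add power2_eq_square field_simps)
  also have "\<dots> \<le> (16 * (real ?n + 1) * 4 ^ (?n + 1) * \<delta>) * (gam ^ (?n + 2) * m S)"
  proof (rule mult_left_mono)
    have d: "0 < diam S" by (rule diam_pos[OF S])
    have "vol S ^ 2 / (\<omega> * ?r ^ (?n + 2)) = gam ^ (?n + 2) * m S * (vol S / (\<omega> * diam S ^ ?n))"
      using gam_pos d omega_pos by (simp add: inrad_def m_def power_divide power_add power2_eq_square field_simps)
    also have "\<dots> \<le> gam ^ (?n + 2) * m S * 1"
      using vol_le[OF S] d omega_pos gam_pos m_pos[OF S] by (intro mult_left_mono) (auto simp: divide_le_eq)
    finally show "vol S ^ 2 / (\<omega> * ?r ^ (?n + 2)) \<le> gam ^ (?n + 2) * m S" by simp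
  qed (use \<delta> in simp)
  finally show ?thesis by (simp only: bubble_const_def mult_ac)
qed

text \<open>Exact cell means, and not merely approximate ones, are what make the pairing of W with a
  piecewise constant function depend on w alone.\<close>

lemma conforming_lifting:
  "\<exists>W. H10 \<Omega> W \<and> (\<forall>S\<in>M. (\<integral>x. indicator (interior (convex hull S)) x * W x \<partial>N) = w S * vol S) \<and>
    sq_norm N (wgrad \<Omega> W) ^ 2 \<le> lift_const * energy w"
proof -
  let ?n = "real DIM('a)" and ?I = "\<lambda>S. interior (convex hull S)"
  define a where "a = nodal w"
  have bd: "\<forall>z. boundary_vertex z \<longrightarrow> a z = 0" by (simp add: a_def nodal_def)
  define v where "v = interpolant a"
  note vH = interpolant_H10[OF bd, folded v_def]
  have v1: "integrable N v"
    using sq_int_mult_integrable[OF H10D(1)[OF vH(1)] sq_int_bounded[OF finite_N, of "\<lambda>_. 1" 1]] by simp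
  define e where "e S = w S * vol S - (\<integral>x. indicator (?I S) x * v x \<partial>N)" for S
  \<comment> \<open>The multiple of the bubble that carries exactly the missing integral over S; no
    other bubble contributes on S.\<close>
  define \<beta> where "\<beta> S = e S / bubble_mass S" for S
  define b where "b x = (\<Sum>S\<in>M. \<beta> S * bubble S x)" for x
  define bg where "bg x = (\<Sum>S\<in>M. \<beta> S *\<^sub>R bubble_grad S x)" for x
  have tb: "test_fun \<Omega> b bg"
    unfolding b_def[abs_def] bg_def[abs_def] by (rule test_fun_sum[OF finite_mesh test_fun_bubble])
  have b1: "integrable N b"
    using sq_int_mult_integrable[OF test_sq_int(1)[OF tb] sq_int_bounded[OF finite_N, of "\<lambda>_. 1" 1]] by simp
  define W where "W x = 1 * v x + b x" for x
  have WH: "H10 \<Omega> W" unfolding W_def[abs_def] by (rule H10_lincomb(1)[OF vH(1) test_fun_H10(1)[OF tb]])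
  have Wg: "AE x in N. wgrad \<Omega> W x = pw_grad a x + bg x"
    using H10_lincomb(2)[OF vH(1) test_fun_H10(1)[OF tb], of 1, folded W_def[abs_def]] vH(2) test_fun_H10(2)[OF tb]
    by eventually_elim simp
  have other: "bubble K x = 0" "bubble_grad K x = 0" if "S \<in> M" "K \<in> M" "K \<noteq> S" "x \<in> ?I S" for S K x
  proof -
    have "x \<notin> cball (center K) (inrad K)"
    proof
      assume "x \<in> cball (center K) (inrad K)"
      then have "x \<in> convex hull K" using inball[OF that(2)] interior_subset by blast
      then show False using interior_cell_unique[OF that(1,2,4)] that(3) by blast
    qed
    then show "bubble K x = 0" "bubble_grad K x = 0" using bubble_outside[OF that(2)] by blast+
  qed
  have b_cell: "b x = \<beta> S * bubble S x" "bg x = \<beta> S *\<^sub>R bubble_grad S x" if "S \<in> M" "x \<in> ?I S" for S x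
  proof -
    have "b x = (\<Sum>K\<in>M. if K = S then \<beta> S * bubble S x else 0)"
      unfolding b_def by (rule sum.cong[OF refl]) (use other[OF that(1) _ _ that(2)] in auto)
    then show "b x = \<beta> S * bubble S x" using finite_mesh that(1) by simp
    have "bg x = (\<Sum>K\<in>M. if K = S then \<beta> S *\<^sub>R bubble_grad S x else 0)"
      unfolding bg_def by (rule sum.cong[OF refl]) (use other[OF that(1) _ _ that(2)] in auto)
    then show "bg x = \<beta> S *\<^sub>R bubble_grad S x" using finite_mesh that(1) by simp
  qed
  have mean: "(\<integral>x. indicator (?I S) x * W x \<partial>N) = w S * vol S" if S: "S \<in> M" for S
  proof -
    have "indicator (?I S) x * b x = \<beta> S * bubble S x" for x
    proof (cases "x \<in> ?I S")
      case True
      then show ?thesis using b_cell(1)[OF S] by simp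
    next
      case False
      then have "x \<notin> cball (center S) (inrad S)" using inball[OF S] by blast
      then show ?thesis using False bubble_outside(1)[OF S] by simp
    qed
    then have "(\<integral>x. indicator (?I S) x * b x \<partial>N) = \<beta> S * bubble_mass S" by (simp add: bubble_mass_def)
    also have "\<dots> = e S" using bubble_mass_lower(2)[OF S] by (simp add: \<beta>_def)
    finally have ib: "(\<integral>x. indicator (?I S) x * b x \<partial>N) = e S" .
    have "(\<integral>x. indicator (?I S) x * W x \<partial>N) = (\<integral>x. indicator (?I S) x * v x + indicator (?I S) x * b x \<partial>N)"
      by (simp add: W_def distrib_left)
    also have "\<dots> = (\<integral>x. indicator (?I S) x * v x \<partial>N) + e S"
      using cellwise_integral(2)[OF v1 S] cellwise_integral(2)[OF b1 S] ib by simp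
    finally show ?thesis by (simp add: e_def)
  qed
  have dev0: "0 \<le> dev a w S" for S unfolding dev_def by (intro sum_nonneg) simp
  have e_bound: "\<bar>e S\<bar> \<le> vol S * sqrt ((?n + 1) * dev a w S)" if S: "S \<in> M" for S
  proof -
    have "e S = (\<integral>x. w S * indicator (?I S) x - indicator (?I S) x * v x \<partial>N)"
      using integral_indicator_cell[OF S] integrable_indicator_cell[of S] cellwise_integral(2)[OF v1 S]
      by (simp add: e_def)
    also have "\<bar>\<dots>\<bar> \<le> (\<integral>x. sqrt ((?n + 1) * dev a w S) * indicator (?I S) x \<partial>N)"
    proof (rule Bochner_Integration.integral_abs_bound_integral)
      fix x
      show "\<bar>w S * indicator (?I S) x - indicator (?I S) x * v x\<bar> \<le> sqrt ((?n + 1) * dev a w S) * indicator (?I S) x"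
      proof (cases "x \<in> ?I S")
        case True
        then have "x \<in> convex hull S" using interior_subset by blast
        from real_sqrt_le_mono[OF interpolant_mean_error[OF S this, of a w]]
        show ?thesis using True by (simp add: v_def abs_minus_commute)
      qed simp
    qed (use integrable_indicator_cell[of S] cellwise_integral(2)[OF v1 S] in auto)
    also have "\<dots> = vol S * sqrt ((?n + 1) * dev a w S)" using integral_indicator_cell[OF S] by simp
    finally show ?thesis .
  qed
  \<comment> \<open>A uniform bound for the squared gradient of the correction, valid on the ball
    that supports the bubble.\<close>
  define B where "B S = \<beta> S ^ 2 * (4 / inrad S)\<^sup>2" for S
  let ?J = "\<lambda>S x. indicator (cball (center S) (inrad S)) x :: real"
  have ball_int: "(\<integral>x. ?J S x \<partial>N) = \<omega> * inrad S ^ DIM('a)" "integrable N (?J S)" if S: "S \<in> M" for S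
  proof -
    have "(\<integral>x. ?J S x \<partial>N) = (\<integral>x. ?J S x \<partial>lborel)"
    proof (rule integral_lebesgue_on_supported)
      show "?J S x = 0" if "x \<notin> \<Omega>" for x
        using that inball[OF S] interior_cell_subset[OF S] by (auto simp: indicator_def)
    qed (simp_all add: dom_sets borel_measurable_indicator borel_closed)
    then show "(\<integral>x. ?J S x \<partial>N) = \<omega> * inrad S ^ DIM('a)"
      using content_cball[of "inrad S" "center S"] inrad_pos[OF S] by (simp add: \<omega>_def)
    interpret finite_measure N by (rule finite_N)
    show "integrable N (?J S)"
      by (rule integrable_const_bound[of _ 1])
        (simp_all add: indicator_le_1 borel_measurable_lebesgue_on borel_measurable_indicator borel_closed)
  qed
  have "sq_norm N (wgrad \<Omega> W) ^ 2 \<le> (\<integral>x. (\<Sum>S\<in>M. 2 * norm (cell_grad a S) ^ 2 * indicator (?I S) x + 2 * B S * ?J S x) \<partial>N)"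
    unfolding sq_norm_pow2
  proof (rule integral_mono_AE)
    show "integrable N (\<lambda>x. norm (wgrad \<Omega> W x) ^ 2)" using H10D(2)[OF WH] by (simp add: sq_int_def)
    show "integrable N (\<lambda>x. \<Sum>S\<in>M. 2 * norm (cell_grad a S) ^ 2 * indicator (?I S) x + 2 * B S * ?J S x)"
      using integrable_indicator_cell ball_int(2) by (intro Bochner_Integration.integrable_sum Bochner_Integration.integrable_add integrable_mult_right) auto
    show "AE x in N. norm (wgrad \<Omega> W x) ^ 2 \<le> (\<Sum>S\<in>M. 2 * norm (cell_grad a S) ^ 2 * indicator (?I S) x + 2 * B S * ?J S x)"
      using Wg AE_interior_cell
    proof eventually_elim
      case (elim x)
      then obtain S where S: "S \<in> M" "x \<in> ?I S" by blast
      have "pw_grad a x = cell_grad a S" unfolding pw_grad_def by (rule sum_interior_indicator[OF S])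
      then have "wgrad \<Omega> W x = cell_grad a S + \<beta> S *\<^sub>R bubble_grad S x" using elim(1) b_cell(2)[OF S] by simp
      then have "norm (wgrad \<Omega> W x) \<le> norm (cell_grad a S) + norm (\<beta> S *\<^sub>R bubble_grad S x)"
        by (simp only: norm_triangle_ineq)
      then have "norm (wgrad \<Omega> W x) ^ 2 \<le> (norm (cell_grad a S) + norm (\<beta> S *\<^sub>R bubble_grad S x)) ^ 2"
        by (intro power_mono) auto
      also have "\<dots> \<le> 2 * norm (cell_grad a S) ^ 2 + 2 * norm (\<beta> S *\<^sub>R bubble_grad S x) ^ 2"
        using sum_squares_bound[of "norm (cell_grad a S)" "norm (\<beta> S *\<^sub>R bubble_grad S x)"] by (simp add: power2_sum)
      finally have le: "norm (wgrad \<Omega> W x) ^ 2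
          \<le> 2 * norm (cell_grad a S) ^ 2 + 2 * norm (\<beta> S *\<^sub>R bubble_grad S x) ^ 2" .
      have "norm (\<beta> S *\<^sub>R bubble_grad S x) ^ 2 \<le> B S * ?J S x"
      proof (cases "x \<in> cball (center S) (inrad S)")
        case True
        have "norm (bubble_grad S x) ^ 2 \<le> (4 / inrad S)\<^sup>2"
          unfolding bubble_grad_def by (intro power_mono bump_grad_norm inrad_pos S) simp
        then show ?thesis using True by (simp add: B_def power_mult_distrib mult_left_mono)
      next
        case False
        then show ?thesis using bubble_outside(2)[OF S(1)] by simp
      qed
      then have "norm (wgrad \<Omega> W x) ^ 2 \<le> 2 * norm (cell_grad a S) ^ 2 * indicator (?I S) x + 2 * B S * ?J S x"
        using le S(2) by simp
      also have "\<dots> \<le> (\<Sum>S\<in>M. 2 * norm (cell_grad a S) ^ 2 * indicator (?I S) x + 2 * B S * ?J S x)"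
        using finite_mesh S(1) by (intro member_le_sum) (auto simp: B_def)
      finally show ?case .
    qed
  qed
  also have "\<dots> = (\<Sum>S\<in>M. \<integral>x. 2 * norm (cell_grad a S) ^ 2 * indicator (?I S) x + 2 * B S * ?J S x \<partial>N)"
    using integrable_indicator_cell ball_int(2)
    by (intro Bochner_Integration.integral_sum Bochner_Integration.integrable_add integrable_mult_right) auto
  also have "\<dots> = (\<Sum>S\<in>M. 2 * (vol S * norm (cell_grad a S) ^ 2) + 2 * (B S * (\<omega> * inrad S ^ DIM('a))))"
  proof (rule sum.cong[OF refl])
    fix S assume S: "S \<in> M"
    show "(\<integral>x. 2 * norm (cell_grad a S) ^ 2 * indicator (?I S) x + 2 * B S * ?J S x \<partial>N)
        = 2 * (vol S * norm (cell_grad a S) ^ 2) + 2 * (B S * (\<omega> * inrad S ^ DIM('a)))"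
      using integrable_indicator_cell[of S] ball_int[OF S] integral_indicator_cell[OF S]
      by (simp add: Bochner_Integration.integral_add)
  qed
  also have "\<dots> \<le> (\<Sum>S\<in>M. 2 * ((?n + 1) * G\<^sup>2 * (m S * dev a w S)) + 2 * (bubble_const * (m S * dev a w S)))"
  proof (intro sum_mono add_mono mult_left_mono)
    fix S assume S: "S \<in> M"
    show "vol S * norm (cell_grad a S) ^ 2 \<le> (?n + 1) * G\<^sup>2 * (m S * dev a w S)" by (rule cell_grad_bound[OF S])
    show "B S * (\<omega> * inrad S ^ DIM('a)) \<le> bubble_const * (m S * dev a w S)"
      unfolding B_def \<beta>_def by (rule bubble_coefficient_bound[OF S e_bound[OF S] dev0])
  qed simp_all
  also have "\<dots> = (2 * (?n + 1) * G\<^sup>2 + 2 * bubble_const) * (\<Sum>S\<in>M. m S * dev a w S)"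
    by (simp add: sum_distrib_left sum.distrib[symmetric] algebra_simps)
  also have "\<dots> \<le> (2 * (?n + 1) * G\<^sup>2 + 2 * bubble_const) * (nodal_const\<^sup>2 * (\<omega> * \<kappa>) * (?n + 1) * energy w)"
    unfolding a_def using bubble_const_nonneg by (intro mult_left_mono sum_dev_le) simp
  finally have "sq_norm N (wgrad \<Omega> W) ^ 2 \<le> lift_const * energy w" by (simp add: lift_const_def mult_ac)
  then show ?thesis using WH mean by blast
qed

end

section \<open>The discrete inf-sup condition\<close>

text \<open>Elements are only used through \<open>comb c v w\<close>, read as \<open>c *\<^sub>R v + w\<close>, so that spaces of functions
  can be used without a vector space instance.\<close>
lemma semidefinite_Cauchy_Schwarz:
  fixes B :: "'v \<Rightarrow> 'v \<Rightarrow> real"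
  assumes closed: "\<And>c v w. v \<in> V \<Longrightarrow> w \<in> V \<Longrightarrow> comb c v w \<in> V"
    and lin: "\<And>c v w z. v \<in> V \<Longrightarrow> w \<in> V \<Longrightarrow> z \<in> V \<Longrightarrow> B (comb c v w) z = c * B v z + B w z"
    and sym: "\<And>v w. v \<in> V \<Longrightarrow> w \<in> V \<Longrightarrow> B v w = B w v"
    and nonneg: "\<And>v. v \<in> V \<Longrightarrow> 0 \<le> B v v"
    and vw: "v \<in> V" "w \<in> V"
  shows "(B v w)\<^sup>2 \<le> B w w * B v v"
proof (rule nonneg_quadratic_discriminant)
  fix t
  let ?u = "comb t v w"
  have u: "?u \<in> V" by (rule closed[OF vw])
  have "B ?u ?u = t * B v ?u + B w ?u" by (rule lin[OF vw u])
  also have "B v ?u = t * B v v + B v w" using sym[OF vw(1) u] lin[OF vw vw(1)] sym[OF vw] by simp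
  also have "B w ?u = t * B v w + B w w" using sym[OF vw(2) u] lin[OF vw vw(2)] by simp
  finally have "B ?u ?u = t ^ 2 * B v v + 2 * t * B v w + B w w" by (simp add: power2_eq_square algebra_simps)
  then show "0 \<le> t ^ 2 * B v v + 2 * t * B v w + B w w" using nonneg[OF u] by simp
qed

text \<open>Riesz representation for a semidefinite form, where finitely many functionals separate
  points up to the null space. The induction passes to the kernel of one functional l: V is this
  kernel plus the multiples of a vector e orthogonal to it, and the representer on the kernel is
  corrected by a multiple of e.\<close>

lemma finite_rank_representation:
  fixes B :: "'v \<Rightarrow> 'v \<Rightarrow> real"
  assumes closed: "\<And>c v w. v \<in> V \<Longrightarrow> w \<in> V \<Longrightarrow> comb c v w \<in> V"
    and lin: "\<And>c v w z. v \<in> V \<Longrightarrow> w \<in> V \<Longrightarrow> z \<in> V \<Longrightarrow> B (comb c v w) z = c * B v z + B w z"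
    and sym: "\<And>v w. v \<in> V \<Longrightarrow> w \<in> V \<Longrightarrow> B v w = B w v"
    and nonneg: "\<And>v. v \<in> V \<Longrightarrow> 0 \<le> B v v"
    and ls: "\<And>l c v w. l \<in> set ls \<Longrightarrow> v \<in> V \<Longrightarrow> w \<in> V \<Longrightarrow> l (comb c v w) = c * l v + l w"
    and sep: "\<And>v. v \<in> V \<Longrightarrow> (\<And>l. l \<in> set ls \<Longrightarrow> l v = 0) \<Longrightarrow> B v v = 0"
    and F: "\<And>c v w. v \<in> V \<Longrightarrow> w \<in> V \<Longrightarrow> F (comb c v w) = c * F v + F w"
    and F0: "\<And>v. v \<in> V \<Longrightarrow> B v v = 0 \<Longrightarrow> F v = 0"
    and ne: "z0 \<in> V"
  shows "\<exists>r\<in>V. \<forall>v\<in>V. B r v = F v"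
  using assms
proof (induction ls arbitrary: V F z0)
  case Nil
  have CS: "(B v w)\<^sup>2 \<le> B w w * B v v" if "v \<in> V" "w \<in> V" for v w
    by (rule semidefinite_Cauchy_Schwarz[where V=V and comb=comb]) (fact Nil.prems(1-4) that)+
  have null: "B v v = 0" if "v \<in> V" for v using Nil.prems(6)[OF that] by simp
  have "B z0 v = F v" if v: "v \<in> V" for v
    using CS[OF Nil.prems(9) v] null[OF v] Nil.prems(8)[OF v null[OF v]] by simp
  then show ?case using Nil.prems(9) by blast
next
  case (Cons l ls)
  note closed = Cons.prems(1) and lin = Cons.prems(2) and sym = Cons.prems(3) and nonneg = Cons.prems(4)
    and ls = Cons.prems(5) and sep = Cons.prems(6) and F = Cons.prems(7) and F0 = Cons.prems(8) and ne = Cons.prems(9)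
  have CS: "(B v w)\<^sup>2 \<le> B w w * B v v" if "v \<in> V" "w \<in> V" for v w
    by (rule semidefinite_Cauchy_Schwarz[where V=V and comb=comb]) (fact closed lin sym nonneg that)+
  have l_lin: "l (comb c v w) = c * l v + l w" if "v \<in> V" "w \<in> V" for c v w
    by (rule ls[OF _ that]) simp
  let ?V = "{v \<in> V. l v = 0}"
  \<comment> \<open>This combination plays the zero vector; every functional vanishes on it, so the
    kernel is not empty.\<close>
  have z: "comb (- 1) z0 z0 \<in> ?V" using closed[OF ne ne] l_lin[OF ne ne] by simp
  have IH: "\<exists>r\<in>?V. \<forall>v\<in>?V. B r v = F' v"
    if F': "\<And>c v w. v \<in> V \<Longrightarrow> w \<in> V \<Longrightarrow> F' (comb c v w) = c * F' v + F' w"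
      and F'0: "\<And>v. v \<in> V \<Longrightarrow> B v v = 0 \<Longrightarrow> F' v = 0" for F'
  proof (rule Cons.IH[where V="?V" and F=F'])
    show "comb c v w \<in> ?V" if "v \<in> ?V" "w \<in> ?V" for c v w
      using closed[of v w c] l_lin[of v w c] that by simp
    show "B v v = 0" if "v \<in> ?V" "\<And>l. l \<in> set ls \<Longrightarrow> l v = 0" for v
      by (rule sep) (use that in auto)
    show "l' (comb c v w) = c * l' v + l' w" if "l' \<in> set ls" "v \<in> ?V" "w \<in> ?V" for l' c v w
      by (rule ls) (use that in auto)
    show "comb (- 1) z0 z0 \<in> ?V" by (rule z)
  qed (use lin sym nonneg F' F'0 in auto)
  show ?case
  proof (cases "\<exists>e\<in>V. l e \<noteq> 0")
    case False
    then have V: "?V = V" by blast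
    show ?thesis using IH[OF F F0] unfolding V .
  next
    case True
    then obtain e0 where e0: "e0 \<in> V" "l e0 \<noteq> 0" by blast
    \<comment> \<open>The orthogonal projection of e0 onto the kernel, obtained from the induction
      hypothesis for the functional B e0; Cauchy-Schwarz shows that this functional vanishes on null
      vectors.\<close>
    have "\<exists>p\<in>?V. \<forall>v\<in>?V. B p v = B e0 v"
    proof (rule IH)
      show "B e0 (comb c v w) = c * B e0 v + B e0 w" if "v \<in> V" "w \<in> V" for c v w
        using sym[OF e0(1) closed[OF that]] lin[OF that e0(1)] sym[OF e0(1)] that by simp
      show "B e0 v = 0" if "v \<in> V" "B v v = 0" for v using CS[OF e0(1) that(1)] that(2) by simp
    qed
    then obtain p where p: "p \<in> V" "l p = 0" "\<And>v. v \<in> V \<Longrightarrow> l v = 0 \<Longrightarrow> B p v = B e0 v" by blast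
    define e where "e = comb (- 1) p e0"
    have e: "e \<in> V" "l e \<noteq> 0" unfolding e_def using closed[OF p(1) e0(1)] l_lin[OF p(1) e0(1)] p(2) e0(2) by auto
    have orth: "B e v = 0" if "v \<in> V" "l v = 0" for v
      unfolding e_def using lin[OF p(1) e0(1) that(1)] p(3)[OF that] by simp
    obtain r where r: "r \<in> V" "l r = 0" "\<And>v. v \<in> V \<Longrightarrow> l v = 0 \<Longrightarrow> B r v = F v" using IH[OF F F0] by blast
    have Bre: "B r e = 0" using orth[OF r(1,2)] sym[OF r(1) e(1)] by simp
    have split: "F v = (l v / l e) * F e + B r v" "B e v = (l v / l e) * B e e" if v: "v \<in> V" for v
    proof -
      let ?t = "l v / l e"
      \<comment> \<open>Removing the component along e lands in the kernel of l, where r represents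
        F and e is orthogonal.\<close>
      let ?v = "comb (- ?t) e v"
      have v': "?v \<in> V" "l ?v = 0" using closed[OF e(1) v] l_lin[OF e(1) v] e(2) by auto
      have "B r ?v = - ?t * B r e + B r v"
        using sym[OF r(1) v'(1)] lin[OF e(1) v r(1)] sym[OF r(1) e(1)] sym[OF r(1) v] by simp
      then have "B r v = F ?v" using Bre r(3)[OF v'] by simp
      then show "F v = ?t * F e + B r v" using F[OF e(1) v] by simp
      have "B e ?v = - ?t * B e e + B e v"
        using sym[OF e(1) v'(1)] lin[OF e(1) v e(1)] sym[OF e(1) v] by simp
      then show "B e v = ?t * B e e" using orth[OF v'] by simp
    qed
    show ?thesis
    \<comment> \<open>If e is itself a null vector, then F vanishes on it and r needs no correction;
      otherwise the coefficient F e / B e e makes the values on e match.\<close>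
    proof (cases "B e e = 0")
      case True
      then have "F e = 0" by (rule F0[OF e(1)])
      then have "\<forall>v\<in>V. B r v = F v" using split(1) by simp
      then show ?thesis using r(1) by blast
    next
      case False
      let ?r = "comb (F e / B e e) e r"
      have "B ?r v = F v" if v: "v \<in> V" for v
        using lin[OF e(1) r(1) v] split[OF v] False by simp
      then show ?thesis using closed[OF e(1) r(1)] by blast
    qed
  qed
qed

section \<open>Divergence-conforming facet fields\<close>

context simplicial_mesh
begin

lemma norm_sum_pow2_le:
  fixes f :: "'i \<Rightarrow> 'b::real_normed_vector"
  assumes "finite I" "J \<subseteq> I" "\<And>i. i \<in> I - J \<Longrightarrow> f i = 0"
  shows "norm (\<Sum>i\<in>I. f i) ^ 2 \<le> real (card J) * (\<Sum>i\<in>I. norm (f i) ^ 2)"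
proof -
  have "(\<Sum>i\<in>I. f i) = (\<Sum>i\<in>J. f i)" using assms by (intro sum.mono_neutral_right) auto
  then have "norm (\<Sum>i\<in>I. f i) ^ 2 \<le> (\<Sum>i\<in>J. norm (f i)) ^ 2" by (simp add: norm_sum power_mono)
  also have "\<dots> \<le> real (card J) * (\<Sum>i\<in>J. norm (f i) ^ 2)" by (rule sum_square_le_card)
  also have "\<dots> \<le> real (card J) * (\<Sum>i\<in>I. norm (f i) ^ 2)"
    using assms(1,2) by (intro mult_left_mono sum_mono2) auto
  finally show ?thesis .
qed

definition opp :: "'a set \<Rightarrow> 'a \<Rightarrow> 'a" where
  "opp S s = (SOME s'. s' \<in> nb S s \<and> nb S s - {s'} = S - {s})"

lemma opp_props:
  assumes "S \<in> M" "s \<in> S" "nb S s \<noteq> {}"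
  shows "opp S s \<in> nb S s" "nb S s - {opp S s} = S - {s}"
proof -
  have "\<exists>s'. s' \<in> nb S s \<and> nb S s - {s'} = S - {s}" using nb_vertex[OF assms] by blast
  from someI_ex[OF this] show "opp S s \<in> nb S s" "nb S s - {opp S s} = S - {s}" unfolding opp_def by blast+
qed

text \<open>The two radial fields are scaled to have equal normal flux through the common facet, so their
  difference has no jump there.\<close>
definition facet_field :: "'a set \<Rightarrow> 'a \<Rightarrow> 'a \<Rightarrow> 'a" where
  "facet_field S s x = cone_field S s x - (if nb S s = {} then 0 else cone_field (nb S s) (opp S s) x)"

definition facet_div :: "'a set \<Rightarrow> 'a \<Rightarrow> 'a \<Rightarrow> real" where
  "facet_div S s x = cell_density S x - (if nb S s = {} then 0 else cell_density (nb S s) x)"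

lemma cone_field_measurable: "cone_field S s \<in> borel_measurable borel"
  unfolding cone_field_def[abs_def]
  by (intro borel_measurable_scaleR borel_measurable_divide borel_measurable_indicator) simp_all

lemma cell_density_measurable: "cell_density S \<in> borel_measurable borel"
  unfolding cell_density_def[abs_def]
  by (intro borel_measurable_divide borel_measurable_indicator) simp_all

lemma cone_field_norm:
  assumes "S \<in> M" "s \<in> S"
  shows "norm (cone_field S s x) ^ 2 \<le> indicator (interior (convex hull S)) x * (1 / (vol S * m S))"
proof (cases "x \<in> interior (convex hull S)")
  case True
  have d: "norm (x - s) \<le> diam S"
    by (rule simplex_dist_le_diameter[OF simplex[OF assms(1)] subsetD[OF interior_subset True] hull_inc[OF assms(2)]])
  have V: "0 < vol S" by (rule vol_pos[OF assms(1)])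
  have n1: "1 * vol S \<le> real DIM('a) * vol S" using V dim2 by (intro mult_right_mono) auto
  have "norm (cone_field S s x) = norm (x - s) / (real DIM('a) * vol S)"
    using True V by (simp add: cone_field_def abs_mult)
  also have "\<dots> \<le> diam S / vol S" using d V n1 diam_pos[OF assms(1)] by (intro frac_le) auto
  finally have "norm (cone_field S s x) ^ 2 \<le> (diam S / vol S) ^ 2" by (intro power_mono) auto
  \<comment> \<open>By definition of m, the square of diameter over volume is the reciprocal of
    volume times m.\<close>
  also have "\<dots> = 1 / (vol S * m S)" using V by (simp add: m_def power_divide power2_eq_square)
  finally show ?thesis using True by simp
next
  case False
  then show ?thesis by (simp add: cone_field_def)
qed

lemma cone_field_sq_int:
  assumes "S \<in> M" "s \<in> S"
  shows "sq_int N (cone_field S s)" "(\<integral>x. norm (cone_field S s x) ^ 2 \<partial>N) \<le> 1 / m S"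
proof -
  have ms: "cone_field S s \<in> borel_measurable N" by (rule borel_measurable_lebesgue_on[OF cone_field_measurable])
  have bi: "integrable N (\<lambda>x. indicator (interior (convex hull S)) x * (1 / (vol S * m S)) :: real)"
    by (intro integrable_mult_left integrable_indicator_cell)
  have i: "integrable N (\<lambda>x. norm (cone_field S s x) ^ 2)"
  proof (rule Bochner_Integration.integrable_bound[OF bi])
    show "(\<lambda>x. norm (cone_field S s x) ^ 2) \<in> borel_measurable N" using ms by measurable
    show "AE x in N. norm (norm (cone_field S s x) ^ 2)
        \<le> norm (indicator (interior (convex hull S)) x * (1 / (vol S * m S)))"
    proof (rule AE_I2)
      show "norm (norm (cone_field S s x) ^ 2) \<le> norm (indicator (interior (convex hull S)) x * (1 / (vol S * m S)))" for x
        unfolding real_norm_def abs_power2 abs_norm_cancel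
        by (rule order_trans[OF cone_field_norm[OF assms] abs_ge_self])
    qed
  qed
  then show "sq_int N (cone_field S s)" using ms by (simp add: sq_int_def)
  have "(\<integral>x. norm (cone_field S s x) ^ 2 \<partial>N) \<le> (\<integral>x. indicator (interior (convex hull S)) x * (1 / (vol S * m S)) \<partial>N)"
    by (rule integral_mono[OF i bi]) (rule cone_field_norm[OF assms])
  also have "\<dots> = vol S * (1 / (vol S * m S))" using integral_indicator_cell[OF assms(1)] by simp
  also have "\<dots> = 1 / m S" using vol_pos[OF assms(1)] by simp
  finally show "(\<integral>x. norm (cone_field S s x) ^ 2 \<partial>N) \<le> 1 / m S" .
qed

lemma cell_density_sq_int: "sq_int N (cell_density S)"
  by (rule sq_int_bounded[OF finite_N borel_measurable_lebesgue_on[OF cell_density_measurable], of _ "\<bar>1 / vol S\<bar>"])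
    (auto simp: cell_density_def indicator_def)

lemma cone_field_integral:
  assumes "S \<in> M" "test_fun \<Omega> \<psi> D"
  shows "(\<integral>x. cone_field S s x \<bullet> D x \<partial>N) = facet_mean S s \<psi> D - (\<integral>x. cell_density S x * \<psi> x \<partial>N)"
proof -
  note mD = borel_measurable_continuous_onI[OF test_funD(2)[OF assms(2)]]
    and m\<psi> = borel_measurable_continuous_onI[OF test_funD(3)[OF assms(2)]]
  have out: "cone_field S s x = 0" "cell_density S x = 0" if "x \<notin> \<Omega>" for x
    using that interior_cell_subset[OF assms(1)] by (auto simp: cone_field_def cell_density_def indicator_def)
  have "(\<integral>x. cone_field S s x \<bullet> D x \<partial>N) = (\<integral>x. cone_field S s x \<bullet> D x \<partial>lborel)"
    by (rule integral_lebesgue_on_supported[OF borel_measurable_inner[OF cone_field_measurable mD] dom_sets])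
      (simp add: out)
  moreover have "(\<integral>x. cell_density S x * \<psi> x \<partial>N) = (\<integral>x. cell_density S x * \<psi> x \<partial>lborel)"
    by (rule integral_lebesgue_on_supported[OF borel_measurable_times[OF cell_density_measurable m\<psi>] dom_sets])
      (simp add: out)
  ultimately show ?thesis using cone_field_weak_div[OF simplex[OF assms(1)] assms(2), of s] by simp
qed

text \<open>The only boundary term is the facet mean. On an interior facet the means from the two
  sides coincide and cancel; on a boundary facet the test function vanishes.\<close>

lemma facet_field_weak_div:
  assumes "S \<in> M" "s \<in> S"
  shows "is_weak_div \<Omega> (facet_field S s) (facet_div S s)" "sq_int N (facet_field S s)" "sq_int N (facet_div S s)"
proof -
  note c = cone_field_sq_int(1)[OF assms]
  have c': "sq_int N (cone_field (nb S s) (opp S s))" if "nb S s \<noteq> {}"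
    by (rule cone_field_sq_int(1)[OF nb_props(1)[OF that] opp_props(1)[OF assms that]])
  have z: "sq_int N (\<lambda>x. 0 :: 'b::euclidean_space)" by (simp add: sq_int_def)
  show "sq_int N (facet_field S s)"
    unfolding facet_field_def[abs_def] by (cases "nb S s = {}") (auto intro: sq_int_diff c c')
  show "sq_int N (facet_div S s)"
    unfolding facet_div_def[abs_def] by (cases "nb S s = {}") (auto intro: sq_int_diff cell_density_sq_int)
  show "is_weak_div \<Omega> (facet_field S s) (facet_div S s)"
    unfolding is_weak_div_iff
  proof (intro allI impI)
    fix \<psi> D assume tf: "test_fun \<Omega> \<psi> D"
    note i\<psi> = test_sq_int(1)[OF tf] and iD = test_sq_int(2)[OF tf]
    show "(\<integral>x. facet_field S s x \<bullet> D x \<partial>N) = - (\<integral>x. facet_div S s x * \<psi> x \<partial>N)"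
    proof (cases "nb S s = {}")
      case True
      have "(\<And>x. (\<psi> has_derivative (\<lambda>h. D x \<bullet> h)) (at x))" "continuous_on UNIV D"
        using test_funD(1,2)[OF tf] by auto
      then have "facet_mean S s \<psi> D = 0"
        unfolding facet_mean_def
        using facet_integral_eq_0[OF simplex[OF assms(1)] assms(2), of \<psi> D]
          test_fun_zero_boundary_facet[OF assms True tf] by simp
      then show ?thesis
        unfolding facet_field_def facet_div_def using True cone_field_integral[OF assms(1) tf, of s] by simp
    next
      case False
      note S' = nb_props(1)[OF False] and o = opp_props[OF assms False]
      have "facet_mean S s \<psi> D = facet_mean (nb S s) (opp S s) \<psi> D"
        by (rule facet_mean_common_facet[OF dim_cases simplex[OF assms(1)] assms(2) simplex[OF S'] o(1)
              o(2)[symmetric] test_funD(1,2)[OF tf]])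
      moreover have "(\<integral>x. facet_field S s x \<bullet> D x \<partial>N)
          = (\<integral>x. cone_field S s x \<bullet> D x \<partial>N) - (\<integral>x. cone_field (nb S s) (opp S s) x \<bullet> D x \<partial>N)"
        unfolding facet_field_def using False sq_int_inner[OF c iD] sq_int_inner[OF c'[OF False] iD]
        by (simp add: inner_diff_left)
      moreover have "(\<integral>x. facet_div S s x * \<psi> x \<partial>N)
          = (\<integral>x. cell_density S x * \<psi> x \<partial>N) - (\<integral>x. cell_density (nb S s) x * \<psi> x \<partial>N)"
        unfolding facet_div_def
        using False sq_int_mult_integrable[OF cell_density_sq_int i\<psi>, of S]
          sq_int_mult_integrable[OF cell_density_sq_int i\<psi>, of "nb S s"]
        by (simp add: left_diff_distrib)
      ultimately show ?thesis using cone_field_integral[OF assms(1) tf] cone_field_integral[OF S' tf] by simp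
    qed
  qed
qed

end

context bounded_open
begin

text \<open>Lebesgue measure is complete, so altering a function on a null set preserves
  measurability. \<open>P0\<close> functions need this, as their values on the cell boundaries are
  arbitrary.\<close>

lemma measurable_cong_AE_N:
  fixes f g :: "'a \<Rightarrow> 'b::euclidean_space"
  assumes g: "g \<in> borel_measurable N" and ae: "AE x in N. f x = g x"
  shows "f \<in> borel_measurable N"
proof (rule measurableI)
  fix A :: "'b set" assume A: "A \<in> sets borel"
  have "AE x in lebesgue. x \<in> \<Omega> \<longrightarrow> f x = g x" using ae dom_sets by (simp add: AE_restrict_space_iff)
  then obtain Z where Z: "Z \<in> null_sets lebesgue" "{x. \<not> (x \<in> \<Omega> \<longrightarrow> f x = g x)} \<subseteq> Z"
    by (auto simp: eventually_ae_filter)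
  have gm: "g -` A \<inter> \<Omega> \<in> sets lebesgue"
    using measurable_sets[OF g A] dom_sets by (simp add: sets_restrict_space_iff)
  have neg: "negligible Z" using Z(1) by (simp only: negligible_iff_null_sets)
  have "(f -` A \<inter> \<Omega>) \<inter> Z \<in> sets lebesgue"
    by (rule negligible_imp_sets, rule negligible_subset[OF neg]) simp
  moreover have "(g -` A \<inter> \<Omega>) - Z \<in> sets lebesgue" using gm negligible_imp_sets[OF neg] by (rule sets.Diff)
  moreover have "f -` A \<inter> \<Omega> = ((g -` A \<inter> \<Omega>) - Z) \<union> ((f -` A \<inter> \<Omega>) \<inter> Z)" using Z(2) by auto
  ultimately have "f -` A \<inter> \<Omega> \<in> sets lebesgue" by (metis sets.Un)
  then show "f -` A \<inter> space N \<in> sets N" using dom_sets by (simp add: sets_restrict_space_iff)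
qed simp

lemma weak_div_sum:
  assumes "finite I" "\<And>i. i \<in> I \<Longrightarrow> is_weak_div \<Omega> (\<tau> i) (d i)"
    "\<And>i. i \<in> I \<Longrightarrow> sq_int N (\<tau> i)" "\<And>i. i \<in> I \<Longrightarrow> sq_int N (d i)"
  shows "is_weak_div \<Omega> (\<lambda>x. \<Sum>i\<in>I. c i *\<^sub>R \<tau> i x) (\<lambda>x. \<Sum>i\<in>I. c i * d i x) \<and>
    sq_int N (\<lambda>x. \<Sum>i\<in>I. c i *\<^sub>R \<tau> i x) \<and> sq_int N (\<lambda>x. \<Sum>i\<in>I. c i * d i x)"
  using assms
proof (induction I rule: finite_induct)
  case empty
  show ?case by (simp add: is_weak_div_iff sq_int_def)
next
  case (insert i I)
  have IH: "is_weak_div \<Omega> (\<lambda>x. \<Sum>i\<in>I. c i *\<^sub>R \<tau> i x) (\<lambda>x. \<Sum>i\<in>I. c i * d i x)"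
    "sq_int N (\<lambda>x. \<Sum>i\<in>I. c i *\<^sub>R \<tau> i x)" "sq_int N (\<lambda>x. \<Sum>i\<in>I. c i * d i x)"
    using insert by auto
  have i: "is_weak_div \<Omega> (\<tau> i) (d i)" "sq_int N (\<tau> i)" "sq_int N (d i)" using insert.prems by auto
  show ?case
    unfolding sum.insert[OF insert(1,2)]
    using weak_div_lincomb[OF i(1) IH(1) i(2,3) IH(2,3), of "c i"]
      sq_int_lincomb[OF i(2) IH(2), of "c i"] sq_int_lincomb[OF i(3) IH(3), of "c i"] by simp
qed

end

section \<open>Piecewise constants and the jump form\<close>

context simplicial_mesh
begin

lemma P0_value:
  assumes "P0 M p"
  obtains c where "\<And>S x. S \<in> M \<Longrightarrow> x \<in> interior (convex hull S) \<Longrightarrow> p x = c S"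
proof -
  have "\<forall>S\<in>M. \<exists>c. \<forall>x\<in>interior (convex hull S). p x = c" using assms unfolding P0_def .
  from bchoice[OF this] obtain c where "\<forall>S\<in>M. \<forall>x\<in>interior (convex hull S). p x = c S" ..
  then show ?thesis using that by blast
qed

lemma P0_sq_int:
  assumes "P0 M p"
  shows "sq_int N p"
proof -
  obtain c where c: "\<And>S x. S \<in> M \<Longrightarrow> x \<in> interior (convex hull S) \<Longrightarrow> p x = c S" using P0_value[OF assms] by blast
  define g where "g x = (\<Sum>S\<in>M. indicator (interior (convex hull S)) x *\<^sub>R c S)" for x
  have gm: "g \<in> borel_measurable N"
    unfolding g_def[abs_def] by (intro borel_measurable_sum borel_measurable_scaleR interior_measurable) simp
  have ae: "AE x in N. p x = g x"
    using AE_interior_cell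
  proof eventually_elim
    case (elim x)
    then obtain S where S: "S \<in> M" "x \<in> interior (convex hull S)" by blast
    show ?case unfolding g_def sum_interior_indicator[OF S] by (rule c[OF S])
  qed
  have pm: "p \<in> borel_measurable N" by (rule measurable_cong_AE_N[OF gm ae])
  show ?thesis
  proof (rule sq_int_bounded[OF finite_N pm])
    show "AE x in N. norm (p x) \<le> (\<Sum>S\<in>M. \<bar>c S\<bar>)"
      using AE_interior_cell
    proof eventually_elim
      case (elim x)
      then obtain S where S: "S \<in> M" "x \<in> interior (convex hull S)" by blast
      show ?case using c[OF S] finite_mesh S(1) member_le_sum[of S M "\<lambda>S. \<bar>c S\<bar>"] by simp
    qed
  qed
qed

lemma jump_lincomb: "jump (\<lambda>S. c * w S + w' S) S s = c * jump w S s + jump w' S s"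
  by (simp add: jump_def algebra_simps)

definition facets :: "('a set \<times> 'a) set" where "facets = (SIGMA S:M. S)"

lemma finite_facets: "finite facets"
  unfolding facets_def using finite_mesh vertices_finite by (intro finite_SigmaI)

text \<open>The bilinear form of the energy. Facets are indexed by a cell and its opposite vertex,
  so an interior facet appears once from each side, with the weight of the respective cell.\<close>

definition form :: "('a set \<Rightarrow> real) \<Rightarrow> ('a set \<Rightarrow> real) \<Rightarrow> real" where
  "form w w' = (\<Sum>(S, s)\<in>facets. m S * (jump w S s * jump w' S s))"

lemma form_energy: "form w w = energy w"
  unfolding form_def energy_def cell_energy_def facets_def power2_eq_square
  by (rule sum.Sigma[symmetric]) (use finite_mesh vertices_finite in auto)

text \<open>A bound for the number of facet fields that are nonzero at one point: the cells that
  touch a given cell, times DIM + 1 facets each.\<close>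

definition overlap :: real where "overlap = (real DIM('a) + 1) * ((real DIM('a) + 1) * (\<omega> * \<kappa>))"

definition infsup_const :: real where
  "infsup_const = sqrt (overlap * (2 * (1 + q)) * lift_const)"

lemma infsup_const_nonneg: "0 \<le> infsup_const"
  unfolding infsup_const_def overlap_def using omega_pos kappa_pos q_ge_1 lift_const_nonneg by simp

lemma card_touching:
  assumes "K \<in> M"
  shows "real (card {S\<in>M. S \<inter> K \<noteq> {}}) \<le> (real DIM('a) + 1) * (\<omega> * \<kappa>)"
proof -
  have "card {S\<in>M. S \<inter> K \<noteq> {}} \<le> card (\<Union>z\<in>K. {S\<in>M. z \<in> S})"
    using finite_mesh vertices_finite[OF assms] by (intro card_mono) auto
  also have "\<dots> \<le> (\<Sum>z\<in>K. card {S\<in>M. z \<in> S})" by (rule card_UN_le[OF vertices_finite[OF assms]])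
  finally have "real (card {S\<in>M. S \<inter> K \<noteq> {}}) \<le> real (\<Sum>z\<in>K. card {S\<in>M. z \<in> S})" by (rule of_nat_mono)
  also have "\<dots> = (\<Sum>z\<in>K. real (card {S\<in>M. z \<in> S}))" by simp
  also have "\<dots> \<le> (\<Sum>z\<in>K. \<omega> * \<kappa>)" by (rule sum_mono) (rule patch_card)
  also have "\<dots> = (real DIM('a) + 1) * (\<omega> * \<kappa>)" by (simp add: vertices_card[OF assms])
  finally show ?thesis .
qed

text \<open>A facet field is supported in the two cells at its facet, so if it is nonzero in K then
  S is K or shares the facet with K; in both cases S and K have a common vertex.\<close>

lemma facet_field_overlap:
  assumes K: "K \<in> M" "x \<in> interior (convex hull K)"
  shows "real (card {i\<in>facets. facet_field (fst i) (snd i) x \<noteq> 0}) \<le> overlap"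
proof -
  let ?T = "{S\<in>M. S \<inter> K \<noteq> {}}"
  have sub: "{i\<in>facets. facet_field (fst i) (snd i) x \<noteq> 0} \<subseteq> (SIGMA S:?T. S)"
  proof
    fix i assume i: "i \<in> {i\<in>facets. facet_field (fst i) (snd i) x \<noteq> 0}"
    then obtain S s where S: "i = (S, s)" "S \<in> M" "s \<in> S" "facet_field S s x \<noteq> 0" by (auto simp: facets_def)
    have eq: "L = K" if "L \<in> M" "cone_field L l x \<noteq> 0" for L l
    proof -
      have "x \<in> interior (convex hull L)" using that(2) by (auto simp: cone_field_def indicator_def split: if_splits)
      then have "x \<in> convex hull L" using interior_subset by blast
      then show ?thesis using interior_cell_unique[OF K(1) that(1) K(2)] by simp
    qed
    have "S \<inter> K \<noteq> {}"
    proof (cases "cone_field S s x = 0")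
      case False
      then show ?thesis using eq[OF S(2)] S(3) by blast
    next
      case True
      then have nb: "nb S s \<noteq> {}" "cone_field (nb S s) (opp S s) x \<noteq> 0"
        using S(4) by (auto simp: facet_field_def split: if_splits)
      then have "nb S s = K" using eq[OF nb_props(1)] by blast
      then have "S - {s} \<subseteq> K" using nb_props(3)[OF nb(1)] by simp
      moreover obtain t where "t \<in> S" "t \<noteq> s" using simplex_other_vertex[OF simplex[OF S(2)]] by blast
      ultimately show ?thesis by blast
    qed
    then show "i \<in> (SIGMA S:?T. S)" using S by blast
  qed
  have fin: "finite (SIGMA S:?T. S)" using finite_mesh vertices_finite by (intro finite_SigmaI) auto
  have "card {i\<in>facets. facet_field (fst i) (snd i) x \<noteq> 0} \<le> card (SIGMA S:?T. S)" by (rule card_mono[OF fin sub])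
  also have "\<dots> = (\<Sum>S\<in>?T. card S)" using finite_mesh vertices_finite by (intro card_SigmaI) auto
  also have "\<dots> = card ?T * (DIM('a) + 1)" using vertices_card by simp
  finally have "real (card {i\<in>facets. facet_field (fst i) (snd i) x \<noteq> 0}) \<le> real (card ?T * (DIM('a) + 1))"
    by (rule of_nat_mono)
  also have "\<dots> = real (card ?T) * (real DIM('a) + 1)" by (simp only: of_nat_mult of_nat_add of_nat_1)
  also have "\<dots> \<le> ((real DIM('a) + 1) * (\<omega> * \<kappa>)) * (real DIM('a) + 1)"
    by (rule mult_right_mono[OF card_touching[OF K(1)]]) simp
  finally show ?thesis unfolding overlap_def by (simp only: mult_ac)
qed

text \<open>The two cone fields contribute the reciprocals of their own weights; q converts the
  weight of the neighbour into that of S.\<close>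

lemma facet_field_norm:
  assumes S: "S \<in> M" "s \<in> S"
  shows "(\<integral>x. norm (facet_field S s x) ^ 2 \<partial>N) \<le> 2 * (1 + q) / m S"
proof (cases "nb S s = {}")
  case True
  have "(\<integral>x. norm (facet_field S s x) ^ 2 \<partial>N) \<le> 1 / m S"
    using cone_field_sq_int(2)[OF S] True by (simp add: facet_field_def)
  also have "\<dots> \<le> 2 * (1 + q) / m S" using q_ge_1 m_pos[OF S(1)] by (intro divide_right_mono) auto
  finally show ?thesis .
next
  case False
  let ?c = "cone_field S s" and ?d = "cone_field (nb S s) (opp S s)"
  note c = cone_field_sq_int[OF S] and d = cone_field_sq_int[OF nb_props(1)[OF False] opp_props(1)[OF S False]]
  have "(\<integral>x. norm (facet_field S s x) ^ 2 \<partial>N) \<le> (\<integral>x. 2 * norm (?c x) ^ 2 + 2 * norm (?d x) ^ 2 \<partial>N)"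
  proof (rule integral_mono)
    show "integrable N (\<lambda>x. norm (facet_field S s x) ^ 2)" using facet_field_weak_div(2)[OF S] by (simp add: sq_int_def)
    show "integrable N (\<lambda>x. 2 * norm (?c x) ^ 2 + 2 * norm (?d x) ^ 2)"
      using c(1) d(1) by (simp add: sq_int_def)
    fix x
    have "norm (?c x - ?d x) ^ 2 \<le> (norm (?c x) + norm (?d x)) ^ 2" by (intro power_mono norm_triangle_ineq4) simp
    also have "\<dots> \<le> 2 * norm (?c x) ^ 2 + 2 * norm (?d x) ^ 2"
      using sum_squares_bound[of "norm (?c x)" "norm (?d x)"] by (simp add: power2_sum)
    finally show "norm (facet_field S s x) ^ 2 \<le> 2 * norm (?c x) ^ 2 + 2 * norm (?d x) ^ 2"
      using False by (simp add: facet_field_def)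
  qed
  also have "\<dots> = 2 * (\<integral>x. norm (?c x) ^ 2 \<partial>N) + 2 * (\<integral>x. norm (?d x) ^ 2 \<partial>N)"
    using c(1) d(1) by (simp add: sq_int_def)
  also have "\<dots> \<le> 2 * (1 / m S) + 2 * (q / m S)"
  proof -
    have "1 / m (nb S s) \<le> q / m S"
      using m_neighbour[OF S False] m_pos[OF S(1)] m_pos[OF nb_props(1)[OF False]] by (simp add: field_simps)
    then show ?thesis using c(2) d(2) by simp
  qed
  finally show ?thesis by (simp add: add_divide_distrib distrib_left)
qed

lemma discrete_inf_sup:
  assumes p: "P0 M p" and D: "0 \<le> D"
    and dual: "\<And>W. H10 \<Omega> W \<Longrightarrow> \<bar>\<integral>x. p x * W x \<partial>N\<bar> \<le> D * sq_norm N (wgrad \<Omega> W)"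
  shows "\<exists>\<rho>\<in>RT0 \<Omega> M. (AE x in N. wdiv \<Omega> \<rho> x = p x) \<and> sq_norm N \<rho> \<le> infsup_const * D"
proof -
  let ?I = "\<lambda>S. interior (convex hull S)"
  obtain c where c: "\<And>S x. S \<in> M \<Longrightarrow> x \<in> ?I S \<Longrightarrow> p x = c S" using P0_value[OF p] by blast
  \<comment> \<open>The integral of p against any function whose cell means are given by w, in
    particular against the lifting of w.\<close>
  define F where "F w = (\<Sum>S\<in>M. c S * (w S * vol S))" for w
  have F_bound: "\<bar>F w\<bar> \<le> D * sqrt (lift_const * energy w)" for w
  proof -
    obtain W where W: "H10 \<Omega> W" "\<And>S. S \<in> M \<Longrightarrow> (\<integral>x. indicator (?I S) x * W x \<partial>N) = w S * vol S"
      "sq_norm N (wgrad \<Omega> W) ^ 2 \<le> lift_const * energy w" using conforming_lifting[of w] by blast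
    have "(\<integral>x. p x * W x \<partial>N) = (\<Sum>S\<in>M. \<integral>x. indicator (?I S) x * (p x * W x) \<partial>N)"
      by (rule cellwise_integral(1)[OF sq_int_mult_integrable[OF P0_sq_int[OF p] H10D(1)[OF W(1)]]])
    also have "\<dots> = F w"
      unfolding F_def
    proof (rule sum.cong[OF refl])
      fix S assume S: "S \<in> M"
      have "(\<integral>x. indicator (?I S) x * (p x * W x) \<partial>N) = (\<integral>x. c S * (indicator (?I S) x * W x) \<partial>N)"
        by (rule Bochner_Integration.integral_cong[OF refl]) (simp add: indicator_def c[OF S])
      then show "(\<integral>x. indicator (?I S) x * (p x * W x) \<partial>N) = c S * (w S * vol S)" using W(2)[OF S] by simp
    qed
    finally have "\<bar>F w\<bar> \<le> D * sq_norm N (wgrad \<Omega> W)" using dual[OF W(1)] by simp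
    also have "\<dots> \<le> D * sqrt (lift_const * energy w)"
      using W(3) D by (intro mult_left_mono real_le_rsqrt)
    finally show ?thesis .
  qed
  obtain Ml where Ml: "set Ml = M" using finite_list[OF finite_mesh] by blast
  define comb where "comb a w w' = (\<lambda>S. a * w S + w' S)" for a and w w' :: "'a set \<Rightarrow> real"
  have "\<exists>r\<in>UNIV. \<forall>w\<in>UNIV. form r w = F w"
  proof (rule finite_rank_representation[where comb=comb and ls="map (\<lambda>S w. w S) Ml"])
    show "form (comb a v w) z = a * form v z + form w z" for a v w z
      unfolding form_def comb_def jump_lincomb sum_distrib_left sum.distrib[symmetric]
      by (rule sum.cong) (auto simp: algebra_simps)
    show "form v w = form w v" for v w unfolding form_def by (rule sum.cong) (auto simp: mult_ac)
    show "0 \<le> form v v" for v unfolding form_energy by (rule energy_nonneg)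
    show "F (comb a v w) = a * F v + F w" for a v w
      unfolding F_def comb_def sum_distrib_left sum.distrib[symmetric]
      by (rule sum.cong) (auto simp: algebra_simps)
    \<comment> \<open>Solvability of the Euler equation: the bound by the energy makes F vanish on
      the null space of the form, without a separate proof of definiteness.\<close>
    show "F v = 0" if "form v v = 0" for v using F_bound[of v] that unfolding form_energy by simp
    show "l (comb a v w) = a * l v + l w" if "l \<in> set (map (\<lambda>S w. w S) Ml)" for l a v w
      using that by (auto simp: comb_def)
    show "form v v = 0" if z: "\<And>l. l \<in> set (map (\<lambda>S w. w S) Ml) \<Longrightarrow> l v = 0" for v
    proof -
      have v0: "v S = 0" if "S \<in> M" for S using z[of "\<lambda>w. w S"] that Ml by auto
      have "jump v S s = 0" if "S \<in> M" for S s
        unfolding jump_def using v0[OF that] v0[OF nb_props(1)] by simp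
      then show ?thesis unfolding form_def facets_def by (intro sum.neutral) auto
    qed
  qed auto
  then obtain r where r: "\<And>w. form r w = F w" by blast
  \<comment> \<open>The flux assigned to a facet is its weight times the jump of the solution r, so
    that pairing the divergence with cell values reproduces the form.\<close>
  define k where "k i = m (fst i) * jump r (fst i) (snd i)" for i :: "'a set \<times> 'a"
  define \<rho> where "\<rho> x = (\<Sum>i\<in>facets. k i *\<^sub>R facet_field (fst i) (snd i) x)" for x
  define d where "d x = (\<Sum>i\<in>facets. k i * facet_div (fst i) (snd i) x)" for x
  have fm: "fst i \<in> M" "snd i \<in> fst i" if "i \<in> facets" for i using that by (auto simp: facets_def)
  have wd: "is_weak_div \<Omega> \<rho> d" "sq_int N \<rho>" "sq_int N d"
    using weak_div_sum[OF finite_facets, of "\<lambda>i. facet_field (fst i) (snd i)" "\<lambda>i. facet_div (fst i) (snd i)" k]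
      facet_field_weak_div[OF fm] unfolding \<rho>_def[abs_def] d_def[abs_def] by blast+
  have density: "cell_density S x = (if S = K then 1 else 0) / vol K" if "K \<in> M" "x \<in> ?I K" "S \<in> M" for S K x
  proof (cases "S = K")
    case True
    then show ?thesis using that by (simp add: cell_density_def)
  next
    case False
    then have "x \<notin> ?I S" using interior_cell_unique[OF that(1,3,2)] interior_subset by blast
    then show ?thesis using False by (simp add: cell_density_def)
  qed
  have d_eq: "AE x in N. d x = p x"
    using AE_interior_cell
  proof eventually_elim
    case (elim x)
    then obtain K where K: "K \<in> M" "x \<in> ?I K" by blast
    \<comment> \<open>Testing the Euler equation with the indicator of the cell K reads off the
      divergence on K: its jumps, divided by the volume, are the values of \<open>facet_div\<close>
      at x.\<close>
    let ?e = "\<lambda>S. if S = K then 1 else 0 :: real"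
    have K0: "K \<noteq> {}" using simplex_verticesD(4)[OF simplex[OF K(1)]] .
    have "facet_div S s x = jump ?e S s / vol K" if "S \<in> M" for S s
      unfolding facet_div_def jump_def using density[OF K that] density[OF K nb_props(1), of S s]
      by (simp add: diff_divide_distrib)
    then have "d x = (\<Sum>i\<in>facets. k i * (jump ?e (fst i) (snd i) / vol K))"
      unfolding d_def by (intro sum.cong refl) (simp add: fm)
    also have "\<dots> = form r ?e / vol K"
      unfolding form_def k_def sum_divide_distrib by (rule sum.cong) (auto simp: mult_ac)
    also have "form r ?e = (\<Sum>S\<in>M. if S = K then c S * vol S else 0)"
      unfolding r F_def by (rule sum.cong) auto
    also have "\<dots> = c K * vol K" using finite_mesh K(1) by simp
    finally show ?case using c[OF K] vol_pos[OF K(1)] by simp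
  qed
  have hd: "Hdiv \<Omega> \<rho>" by (rule HdivI[OF wd(2,1,3)])
  have div: "AE x in N. wdiv \<Omega> \<rho> x = p x" using wdiv_props(3)[OF wd(1,3)] d_eq by eventually_elim simp
  have cone_aff: "\<exists>a b. \<forall>x\<in>?I K. cone_field S s x = a + b *\<^sub>R x" if "K \<in> M" "S \<in> M" for K S s
  proof (cases "S = K")
    case True
    let ?f = "1 / (real DIM('a) * vol S)"
    have "\<forall>x\<in>?I K. cone_field S s x = (- ?f) *\<^sub>R s + ?f *\<^sub>R x"
      using True by (simp add: cone_field_def scaleR_diff_right)
    then show ?thesis by blast
  next
    case False
    have "\<forall>x\<in>?I K. cone_field S s x = 0 + 0 *\<^sub>R x"
    proof
      fix x assume "x \<in> ?I K"
      then have "x \<notin> ?I S" using interior_cell_unique[OF that] False interior_subset by blast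
      then show "cone_field S s x = 0 + 0 *\<^sub>R x" by (simp add: cone_field_def)
    qed
    then show ?thesis by blast
  qed
  have facet_aff: "\<exists>a b. \<forall>x\<in>?I K. facet_field S s x = a + b *\<^sub>R x"
    if KS: "K \<in> M" "S \<in> M" for K S s
  proof (cases "nb S s = {}")
    case True
    then show ?thesis using cone_aff[OF KS, of s] by (simp add: facet_field_def)
  next
    case False
    obtain a b where 1: "\<And>x. x \<in> ?I K \<Longrightarrow> cone_field S s x = a + b *\<^sub>R x" using cone_aff[OF KS] by blast
    obtain a' b' where 2: "\<And>x. x \<in> ?I K \<Longrightarrow> cone_field (nb S s) (opp S s) x = a' + b' *\<^sub>R x"
      using cone_aff[OF KS(1) nb_props(1)[OF False]] by blast
    have "\<forall>x\<in>?I K. facet_field S s x = (a - a') + (b - b') *\<^sub>R x"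
      using False by (simp add: facet_field_def 1 2 scaleR_diff_left)
    then show ?thesis by blast
  qed
  have "\<rho> \<in> RT0 \<Omega> M"
    unfolding RT0_def
  proof (intro CollectI conjI ballI hd)
    fix K assume K: "K \<in> M"
    have "\<forall>i\<in>facets. \<exists>ab. \<forall>x\<in>?I K. facet_field (fst i) (snd i) x = fst ab + snd ab *\<^sub>R x"
      using facet_aff[OF K fm(1)] by (metis fst_conv snd_conv)
    from bchoice[OF this] obtain ab where ab: "\<And>i x. i \<in> facets \<Longrightarrow> x \<in> ?I K \<Longrightarrow>
        facet_field (fst i) (snd i) x = fst (ab i) + snd (ab i) *\<^sub>R x" by blast
    have "\<rho> x = (\<Sum>i\<in>facets. k i *\<^sub>R fst (ab i)) + (\<Sum>i\<in>facets. k i * snd (ab i)) *\<^sub>R x" if "x \<in> ?I K" for x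
      unfolding \<rho>_def scaleR_sum_left sum.distrib[symmetric]
      by (rule sum.cong) (simp_all add: ab[OF _ that] scaleR_add_right)
    then show "\<exists>a b. \<forall>x\<in>?I K. \<rho> x = a + b *\<^sub>R x" by blast
  qed
  moreover have "sq_norm N \<rho> \<le> infsup_const * D"
  proof -
    let ?f = "\<lambda>i x. k i *\<^sub>R facet_field (fst i) (snd i) x"
    have fi: "sq_int N (?f i)" if "i \<in> facets" for i
      by (rule sq_int_scaleR[OF facet_field_weak_div(2)[OF fm[OF that]]])
    have ov: "0 \<le> overlap" unfolding overlap_def using omega_pos kappa_pos by simp
    have "sq_norm N \<rho> ^ 2 \<le> (\<integral>x. overlap * (\<Sum>i\<in>facets. norm (?f i x) ^ 2) \<partial>N)"
      unfolding sq_norm_pow2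
    proof (rule integral_mono_AE)
      show "integrable N (\<lambda>x. norm (\<rho> x) ^ 2)" using wd(2) by (simp add: sq_int_def)
      show "integrable N (\<lambda>x. overlap * (\<Sum>i\<in>facets. norm (?f i x) ^ 2))"
        using fi unfolding sq_int_def by (intro integrable_mult_right Bochner_Integration.integrable_sum) blast
      show "AE x in N. norm (\<rho> x) ^ 2 \<le> overlap * (\<Sum>i\<in>facets. norm (?f i x) ^ 2)"
        using AE_interior_cell
      proof eventually_elim
        case (elim x)
        then obtain K where K: "K \<in> M" "x \<in> ?I K" by blast
        have "norm (\<rho> x) ^ 2 \<le> real (card {i\<in>facets. facet_field (fst i) (snd i) x \<noteq> 0}) * (\<Sum>i\<in>facets. norm (?f i x) ^ 2)"
          unfolding \<rho>_def by (rule norm_sum_pow2_le[OF finite_facets]) auto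
        also have "\<dots> \<le> overlap * (\<Sum>i\<in>facets. norm (?f i x) ^ 2)"
          by (intro mult_right_mono facet_field_overlap[OF K] sum_nonneg) simp
        finally show ?case .
      qed
    qed
    also have "\<dots> = overlap * (\<Sum>i\<in>facets. \<integral>x. norm (?f i x) ^ 2 \<partial>N)"
      using fi unfolding sq_int_def by (subst integral_mult_right_zero, subst Bochner_Integration.integral_sum) blast+
    also have "\<dots> \<le> overlap * (\<Sum>i\<in>facets. 2 * (1 + q) * (m (fst i) * (jump r (fst i) (snd i) * jump r (fst i) (snd i))))"
    proof (intro mult_left_mono[OF _ ov] sum_mono)
      fix i assume i: "i \<in> facets"
      note f = fm[OF i]
      have "(\<integral>x. norm (?f i x) ^ 2 \<partial>N) = (k i)\<^sup>2 * (\<integral>x. norm (facet_field (fst i) (snd i) x) ^ 2 \<partial>N)"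
        by (simp add: power_mult_distrib)
      also have "\<dots> \<le> (k i)\<^sup>2 * (2 * (1 + q) / m (fst i))" by (intro mult_left_mono facet_field_norm f) simp
      also have "\<dots> = 2 * (1 + q) * (m (fst i) * (jump r (fst i) (snd i) * jump r (fst i) (snd i)))"
        using m_pos[OF f(1)] by (simp add: k_def power2_eq_square)
      finally show "(\<integral>x. norm (?f i x) ^ 2 \<partial>N)
          \<le> 2 * (1 + q) * (m (fst i) * (jump r (fst i) (snd i) * jump r (fst i) (snd i)))" .
    qed
    also have "\<dots> = overlap * (2 * (1 + q)) * energy r"
      unfolding form_energy[symmetric] form_def sum_distrib_left[symmetric]
      by (simp add: case_prod_unfold)
    finally have 1: "sq_norm N \<rho> ^ 2 \<le> overlap * (2 * (1 + q)) * energy r" .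
    have E: "0 \<le> energy r" by (rule energy_nonneg)
    have "energy r \<le> lift_const * D ^ 2"
    proof (cases "energy r = 0")
      case True
      then show ?thesis using lift_const_nonneg by simp
    next
      case False
      then have E0: "0 < energy r" using E by simp
      \<comment> \<open>The Euler equation tested with its own solution: the energy of r equals F r,
        to which the bound through the lifting applies.\<close>
      have "energy r \<le> D * sqrt (lift_const * energy r)"
        using F_bound[of r] r[of r] E unfolding form_energy by simp
      then have "(energy r)\<^sup>2 \<le> (D * sqrt (lift_const * energy r))\<^sup>2" using E by (intro power_mono)
      also have "\<dots> = D\<^sup>2 * (lift_const * energy r)" using E lift_const_nonneg by (simp add: power_mult_distrib)
      finally have "energy r * energy r \<le> (lift_const * D ^ 2) * energy r" by (simp add: power2_eq_square mult_ac)
      then show ?thesis using E0 by (simp only: mult_le_cancel_right_pos)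
    qed
    then have "overlap * (2 * (1 + q)) * energy r \<le> overlap * (2 * (1 + q)) * (lift_const * D ^ 2)"
      using ov q_ge_1 by (intro mult_left_mono) auto
    with 1 have "sq_norm N \<rho> ^ 2 \<le> overlap * (2 * (1 + q)) * lift_const * D ^ 2" by (simp add: mult.assoc)
    then have "sq_norm N \<rho> \<le> sqrt (overlap * (2 * (1 + q)) * lift_const * D ^ 2)" by (rule real_le_rsqrt)
    then show ?thesis unfolding infsup_const_def using D by (simp add: real_sqrt_mult)
  qed
  ultimately show ?thesis using div by blast
qed

end

section \<open>Coercivity and quasi-optimality\<close>

context bounded_open
begin

lemma emb_N: "emb \<Omega> p v = (\<integral>x. p x * v x \<partial>N)"
  unfolding emb_def by (rule set_integral_eq_lebesgue_on[OF dom_sets])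

lemma Hm1_D:
  assumes "Hm1 \<Omega> f"
  shows "H10 \<Omega> v \<Longrightarrow> H10 \<Omega> w \<Longrightarrow> f (\<lambda>x. c * v x + w x) = c * f v + f w"
    "\<exists>K. \<forall>v. H10 \<Omega> v \<longrightarrow> \<bar>f v\<bar> \<le> K * sq_norm N (wgrad \<Omega> v)"
  using assms unfolding Hm1_def L2norm_sq_norm by blast+

lemma wgrad_zero: "H10 \<Omega> (\<lambda>_. 0)" "AE x in N. wgrad \<Omega> (\<lambda>_. 0) x = 0"
  using test_fun_H10[of "\<lambda>_. 0" "\<lambda>_. 0"] by (simp_all add: test_fun_def)

lemma wgrad_scale:
  assumes "H10 \<Omega> v"
  shows "H10 \<Omega> (\<lambda>x. c * v x + 0)" "sq_norm N (wgrad \<Omega> (\<lambda>x. c * v x + 0)) = \<bar>c\<bar> * sq_norm N (wgrad \<Omega> v)"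
proof -
  note l = H10_lincomb[OF assms wgrad_zero(1), of c]
  show H: "H10 \<Omega> (\<lambda>x. c * v x + 0)" by (rule l(1))
  have "AE x in N. wgrad \<Omega> (\<lambda>x. c * v x + 0) x = c *\<^sub>R wgrad \<Omega> v x"
    using l(2) wgrad_zero(2) by eventually_elim simp
  then have "sq_norm N (wgrad \<Omega> (\<lambda>x. c * v x + 0)) = sq_norm N (\<lambda>x. c *\<^sub>R wgrad \<Omega> v x)"
    by (intro sq_norm_cong_AE sq_int_measurable H10D(2)[OF H] sq_int_scaleR H10D(2)[OF assms])
  then show "sq_norm N (wgrad \<Omega> (\<lambda>x. c * v x + 0)) = \<bar>c\<bar> * sq_norm N (wgrad \<Omega> v)" by (simp add: sq_norm_scaleR)
qed

text \<open>Membership in \<open>Hm1\<close> bounds the set of values above, so its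
  \<open>Sup\<close> is a true supremum; scaling v to unit gradient norm gives the
  inequality.\<close>

lemma dual_norm_bound:
  assumes f: "Hm1 \<Omega> f" and v: "H10 \<Omega> v"
  shows "\<bar>f v\<bar> \<le> dual_norm \<Omega> f * sq_norm N (wgrad \<Omega> v)" "0 \<le> dual_norm \<Omega> f"
proof -
  let ?X = "{\<bar>f v\<bar> | v. H10 \<Omega> v \<and> L2norm \<Omega> (wgrad \<Omega> v) \<le> 1}"
  obtain K where K: "\<And>v. H10 \<Omega> v \<Longrightarrow> \<bar>f v\<bar> \<le> K * sq_norm N (wgrad \<Omega> v)" using Hm1_D(2)[OF f] by blast
  have bdd: "bdd_above ?X"
  proof (rule bdd_aboveI)
    fix y assume "y \<in> ?X"
    then obtain v where v: "y = \<bar>f v\<bar>" "H10 \<Omega> v" "sq_norm N (wgrad \<Omega> v) \<le> 1" unfolding L2norm_sq_norm by blast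
    have "y \<le> K * sq_norm N (wgrad \<Omega> v)" using K[OF v(2)] v(1) by simp
    also have "\<dots> \<le> \<bar>K\<bar> * 1" using v(3) by (intro mult_mono) auto
    finally show "y \<le> \<bar>K\<bar>" by simp
  qed
  have upper: "\<bar>f v\<bar> \<le> dual_norm \<Omega> f" if "H10 \<Omega> v" "sq_norm N (wgrad \<Omega> v) \<le> 1" for v
    unfolding dual_norm_def by (rule cSup_upper[OF _ bdd]) (use that in \<open>auto simp: L2norm_sq_norm\<close>)
  have z: "sq_norm N (wgrad \<Omega> (\<lambda>_. 0)) = 0"
    using sq_norm_eq_0_iff[OF H10D(2)[OF wgrad_zero(1)]] wgrad_zero(2) by simp
  have "sq_norm N (wgrad \<Omega> (\<lambda>_. 0)) \<le> 1" using z by simp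
  from order_trans[OF abs_ge_zero upper[OF wgrad_zero(1) this]] show "0 \<le> dual_norm \<Omega> f" .
  show "\<bar>f v\<bar> \<le> dual_norm \<Omega> f * sq_norm N (wgrad \<Omega> v)"
  \<comment> \<open>With vanishing gradient no scaling is possible, but then the bound with K forces
    f v = 0.\<close>
  proof (cases "sq_norm N (wgrad \<Omega> v) = 0")
    case True
    then show ?thesis using K[OF v] by simp
  next
    case False
    let ?n = "sq_norm N (wgrad \<Omega> v)"
    have n: "0 < ?n" using False sq_norm_nonneg[of N "wgrad \<Omega> v"] by linarith
    note s = wgrad_scale[OF v, of "1 / ?n"]
    have f0: "f (\<lambda>_. 0) = 0"
      using Hm1_D(1)[OF f wgrad_zero(1) wgrad_zero(1), of 1] by simp
    have "f (\<lambda>x. (1 / ?n) * v x + 0) = (1 / ?n) * f v"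
      using Hm1_D(1)[OF f v wgrad_zero(1), of "1 / ?n"] f0 by simp
    moreover have "\<bar>f (\<lambda>x. (1 / ?n) * v x + 0)\<bar> \<le> dual_norm \<Omega> f"
      using s(2) n by (intro upper s(1)) simp
    ultimately have "\<bar>(1 / ?n) * f v\<bar> \<le> dual_norm \<Omega> f" by simp
    then have "\<bar>f v\<bar> / ?n \<le> dual_norm \<Omega> f" using n by (simp add: abs_mult)
    then show ?thesis using n by (simp add: pos_divide_le_eq)
  qed
qed

lemma dual_norm_le:
  assumes "\<And>v. H10 \<Omega> v \<Longrightarrow> \<bar>f v\<bar> \<le> K * sq_norm N (wgrad \<Omega> v)" "0 \<le> K"
  shows "dual_norm \<Omega> f \<le> K"
  unfolding dual_norm_def
proof (rule cSup_least)
  have z: "sq_norm N (wgrad \<Omega> (\<lambda>_. 0)) = 0"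
    using sq_norm_eq_0_iff[OF H10D(2)[OF wgrad_zero(1)]] wgrad_zero(2) by simp
  have "\<bar>f (\<lambda>_. 0)\<bar> \<in> {\<bar>f v\<bar> | v. H10 \<Omega> v \<and> L2norm \<Omega> (wgrad \<Omega> v) \<le> 1}"
    using wgrad_zero(1) z unfolding L2norm_sq_norm by force
  then show "{\<bar>f v\<bar> | v. H10 \<Omega> v \<and> L2norm \<Omega> (wgrad \<Omega> v) \<le> 1} \<noteq> {}" by blast
  fix y assume "y \<in> {\<bar>f v\<bar> | v. H10 \<Omega> v \<and> L2norm \<Omega> (wgrad \<Omega> v) \<le> 1}"
  then obtain v where v: "y = \<bar>f v\<bar>" "H10 \<Omega> v" "sq_norm N (wgrad \<Omega> v) \<le> 1" unfolding L2norm_sq_norm by blast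
  have "y \<le> K * sq_norm N (wgrad \<Omega> v)" using assms(1)[OF v(2)] v(1) by simp
  also have "\<dots> \<le> K * 1" using v(3) assms(2) by (intro mult_left_mono) auto
  finally show "y \<le> K" by simp
qed

text \<open>The Friedrichs inequality turns the bound by the L2 norm of v into a bound by the norm
  of its gradient.\<close>

lemma emb_Hm1:
  assumes p: "sq_int N p"
  shows "Hm1 \<Omega> (emb \<Omega> p)"
proof -
  obtain C where C: "C \<ge> 0" "\<And>v. H10 \<Omega> v \<Longrightarrow> sq_norm N v \<le> C * sq_norm N (wgrad \<Omega> v)" using Friedrichs by blast
  have "\<bar>emb \<Omega> p v\<bar> \<le> (sq_norm N p * C) * sq_norm N (wgrad \<Omega> v)" if v: "H10 \<Omega> v" for v
  proof -
    have "\<bar>emb \<Omega> p v\<bar> \<le> sq_norm N p * sq_norm N v"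
      using sq_norm_Cauchy_Schwarz[OF p H10D(1)[OF v]] by (simp add: emb_N)
    also have "\<dots> \<le> sq_norm N p * (C * sq_norm N (wgrad \<Omega> v))" by (intro mult_left_mono C(2) v) simp
    finally show ?thesis by simp
  qed
  moreover have "emb \<Omega> p (\<lambda>x. c * v x + w x) = c * emb \<Omega> p v + emb \<Omega> p w" if "H10 \<Omega> v" "H10 \<Omega> w" for c v w
  proof -
    have "emb \<Omega> p (\<lambda>x. c * v x + w x) = (\<integral>x. c * (p x * v x) + p x * w x \<partial>N)"
      by (simp add: emb_N algebra_simps)
    also have "\<dots> = c * emb \<Omega> p v + emb \<Omega> p w"
      using sq_int_mult_integrable[OF p H10D(1)[OF that(1)]] sq_int_mult_integrable[OF p H10D(1)[OF that(2)]]
      by (simp add: emb_N)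
    finally show ?thesis .
  qed
  ultimately show ?thesis unfolding Hm1_def L2norm_sq_norm by blast
qed

text \<open>Coercivity: \<open>\<parallel>\<nabla>w\<parallel>\<^sup>2 + \<parallel>\<rho>\<parallel>\<^sup>2 = \<parallel>\<nabla>w - \<rho>\<parallel>\<^sup>2 - 2 (div \<rho>, w)\<close>.\<close>
lemma fosls_coercive:
  assumes w: "H10 \<Omega> w" and \<rho>: "Hdiv \<Omega> \<rho>"
    and C: "0 \<le> C" "\<And>v. H10 \<Omega> v \<Longrightarrow> sq_norm N v \<le> C * sq_norm N (wgrad \<Omega> v)"
  shows "sq_norm N (wgrad \<Omega> w) + sq_norm N \<rho>
    \<le> 2 * sq_norm N (\<lambda>x. wgrad \<Omega> w x - \<rho> x) + 4 * C * sq_norm N (wdiv \<Omega> \<rho>)"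
proof -
  let ?a = "sq_norm N (wgrad \<Omega> w)" and ?b = "sq_norm N \<rho>"
    and ?d = "sq_norm N (wdiv \<Omega> \<rho>)" and ?e = "sq_norm N (\<lambda>x. wgrad \<Omega> w x - \<rho> x)"
  note g = H10D[OF w] and r = HdivD[OF \<rho>]
  have "?e ^ 2 = ?b ^ 2 - 2 * (\<integral>x. \<rho> x \<bullet> wgrad \<Omega> w x \<partial>N) + ?a ^ 2"
    using sq_norm_lincomb_pow2[OF r(1) g(2), of "-1"] by simp
  moreover have "(\<integral>x. \<rho> x \<bullet> wgrad \<Omega> w x \<partial>N) = - (\<integral>x. wdiv \<Omega> \<rho> x * w x \<partial>N)"
    using Green_H10_Hdiv[OF w r(1,3,2)] by (simp add: inner_commute)
  moreover have "\<bar>\<integral>x. wdiv \<Omega> \<rho> x * w x \<partial>N\<bar> \<le> ?d * (C * ?a)"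
    using sq_norm_Cauchy_Schwarz[OF r(2) g(1)] mult_left_mono[OF C(2)[OF w] sq_norm_nonneg[of N "wdiv \<Omega> \<rho>"]]
    by simp
  ultimately have 1: "?a ^ 2 + ?b ^ 2 \<le> ?e ^ 2 + 2 * (C * ?d) * ?a" by (simp add: mult_ac)
  \<comment> \<open>Young's inequality, weighted so that twice the mixed term of the preceding
    estimate is absorbed by one square of \<open>?a\<close>.\<close>
  have 2: "4 * (C * ?d) * ?a \<le> ?a ^ 2 + 4 * (C * ?d) ^ 2"
    using sum_squares_bound[of ?a "2 * (C * ?d)"] by (simp add: power_mult_distrib mult_ac)
  have 3: "2 * ?a * ?b \<le> ?a ^ 2 + ?b ^ 2" using sum_squares_bound[of ?a ?b] by simp
  have "(?a + ?b) ^ 2 = ?a ^ 2 + ?b ^ 2 + 2 * ?a * ?b" by (simp add: power2_sum)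
  also have "\<dots> \<le> 4 * ?e ^ 2 + 8 * (C * ?d) ^ 2"
  proof -
    have "?a ^ 2 + 2 * ?b ^ 2 \<le> 2 * ?e ^ 2 + 4 * (C * ?d) ^ 2" using 1 2 by linarith
    moreover have "0 \<le> ?b ^ 2" by simp
    ultimately show ?thesis using 3 by linarith
  qed
  also have "\<dots> \<le> (2 * ?e + 4 * (C * ?d)) ^ 2"
  proof -
    have "0 \<le> ?e * (C * ?d)" using C(1) by simp
    then have "0 \<le> 16 * (?e * (C * ?d)) + 8 * (C * ?d) ^ 2" by simp
    moreover have "(2 * ?e + 4 * (C * ?d)) ^ 2 = 4 * ?e ^ 2 + 16 * (?e * (C * ?d)) + 16 * (C * ?d) ^ 2"
      unfolding power2_sum by (simp only: power_mult_distrib mult_ac) simp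
    ultimately show ?thesis by linarith
  qed
  finally have "?a + ?b \<le> 2 * ?e + 4 * (C * ?d)"
    by (rule power2_le_imp_le) (use C(1) in simp)
  then show ?thesis by (simp add: mult.assoc)
qed

end

section \<open>The discrete spaces\<close>

context simplicial_mesh
begin

lemma RT0_Hdiv: "\<tau> \<in> RT0 \<Omega> M \<Longrightarrow> Hdiv \<Omega> \<tau>"
  unfolding RT0_def by blast

lemma RT0_lincomb:
  assumes "\<tau> \<in> RT0 \<Omega> M" "\<rho> \<in> RT0 \<Omega> M"
  shows "(\<lambda>x. c *\<^sub>R \<tau> x + \<rho> x) \<in> RT0 \<Omega> M"
  unfolding RT0_def
proof (intro CollectI conjI ballI)
  show "Hdiv \<Omega> (\<lambda>x. c *\<^sub>R \<tau> x + \<rho> x)" by (rule Hdiv_lincomb(1)[OF assms[THEN RT0_Hdiv]])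
  fix S assume S: "S \<in> M"
  obtain a b where 1: "\<And>x. x \<in> interior (convex hull S) \<Longrightarrow> \<tau> x = a + b *\<^sub>R x" using assms(1) S unfolding RT0_def by blast
  obtain a' b' where 2: "\<And>x. x \<in> interior (convex hull S) \<Longrightarrow> \<rho> x = a' + b' *\<^sub>R x" using assms(2) S unfolding RT0_def by blast
  have "\<forall>x\<in>interior (convex hull S). c *\<^sub>R \<tau> x + \<rho> x = (c *\<^sub>R a + a') + (c * b + b') *\<^sub>R x"
    by (simp add: 1 2 scaleR_add_right scaleR_add_left)
  then show "\<exists>a b. \<forall>x\<in>interior (convex hull S). c *\<^sub>R \<tau> x + \<rho> x = a + b *\<^sub>R x" by blast
qed

lemma UT_H10: "v \<in> UT \<Omega> M \<Longrightarrow> H10 \<Omega> v"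
  unfolding UT_def by blast

lemma UT_lincomb:
  assumes "v \<in> UT \<Omega> M" "w \<in> UT \<Omega> M"
  shows "(\<lambda>x. c * v x + w x) \<in> UT \<Omega> M"
  unfolding UT_def P1_def
proof (intro CollectI conjI ballI)
  show "H10 \<Omega> (\<lambda>x. c * v x + w x)" by (rule H10_lincomb(1)[OF assms[THEN UT_H10]])
  fix S assume S: "S \<in> M"
  obtain a b where 1: "\<And>x. x \<in> convex hull S \<Longrightarrow> v x = a \<bullet> x + b" using assms(1) S unfolding UT_def P1_def by blast
  obtain a' b' where 2: "\<And>x. x \<in> convex hull S \<Longrightarrow> w x = a' \<bullet> x + b'" using assms(2) S unfolding UT_def P1_def by blast
  have "\<forall>x\<in>convex hull S. c * v x + w x = (c *\<^sub>R a + a') \<bullet> x + (c * b + b')"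
    by (simp add: 1 2 inner_add_left algebra_simps)
  then show "\<exists>a b. \<forall>x\<in>convex hull S. c * v x + w x = a \<bullet> x + b" by blast
qed

lemma zero_UT: "(\<lambda>_. 0) \<in> UT \<Omega> M"
proof -
  have "\<forall>x\<in>convex hull S. 0 = (0::'a) \<bullet> x + (0::real)" for S :: "'a set" by simp
  then have "P1 M (\<lambda>_. 0)" unfolding P1_def by blast
  then show ?thesis using wgrad_zero(1) by (simp add: UT_def)
qed

lemma zero_weak_div: "is_weak_div \<Omega> (\<lambda>_. 0) (\<lambda>_. 0)" by (simp add: is_weak_div_iff)

lemma zero_RT0: "(\<lambda>_. 0) \<in> RT0 \<Omega> M"
proof -
  have "Hdiv \<Omega> (\<lambda>_. 0)" by (rule HdivI[OF _ zero_weak_div]) (simp_all add: sq_int_def)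
  moreover have "\<forall>x\<in>interior (convex hull S). 0 = (0::'a) + 0 *\<^sub>R x" for S :: "'a set" by simp
  ultimately show ?thesis unfolding RT0_def by blast
qed

text \<open>On a cell the field is a + b x with divergence DIM * b. Testing the weak divergence with
  functions supported in the interior of that cell identifies it there; the lemma lets the
  projection Q act on the divergence.\<close>

lemma RT0_div_P0:
  assumes \<tau>: "\<tau> \<in> RT0 \<Omega> M"
  obtains p where "P0 M p" "AE x in N. wdiv \<Omega> \<tau> x = p x"
proof -
  let ?n = "real DIM('a)" and ?I = "\<lambda>S. interior (convex hull S)"
  note h = HdivD[OF RT0_Hdiv[OF \<tau>]]
  have "\<forall>S\<in>M. \<exists>ab. \<forall>x\<in>?I S. \<tau> x = fst ab + snd ab *\<^sub>R x"
  proof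
    fix S assume "S \<in> M"
    then obtain a b where "\<forall>x\<in>?I S. \<tau> x = a + b *\<^sub>R x" using \<tau> unfolding RT0_def by blast
    then show "\<exists>ab. \<forall>x\<in>?I S. \<tau> x = fst ab + snd ab *\<^sub>R x" by (intro exI[of _ "(a, b)"]) simp
  qed
  from bchoice[OF this] obtain ab where ab: "\<And>S x. S \<in> M \<Longrightarrow> x \<in> ?I S \<Longrightarrow> \<tau> x = fst (ab S) + snd (ab S) *\<^sub>R x" by blast
  define p where "p x = (\<Sum>S\<in>M. indicator (?I S) x *\<^sub>R (?n * snd (ab S)))" for x
  have pS: "p x = ?n * snd (ab S)" if "S \<in> M" "x \<in> ?I S" for S x
    unfolding p_def by (rule sum_interior_indicator[OF that])
  have P0p: "P0 M p" unfolding P0_def using pS by blast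
  have cell: "AE x in N. x \<in> ?I S \<longrightarrow> wdiv \<Omega> \<tau> x = p x" if S: "S \<in> M" for S
  proof -
    have sI: "?I S \<in> sets lebesgue" and op: "open (?I S)" by (simp_all add: borel_open)
    have bd: "bounded (?I S)" using bounded_subset[OF bounded_dom interior_cell_subset[OF S]] .
    let ?b = "snd (ab S)"
    have restr: "(\<integral>x. f x \<partial>lebesgue_on (?I S)) = (\<integral>x. indicator (?I S) x *\<^sub>R f x \<partial>N)" for f :: "'a \<Rightarrow> real"
    proof -
      have "(\<lambda>x. indicator \<Omega> x *\<^sub>R (indicator (?I S) x *\<^sub>R f x)) = (\<lambda>x. indicator (?I S) x *\<^sub>R f x)"
        using interior_cell_subset[OF S] by (auto simp: fun_eq_iff indicator_def)
      then show ?thesis using sI dom_sets by (simp add: integral_restrict_space)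
    qed
    have m: "wdiv \<Omega> \<tau> \<in> borel_measurable (lebesgue_on (?I S))"
      using measurable_restrict_mono[OF sq_int_measurable[OF h(2)] interior_cell_subset[OF S]] .
    have "integrable (lebesgue_on (?I S)) (\<lambda>x. norm (wdiv \<Omega> \<tau> x) ^ 2)"
    proof -
      have "set_integrable lebesgue \<Omega> (\<lambda>x. norm (wdiv \<Omega> \<tau> x) ^ 2)"
        using h(2) dom_sets unfolding sq_int_def by (simp add: integrable_restrict_space set_integrable_def)
      then have "set_integrable lebesgue (?I S) (\<lambda>x. norm (wdiv \<Omega> \<tau> x) ^ 2)"
        by (rule set_integrable_subset[OF _ sI interior_cell_subset[OF S]])
      then show ?thesis using sI by (simp add: integrable_restrict_space set_integrable_def)
    qed
    then have sq: "sq_int (lebesgue_on (?I S)) (wdiv \<Omega> \<tau>)" using m by (simp add: sq_int_def)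
    have fin: "finite_measure (lebesgue_on (?I S))" by (rule finite_measure_lebesgue_on[OF bd sI])
    have sc: "sq_int (lebesgue_on (?I S)) (\<lambda>_. ?n * ?b)"
      by (rule sq_int_bounded[OF fin, of _ "\<bar>?n * ?b\<bar>"]) auto
    have "AE x in lebesgue_on (?I S). wdiv \<Omega> \<tau> x - ?n * ?b = 0"
    proof (rule test_fun_orthogonal_imp_zero[OF op bd sq_int_diff[OF sq sc]])
      fix \<psi> D assume tf: "test_fun (?I S) \<psi> D"
      have tf\<Omega>: "test_fun \<Omega> \<psi> D" by (rule test_fun_mono[OF tf interior_cell_subset[OF S]])
      have out: "\<psi> x = 0" "D x = 0" if "x \<notin> ?I S" for x
      proof -
        have "x \<notin> closure {x. \<psi> x \<noteq> 0}" using test_funD(5)[OF tf] that by blast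
        then show "\<psi> x = 0" "D x = 0" by (rule test_funD(6)[OF tf], rule test_fun_grad_zero[OF tf])
      qed
      have out\<Omega>: "\<psi> x = 0" "D x = 0" if "x \<notin> \<Omega>" for x
        using out[of x] that interior_cell_subset[OF S] by blast+
      have "(\<integral>x. wdiv \<Omega> \<tau> x * \<psi> x \<partial>N) = - (\<integral>x. \<tau> x \<bullet> D x \<partial>N)"
        using weak_divD[OF h(3) tf\<Omega>] by simp
      also have "(\<integral>x. \<tau> x \<bullet> D x \<partial>N) = (\<integral>x. fst (ab S) \<bullet> D x + ?b * ((x - 0) \<bullet> D x) \<partial>N)"
      proof (rule Bochner_Integration.integral_cong[OF refl])
        fix x show "\<tau> x \<bullet> D x = fst (ab S) \<bullet> D x + ?b * ((x - 0) \<bullet> D x)"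
          by (cases "x \<in> ?I S") (simp_all add: ab[OF S] out(2) inner_add_left)
      qed
      also have "\<dots> = (\<integral>x. fst (ab S) \<bullet> D x + ?b * ((x - 0) \<bullet> D x) \<partial>lborel)"
        by (rule integral_lebesgue_on_supported[OF borel_measurable_continuous_onI dom_sets])
          (auto intro!: continuous_intros test_funD(2)[OF tf] simp: out\<Omega>)
      also have "\<dots> = fst (ab S) \<bullet> (\<integral>x. D x \<partial>lborel) + ?b * (\<integral>x. (x - 0) \<bullet> D x \<partial>lborel)"
        using test_fun_integrable(2)[OF tf] test_fun_integral_radial(2)[OF tf, of 0] by simp
      also have "\<dots> = - (?n * ?b * (\<integral>x. \<psi> x \<partial>lborel))"
        using test_fun_integral_grad_zero[OF tf] test_fun_integral_radial(1)[OF tf, of 0] by simp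
      also have "(\<integral>x. \<psi> x \<partial>lborel) = (\<integral>x. \<psi> x \<partial>N)"
        by (rule integral_lebesgue_on_supported[symmetric, OF borel_measurable_continuous_onI[OF test_funD(3)[OF tf]] dom_sets])
          (rule out\<Omega>)
      finally have e: "(\<integral>x. wdiv \<Omega> \<tau> x * \<psi> x \<partial>N) = ?n * ?b * (\<integral>x. \<psi> x \<partial>N)" by simp
      have i1: "integrable N (\<lambda>x. wdiv \<Omega> \<tau> x * \<psi> x)" by (rule sq_int_mult_integrable[OF h(2) test_sq_int(1)[OF tf\<Omega>]])
      have i2: "integrable N \<psi>"
        using sq_int_mult_integrable[OF test_sq_int(1)[OF tf\<Omega>] sq_int_bounded[OF finite_N, of "\<lambda>_. 1" 1]] by simp
      have "(\<integral>x. \<psi> x *\<^sub>R (wdiv \<Omega> \<tau> x - ?n * ?b) \<partial>lebesgue_on (?I S))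
          = (\<integral>x. wdiv \<Omega> \<tau> x * \<psi> x - ?n * ?b * \<psi> x \<partial>N)"
        unfolding restr by (rule Bochner_Integration.integral_cong[OF refl])
          (simp add: indicator_def out(1) algebra_simps)
      also have "\<dots> = 0" using i1 i2 e by simp
      finally show "(\<integral>x. \<psi> x *\<^sub>R (wdiv \<Omega> \<tau> x - ?n * ?b) \<partial>lebesgue_on (?I S)) = 0" .
    qed
    then have "AE x in lebesgue. x \<in> ?I S \<longrightarrow> wdiv \<Omega> \<tau> x = ?n * ?b" using sI by (simp add: AE_restrict_space_iff)
    then have "AE x in lebesgue. x \<in> \<Omega> \<longrightarrow> x \<in> ?I S \<longrightarrow> wdiv \<Omega> \<tau> x = p x"
      by eventually_elim (simp add: pS[OF S])
    then show ?thesis using dom_sets by (simp add: AE_restrict_space_iff)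
  qed
  have "AE x in N. \<forall>S\<in>M. x \<in> ?I S \<longrightarrow> wdiv \<Omega> \<tau> x = p x" by (rule AE_finite_allI[OF finite_mesh cell])
  then have "AE x in N. wdiv \<Omega> \<tau> x = p x" using AE_interior_cell by eventually_elim blast
  then show ?thesis using that P0p by blast
qed

end

section \<open>The least-squares problem\<close>

context simplicial_mesh
begin

definition pairs :: "(('a \<Rightarrow> real) \<times> ('a \<Rightarrow> 'a)) set" where
  "pairs = UT \<Omega> M \<times> RT0 \<Omega> M"

definition comb :: "real \<Rightarrow> ('a \<Rightarrow> real) \<times> ('a \<Rightarrow> 'a) \<Rightarrow> ('a \<Rightarrow> real) \<times> ('a \<Rightarrow> 'a) \<Rightarrow> ('a \<Rightarrow> real) \<times> ('a \<Rightarrow> 'a)" where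
  "comb c y z = ((\<lambda>x. c * fst y x + fst z x), (\<lambda>x. c *\<^sub>R snd y x + snd z x))"

text \<open>With values in a product space the functional becomes a single squared L2 norm, that of
  the residual shifted by (g, 0), and least-squares theory applies to one linear map.\<close>

definition residual :: "('a \<Rightarrow> real) \<times> ('a \<Rightarrow> 'a) \<Rightarrow> 'a \<Rightarrow> real \<times> 'a" where
  "residual y x = (wdiv \<Omega> (snd y) x, wgrad \<Omega> (fst y) x - snd y x)"

lemma pairsD: "y \<in> pairs \<Longrightarrow> fst y \<in> UT \<Omega> M" "y \<in> pairs \<Longrightarrow> snd y \<in> RT0 \<Omega> M"
  unfolding pairs_def by auto

lemma comb_pairs: "y \<in> pairs \<Longrightarrow> z \<in> pairs \<Longrightarrow> comb c y z \<in> pairs"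
  using UT_lincomb RT0_lincomb by (simp add: pairs_def comb_def mem_Times_iff)

lemma sq_int_Pair:
  fixes f :: "'a \<Rightarrow> real" and g :: "'a \<Rightarrow> 'a"
  assumes "sq_int N f" "sq_int N g"
  shows "sq_int N (\<lambda>x. (f x, g x))" "sq_norm N (\<lambda>x. (f x, g x)) ^ 2 = sq_norm N f ^ 2 + sq_norm N g ^ 2"
  using assms unfolding sq_norm_pow2 by (auto simp: sq_int_def norm_Pair)

lemma residual_sq_int:
  assumes "y \<in> pairs"
  shows "sq_int N (residual y)"
  using sq_int_Pair(1)[OF HdivD(2)[OF RT0_Hdiv[OF pairsD(2)[OF assms]]]
      sq_int_diff[OF H10D(2)[OF UT_H10[OF pairsD(1)[OF assms]]] HdivD(1)[OF RT0_Hdiv[OF pairsD(2)[OF assms]]]]]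
  unfolding residual_def .

lemma residual_comb:
  assumes "y \<in> pairs" "z \<in> pairs"
  shows "AE x in N. residual (comb c y z) x = c *\<^sub>R residual y x + residual z x"
  using H10_lincomb(2)[OF UT_H10[OF pairsD(1)[OF assms(1)]] UT_H10[OF pairsD(1)[OF assms(2)]], of c]
    Hdiv_lincomb(2)[OF RT0_Hdiv[OF pairsD(2)[OF assms(1)]] RT0_Hdiv[OF pairsD(2)[OF assms(2)]], of c]
  by eventually_elim (simp add: residual_def comb_def algebra_simps)

lemma residual_inner_comb:
  assumes y: "y \<in> pairs" and z: "z \<in> pairs" and g: "sq_int N g"
  shows "(\<integral>x. residual (comb c y z) x \<bullet> g x \<partial>N) = c * (\<integral>x. residual y x \<bullet> g x \<partial>N) + (\<integral>x. residual z x \<bullet> g x \<partial>N)"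
proof -
  note i = residual_sq_int[OF y] residual_sq_int[OF z] residual_sq_int[OF comb_pairs[OF y z]]
  have ae: "AE x in N. residual (comb c y z) x \<bullet> g x = (c *\<^sub>R residual y x + residual z x) \<bullet> g x"
    using residual_comb[OF y z, of c] by eventually_elim simp
  have "(\<integral>x. residual (comb c y z) x \<bullet> g x \<partial>N) = (\<integral>x. (c *\<^sub>R residual y x + residual z x) \<bullet> g x \<partial>N)"
    by (rule integral_cong_AE[OF _ _ ae])
      (intro borel_measurable_inner sq_int_measurable[OF i(3)] sq_int_measurable[OF g]
        sq_int_measurable[OF sq_int_lincomb[OF i(1,2)]])+
  also have "\<dots> = c * (\<integral>x. residual y x \<bullet> g x \<partial>N) + (\<integral>x. residual z x \<bullet> g x \<partial>N)"
    using sq_int_inner[OF i(1) g] sq_int_inner[OF i(2) g] by (simp add: inner_add_left)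
  finally show ?thesis .
qed

lemma fosls_residual:
  assumes y: "y \<in> pairs" and g: "sq_int N g"
  shows "fosls \<Omega> g (fst y) (snd y) = sq_norm N (\<lambda>x. residual y x + (g x, 0)) ^ 2"
proof -
  note h = H10D(2)[OF UT_H10[OF pairsD(1)[OF y]]] and t = HdivD[OF RT0_Hdiv[OF pairsD(2)[OF y]]]
  have "sq_int N (\<lambda>x. wdiv \<Omega> (snd y) x + g x)" using sq_int_lincomb[OF t(2) g, of 1] by simp
  from sq_int_Pair(2)[OF this sq_int_diff[OF h t(1)]] show ?thesis
    by (simp add: fosls_def residual_def L2norm_sq_norm)
qed

lemma residual_coercive:
  assumes y: "y \<in> pairs"
    and C: "0 \<le> C" "\<And>v. H10 \<Omega> v \<Longrightarrow> sq_norm N v \<le> C * sq_norm N (wgrad \<Omega> v)"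
  shows "sq_norm N (wgrad \<Omega> (fst y)) + sq_norm N (snd y) \<le> (2 + 4 * C) * sq_norm N (residual y)"
proof -
  note h = UT_H10[OF pairsD(1)[OF y]] and t = RT0_Hdiv[OF pairsD(2)[OF y]]
  let ?d = "sq_norm N (wdiv \<Omega> (snd y))" and ?e = "sq_norm N (\<lambda>x. wgrad \<Omega> (fst y) x - snd y x)"
  have e: "sq_norm N (residual y) ^ 2 = ?d ^ 2 + ?e ^ 2"
    using sq_int_Pair(2)[OF HdivD(2)[OF t] sq_int_diff[OF H10D(2)[OF h] HdivD(1)[OF t]]]
    unfolding residual_def .
  have d: "?d \<le> sq_norm N (residual y)" and e: "?e \<le> sq_norm N (residual y)"
    by (rule power2_le_imp_le; simp add: e)+
  have "sq_norm N (wgrad \<Omega> (fst y)) + sq_norm N (snd y) \<le> 2 * ?e + 4 * C * ?d" by (rule fosls_coercive[OF h t C])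
  also have "\<dots> \<le> 2 * sq_norm N (residual y) + 4 * C * sq_norm N (residual y)"
    using d e C(1) by (intro add_mono mult_left_mono) auto
  finally show ?thesis by (simp add: algebra_simps)
qed

text \<open>Finitely many values determine a pair: those of the first component at the vertices, and
  those of the second at two points of each cell.\<close>
lemma residual_separation:
  obtains Vt Pt where "finite Vt" "finite Pt"
    "\<And>y. y \<in> pairs \<Longrightarrow> (\<And>s. s \<in> Vt \<Longrightarrow> fst y s = 0) \<Longrightarrow> (\<And>p. p \<in> Pt \<Longrightarrow> snd y p = 0)
      \<Longrightarrow> AE x in N. residual y x = 0"
proof -
  let ?I = "\<lambda>S. interior (convex hull S)"
  obtain b :: 'a where b: "b \<in> Basis" using nonempty_Basis by blast
  have "\<forall>S\<in>M. \<exists>pq. fst pq \<in> ?I S \<and> snd pq \<in> ?I S \<and> fst pq \<noteq> snd pq"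
  proof
    fix S assume "S \<in> M"
    then obtain a e where e: "a \<in> ?I S" "0 < e" "cball a e \<subseteq> ?I S"
      using simplex_interior_nonempty[OF simplex] open_contains_cball[of "?I S"] open_interior by blast
    have "a + e *\<^sub>R b \<in> cball a e" using e(2) b by (simp add: dist_norm)
    then have "a + e *\<^sub>R b \<in> ?I S" using e(3) by blast
    then show "\<exists>pq. fst pq \<in> ?I S \<and> snd pq \<in> ?I S \<and> fst pq \<noteq> snd pq"
      using e(1,2) nonzero_Basis[OF b] by (intro exI[of _ "(a, a + e *\<^sub>R b)"]) simp
  qed
  from bchoice[OF this] obtain pq where pq: "\<forall>S\<in>M. fst (pq S) \<in> ?I S \<and> snd (pq S) \<in> ?I S \<and> fst (pq S) \<noteq> snd (pq S)" ..
  let ?Vt = "\<Union>M" and ?Pt = "(fst \<circ> pq) ` M \<union> (snd \<circ> pq) ` M"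
  have "AE x in N. residual y x = 0"
    if y: "y \<in> pairs" and v0: "\<And>s. s \<in> ?Vt \<Longrightarrow> fst y s = 0" and t0: "\<And>p. p \<in> ?Pt \<Longrightarrow> snd y p = 0" for y
  proof -
    have vh: "fst y x = 0" if S: "S \<in> M" and x: "x \<in> convex hull S" for S x
    proof -
      obtain a c where ac: "\<And>x. x \<in> convex hull S \<Longrightarrow> fst y x = a \<bullet> x + c"
        using pairsD(1)[OF y] S unfolding UT_def P1_def by blast
      have "S \<subseteq> {x. a \<bullet> x = - c}"
      proof
        fix s assume s: "s \<in> S"
        then have "a \<bullet> s + c = 0" using ac[OF hull_inc[of s S convex]] v0[of s] S by auto
        then show "s \<in> {x. a \<bullet> x = - c}" by simp
      qed
      then have "convex hull S \<subseteq> {x. a \<bullet> x = - c}" by (rule hull_minimal) (rule convex_hyperplane)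
      then have "a \<bullet> x = - c" using x by blast
      then show ?thesis using ac[OF x] by simp
    qed
    have v\<Omega>: "fst y x = 0" if "x \<in> \<Omega>" for x
    proof -
      have "x \<in> (\<Union>S\<in>M. convex hull S)" using that closure_subset cells_union by blast
      then show ?thesis using vh by blast
    qed
    have "is_weak_grad \<Omega> (fst y) (\<lambda>_. 0)"
      unfolding is_weak_grad_iff
    proof (intro allI impI)
      fix \<phi> D
      have "(\<integral>x. fst y x *\<^sub>R D x \<partial>N) = (\<integral>x. 0 \<partial>N)"
        by (rule Bochner_Integration.integral_cong[OF refl]) (simp add: v\<Omega>)
      then show "(\<integral>x. fst y x *\<^sub>R D x \<partial>N) = - (\<integral>x. \<phi> x *\<^sub>R 0 \<partial>N)" by simp
    qed
    then have g0: "AE x in N. wgrad \<Omega> (fst y) x = 0" by (rule wgrad_props(3)) (simp add: sq_int_def)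
    have th: "snd y x = 0" if S: "S \<in> M" and x: "x \<in> ?I S" for S x
    proof -
      obtain a c where ac: "\<And>x. x \<in> ?I S \<Longrightarrow> snd y x = a + c *\<^sub>R x"
        using pairsD(2)[OF y] S unfolding RT0_def by blast
      note q = bspec[OF pq S]
      have 1: "a + c *\<^sub>R fst (pq S) = 0" "a + c *\<^sub>R snd (pq S) = 0"
        using ac q t0[of "fst (pq S)"] t0[of "snd (pq S)"] S by auto
      then have "c *\<^sub>R (fst (pq S) - snd (pq S)) = 0"
        by (simp add: scaleR_diff_right add_eq_0_iff)
      then have "c = 0" using q by simp
      then show ?thesis using 1(1) ac[OF x] by simp
    qed
    have t: "AE x in N. snd y x = 0" using AE_interior_cell by eventually_elim (use th in blast)
    have "is_weak_div \<Omega> (snd y) (\<lambda>_. 0)"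
      unfolding is_weak_div_iff
    proof (intro allI impI)
      fix \<phi> D assume tf: "test_fun \<Omega> \<phi> D"
      have "(\<integral>x. snd y x \<bullet> D x \<partial>N) = 0"
        by (rule integral_eq_zero_AE) (use t in eventually_elim, simp)
      then show "(\<integral>x. snd y x \<bullet> D x \<partial>N) = - (\<integral>x. 0 * \<phi> x \<partial>N)" by simp
    qed
    then have d0: "AE x in N. wdiv \<Omega> (snd y) x = 0" by (rule wdiv_props(3)) (simp add: sq_int_def)
    show ?thesis using t g0 d0 by eventually_elim (simp add: residual_def zero_prod_def)
  qed
  moreover have "finite ?Vt" "finite ?Pt" using finite_mesh vertices_finite by auto
  ultimately show ?thesis by (intro that[of ?Vt ?Pt]) blast+
qed

text \<open>The discrete spaces are sets of functions without a chosen basis, so existence comes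
  from \<open>finite_rank_representation\<close> for the product of residuals. The separating
  functionals are the point values of \<open>residual_separation\<close>.\<close>

lemma fosls_normal_equations:
  assumes g: "sq_int N g"
  shows "\<exists>r\<in>pairs. \<forall>y\<in>pairs. (\<integral>x. residual r x \<bullet> residual y x \<partial>N) = - (\<integral>x. residual y x \<bullet> (g x, 0) \<partial>N)"
proof -
  obtain Vt Pt where sep: "finite Vt" "finite Pt"
    "\<And>y. y \<in> pairs \<Longrightarrow> (\<And>s. s \<in> Vt \<Longrightarrow> fst y s = 0) \<Longrightarrow> (\<And>p. p \<in> Pt \<Longrightarrow> snd y p = 0)
      \<Longrightarrow> AE x in N. residual y x = 0"
    using residual_separation by blast
  obtain vs where vs: "set vs = Vt" using finite_list[OF sep(1)] by blast
  obtain ps where ps: "set ps = Pt \<times> (Basis :: 'a set)" using finite_list[OF finite_cartesian_product[OF sep(2) finite_Basis]] by blast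
  let ?ls = "map (\<lambda>s y. fst y s) vs @ map (\<lambda>p y. snd y (fst p) \<bullet> snd p) ps"
  have g': "sq_int N (\<lambda>x. (g x, 0 :: 'a))" by (rule sq_int_Pair(1)[OF g]) (simp add: sq_int_def)
  note pow = power2_norm_eq_inner[symmetric]
  have B0: "(\<integral>x. residual y x \<bullet> residual y x \<partial>N) = 0 \<longleftrightarrow> (AE x in N. residual y x = 0)" if "y \<in> pairs" for y
    using sq_norm_eq_0_iff[OF residual_sq_int[OF that]] sq_norm_pow2[of N "residual y"]
    by (simp add: pow) (metis power_eq_0_iff zero_neq_numeral zero_power2)
  show ?thesis
  proof (rule finite_rank_representation[where comb = comb and ls = ?ls and ?z0.0 = "(\<lambda>_. 0, \<lambda>_. 0)"])
    show "comb c v w \<in> pairs" if "v \<in> pairs" "w \<in> pairs" for c v w by (rule comb_pairs[OF that])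
    show "(\<integral>x. residual (comb c v w) x \<bullet> residual z x \<partial>N)
        = c * (\<integral>x. residual v x \<bullet> residual z x \<partial>N) + (\<integral>x. residual w x \<bullet> residual z x \<partial>N)"
      if "v \<in> pairs" "w \<in> pairs" "z \<in> pairs" for c v w z
      by (rule residual_inner_comb[OF that(1,2) residual_sq_int[OF that(3)]])
    show "(\<integral>x. residual v x \<bullet> residual w x \<partial>N) = (\<integral>x. residual w x \<bullet> residual v x \<partial>N)" for v w
      by (simp add: inner_commute)
    show "0 \<le> (\<integral>x. residual v x \<bullet> residual v x \<partial>N)" for v by simp
    show "l (comb c v w) = c * l v + l w" if "l \<in> set ?ls" for l c v w
      using that by (auto simp: comb_def inner_add_left)
    show "(\<integral>x. residual v x \<bullet> residual v x \<partial>N) = 0"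
      if v: "v \<in> pairs" and l0: "\<And>l. l \<in> set ?ls \<Longrightarrow> l v = 0" for v
    proof -
      have "fst v s = 0" if s: "s \<in> Vt" for s
        by (rule l0) (use s vs in auto)
      moreover have "snd v p = 0" if p: "p \<in> Pt" for p
      proof (rule euclidean_eqI)
        fix e :: 'a assume "e \<in> Basis"
        then have pe: "(p, e) \<in> set ps" using p ps by simp
        have "(\<lambda>y. snd y p \<bullet> e) \<in> set ?ls"
          using imageI[OF pe, of "\<lambda>p (y :: ('a \<Rightarrow> real) \<times> ('a \<Rightarrow> 'a)). snd y (fst p) \<bullet> snd p"]
          by (simp only: set_append set_map Un_iff fst_conv snd_conv) simp
        from l0[OF this] show "snd v p \<bullet> e = 0 \<bullet> e" by simp
      qed
      ultimately show ?thesis using sep(3)[OF v] B0[OF v] by blast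
    qed
    show "- (\<integral>x. residual (comb c v w) x \<bullet> (g x, 0) \<partial>N)
        = c * - (\<integral>x. residual v x \<bullet> (g x, 0) \<partial>N) + - (\<integral>x. residual w x \<bullet> (g x, 0) \<partial>N)"
      if "v \<in> pairs" "w \<in> pairs" for c v w
      using residual_inner_comb[OF that g', of c] by simp
    show "- (\<integral>x. residual v x \<bullet> (g x, 0) \<partial>N) = 0"
      if v: "v \<in> pairs" and 0: "(\<integral>x. residual v x \<bullet> residual v x \<partial>N) = 0" for v
    proof -
      have ae: "AE x in N. residual v x = 0" using 0 B0[OF v] by blast
      have "AE x in N. residual v x \<bullet> (g x, 0) = 0" using ae by eventually_elim simp
      then show ?thesis by (simp add: integral_eq_zero_AE)
    qed
    show "(\<lambda>_. 0, \<lambda>_. 0) \<in> pairs" using zero_UT zero_RT0 by (simp add: pairs_def)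
  qed
qed

text \<open>By the normal equations the shifted residual of r is orthogonal to all residuals, in
  particular to that of \<open>comb (-1) r y\<close>, which is y - r.\<close>

lemma fosls_Pythagoras:
  assumes g: "sq_int N g" and r: "r \<in> pairs" and y: "y \<in> pairs"
    and orth: "\<forall>y\<in>pairs. (\<integral>x. residual r x \<bullet> residual y x \<partial>N) = - (\<integral>x. residual y x \<bullet> (g x, 0) \<partial>N)"
  shows "fosls \<Omega> g (fst y) (snd y) = fosls \<Omega> g (fst r) (snd r) + sq_norm N (residual (comb (-1) r y)) ^ 2"
proof -
  let ?z = "comb (-1) r y" and ?g = "\<lambda>x. (g x, 0 :: 'a)"
  have z: "?z \<in> pairs" by (rule comb_pairs[OF r y])
  have g': "sq_int N ?g" by (rule sq_int_Pair(1)[OF g]) (simp add: sq_int_def)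
  note i = residual_sq_int[OF r] residual_sq_int[OF y] residual_sq_int[OF z]
  have rg: "sq_int N (\<lambda>x. residual r x + ?g x)" using sq_int_lincomb[OF i(1) g', of 1] by simp
  have yg: "sq_int N (\<lambda>x. residual y x + ?g x)" using sq_int_lincomb[OF i(2) g', of 1] by simp
  have zg: "sq_int N (\<lambda>x. 1 *\<^sub>R (residual r x + ?g x) + residual ?z x)" by (rule sq_int_lincomb[OF rg i(3)])
  have ae: "AE x in N. residual y x + ?g x = 1 *\<^sub>R (residual r x + ?g x) + residual ?z x"
    using residual_comb[OF r y, of "-1"] by eventually_elim simp
  have "fosls \<Omega> g (fst y) (snd y) = sq_norm N (\<lambda>x. 1 *\<^sub>R (residual r x + ?g x) + residual ?z x) ^ 2"
    using sq_norm_cong_AE[OF sq_int_measurable[OF yg] sq_int_measurable[OF zg] ae]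
    by (simp add: fosls_residual[OF y g])
  also have "\<dots> = sq_norm N (\<lambda>x. residual r x + ?g x) ^ 2 + 2 * (\<integral>x. (residual r x + ?g x) \<bullet> residual ?z x \<partial>N)
      + sq_norm N (residual ?z) ^ 2"
    unfolding sq_norm_lincomb_pow2[OF rg i(3)] by simp
  also have "(\<integral>x. (residual r x + ?g x) \<bullet> residual ?z x \<partial>N)
      = (\<integral>x. residual r x \<bullet> residual ?z x \<partial>N) + (\<integral>x. residual ?z x \<bullet> ?g x \<partial>N)"
    using sq_int_inner[OF i(1,3)] sq_int_inner[OF g' i(3)]
    by (simp add: inner_add_left inner_commute[of "residual (comb (- 1) r y) _" "(g _, 0)"])
  also have "\<dots> = 0" using bspec[OF orth z] by simp
  finally show ?thesis by (simp add: fosls_residual[OF r g])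
qed

text \<open>With p the divergence of \<tau> and q = Q (p + f), linearity and the projection property
  give q = p + Q f. Subtracting from \<tau> a field with divergence q leaves the divergence - Q f.
  The cost is bounded because p + f, as a functional, is the pairing of \<sigma> - \<tau> with
  gradients.\<close>

lemma equilibrated_RT0:
  assumes f: "Hm1 \<Omega> f" and Q: "bounded_P0_projection \<Omega> M CQ Q"
    and u: "H10 \<Omega> u" "\<And>v. H10 \<Omega> v \<Longrightarrow> (\<integral>x. wgrad \<Omega> u x \<bullet> wgrad \<Omega> v x \<partial>N) = f v"
    and \<sigma>: "sq_int N \<sigma>" "is_weak_grad \<Omega> u \<sigma>" and \<tau>: "\<tau> \<in> RT0 \<Omega> M"
  shows "\<exists>\<rho>\<in>RT0 \<Omega> M. (AE x in N. wdiv \<Omega> \<rho> x + Q f x = 0) \<and>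
    sq_norm N (\<lambda>x. \<rho> x - \<tau> x) \<le> infsup_const * \<bar>CQ\<bar> * sq_norm N (\<lambda>x. \<sigma> x - \<tau> x)"
proof -
  obtain p where p: "P0 M p" "AE x in N. wdiv \<Omega> \<tau> x = p x" using RT0_div_P0[OF \<tau>] by blast
  note t = HdivD[OF RT0_Hdiv[OF \<tau>]]
  note pe = emb_Hm1[OF P0_sq_int[OF p(1)]]
  \<comment> \<open>The factor 1 gives the functional the shape c * \<phi> + \<psi> in which
    linearity of Q is stated.\<close>
  define \<phi> where "\<phi> = (\<lambda>v. 1 * emb \<Omega> p v + f v)"
  let ?R = "sq_norm N (\<lambda>x. \<sigma> x - \<tau> x)"
  have \<phi>v: "\<phi> v = (\<integral>x. (\<sigma> x - \<tau> x) \<bullet> wgrad \<Omega> v x \<partial>N)" if v: "H10 \<Omega> v" for v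
  proof -
    note h = H10D[OF v]
    have "emb \<Omega> p v = (\<integral>x. wdiv \<Omega> \<tau> x * v x \<partial>N)"
      unfolding emb_N
    proof (rule integral_cong_AE)
      show "AE x in N. p x * v x = wdiv \<Omega> \<tau> x * v x" using p(2) by eventually_elim simp
    qed (intro borel_measurable_times sq_int_measurable[OF P0_sq_int[OF p(1)]] sq_int_measurable[OF h(1)]
        sq_int_measurable[OF t(2)])+
    also have "\<dots> = - (\<integral>x. \<tau> x \<bullet> wgrad \<Omega> v x \<partial>N)"
      using Green_H10_Hdiv[OF v t(1,3,2)] by (simp add: inner_commute)
    finally have 1: "emb \<Omega> p v = - (\<integral>x. \<tau> x \<bullet> wgrad \<Omega> v x \<partial>N)" .
    have "(\<integral>x. wgrad \<Omega> u x \<bullet> wgrad \<Omega> v x \<partial>N) = (\<integral>x. \<sigma> x \<bullet> wgrad \<Omega> v x \<partial>N)"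
    proof (rule integral_cong_AE)
      show "AE x in N. wgrad \<Omega> u x \<bullet> wgrad \<Omega> v x = \<sigma> x \<bullet> wgrad \<Omega> v x"
        using wgrad_props(3)[OF \<sigma>(2,1)] by eventually_elim simp
    qed (intro borel_measurable_inner sq_int_measurable[OF H10D(2)[OF u(1)]] sq_int_measurable[OF h(2)]
        sq_int_measurable[OF \<sigma>(1)])+
    then have 2: "f v = (\<integral>x. \<sigma> x \<bullet> wgrad \<Omega> v x \<partial>N)" using u(2)[OF v] by simp
    show ?thesis using sq_int_inner[OF \<sigma>(1) h(2)] sq_int_inner[OF t(1) h(2)]
      by (simp add: \<phi>_def 1 2 inner_diff_left)
  qed
  have \<phi>_le: "\<bar>\<phi> v\<bar> \<le> ?R * sq_norm N (wgrad \<Omega> v)" if v: "H10 \<Omega> v" for v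
    using sq_norm_Cauchy_Schwarz[OF sq_int_diff[OF \<sigma>(1) t(1)] H10D(2)[OF v]] \<phi>v[OF v] by simp
  have \<phi>: "Hm1 \<Omega> \<phi>"
    unfolding Hm1_def
  proof (intro conjI allI impI exI[of _ ?R])
    show "\<bar>\<phi> v\<bar> \<le> ?R * L2norm \<Omega> (wgrad \<Omega> v)" if "H10 \<Omega> v" for v
      using \<phi>_le[OF that] unfolding L2norm_sq_norm .
    show "\<phi> (\<lambda>x. c * v x + w x) = c * \<phi> v + \<phi> w" if "H10 \<Omega> v \<and> H10 \<Omega> w" for c v w
      using Hm1_D(1)[OF f, of v w c] Hm1_D(1)[OF pe, of v w c] that by (simp add: \<phi>_def algebra_simps)
  qed
  have dual: "dual_norm \<Omega> \<phi> \<le> ?R" by (rule dual_norm_le[OF \<phi>_le]) simp_all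
  let ?q = "Q \<phi>"
  have q: "P0 M ?q" and dq: "dual_norm \<Omega> (emb \<Omega> ?q) \<le> CQ * dual_norm \<Omega> \<phi>"
    using Q \<phi> unfolding bounded_P0_projection_def by blast+
  have "AE x in lebesgue. x \<in> \<Omega> \<longrightarrow> Q (\<lambda>v. 1 * emb \<Omega> p v + f v) x = 1 * Q (emb \<Omega> p) x + Q f x"
    and "AE x in lebesgue. x \<in> \<Omega> \<longrightarrow> Q (emb \<Omega> p) x = p x"
    using Q pe f p(1) unfolding bounded_P0_projection_def by blast+
  then have "AE x in lebesgue. x \<in> \<Omega> \<longrightarrow> ?q x = p x + Q f x" unfolding \<phi>_def by eventually_elim simp
  then have qe: "AE x in N. ?q x = p x + Q f x" using dom_sets by (simp add: AE_restrict_space_iff)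
  note qs = P0_sq_int[OF q]
  \<comment> \<open>The absolute value serves because no sign of CQ is assumed, while the bound
    passed to the inf-sup condition must be nonnegative.\<close>
  let ?D = "\<bar>CQ\<bar> * ?R"
  have "\<bar>\<integral>x. ?q x * W x \<partial>N\<bar> \<le> ?D * sq_norm N (wgrad \<Omega> W)" if W: "H10 \<Omega> W" for W
  proof -
    have "\<bar>\<integral>x. ?q x * W x \<partial>N\<bar> \<le> dual_norm \<Omega> (emb \<Omega> ?q) * sq_norm N (wgrad \<Omega> W)"
      using dual_norm_bound(1)[OF emb_Hm1[OF qs] W] by (simp add: emb_N)
    also have "dual_norm \<Omega> (emb \<Omega> ?q) \<le> ?D"
    proof -
      have "CQ * dual_norm \<Omega> \<phi> \<le> \<bar>CQ\<bar> * dual_norm \<Omega> \<phi>"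
        using dual_norm_bound(2)[OF \<phi> wgrad_zero(1)] by (intro mult_right_mono) auto
      also have "\<dots> \<le> ?D" using dual by (intro mult_left_mono) auto
      finally show ?thesis using dq by simp
    qed
    finally show ?thesis by (simp add: mult_right_mono)
  qed
  then obtain \<rho> where \<rho>: "\<rho> \<in> RT0 \<Omega> M" "AE x in N. wdiv \<Omega> \<rho> x = ?q x" "sq_norm N \<rho> \<le> infsup_const * ?D"
    using discrete_inf_sup[OF q, of ?D] by auto
  let ?\<tau> = "\<lambda>x. (-1) *\<^sub>R \<rho> x + \<tau> x"
  have "AE x in N. wdiv \<Omega> ?\<tau> x + Q f x = 0"
    using Hdiv_lincomb(2)[OF RT0_Hdiv[OF \<rho>(1)] RT0_Hdiv[OF \<tau>], of "-1"] \<rho>(2) qe p(2)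
    by eventually_elim simp
  moreover have "sq_norm N (\<lambda>x. ?\<tau> x - \<tau> x) \<le> infsup_const * \<bar>CQ\<bar> * ?R"
    using sq_norm_scaleR[of N "-1" \<rho>] \<rho>(3) by (simp add: mult.assoc)
  ultimately show ?thesis by (intro bexI[OF _ RT0_lincomb[OF \<rho>(1) \<tau>, of "-1"]] conjI)
qed

text \<open>Origin of the constant: replacing \<tau> by the equilibrated field multiplies the error
  by at most 1 + \<open>infsup_const\<close> |CQ|, coercivity contributes 2 + 4 C, and the triangle
  inequality through the comparison pair adds one more.\<close>

theorem fosls_quasi_optimal:
  assumes C: "0 \<le> C" "\<And>v. H10 \<Omega> v \<Longrightarrow> sq_norm N v \<le> C * sq_norm N (wgrad \<Omega> v)"
    and f: "Hm1 \<Omega> f" and Q: "bounded_P0_projection \<Omega> M CQ Q"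
    and u: "H10 \<Omega> u" "\<And>v. H10 \<Omega> v \<Longrightarrow> (\<integral>x. wgrad \<Omega> u x \<bullet> wgrad \<Omega> v x \<partial>N) = f v"
    and \<sigma>: "sq_int N \<sigma>" "is_weak_grad \<Omega> u \<sigma>"
  shows "\<exists>uT \<sigma>T. fosls_min \<Omega> M (Q f) uT \<sigma>T \<and>
    (\<forall>v \<tau>. fosls_min \<Omega> M (Q f) v \<tau> \<longrightarrow>
      L2norm \<Omega> (\<lambda>x. wgrad \<Omega> v x - wgrad \<Omega> uT x) = 0 \<and> L2norm \<Omega> (\<lambda>x. \<tau> x - \<sigma>T x) = 0) \<and>
    (\<forall>v\<in>UT \<Omega> M. \<forall>\<tau>\<in>RT0 \<Omega> M.
      L2norm \<Omega> (wgrad \<Omega> (\<lambda>x. u x - uT x)) + L2norm \<Omega> (\<lambda>x. \<sigma> x - \<sigma>T x)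
      \<le> (1 + infsup_const * \<bar>CQ\<bar>) * (3 + 4 * C)
        * (L2norm \<Omega> (wgrad \<Omega> (\<lambda>x. u x - v x)) + L2norm \<Omega> (\<lambda>x. \<sigma> x - \<tau> x)))"
proof -
  have "P0 M (Q f)" using Q f unfolding bounded_P0_projection_def by blast
  then have g: "sq_int N (Q f)" by (rule P0_sq_int)
  obtain r where r: "r \<in> pairs"
    and orth: "\<forall>y\<in>pairs. (\<integral>x. residual r x \<bullet> residual y x \<partial>N) = - (\<integral>x. residual y x \<bullet> (Q f x, 0) \<partial>N)"
    using fosls_normal_equations[OF g] by blast
  note pyth = fosls_Pythagoras[OF g r _ orth]
  let ?uT = "fst r" and ?\<sigma>T = "snd r" and ?k = "1 + infsup_const * \<bar>CQ\<bar>"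
  note hr = H10D[OF UT_H10[OF pairsD(1)[OF r]]] and tr = HdivD[OF RT0_Hdiv[OF pairsD(2)[OF r]]]
  have dist: "sq_norm N (\<lambda>x. wgrad \<Omega> v x - wgrad \<Omega> ?uT x) + sq_norm N (\<lambda>x. \<tau> x - ?\<sigma>T x)
      \<le> (2 + 4 * C) * sq_norm N (residual (comb (-1) r (v, \<tau>)))"
    if v: "v \<in> UT \<Omega> M" and \<tau>: "\<tau> \<in> RT0 \<Omega> M" for v \<tau>
  proof -
    have y: "(v, \<tau>) \<in> pairs" using v \<tau> by (simp add: pairs_def)
    note z = comb_pairs[OF r y, of "-1"]
    have "sq_norm N (wgrad \<Omega> (fst (comb (-1) r (v, \<tau>)))) = sq_norm N (\<lambda>x. wgrad \<Omega> v x - wgrad \<Omega> ?uT x)"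
    proof (rule sq_norm_cong_AE)
      show "AE x in N. wgrad \<Omega> (fst (comb (-1) r (v, \<tau>))) x = wgrad \<Omega> v x - wgrad \<Omega> ?uT x"
        using H10_lincomb(2)[OF UT_H10[OF pairsD(1)[OF r]] UT_H10[OF v], of "-1"]
        by eventually_elim (simp add: comb_def)
    qed (intro sq_int_measurable H10D(2)[OF UT_H10[OF pairsD(1)[OF z]]] sq_int_diff[OF H10D(2)[OF UT_H10[OF v]] hr(2)])+
    moreover have "snd (comb (-1) r (v, \<tau>)) = (\<lambda>x. \<tau> x - ?\<sigma>T x)" by (simp add: comb_def)
    ultimately show ?thesis using residual_coercive[OF z C] by simp
  qed
  have min: "fosls_min \<Omega> M (Q f) ?uT ?\<sigma>T"
    unfolding fosls_min_def
  proof (intro conjI ballI pairsD[OF r])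
    fix w \<rho> assume "w \<in> UT \<Omega> M" "\<rho> \<in> RT0 \<Omega> M"
    then have "(w, \<rho>) \<in> pairs" by (simp add: pairs_def)
    from pyth[OF this] show "fosls \<Omega> (Q f) ?uT ?\<sigma>T \<le> fosls \<Omega> (Q f) w \<rho>" by simp
  qed
  have uniq: "sq_norm N (\<lambda>x. wgrad \<Omega> v x - wgrad \<Omega> ?uT x) = 0 \<and> sq_norm N (\<lambda>x. \<tau> x - ?\<sigma>T x) = 0"
    if m: "fosls_min \<Omega> M (Q f) v \<tau>" for v \<tau>
  proof -
    have v: "v \<in> UT \<Omega> M" and \<tau>: "\<tau> \<in> RT0 \<Omega> M" and le: "fosls \<Omega> (Q f) v \<tau> \<le> fosls \<Omega> (Q f) ?uT ?\<sigma>T"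
      using m pairsD[OF r] unfolding fosls_min_def by blast+
    have y: "(v, \<tau>) \<in> pairs" using v \<tau> by (simp add: pairs_def)
    have "sq_norm N (residual (comb (-1) r (v, \<tau>))) ^ 2 \<le> 0" using pyth[OF y] le by simp
    then have "sq_norm N (residual (comb (-1) r (v, \<tau>))) = 0" by simp
    then have "sq_norm N (\<lambda>x. wgrad \<Omega> v x - wgrad \<Omega> ?uT x) + sq_norm N (\<lambda>x. \<tau> x - ?\<sigma>T x) \<le> 0"
      using dist[OF v \<tau>] by simp
    then show ?thesis
      using sq_norm_nonneg[of N "\<lambda>x. wgrad \<Omega> v x - wgrad \<Omega> ?uT x"] sq_norm_nonneg[of N "\<lambda>x. \<tau> x - ?\<sigma>T x"]
      by linarith
  qed
  have diff: "sq_norm N (wgrad \<Omega> (\<lambda>x. u x - v x)) = sq_norm N (\<lambda>x. \<sigma> x - wgrad \<Omega> v x)"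
    if v: "H10 \<Omega> v" for v
  proof -
    have e: "(\<lambda>x. u x - v x) = (\<lambda>x. (-1) * v x + u x)" by (simp add: fun_eq_iff)
    note l = H10_lincomb[OF v u(1), of "-1"]
    show ?thesis
      unfolding e
    proof (rule sq_norm_cong_AE)
      show "AE x in N. wgrad \<Omega> (\<lambda>x. (-1) * v x + u x) x = \<sigma> x - wgrad \<Omega> v x"
        using l(2) wgrad_props(3)[OF \<sigma>(2,1)] by eventually_elim simp
    qed (intro sq_int_measurable H10D(2)[OF l(1)] sq_int_diff[OF \<sigma>(1) H10D(2)[OF v]])+
  qed
  have err: "sq_norm N (wgrad \<Omega> (\<lambda>x. u x - ?uT x)) + sq_norm N (\<lambda>x. \<sigma> x - ?\<sigma>T x)
      \<le> ?k * (3 + 4 * C) * (sq_norm N (wgrad \<Omega> (\<lambda>x. u x - v x)) + sq_norm N (\<lambda>x. \<sigma> x - \<tau> x))"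
    if v: "v \<in> UT \<Omega> M" and \<tau>: "\<tau> \<in> RT0 \<Omega> M" for v \<tau>
  proof -
    note hv = UT_H10[OF v] and ht = HdivD[OF RT0_Hdiv[OF \<tau>]]
    obtain \<rho> where \<rho>: "\<rho> \<in> RT0 \<Omega> M" "AE x in N. wdiv \<Omega> \<rho> x + Q f x = 0"
      "sq_norm N (\<lambda>x. \<rho> x - \<tau> x) \<le> infsup_const * \<bar>CQ\<bar> * sq_norm N (\<lambda>x. \<sigma> x - \<tau> x)"
      using equilibrated_RT0[OF f Q u \<sigma> \<tau>] by blast
    note hp = HdivD[OF RT0_Hdiv[OF \<rho>(1)]]
    have y: "(v, \<rho>) \<in> pairs" using v \<rho>(1) by (simp add: pairs_def)
    let ?A = "sq_norm N (wgrad \<Omega> (\<lambda>x. u x - v x))" and ?B = "sq_norm N (\<lambda>x. \<sigma> x - \<tau> x)"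
    have k: "infsup_const * \<bar>CQ\<bar> * ?B \<le> infsup_const * \<bar>CQ\<bar> * (?A + ?B)"
      using infsup_const_nonneg by (intro mult_left_mono) auto
    have \<sigma>\<rho>: "sq_norm N (\<lambda>x. \<sigma> x - \<rho> x) \<le> ?B + infsup_const * \<bar>CQ\<bar> * ?B"
      using sq_norm_triangle[OF \<sigma>(1) ht(1) hp(1)] \<rho>(3) sq_norm_minus_commute[of N \<tau> \<rho>] by linarith
    have "sq_norm N (\<lambda>x. wgrad \<Omega> v x - \<rho> x) \<le> sq_norm N (\<lambda>x. wgrad \<Omega> v x - \<sigma> x) + sq_norm N (\<lambda>x. \<sigma> x - \<rho> x)"
      by (rule sq_norm_triangle[OF H10D(2)[OF hv] \<sigma>(1) hp(1)])
    then have vr: "sq_norm N (\<lambda>x. wgrad \<Omega> v x - \<rho> x) \<le> ?k * (?A + ?B)"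
      using \<sigma>\<rho> k diff[OF hv] sq_norm_minus_commute[of N "wgrad \<Omega> v" \<sigma>] by (simp add: algebra_simps)
    have dp: "sq_int N (\<lambda>x. wdiv \<Omega> \<rho> x + Q f x)" using sq_int_lincomb[OF hp(2) g, of 1] by simp
    \<comment> \<open>At the equilibrated pair the first term of the functional is zero, so no norm
      of f beyond the dual norm enters.\<close>
    have "fosls \<Omega> (Q f) v \<rho> = sq_norm N (\<lambda>x. wgrad \<Omega> v x - \<rho> x) ^ 2"
      using sq_norm_eq_0_iff[OF dp] \<rho>(2) by (simp add: fosls_def L2norm_sq_norm)
    then have "sq_norm N (residual (comb (-1) r (v, \<rho>))) ^ 2 \<le> sq_norm N (\<lambda>x. wgrad \<Omega> v x - \<rho> x) ^ 2"
      using pyth[OF y] by (simp add: fosls_def)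
    then have "sq_norm N (residual (comb (-1) r (v, \<rho>))) \<le> sq_norm N (\<lambda>x. wgrad \<Omega> v x - \<rho> x)"
      by (rule power2_le_imp_le) simp
    then have res: "sq_norm N (residual (comb (-1) r (v, \<rho>))) \<le> ?k * (?A + ?B)" using vr by simp
    have d: "sq_norm N (\<lambda>x. wgrad \<Omega> v x - wgrad \<Omega> ?uT x) + sq_norm N (\<lambda>x. \<rho> x - ?\<sigma>T x)
        \<le> (2 + 4 * C) * (?k * (?A + ?B))"
      by (rule order_trans[OF dist[OF v \<rho>(1)] mult_left_mono[OF res]]) (use C(1) in simp)
    have 1: "sq_norm N (wgrad \<Omega> (\<lambda>x. u x - ?uT x)) \<le> ?A + sq_norm N (\<lambda>x. wgrad \<Omega> v x - wgrad \<Omega> ?uT x)"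
      unfolding diff[OF hv] diff[OF UT_H10[OF pairsD(1)[OF r]]]
      by (rule sq_norm_triangle[OF \<sigma>(1) H10D(2)[OF hv] hr(2)])
    have 2: "sq_norm N (\<lambda>x. \<sigma> x - ?\<sigma>T x) \<le> sq_norm N (\<lambda>x. \<sigma> x - \<rho> x) + sq_norm N (\<lambda>x. \<rho> x - ?\<sigma>T x)"
      by (rule sq_norm_triangle[OF \<sigma>(1) hp(1) tr(1)])
    have 3: "?A + sq_norm N (\<lambda>x. \<sigma> x - \<rho> x) \<le> ?k * (?A + ?B)"
      using \<sigma>\<rho> k by (simp add: algebra_simps)
    have "?k * (3 + 4 * C) * (?A + ?B) = (2 + 4 * C) * (?k * (?A + ?B)) + ?k * (?A + ?B)"
      by (simp add: algebra_simps)
    then show ?thesis using 1 2 3 d by linarith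
  qed
  show ?thesis
    using min uniq err unfolding L2norm_sq_norm by (intro exI[of _ ?uT] exI[of _ ?\<sigma>T]) blast
qed

end

text \<open>Members of \<open>UT\<close> and \<open>RT0\<close> are functions on the whole space
  with free values outside, so uniqueness is expressed by vanishing norms of differences. The
  minimum on the right is expressed by quantifying over all discrete pairs, and \<sigma> is any
  square integrable representative of the weak gradient of u.\<close>

theorem mainTheorem5:
  fixes \<Omega> :: "'a::euclidean_space set" and \<kappa>0 CQ :: real
  assumes "DIM('a) = 2 \<or> DIM('a) = 3"
    and "lipschitz_domain \<Omega>" and "polytopal \<Omega>"
  shows "\<exists>C. \<forall>M Q f u \<sigma>.
    conforming_mesh \<Omega> M \<and> shape_reg M \<le> \<kappa>0 \<and>
    bounded_P0_projection \<Omega> M CQ Q \<and>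
    Hm1 \<Omega> f \<and>
    H10 \<Omega> u \<and> (\<forall>v. H10 \<Omega> v \<longrightarrow> (LINT x:\<Omega>|lebesgue. wgrad \<Omega> u x \<bullet> wgrad \<Omega> v x) = f v) \<and>
    L2 \<Omega> \<sigma> \<and> is_weak_grad \<Omega> u \<sigma>
    \<longrightarrow>
    (\<exists>uT \<sigma>T. fosls_min \<Omega> M (Q f) uT \<sigma>T \<and>
       (\<forall>v \<tau>. fosls_min \<Omega> M (Q f) v \<tau> \<longrightarrow>
           L2norm \<Omega> (\<lambda>x. wgrad \<Omega> v x - wgrad \<Omega> uT x) = 0 \<and> L2norm \<Omega> (\<lambda>x. \<tau> x - \<sigma>T x) = 0) \<and>
       (\<forall>v\<in>UT \<Omega> M. \<forall>\<tau>\<in>RT0 \<Omega> M.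
           L2norm \<Omega> (wgrad \<Omega> (\<lambda>x. u x - uT x)) + L2norm \<Omega> (\<lambda>x. \<sigma> x - \<sigma>T x)
           \<le> C * (L2norm \<Omega> (wgrad \<Omega> (\<lambda>x. u x - v x)) + L2norm \<Omega> (\<lambda>x. \<sigma> x - \<tau> x))))"
proof -
  interpret bounded_open \<Omega> using assms(2) unfolding lipschitz_domain_def by unfold_locales blast+
  obtain C where C: "0 \<le> C" "\<And>v. H10 \<Omega> v \<Longrightarrow> sq_norm N v \<le> C * sq_norm N (wgrad \<Omega> v)" using Friedrichs by blast
  have mesh: "simplicial_mesh \<Omega> M \<kappa>0" if M: "conforming_mesh \<Omega> M" and \<kappa>: "shape_reg M \<le> \<kappa>0" for M
  proof unfold_locales
    show "\<Omega> \<noteq> {}" using assms(2) unfolding lipschitz_domain_def by blast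
    fix S assume S: "S \<in> M"
    have "finite M" and "is_simplex_vertices S" using M S unfolding conforming_mesh_def by blast+
    have "diameter (convex hull S) ^ DIM('a) / measure lebesgue (convex hull S) \<le> shape_reg M"
      unfolding shape_reg_def using \<open>finite M\<close> S by (intro Max_ge) auto
    then have "diameter (convex hull S) ^ DIM('a) / measure lebesgue (convex hull S) \<le> \<kappa>0" using \<kappa> by simp
    moreover have "0 < measure lebesgue (convex hull S)" by (rule simplex_measure_pos) fact
    ultimately show "diameter (convex hull S) ^ DIM('a) \<le> \<kappa>0 * measure lebesgue (convex hull S)"
      by (simp add: pos_divide_le_eq)
  qed (fact assms(1) M lipschitz_domain_interior_closure[OF assms(2)])+
  \<comment> \<open>Formed before any mesh is fixed: outside its locale \<open>infsup_const\<close>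
    depends on the space and on \<kappa>0 only, so one constant serves all meshes.\<close>
  let ?K = "(1 + simplicial_mesh.infsup_const TYPE('a) \<kappa>0 * \<bar>CQ\<bar>) * (3 + 4 * C)"
  have quasi_optimal: "\<exists>uT \<sigma>T. fosls_min \<Omega> M (Q f) uT \<sigma>T \<and>
      (\<forall>v \<tau>. fosls_min \<Omega> M (Q f) v \<tau> \<longrightarrow>
        L2norm \<Omega> (\<lambda>x. wgrad \<Omega> v x - wgrad \<Omega> uT x) = 0 \<and> L2norm \<Omega> (\<lambda>x. \<tau> x - \<sigma>T x) = 0) \<and>
      (\<forall>v\<in>UT \<Omega> M. \<forall>\<tau>\<in>RT0 \<Omega> M.
        L2norm \<Omega> (wgrad \<Omega> (\<lambda>x. u x - uT x)) + L2norm \<Omega> (\<lambda>x. \<sigma> x - \<sigma>T x)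
        \<le> ?K * (L2norm \<Omega> (wgrad \<Omega> (\<lambda>x. u x - v x)) + L2norm \<Omega> (\<lambda>x. \<sigma> x - \<tau> x)))"
    if h: "conforming_mesh \<Omega> M" "shape_reg M \<le> \<kappa>0" "bounded_P0_projection \<Omega> M CQ Q" "Hm1 \<Omega> f" "H10 \<Omega> u"
      "\<forall>v. H10 \<Omega> v \<longrightarrow> (LINT x:\<Omega>|lebesgue. wgrad \<Omega> u x \<bullet> wgrad \<Omega> v x) = f v" "L2 \<Omega> \<sigma>" "is_weak_grad \<Omega> u \<sigma>"
    for M Q f u \<sigma>
  proof -
    interpret simplicial_mesh \<Omega> M \<kappa>0 by (rule mesh[OF h(1,2)])
    have weak: "(\<integral>x. wgrad \<Omega> u x \<bullet> wgrad \<Omega> v x \<partial>N) = f v" if "H10 \<Omega> v" for v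
      using h(6) that unfolding set_integral_eq_lebesgue_on[OF dom_sets] by blast
    show ?thesis by (rule fosls_quasi_optimal[OF C h(4,3,5) weak h(7)[unfolded L2_sq_int] h(8)])
  qed
  show ?thesis
    apply (rule exI[of _ ?K], intro allI impI, elim conjE)
    subgoal premises h for M Q f u \<sigma>
      by (rule quasi_optimal[of M Q f u \<sigma>, OF h])
    done
qed

end
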